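(* There are natural one-to-one correspondences among the following four sets: (a) the idempotent elements of $A_\kappa$; (b) the idempotent elements of $A^{int}_{\eta_0}$; (c) the idempotent elements of $A_{\eta_0}$; (d) the idempotent analytic functions on $\mathbb X_{\eta_0}$. (Here (b), (c), (d) are identified via the inclusions $A^{int}_{\eta_0}\subseteq A_{\eta_0}\subseteq\mathcal O(\mathbb X_{\eta_0})$, and (b) corresponds to (a) via reduction modulo $\pi_K$.)
   Context: Let $K$ be a complete discretely valued field of characteristic $0$, ring of integers $\mathcal O_K$, uniformizer $\pi_K$, residue field $\kappa$ of characteristic $p>0$, with $|p|=p^{-1}$. Fix $n\ge1$; $R^{int}=\mathcal O_K\langle u_1,\dots,u_n\rangle((S))$ (series $\sum_{j\in\mathbb Z}f_jS^j$, $f_j$ in the Tate algebra, $f_j\to0$ as $j\to-\infty$), $R=R^{int}\otimes K$, $R_\kappa=R^{int}\otimes\kappa=\kappa[u_1,\dots,u_n]((S))$; $|\cdot|_\eta$ is the $(1,\dots,1,\eta)$-Gauss norm. Monomial order on $R_\kappa$: $u^iS^j\succeq u^{i'}S^{j'}$ iff $(-j,i)\ge(-j',i')$ lexicographically. $I^{int}\subseteq R^{int}$ is an ideal with $R^{int}/I^{int}$ flat over $\mathcal O_K$; $I=I^{int}\otimes K$, $I_\kappa=I^{int}\otimes\kappa$. Let $\bar r_1,\dots,\bar r_m$ be a Gröbner basis of $I_\kappa$ (finite subset of $I_\kappa$ whose leading terms have $S$-exponent $0$ and generate the ideal of leading terms of $I_\kappa$) and $r_1,\dots,r_m\in I^{int}$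 lifts involving finitely many negative powers of $S$; $\mathbf j_I\le0$ is the minimal $S$-exponent occurring in the $r_h$. Assume $A_\kappa=R_\kappa/I_\kappa$ (an affinoid algebra over $\kappa((S))$) is reduced; fix $c>0$ with $|\cdot|_{\kappa,quot}\le|S|_\kappa^{-c}|\cdot|_{\kappa,sp}$ on $A_\kappa$ (quotient norm of the Gauss norm, and spectral norm). Fix $\eta_0\in(|\pi_K|^{1/(-\mathbf j_I+pc)},1)$. Let $\mathcal R_{\eta_0}$ be the Fréchet completion of $R$ for $|\cdot|_\eta$, $\eta\in[\eta_0,1)$; $R^{int}_{\eta_0}=\{f\in\mathcal R_{\eta_0}:|f|_1\le1\}$, $R_{\eta_0}=R^{int}_{\eta_0}\otimes K$, $I_{\eta_0}=IR_{\eta_0}$, $A_{\eta_0}=R_{\eta_0}/I_{\eta_0}$, and $A^{int}_{\eta_0}$ the image of $R^{int}_{\eta_0}$ in $A_{\eta_0}$. Finally $\mathbb X_{\eta_0}=\{(u_1,\dots,u_n,S)\in\mathbb A^{n+1}_K:\eta_0\le|S|<1;\ |u_1|,\dots,|u_n|\le1;\ r_1=\cdots=r_m=0\}$ (a rigid analytic space over $K$). *)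

theory Defs
  imports
    "HOL-Analysis.Infinite_Sum"
    "HOL-Library.Extended_Nonnegative_Real"
    "HOL-Library.Poly_Mapping"
    "HOL-Computational_Algebra.Formal_Laurent_Series"
    "HOL-Algebra.Algebra"
    "HOL-Algebra.Algebraic_Closure_Type"
begin

section \<open>The base field and its residue field\<close>

text \<open>
  Completeness, for the metric of the absolute value, is inherited from \<^class>\<open>complete_space\<close>.
  The constant \<^const>\<open>norm\<close> is not used because it is reserved for real normed spaces.
\<close>

class complete_discretely_valued_field = field_char_0 + complete_space +
  fixes absval :: "'a \<Rightarrow> real"
  assumes dist_absval: "dist x y = absval (x - y)"
    and valuation_mult: "absval (x * y) = absval x * absval y"
    and valuation_ultrametric: "absval (x + y) \<le> max (absval x) (absval y)"
    and valuation_discrete: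
      "\<exists>u. 0 < absval u \<and> absval u < 1 \<and> (\<forall>x. x \<noteq> 0 \<longrightarrow> (\<exists>k::int. absval x = absval u powi k))"

definition uniformizer :: "'k::complete_discretely_valued_field \<Rightarrow> bool" where
  "uniformizer u \<longleftrightarrow> 0 < absval u \<and> absval u < 1 \<and> (\<forall>x::'k. x \<noteq> 0 \<longrightarrow> (\<exists>k::int. absval x = absval u powi k))"

definition integer_ring :: "'k::complete_discretely_valued_field ring" where
  "integer_ring = ring_of_type_algebra\<lparr>carrier := {x. absval x \<le> 1}\<rparr>"

text \<open>
  The residue field is any field \<open>'r\<close> together with a surjective homomorphism from the integers
  whose kernel is the maximal ideal; values of \<open>res\<close> outside the integers are irrelevant.
\<close>

definition residue_map :: "('k::complete_discretely_valued_field \<Rightarrow> 'r::field) \<Rightarrow> bool" where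
  "residue_map res \<longleftrightarrow>
     res \<in> ring_hom integer_ring ring_of_type_algebra \<and>
     res ` carrier integer_ring = UNIV \<and>
     a_kernel integer_ring ring_of_type_algebra res = {x. absval x < 1}"

text \<open>The group of \<open>k\<close>-th roots, \<open>k \<ge> 1\<close>, of absolute values of nonzero elements of the field:
  the radii which classical rigid geometry can see.\<close>

definition divisible_value_group :: "'k::complete_discretely_valued_field itself \<Rightarrow> real set" where
  "divisible_value_group _ = {\<alpha>. 0 < \<alpha> \<and> (\<exists>k\<ge>1. \<exists>x::'k. \<alpha> ^ k = absval x)}"


section \<open>Tensor products and flatness\<close>

definition tensor_relations ::
    "('a, 'c) ring_scheme \<Rightarrow> ('a, 'x, 'd) module_scheme \<Rightarrow> ('a, 'y, 'e) module_scheme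
      \<Rightarrow> ('x \<times> 'y \<Rightarrow>\<^sub>0 int) set" where
  "tensor_relations R N M = generate (free_Abelian_group (carrier N \<times> carrier M))
     ({frag_of (x \<oplus>\<^bsub>N\<^esub> x', y) - frag_of (x, y) - frag_of (x', y) | x x' y.
         x \<in> carrier N \<and> x' \<in> carrier N \<and> y \<in> carrier M} \<union>
      {frag_of (x, y \<oplus>\<^bsub>M\<^esub> y') - frag_of (x, y) - frag_of (x, y') | x y y'.
         x \<in> carrier N \<and> y \<in> carrier M \<and> y' \<in> carrier M} \<union>
      {frag_of (a \<odot>\<^bsub>N\<^esub> x, y) - frag_of (x, a \<odot>\<^bsub>M\<^esub> y) | a x y.
         a \<in> carrier R \<and> x \<in> carrier N \<and> y \<in> carrier M})"

definition tensor_product ::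
    "('a, 'c) ring_scheme \<Rightarrow> ('a, 'x, 'd) module_scheme \<Rightarrow> ('a, 'y, 'e) module_scheme
      \<Rightarrow> ('x \<times> 'y \<Rightarrow>\<^sub>0 int) set monoid" where
  "tensor_product R N M =
     free_Abelian_group (carrier N \<times> carrier M) Mod tensor_relations R N M"

text \<open>The map \<open>N' \<otimes> M \<rightarrow> N \<otimes> M\<close> induced by \<open>f : N' \<rightarrow> N\<close>; the argument is a class in \<open>N' \<otimes> M\<close>.\<close>

definition tensor_map ::
    "('a, 'c) ring_scheme \<Rightarrow> ('a, 'x, 'd) module_scheme \<Rightarrow> ('a, 'y, 'e) module_scheme
      \<Rightarrow> ('z \<Rightarrow> 'x) \<Rightarrow> ('z \<times> 'y \<Rightarrow>\<^sub>0 int) set \<Rightarrow> ('x \<times> 'y \<Rightarrow>\<^sub>0 int) set" where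
  "tensor_map R N M f Z =
     (\<Union>z\<in>Z. tensor_relations R N M #>\<^bsub>free_Abelian_group (carrier N \<times> carrier M)\<^esub>
        frag_extend (\<lambda>(x, y). frag_of (f x, y)) z)"

definition linear_maps ::
    "('a, 'c) ring_scheme \<Rightarrow> ('a, 'x, 'd) module_scheme \<Rightarrow> ('a, 'y, 'e) module_scheme
      \<Rightarrow> ('x \<Rightarrow> 'y) set" where
  "linear_maps R N M = {f \<in> carrier N \<rightarrow> carrier M.
     (\<forall>x\<in>carrier N. \<forall>y\<in>carrier N. f (x \<oplus>\<^bsub>N\<^esub> y) = f x \<oplus>\<^bsub>M\<^esub> f y) \<and>
     (\<forall>a\<in>carrier R. \<forall>x\<in>carrier N. f (a \<odot>\<^bsub>N\<^esub> x) = a \<odot>\<^bsub>M\<^esub> f x)}"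

text \<open>
  Tensoring with \<open>M\<close> preserves injectivity. The test modules range over all modules whose
  underlying set lies in the type of ring elements; as these include all ideals of \<open>R\<close>, this is
  no restriction.
\<close>

definition flat_module :: "('a, 'c) ring_scheme \<Rightarrow> ('a, 'y, 'e) module_scheme \<Rightarrow> bool" where
  "flat_module R M \<longleftrightarrow>
     (\<forall>(N' :: ('a, 'a) module) (N :: ('a, 'a) module) f.
        Module.module R N' \<and> Module.module R N \<and>
        f \<in> linear_maps R N' N \<and> inj_on f (carrier N') \<longrightarrow>
        inj_on (tensor_map R N M f) (carrier (tensor_product R N' M)))"


section \<open>Laurent series in \<open>S\<close> over power series in the \<open>u\<close>-variables\<close>

text \<open>
  The index type \<open>'n\<close> stands for \<open>{1..n}\<close>. A series \<open>f\<close> has \<open>S\<close>-coefficients \<open>f j\<close>, and \<open>f j i\<close>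
  is the coefficient of \<open>u\<^sup>i S\<^sup>j\<close>.
\<close>

type_synonym ('n, 'k) series = "int \<Rightarrow> ('n \<Rightarrow>\<^sub>0 nat) \<Rightarrow> 'k"

definition series_mult ::
    "('n, 'k::complete_discretely_valued_field) series \<Rightarrow> ('n, 'k) series \<Rightarrow> ('n, 'k) series" where
  "series_mult f g = (\<lambda>j i. \<Sum>\<^sub>\<infinity>a\<in>UNIV. \<Sum>(b, b') | b + b' = i. f a b * g (j - a) b')"

definition series_ring ::
    "('n, 'k::complete_discretely_valued_field) series set \<Rightarrow> ('n, 'k) series ring" where
  "series_ring C = \<lparr>carrier = C, mult = series_mult,
     one = (\<lambda>j i. if j = 0 \<and> i = 0 then 1 else 0),
     ring.zero = (\<lambda>j i. 0), ring.add = (\<lambda>f g j i. f j i + g j i)\<rparr>"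

definition scale :: "'k::complete_discretely_valued_field \<Rightarrow> ('n, 'k) series \<Rightarrow> ('n, 'k) series" where
  "scale a f = (\<lambda>j i. a * f j i)"

text \<open>\<open>Y \<otimes> K\<close> for a set \<open>Y\<close> of series closed under addition and under scaling by integers.\<close>

definition extend_scalars ::
    "('n, 'k::complete_discretely_valued_field) series set \<Rightarrow> ('n, 'k) series set" where
  "extend_scalars Y = {scale a f | a f. f \<in> Y}"

definition finite_principal_part :: "('n, 'k::zero) series \<Rightarrow> bool" where
  "finite_principal_part f \<longleftrightarrow> (\<exists>N. \<forall>j<N. f j = (\<lambda>i. 0))"

text \<open>The \<open>(1,\<dots>,1,\<eta>)\<close>-Gauss norm, possibly infinite.\<close>

definition gauss_norm ::
    "real \<Rightarrow> ('n, 'k::complete_discretely_valued_field) series \<Rightarrow> ennreal" where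
  "gauss_norm \<eta> f = (SUP (j, i). ennreal (absval (f j i) * \<eta> powi j))"

definition Tate_int :: "(('n \<Rightarrow>\<^sub>0 nat) \<Rightarrow> 'k::complete_discretely_valued_field) set" where
  "Tate_int = {g. (\<forall>i. absval (g i) \<le> 1) \<and> ((\<lambda>i. absval (g i)) \<longlongrightarrow> 0) cofinite}"

definition R_int :: "('n, 'k::complete_discretely_valued_field) series ring" where
  "R_int = series_ring {f. (\<forall>j. f j \<in> Tate_int) \<and>
     ((\<lambda>j. SUP i. ennreal (absval (f j i))) \<longlongrightarrow> 0) at_bot}"

definition R_K :: "('n, 'k::complete_discretely_valued_field) series ring" where
  "R_K = series_ring (extend_scalars (carrier R_int))"

definition quotient_module ::
    "('n, 'k::complete_discretely_valued_field) series set \<Rightarrow> ('k, ('n, 'k) series set) module" where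
  "quotient_module I = ring.extend (R_int Quot I)
     (module.fields (\<lambda>a Y. \<Union>f\<in>Y. I +>\<^bsub>R_int\<^esub> scale a f))"

definition minimal_exponent ::
    "nat \<Rightarrow> (nat \<Rightarrow> ('n, 'k::zero) series) \<Rightarrow> int" where
  "minimal_exponent m r = Inf (insert 0 {j. \<exists>h\<in>{1..m}. \<exists>i. r h j i \<noteq> 0})"


section \<open>The special fibre\<close>

text \<open>\<open>\<kappa>[u]((S))\<close>: the multivariate polynomial ring is \<open>('n \<Rightarrow>\<^sub>0 nat) \<Rightarrow>\<^sub>0 'r\<close>.\<close>

type_synonym ('n, 'r) kseries = "(('n \<Rightarrow>\<^sub>0 nat) \<Rightarrow>\<^sub>0 'r) fls"

abbreviation R_kappa :: "('n, 'r::field) kseries ring" where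
  "R_kappa \<equiv> ring_of_type_algebra"

definition reduce ::
    "('k::complete_discretely_valued_field \<Rightarrow> 'r::field) \<Rightarrow> ('n, 'k) series \<Rightarrow> ('n, 'r) kseries" where
  "reduce res f = Abs_fls (\<lambda>j. Abs_poly_mapping (\<lambda>i. res (f j i)))"

text \<open>By flatness of \<open>R_int/I\<close>, the tensor product of \<open>I\<close> with the residue field is the image of
  \<open>I\<close> in \<open>R_kappa\<close>.\<close>

definition I_kappa ::
    "('k::complete_discretely_valued_field \<Rightarrow> 'r::field) \<Rightarrow> ('n, 'k) series set
      \<Rightarrow> ('n, 'r) kseries set" where
  "I_kappa res I = reduce res ` I"

definition A_kappa ::
    "('k::complete_discretely_valued_field \<Rightarrow> 'r::field) \<Rightarrow> ('n, 'k) series set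
      \<Rightarrow> ('n, 'r) kseries set ring" where
  "A_kappa res I = R_kappa Quot I_kappa res I"

definition kcoeff :: "('n, 'r::zero) kseries \<Rightarrow> int \<times> ('n \<Rightarrow>\<^sub>0 nat) \<Rightarrow> 'r" where
  "kcoeff f = (\<lambda>(j, i). Poly_Mapping.lookup (fls_nth f j) i)"

text \<open>The order on exponents \<open>(j, i)\<close> of \<open>u\<^sup>i S\<^sup>j\<close>. The linear order on \<open>'n \<Rightarrow>\<^sub>0 nat\<close> is lexicographic,
  the smallest index of \<open>'n\<close> being the most significant.\<close>

definition monomial_ge ::
    "int \<times> ('n::linorder \<Rightarrow>\<^sub>0 nat) \<Rightarrow> int \<times> ('n \<Rightarrow>\<^sub>0 nat) \<Rightarrow> bool" where
  "monomial_ge = (\<lambda>(j, i) (j', i'). - j > - j' \<or> (- j = - j' \<and> i \<ge> i'))"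

definition leading_exponent ::
    "('n::linorder, 'r::zero) kseries \<Rightarrow> int \<times> ('n \<Rightarrow>\<^sub>0 nat)" where
  "leading_exponent f =
     (THE e. kcoeff f e \<noteq> 0 \<and> (\<forall>e'. kcoeff f e' \<noteq> 0 \<longrightarrow> monomial_ge e e'))"

definition leading_term :: "('n::linorder, 'r::field) kseries \<Rightarrow> ('n, 'r) kseries" where
  "leading_term f = (let (j, i) = leading_exponent f in
     fls_const (Poly_Mapping.single i (kcoeff f (j, i))) * fls_X_intpow j)"

definition Groebner_basis ::
    "('n::linorder, 'r::field) kseries set \<Rightarrow> ('n, 'r) kseries set \<Rightarrow> bool" where
  "Groebner_basis J G \<longleftrightarrow> finite G \<and> G \<subseteq> J \<and> 0 \<notin> G \<and>
     (\<forall>g\<in>G. fst (leading_exponent g) = 0) \<and>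
     Idl\<^bsub>R_kappa\<^esub> (leading_term ` G) = Idl\<^bsub>R_kappa\<^esub> (leading_term ` (J - {0}))"

text \<open>The argument \<open>\<sigma>\<close> is the chosen absolute value of \<open>S\<close>, coefficients in the residue field being
  trivially valued.\<close>

definition kgauss_norm :: "real \<Rightarrow> ('n, 'r::field) kseries \<Rightarrow> real" where
  "kgauss_norm \<sigma> f = Sup (insert 0 {\<sigma> powi j | j i. kcoeff f (j, i) \<noteq> 0})"

definition quotient_norm :: "real \<Rightarrow> ('n, 'r::field) kseries set \<Rightarrow> real" where
  "quotient_norm \<sigma> Y = Inf (kgauss_norm \<sigma> ` Y)"

definition spectral_norm ::
    "real \<Rightarrow> (('n, 'r::field) kseries set, 'c) ring_scheme \<Rightarrow> ('n, 'r) kseries set \<Rightarrow> real" where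
  "spectral_norm \<sigma> A Y = lim (\<lambda>k. root k (quotient_norm \<sigma> (Y [^]\<^bsub>A\<^esub> (k::nat))))"

definition reduced_ring :: "('a, 'c) ring_scheme \<Rightarrow> bool" where
  "reduced_ring A \<longleftrightarrow> (\<forall>x\<in>carrier A. \<forall>k::nat. x [^]\<^bsub>A\<^esub> k = \<zero>\<^bsub>A\<^esub> \<longrightarrow> x = \<zero>\<^bsub>A\<^esub>)"


section \<open>The rings over the half-open annulus\<close>

text \<open>
  The Frechet completion, realised inside all formal series. An element of \<open>R_K\<close> with infinitely
  many negative powers of \<open>S\<close> may have infinite \<open>\<eta>\<close>-Gauss norm, so only those with finitely many
  are completed. The result is the ring of series in \<open>S\<close> over the Tate algebra
  that converge on the annulus \<open>\<eta>\<^sub>0 \<le> |S| < 1\<close>.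
\<close>

definition Frechet_ring ::
    "real \<Rightarrow> ('n, 'k::complete_discretely_valued_field) series ring" where
  "Frechet_ring \<eta>0 = series_ring {f. \<exists>Y :: nat \<Rightarrow> ('n, 'k) series.
     (\<forall>k. Y k \<in> carrier R_K \<and> finite_principal_part (Y k)) \<and>
     (\<forall>\<eta>\<in>{\<eta>0..<1}. (\<lambda>k. gauss_norm \<eta> (\<lambda>j i. Y k j i - f j i)) \<longlonglongrightarrow> 0)}"

definition R_eta_int ::
    "real \<Rightarrow> ('n, 'k::complete_discretely_valued_field) series ring" where
  "R_eta_int \<eta>0 = series_ring {f \<in> carrier (Frechet_ring \<eta>0). gauss_norm 1 f \<le> 1}"

definition R_eta ::
    "real \<Rightarrow> ('n, 'k::complete_discretely_valued_field) series ring" where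
  "R_eta \<eta>0 = series_ring (extend_scalars (carrier (R_eta_int \<eta>0)))"

text \<open>\<open>R_K\<close> is not contained in \<open>R_eta\<close>; the ideal generated by \<open>I \<otimes> K\<close> in \<open>R_eta\<close> is generated by
  those of its elements that lie in \<open>R_eta\<close>.\<close>

definition I_eta ::
    "real \<Rightarrow> ('n, 'k::complete_discretely_valued_field) series set \<Rightarrow> ('n, 'k) series set" where
  "I_eta \<eta>0 I = Idl\<^bsub>R_eta \<eta>0\<^esub> (extend_scalars I \<inter> carrier (R_eta \<eta>0))"

definition A_eta ::
    "real \<Rightarrow> ('n, 'k::complete_discretely_valued_field) series set \<Rightarrow> ('n, 'k) series set ring" where
  "A_eta \<eta>0 I = R_eta \<eta>0 Quot I_eta \<eta>0 I"

definition A_eta_int ::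
    "real \<Rightarrow> ('n, 'k::complete_discretely_valued_field) series set \<Rightarrow> ('n, 'k) series set ring" where
  "A_eta_int \<eta>0 I =
     (A_eta \<eta>0 I)\<lparr>carrier := (\<lambda>f. I_eta \<eta>0 I +>\<^bsub>R_eta \<eta>0\<^esub> f) ` carrier (R_eta_int \<eta>0)\<rparr>"

text \<open>Reduction modulo the uniformizer on \<open>A_eta_int\<close>, computed on integral representatives.\<close>

definition reduction ::
    "real \<Rightarrow> ('k::complete_discretely_valued_field \<Rightarrow> 'r::field) \<Rightarrow> ('n, 'k) series set
      \<Rightarrow> ('n, 'k) series set \<Rightarrow> ('n, 'r) kseries set" where
  "reduction \<eta>0 res I Y =
     (\<Union>f\<in>Y \<inter> carrier (R_eta_int \<eta>0). I_kappa res I +>\<^bsub>R_kappa\<^esub> reduce res f)"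


section \<open>Analytic functions on the rigid space\<close>

text \<open>
  The space is the increasing union of the affinoids \<open>\<alpha> \<le> |S| \<le> \<beta>\<close>, \<open>|u\<^sub>i| \<le> 1\<close>, \<open>r\<^sub>h = 0\<close> with
  \<open>\<eta>\<^sub>0 \<le> \<alpha> \<le> \<beta> < 1\<close> in the divisible value group, and these form an admissible covering.
  So a global section is a compatible family of elements of the affinoid algebras
  \<open>K\<langle>u, \<alpha>/S, S/\<beta>\<rangle>/(r\<^sub>1,\<dots>,r\<^sub>m)\<close>.
\<close>

definition annulus_ring ::
    "real \<times> real \<Rightarrow> ('n, 'k::complete_discretely_valued_field) series ring" where
  "annulus_ring = (\<lambda>(\<alpha>, \<beta>). series_ring
     {f. ((\<lambda>(j, i). absval (f j i) * \<alpha> powi j) \<longlongrightarrow> 0) cofinite \<and>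
         ((\<lambda>(j, i). absval (f j i) * \<beta> powi j) \<longlongrightarrow> 0) cofinite})"

definition annulus_ideal ::
    "nat \<Rightarrow> (nat \<Rightarrow> ('n, 'k::complete_discretely_valued_field) series) \<Rightarrow> real \<times> real
      \<Rightarrow> ('n, 'k) series set" where
  "annulus_ideal m r w = Idl\<^bsub>annulus_ring w\<^esub> (r ` {1..m})"

definition annulus_algebra ::
    "nat \<Rightarrow> (nat \<Rightarrow> ('n, 'k::complete_discretely_valued_field) series) \<Rightarrow> real \<times> real
      \<Rightarrow> ('n, 'k) series set ring" where
  "annulus_algebra m r w = annulus_ring w Quot annulus_ideal m r w"

text \<open>Restriction of functions to the affinoid with radii \<open>w\<close>.\<close>

definition restriction ::
    "nat \<Rightarrow> (nat \<Rightarrow> ('n, 'k::complete_discretely_valued_field) series) \<Rightarrow> real \<times> real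
      \<Rightarrow> ('n, 'k) series set \<Rightarrow> ('n, 'k) series set" where
  "restriction m r w Y = (\<Union>f\<in>Y. annulus_ideal m r w +>\<^bsub>annulus_ring w\<^esub> f)"

definition radii :: "'k::complete_discretely_valued_field itself \<Rightarrow> real \<Rightarrow> (real \<times> real) set" where
  "radii K \<eta>0 = {(\<alpha>, \<beta>). \<eta>0 \<le> \<alpha> \<and> \<alpha> \<le> \<beta> \<and> \<beta> < 1 \<and>
     \<alpha> \<in> divisible_value_group K \<and> \<beta> \<in> divisible_value_group K}"

definition analytic_functions ::
    "real \<Rightarrow> nat \<Rightarrow> (nat \<Rightarrow> ('n, 'k::complete_discretely_valued_field) series)
      \<Rightarrow> (real \<times> real \<Rightarrow> ('n, 'k) series set) ring" where
  "analytic_functions \<eta>0 m r = (let W = radii TYPE('k) \<eta>0; B = annulus_algebra m r in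
     \<lparr>carrier = {F \<in> (\<Pi>\<^sub>E w\<in>W. carrier (B w)).
        \<forall>(\<alpha>, \<beta>)\<in>W. \<forall>(\<alpha>', \<beta>')\<in>W. \<alpha> \<le> \<alpha>' \<and> \<beta>' \<le> \<beta> \<longrightarrow>
          F (\<alpha>', \<beta>') = restriction m r (\<alpha>', \<beta>') (F (\<alpha>, \<beta>))},
      mult = (\<lambda>F G. \<lambda>w\<in>W. F w \<otimes>\<^bsub>B w\<^esub> G w),
      one = (\<lambda>w\<in>W. \<one>\<^bsub>B w\<^esub>),
      ring.zero = (\<lambda>w\<in>W. \<zero>\<^bsub>B w\<^esub>),
      ring.add = (\<lambda>F G. \<lambda>w\<in>W. F w \<oplus>\<^bsub>B w\<^esub> G w)\<rparr>)"

definition to_analytic ::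
    "real \<Rightarrow> nat \<Rightarrow> (nat \<Rightarrow> ('n, 'k::complete_discretely_valued_field) series)
      \<Rightarrow> ('n, 'k) series set \<Rightarrow> (real \<times> real \<Rightarrow> ('n, 'k) series set)" where
  "to_analytic \<eta>0 m r Y = (\<lambda>w\<in>radii TYPE('k) \<eta>0. restriction m r w Y)"


definition idempotents :: "('a, 'c) ring_scheme \<Rightarrow> 'a set" where
  "idempotents A = {e \<in> carrier A. e \<otimes>\<^bsub>A\<^esub> e = e}"

end

theory Submission
  imports Defs "HOL-Library.Function_Algebras" "HOL-Analysis.Product_Vector"
begin

text \<open>
  Dividing by the lifts \<open>r\<^sub>h\<close> of the Groebner basis gives every series on a thin enough annulus a
  unique normal form modulo the ideal, without increasing Gauss norms; hence the algebras over all
  annuli are compared through normal forms.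

  The bound between quotient and spectral norms gives an idempotent of \<open>A_kappa\<close> a representative whose
  pole in \<open>S\<close> has order at most \<open>c\<close>. On a lift of it, Newton's iteration converges to an idempotent,
  because one uniformizer beats the poles created by a division step on the chosen annulus. Since the
  difference \<open>z\<close> of two idempotents satisfies \<open>z\<^sup>3 = z\<close>, the lift is unique. As \<open>A_kappa\<close> is reduced,
  idempotents of \<open>A_eta\<close> are integral.

  An idempotent analytic function has one normal form \<open>\<nu>\<close> on all annuli, with \<open>\<nu>\<^sup>p = \<nu>\<close>. Comparing
  Gauss norms of \<open>\<nu>\<close> and \<open>\<nu>\<^sup>p\<close>, using that the spectral norm of \<open>A_kappa\<close> is multiplicative on
  \<open>p\<close>-th powers, bounds the norm of \<open>\<nu>\<close> at radius \<open>\<eta>\<close> by a fixed power of \<open>1/\<eta>\<close>. Letting \<open>\<eta>\<close> tend to 1 shows that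
  \<open>\<nu>\<close> is integral, so it has a reduction, and it is the lift of that reduction.
\<close>

section \<open>Nonarchimedean fields\<close>

text \<open>The bound on \<eta>0 enters as \<open>|uK| \<eta>^jI < \<eta>^(pc)\<close>, and the
  exponent pc has two uses. In the lift, squaring a representative with poles of order c costs 2c,
  which is at most pc. In the bound for analytic idempotents, comparing an element with its p-th
  power through the spectral norm costs pc, while each error carries the factor
  \<open>|uK| \<eta>^jI\<close>. The obstacle there is that a function on the half-open annulus may
  have unbounded coefficients: it has no reduction, and the spectral norm of \<open>A_kappa\<close>
  says nothing about it. p-th powers help because they are additive up to multiples of p, so the
  function can be cut into pieces with coefficients of one absolute value; each piece, rescaled,
  does have a reduction. Division treats each power of S separately and divides only by the S-free
  part of \<open>r h\<close>. The negative part of \<open>r h\<close> is divisible by the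
  uniformizer and the positive part gains a factor \<eta>, so a step contracts all Gauss norms with
  \<open>\<eta> < 1\<close> and \<open>|uK| \<eta>^jI < 1\<close> at once. One choice of quotients
  thus serves all these radii.\<close>

lemma absval_0 [simp]: "absval (0::'k::complete_discretely_valued_field) = 0"
  using dist_absval[of "0::'k" 0] by simp

lemma absval_eq_dist: "absval (x::'k::complete_discretely_valued_field) = dist x 0"
  by (simp add: dist_absval)

lemma absval_nonneg [simp]: "absval (x::'k::complete_discretely_valued_field) \<ge> 0"
  by (simp add: absval_eq_dist)

lemma absval_eq_0 [simp]: "absval (x::'k::complete_discretely_valued_field) = 0 \<longleftrightarrow> x = 0"
  by (simp add: absval_eq_dist)

lemma absval_pos [simp]: "absval (x::'k::complete_discretely_valued_field) > 0 \<longleftrightarrow> x \<noteq> 0"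
  by (simp add: absval_eq_dist)

lemma absval_le_0 [simp]: "absval (x::'k::complete_discretely_valued_field) \<le> 0 \<longleftrightarrow> x = 0"
  by (simp add: absval_eq_dist)

lemma absval_minus [simp]: "absval (- x) = absval (x::'k::complete_discretely_valued_field)"
  using dist_absval[of 0 x] by (simp add: absval_eq_dist dist_commute)

lemma absval_1 [simp]: "absval (1::'k::complete_discretely_valued_field) = 1"
  using valuation_mult[of "1::'k" 1] by (simp add: absval_eq_dist)

lemma absval_add_le: "absval x \<le> B \<Longrightarrow> absval y \<le> B \<Longrightarrow> absval (x + y::'k::complete_discretely_valued_field) \<le> B"
  using valuation_ultrametric[of x y] by linarith

lemma absval_diff_le: "absval x \<le> B \<Longrightarrow> absval y \<le> B \<Longrightarrow> absval (x - y::'k::complete_discretely_valued_field) \<le> B"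
  using absval_add_le[of x B "- y"] by simp

lemma absval_add_less: "absval x < B \<Longrightarrow> absval y < B \<Longrightarrow> absval (x + y::'k::complete_discretely_valued_field) < B"
  using valuation_ultrametric[of x y] by linarith

lemma absval_diff_less: "absval x < B \<Longrightarrow> absval y < B \<Longrightarrow> absval (x - y::'k::complete_discretely_valued_field) < B"
  using absval_add_less[of x B "- y"] by simp

lemma absval_add_eq:
  assumes "absval y < absval (x::'k::complete_discretely_valued_field)"
  shows "absval (x + y) = absval x"
  using valuation_ultrametric[of x y] absval_diff_less[of "x + y" "absval x" y] assms
  by (metis add_diff_cancel_right' less_irrefl linorder_neqE_linordered_idom max.absorb3 not_le)

lemma absval_sum_le:
  assumes "\<And>x. x \<in> A \<Longrightarrow> absval (f x :: 'k::complete_discretely_valued_field) \<le> B" "B \<ge> 0"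
  shows "absval (sum f A) \<le> B"
  using assms by (induction A rule: infinite_finite_induct) (auto intro: absval_add_le)

lemma absval_sum_less:
  assumes "\<And>x. x \<in> A \<Longrightarrow> absval (f x :: 'k::complete_discretely_valued_field) < B" "B > 0"
  shows "absval (sum f A) < B"
  using assms by (induction A rule: infinite_finite_induct) (auto intro: absval_add_less)

lemma absval_power: "absval (x ^ n) = absval (x::'k::complete_discretely_valued_field) ^ n"
  by (induction n) (auto simp: valuation_mult)

lemma absval_inverse: "absval (inverse x) = inverse (absval (x::'k::complete_discretely_valued_field))"
proof (cases "x = 0")
  case False
  then have "absval x * absval (inverse x) = 1" by (simp flip: valuation_mult)
  then show ?thesis by (simp add: inverse_unique)
qed simp

lemma absval_divide: "absval (x / y) = absval x / absval (y::'k::complete_discretely_valued_field)"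
  by (simp add: divide_inverse valuation_mult absval_inverse)

lemma absval_power_int: "absval (x powi n) = absval (x::'k::complete_discretely_valued_field) powi n"
  by (simp add: power_int_def absval_power absval_inverse)

lemma absval_of_nat_le_1: "absval (of_nat n :: 'k::complete_discretely_valued_field) \<le> 1"
  by (induction n) (auto intro: absval_add_le)

text \<open>Together with the two instances below it makes the rules for \<open>infsum\<close>
  (sums, negation, multiplication by a constant) applicable to the field. By the ultrametric
  inequality addition and negation are uniformly continuous with the same \<open>e\<close> on both
  sides.\<close>

instance complete_discretely_valued_field \<subseteq> uniform_topological_group_add
proof
  fix a b :: 'a
  have *: "dist (x + y) (x' + y') \<le> max (dist x x') (dist y y')" for x y x' y' :: 'a
    using valuation_ultrametric[of "x - x'" "y - y'"] by (simp add: dist_absval algebra_simps)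
  have dm: "dist (- x) (- y) = dist x y" for x y :: 'a
    by (metis dist_absval absval_minus minus_diff_minus)
  show "LIM x (nhds a \<times>\<^sub>F nhds b). fst x + snd x :> nhds (a + b)"
    unfolding tendsto_iff
  proof (intro allI impI)
    fix e :: real assume "e > 0"
    then have "eventually (\<lambda>x. dist x a < e) (nhds a)" "eventually (\<lambda>x. dist x b < e) (nhds b)"
      by (auto simp: eventually_nhds_metric)
    then have "eventually (\<lambda>x. dist (fst x) a < e \<and> dist (snd x) b < e) (nhds a \<times>\<^sub>F nhds b)"
      unfolding eventually_prod_filter by fastforce
    then show "eventually (\<lambda>x. dist (fst x + snd x) (a + b) < e) (nhds a \<times>\<^sub>F nhds b)"
      by (rule eventually_mono) (use * in \<open>smt (verit)\<close>)
  qed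
  show "(uminus \<longlongrightarrow> - a) (nhds a)"
    unfolding tendsto_iff by (auto simp: dm eventually_nhds_metric)
  show "filterlim (\<lambda>((a::'a,b), (c,d)). (a + c, b + d)) uniformity (uniformity \<times>\<^sub>F uniformity)"
    unfolding filterlim_iff
  proof (intro allI impI)
    fix P :: "'a \<times> 'a \<Rightarrow> bool" assume "eventually P uniformity"
    then obtain e where e: "e > 0" "\<And>x y. dist x y < e \<Longrightarrow> P (x, y)"
      by (auto simp: eventually_uniformity_metric)
    have "eventually (\<lambda>(x::'a, y). dist x y < e) uniformity"
      using e(1) unfolding eventually_uniformity_metric by auto
    then have "eventually (\<lambda>((x::'a,y), (z::'a,w)). dist x y < e \<and> dist z w < e) (uniformity \<times>\<^sub>F uniformity)"
      unfolding eventually_prod_filter by fastforce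
    then show "eventually (\<lambda>x. P ((\<lambda>((a::'a,b), (c,d)). (a + c, b + d)) x)) (uniformity \<times>\<^sub>F uniformity)"
      by (rule eventually_mono) (auto intro!: e(2) le_less_trans[OF *])
  qed
  show "filterlim (\<lambda>(a::'a, b). (- a, - b)) uniformity uniformity"
    unfolding filterlim_iff by (auto simp: eventually_uniformity_metric dm case_prod_unfold)
qed

instance complete_discretely_valued_field \<subseteq> topological_ab_group_add ..

instance complete_discretely_valued_field \<subseteq> topological_semigroup_mult
proof
  fix a b :: 'a
  show "LIM x (nhds a \<times>\<^sub>F nhds b). fst x * snd x :> nhds (a * b)"
    unfolding tendsto_iff
  proof (intro allI impI)
    fix e :: real assume e: "e > 0"
    \<comment> \<open>The difference of the products is \<open>u * v + (u * b + a * v)\<close>. The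
      bound \<open>d \<le> 1\<close> serves the quadratic term, and the summand 1 in the denominator
      keeps the products of \<open>d\<close> with \<open>absval a\<close> and
      \<open>absval b\<close> strictly below \<open>e\<close>.\<close>
    define d where "d = min 1 (e / (1 + absval a + absval b))"
    have d: "d > 0" "d \<le> 1" "d * (1 + absval a + absval b) \<le> e"
      using e by (auto simp: d_def min_def field_simps add_pos_nonneg add_nonneg_pos intro!: divide_pos_pos)
    have "eventually (\<lambda>x. dist x a < d) (nhds a)" "eventually (\<lambda>x. dist x b < d) (nhds b)"
      using d by (auto simp: eventually_nhds_metric)
    then have "eventually (\<lambda>x. dist (fst x) a < d \<and> dist (snd x) b < d) (nhds a \<times>\<^sub>F nhds b)"
      unfolding eventually_prod_filter by fastforce
    then show "eventually (\<lambda>x. dist (fst x * snd x) (a * b) < e) (nhds a \<times>\<^sub>F nhds b)"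
    proof (rule eventually_mono)
      fix x :: "'a \<times> 'a" assume x: "dist (fst x) a < d \<and> dist (snd x) b < d"
      define u v where "u = fst x - a" and "v = snd x - b"
      have uv: "absval u < d" "absval v < d" using x by (auto simp: u_def v_def dist_absval)
      have "fst x * snd x - a * b = u * v + (u * b + a * v)" by (simp add: u_def v_def algebra_simps)
      moreover have "absval (u * v) < e"
        using mult_strict_mono[OF uv] uv d
        by (smt (verit) absval_nonneg mult_left_le mult_nonneg_nonneg valuation_mult mult_le_cancel_left1)
      moreover have "d * absval b < e"  "absval a * d < e"
        using d by (smt (verit) absval_nonneg mult_less_cancel_left_disj mult.commute)+
      moreover have "absval (u * b) \<le> d * absval b" "absval (a * v) \<le> absval a * d"
        using uv d(1) by (auto simp: valuation_mult intro!: mult_mono)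
      ultimately show "dist (fst x * snd x) (a * b) < e"
        by (simp add: dist_absval) (intro absval_add_less, auto)
    qed
  qed
qed

text \<open>Over an ultrametric, terms tending to zero suffice: enlarging the finite set
  \<open>?T\<close> of terms of size at least \<open>e\<close> changes the sum by less than
  \<open>e\<close>. So the net of finite sums is Cauchy, and the field is complete.\<close>

lemma nonarch_summable:
  fixes x :: "'i \<Rightarrow> 'k::complete_discretely_valued_field"
  assumes "\<And>e. e > 0 \<Longrightarrow> finite {a. absval (x a) \<ge> e}"
  shows "x summable_on UNIV"
proof -
  let ?F = "filtermap (sum x) (finite_subsets_at_top UNIV)"
  have "cauchy_filter ?F"
    unfolding cauchy_filter_def filter_leD
  proof (rule filter_leI)
    fix P :: "'k \<times> 'k \<Rightarrow> bool" assume "eventually P uniformity"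
    then obtain e where e: "e > 0" "\<And>x y. dist x y < e \<Longrightarrow> P (x, y)"
      by (auto simp: eventually_uniformity_metric)
    let ?T = "{a. absval (x a) \<ge> e}"
    have fin: "finite ?T" using assms[OF e(1)] .
    have close: "dist (sum x S) (sum x ?T) < e" if "finite S" "?T \<subseteq> S" for S
    proof -
      have "sum x S - sum x ?T = sum x (S - ?T)"
        using that fin by (simp add: sum_diff)
      moreover have "absval (sum x (S - ?T)) < e" by (rule absval_sum_less) (use e in auto)
      ultimately show ?thesis by (simp add: dist_absval)
    qed
    have ev: "eventually (\<lambda>y. dist y (sum x ?T) < e) ?F"
      unfolding eventually_filtermap eventually_finite_subsets_at_top
      by (intro exI[of _ ?T]) (auto intro: close fin)
    show "eventually P (?F \<times>\<^sub>F ?F)"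
      unfolding eventually_prod_filter
    proof (intro exI conjI allI impI)
      show "eventually (\<lambda>y. dist y (sum x ?T) < e) ?F" "eventually (\<lambda>y. dist y (sum x ?T) < e) ?F"
        using ev by auto
    next
      fix y z assume "dist y (sum x ?T) < e" "dist z (sum x ?T) < e"
      then show "P (y, z)"
        by (intro e(2)) (use absval_diff_less[of "y - sum x ?T" e "z - sum x ?T"] in \<open>simp add: dist_absval\<close>)
    qed
  qed
  moreover have "?F \<noteq> bot" by (simp add: filtermap_bot_iff)
  ultimately have "convergent_filter ?F" by (simp add: convergent_filter_iff_cauchy)
  then show ?thesis
    by (auto simp: summable_on_def has_sum_def convergent_filter_iff filterlim_def)
qed

text \<open>A partial sum that is closer to the total than the absolute value of the total has that
  same absolute value, and finite sums obey the bound. A divergent \<open>infsum\<close> is 0, so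
  the bound holds there as well.\<close>

lemma infsum_absval_le:
  fixes x :: "'i \<Rightarrow> 'k::complete_discretely_valued_field"
  assumes "\<And>a. absval (x a) \<le> B" "B \<ge> 0"
  shows "absval (infsum x UNIV) \<le> B"
proof (cases "x summable_on UNIV")
  case True
  then have lim: "(sum x \<longlongrightarrow> infsum x UNIV) (finite_subsets_at_top UNIV)"
    by (simp add: infsum_tendsto)
  show ?thesis
  proof (rule ccontr)
    assume *: "\<not> ?thesis"
    have "eventually (\<lambda>S. dist (sum x S) (infsum x UNIV) < absval (infsum x UNIV)) (finite_subsets_at_top UNIV)"
      using tendstoD[OF lim, of "absval (infsum x UNIV)"] * assms(2) by linarith
    then obtain S where S: "dist (sum x S) (infsum x UNIV) < absval (infsum x UNIV)"
      using eventually_happens' finite_subsets_at_top_neq_bot by blast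
    then have "absval (infsum x UNIV) = absval (sum x S)"
      using absval_add_eq[of "sum x S - infsum x UNIV" "infsum x UNIV"] by (simp add: dist_absval)
    moreover have "absval (sum x S) \<le> B" by (rule absval_sum_le) (use assms in auto)
    ultimately show False using * by simp
  qed
qed (simp add: infsum_not_exists assms)

lemma infsum_neutral_finite:
  fixes x :: "'i \<Rightarrow> 'k::complete_discretely_valued_field"
  assumes "finite A" "\<And>a. a \<notin> A \<Longrightarrow> x a = 0"
  shows "infsum x UNIV = sum x A"
proof -
  have "infsum x UNIV = infsum x A" by (rule infsum_cong_neutral) (use assms in auto)
  then show ?thesis using assms by simp
qed

text \<open>Consecutive differences bound all later ones by their maximum, so the n-th term is
  within \<open>M * \<rho> ^ n\<close> of every later term, with no geometric series to sum.\<close>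

lemma nonarch_lim:
  fixes x :: "nat \<Rightarrow> 'k::complete_discretely_valued_field"
  assumes "\<And>n. absval (x (Suc n) - x n) \<le> M * \<rho> ^ n" "0 \<le> \<rho>" "\<rho> < 1"
  shows "convergent x"
proof -
  have M: "M \<ge> 0" using assms(1)[of 0] absval_nonneg[of "x (Suc 0) - x 0"] unfolding power_0 mult_1_right by linarith
  have le: "absval (x (n + k) - x n) \<le> M * \<rho> ^ n" for n k
  proof (induction k)
    case (Suc k)
    have "M * \<rho> ^ (n + k) \<le> M * \<rho> ^ n"
      by (intro mult_left_mono power_decreasing) (use assms M in auto)
    then have "absval (x (Suc (n + k)) - x (n + k)) \<le> M * \<rho> ^ n" using assms(1)[of "n + k"] by linarith
    from absval_add_le[OF this Suc] show ?case by simp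
  qed (use M assms in simp)
  have "(\<lambda>n. M * \<rho> ^ n) \<longlonglongrightarrow> 0"
    using tendsto_mult[OF tendsto_const LIMSEQ_realpow_zero[OF assms(2,3)], of M] by simp
  have "Cauchy x"
  proof (rule metric_CauchyI)
    fix e :: real assume "e > 0"
    then obtain N where N: "M * \<rho> ^ N < e"
      using order_tendstoD(2)[OF \<open>_ \<longlonglongrightarrow> 0\<close>, of e] by (meson eventually_sequentially order_refl)
    have c: "absval (x n - x N) < e" if "n \<ge> N" for n
      using le[of N "n - N"] N that by simp
    show "\<exists>N. \<forall>m\<ge>N. \<forall>n\<ge>N. dist (x m) (x n) < e"
      using absval_diff_less[OF c c] by (auto simp: dist_absval intro!: exI[of _ N])
  qed
  then show ?thesis by (rule Cauchy_convergent)
qed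

lemma absval_lim_le:
  fixes x :: "nat \<Rightarrow> 'k::complete_discretely_valued_field"
  assumes "x \<longlonglongrightarrow> l" "\<And>n. n \<ge> N \<Longrightarrow> absval (x n - y) \<le> B"
  shows "absval (l - y) \<le> B"
proof -
  have "(\<lambda>n. absval (x n - y)) \<longlonglongrightarrow> absval (l - y)"
    using tendsto_dist[OF assms(1) tendsto_const, of y] by (simp add: dist_absval)
  then show ?thesis by (rule LIMSEQ_le_const2) (use assms(2) in blast)
qed

section \<open>Convolution of series\<close>

notation series_mult (infixl "\<star>" 70)

text \<open>A real-valued stand-in for \<open>gauss_norm \<eta> f \<le> B\<close>, see
  \<open>gauss_norm_le_iff\<close>. It keeps the estimates out of \<open>ennreal\<close>, and a
  series of infinite norm simply has no bound.\<close>

definition gauss_bound :: "real \<Rightarrow> ('n, 'k::complete_discretely_valued_field) series \<Rightarrow> real \<Rightarrow> bool" where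
  "gauss_bound \<eta> f B \<longleftrightarrow> (\<forall>j i. absval (f j i) * \<eta> powi j \<le> B)"

text \<open>The functions on the circle \<open>|S| = \<eta>\<close> over the closed unit polydisc in
  \<open>u\<close>: the weighted coefficients tend to zero in all exponents jointly, see
  \<open>null_series_iff_tendsto\<close>.\<close>

definition null_series :: "real \<Rightarrow> ('n, 'k::complete_discretely_valued_field) series set" where
  "null_series \<eta> = {f. \<forall>e>0. finite {(j, i). e \<le> absval (f j i) * \<eta> powi j}}"

text \<open>Laurent polynomials in \<open>S\<close> over polynomials in \<open>u\<close>; they lie
  in every \<open>null_series \<eta>\<close> and are dense there.\<close>

definition finite_series :: "('n, 'k::zero) series \<Rightarrow> bool" where
  "finite_series f \<longleftrightarrow> finite {(j, i). f j i \<noteq> 0}"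

definition series_monom :: "int \<Rightarrow> ('n \<Rightarrow>\<^sub>0 nat) \<Rightarrow> 'k \<Rightarrow> ('n, 'k::zero) series" where
  "series_monom a b c = (\<lambda>j i. if j = a \<and> i = b then c else 0)"

abbreviation series_one :: "('n, 'k::zero_neq_one) series" where
  "series_one \<equiv> series_monom 0 0 1"

section \<open>Gauss bounds and convergence on a circle\<close>

lemma gauss_boundD: "gauss_bound \<eta> f B \<Longrightarrow> absval (f j i) * \<eta> powi j \<le> B"
  by (simp add: gauss_bound_def)

lemma gauss_bound_nonneg: "gauss_bound \<eta> f B \<Longrightarrow> \<eta> > 0 \<Longrightarrow> B \<ge> 0"
  by (meson absval_nonneg gauss_bound_def mult_nonneg_nonneg order_trans zero_le_power_int less_imp_le)

lemma gauss_bound_mono: "gauss_bound \<eta> f B \<Longrightarrow> B \<le> B' \<Longrightarrow> gauss_bound \<eta> f B'"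
  by (meson gauss_bound_def order_trans)

lemma gauss_bound_0 [simp]: "gauss_bound \<eta> 0 B \<longleftrightarrow> B \<ge> 0"
  by (auto simp: gauss_bound_def)

lemma absval_times_le:
  assumes "absval (x::'k::complete_discretely_valued_field) * t \<le> B" "absval y * t \<le> B" "t > 0"
  shows "absval (x + y) * t \<le> B"
  using assms absval_add_le[of x "B / t" y] by (simp add: field_simps)

lemma gauss_bound_add:
  assumes "gauss_bound \<eta> f B" "gauss_bound \<eta> g B" "\<eta> > 0"
  shows "gauss_bound \<eta> (f + g) B"
  using assms by (auto simp: gauss_bound_def plus_fun_def intro!: absval_times_le)

lemma gauss_bound_uminus [simp]: "gauss_bound \<eta> (- f) B \<longleftrightarrow> gauss_bound \<eta> f B"
  by (simp add: gauss_bound_def fun_Compl_def)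

lemma gauss_bound_diff:
  assumes "gauss_bound \<eta> f B" "gauss_bound \<eta> g B" "\<eta> > 0"
  shows "gauss_bound \<eta> (f - g) B"
  using gauss_bound_add[OF assms(1), of "- g"] assms by simp

lemma gauss_bound_diff_commute: "gauss_bound \<eta> (f - g) B \<longleftrightarrow> gauss_bound \<eta> (g - f) B"
  by (metis gauss_bound_uminus minus_diff_eq)

lemma gauss_bound_sum:
  assumes "\<And>h. h \<in> H \<Longrightarrow> gauss_bound \<eta> (f h) B" "\<eta> > 0" "B \<ge> 0"
  shows "gauss_bound \<eta> (sum f H) B"
  using assms by (induction H rule: infinite_finite_induct) (auto intro!: gauss_bound_add)

lemma gauss_bound_scale:
  "gauss_bound \<eta> f B \<Longrightarrow> gauss_bound \<eta> (scale c f) (absval c * B)"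
  by (auto simp: gauss_bound_def scale_def valuation_mult mult.assoc intro!: mult_left_mono)

text \<open>Identities between limits, such as associativity and the division formula, come from it:
  both sides are shown to differ by at most any given \<open>e\<close> in one Gauss norm.\<close>

lemma gauss_bound_small_eq_0:
  assumes "\<And>e. e > 0 \<Longrightarrow> gauss_bound \<eta> f e" "\<eta> > 0"
  shows "f = 0"
proof (intro ext)
  fix j i
  have "absval (f j i) * \<eta> powi j \<le> 0"
    by (rule field_le_epsilon) (use assms gauss_boundD in fastforce)
  then show "f j i = 0 j i"
    using assms(2) by (auto simp: mult_le_0_iff not_le)
       (metis absval_pos assms(2) leD mult_pos_pos zero_less_power_int)
qed

lemma null_seriesD: "f \<in> null_series \<eta> \<Longrightarrow> e > 0 \<Longrightarrow> finite {(j, i). e \<le> absval (f j i) * \<eta> powi j}"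
  by (simp add: null_series_def)

text \<open>As a function of \<eta> the power is increasing for \<open>j \<ge> 0\<close> and
  decreasing for \<open>j < 0\<close>, so it is largest at an end of the interval.\<close>

lemma powi_between:
  assumes "0 < \<alpha>" "\<alpha> \<le> \<eta>" "\<eta> \<le> (\<beta>::real)"
  shows "\<eta> powi j \<le> max (\<alpha> powi j) (\<beta> powi j)"
proof (cases "j \<ge> 0")
  case True
  then have "\<eta> powi j \<le> \<beta> powi j" using assms by (intro power_int_mono) auto
  then show ?thesis by simp
next
  case False
  have "inverse \<eta> ^ nat (-j) \<le> inverse \<alpha> ^ nat (-j)"
    using assms by (intro power_mono) auto
  then have "\<eta> powi j \<le> \<alpha> powi j" using False by (simp add: power_int_def)
  then show ?thesis by simp
qed

lemma null_series_iff_tendsto: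
  assumes "\<eta> > 0"
  shows "f \<in> null_series \<eta> \<longleftrightarrow> ((\<lambda>(j, i). absval (f j i) * \<eta> powi j) \<longlongrightarrow> 0) cofinite"
proof -
  have "\<bar>absval (f j i) * \<eta> powi j\<bar> = absval (f j i) * \<eta> powi j" for j i
    using assms by (simp add: abs_mult)
  then show ?thesis
    unfolding tendsto_iff null_series_def eventually_cofinite
    by (simp add: case_prod_unfold dist_real_def not_less)
qed

text \<open>Convergence on the two boundary circles controls everything between them; this is why
  \<open>annulus_ring\<close> tests only its two end radii.\<close>

lemma null_series_between:
  assumes "f \<in> null_series \<alpha>" "f \<in> null_series \<beta>" "0 < \<alpha>" "\<alpha> \<le> \<eta>" "\<eta> \<le> \<beta>"
  shows "f \<in> null_series \<eta>"
  unfolding null_series_def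
proof safe
  fix e :: real assume "e > 0"
  have "{(j, i). e \<le> absval (f j i) * \<eta> powi j} \<subseteq>
     {(j, i). e \<le> absval (f j i) * \<alpha> powi j} \<union> {(j, i). e \<le> absval (f j i) * \<beta> powi j}"
  proof safe
    fix j i assume e: "e \<le> absval (f j i) * \<eta> powi j" "\<not> e \<le> absval (f j i) * \<beta> powi j"
    have "absval (f j i) * \<eta> powi j \<le> absval (f j i) * max (\<alpha> powi j) (\<beta> powi j)"
      by (intro mult_left_mono powi_between assms) auto
    then show "e \<le> absval (f j i) * \<alpha> powi j" using e by (auto simp: max_def split: if_splits)
  qed
  then show "finite {(j, i). e \<le> absval (f j i) * \<eta> powi j}"
    by (rule finite_subset) (use assms \<open>e > 0\<close> in \<open>auto simp: null_series_def\<close>)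
qed

text \<open>\<open>null_series \<eta>\<close> is closed for the Gauss norm: where \<open>f\<close>
  has weight at least \<open>e\<close>, an approximation within \<open>e / 2\<close> has weight at
  least \<open>e / 2\<close>, and that happens finitely often.\<close>

lemma null_series_closed_limit:
  assumes "\<And>e. e > 0 \<Longrightarrow> \<exists>g\<in>null_series \<eta>. gauss_bound \<eta> (f - g) e" "\<eta> > 0"
  shows "f \<in> null_series \<eta>"
  unfolding null_series_def
proof safe
  fix e :: real assume "e > 0"
  then obtain g where g: "g \<in> null_series \<eta>" "gauss_bound \<eta> (f - g) (e / 2)"
    using assms(1)[of "e / 2"] by auto
  have "{(j, i). e \<le> absval (f j i) * \<eta> powi j} \<subseteq> {(j, i). e / 2 \<le> absval (g j i) * \<eta> powi j}"
  proof safe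
    fix j i assume e': "e \<le> absval (f j i) * \<eta> powi j"
    show "e / 2 \<le> absval (g j i) * \<eta> powi j"
    proof (rule ccontr)
      assume "\<not> ?thesis"
      then have "absval (g j i + (f - g) j i) * \<eta> powi j \<le> e / 2"
        using gauss_boundD[OF g(2), of j i] assms(2) by (intro absval_times_le) auto
      then show False using e' \<open>e > 0\<close> by simp
    qed
  qed
  then show "finite {(j, i). e \<le> absval (f j i) * \<eta> powi j}"
    by (rule finite_subset) (intro null_seriesD g, use \<open>e > 0\<close> in simp)
qed

lemma null_series_add:
  assumes "f \<in> null_series \<eta>" "g \<in> null_series \<eta>" "\<eta> > 0"
  shows "f + g \<in> null_series \<eta>"
  unfolding null_series_def
proof safe
  fix e :: real assume "e > 0"
  have "{(j, i). e \<le> absval ((f + g) j i) * \<eta> powi j} \<subseteq>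
     {(j, i). e / 2 \<le> absval (f j i) * \<eta> powi j} \<union> {(j, i). e / 2 \<le> absval (g j i) * \<eta> powi j}"
  proof safe
    fix j i assume e: "e \<le> absval ((f + g) j i) * \<eta> powi j" "\<not> e / 2 \<le> absval (g j i) * \<eta> powi j"
    show "e / 2 \<le> absval (f j i) * \<eta> powi j"
    proof (rule ccontr)
      assume "\<not> ?thesis"
      then have "absval (f j i + g j i) * \<eta> powi j \<le> e / 2"
        using e assms(3) by (intro absval_times_le) auto
      then show False using e \<open>e > 0\<close> by simp
    qed
  qed
  then show "finite {(j, i). e \<le> absval ((f + g) j i) * \<eta> powi j}"
    by (rule finite_subset) (intro finite_UnI null_seriesD assms, use \<open>e > 0\<close> in simp_all)
qed

lemma null_series_0 [simp]: "0 \<in> null_series \<eta>"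
  by (auto simp: null_series_def)

lemma null_series_uminus [simp]: "- f \<in> null_series \<eta> \<longleftrightarrow> f \<in> null_series \<eta>"
  by (simp add: null_series_def fun_Compl_def)

lemma null_series_diff:
  "f \<in> null_series \<eta> \<Longrightarrow> g \<in> null_series \<eta> \<Longrightarrow> \<eta> > 0 \<Longrightarrow> f - g \<in> null_series \<eta>"
  using null_series_add[of f \<eta> "- g"] by simp

lemma null_series_sum:
  assumes "\<And>h. h \<in> H \<Longrightarrow> f h \<in> null_series \<eta>" "\<eta> > 0"
  shows "sum f H \<in> null_series \<eta>"
  using assms by (induction H rule: infinite_finite_induct) (auto intro!: null_series_add)

lemma null_series_scale:
  assumes "f \<in> null_series \<eta>"
  shows "scale c f \<in> null_series \<eta>"
proof (cases "c = 0")
  case False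
  have "{(j, i). e \<le> absval (scale c f j i) * \<eta> powi j} = {(j, i). e / absval c \<le> absval (f j i) * \<eta> powi j}" for e
    using False by (auto simp: scale_def valuation_mult field_simps)
  then show ?thesis using assms False by (auto simp: null_series_def)
qed (auto simp: null_series_def scale_def)

lemma null_series_bounded:
  assumes "f \<in> null_series \<eta>"
  obtains B where "B > 0" "gauss_bound \<eta> f B"
proof -
  let ?F = "{(j, i). 1 \<le> absval (f j i) * \<eta> powi j}"
  have fin: "finite ?F" using assms by (auto simp: null_series_def)
  let ?v = "\<lambda>(j, i). absval (f j i) * \<eta> powi j"
  let ?B = "Max (insert 1 (?v ` ?F))"
  have "absval (f j i) * \<eta> powi j \<le> ?B" for j i
  proof (cases "(j, i) \<in> ?F")
    case True
    then show ?thesis using fin by (intro Max_ge) (auto intro!: image_eqI[of _ _ "(j, i)"])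
  next
    case False
    moreover have "1 \<le> ?B" using fin by (intro Max_ge) auto
    ultimately show ?thesis by auto
  qed
  moreover have "?B > 0" using fin by (subst Max_gr_iff) auto
  ultimately show ?thesis using that by (auto simp: gauss_bound_def)
qed

text \<open>Small coefficients are dropped and the others kept unchanged. That no coefficient is
  altered matters later: the truncation of a normal series is again normal and obeys the same
  bounds.\<close>

lemma null_series_truncate:
  assumes "f \<in> null_series \<eta>" "e > 0"
  obtains g where "finite_series g" "gauss_bound \<eta> (f - g) e" "\<And>j i. g j i = f j i \<or> g j i = 0"
    "\<And>j i. g j i \<noteq> 0 \<Longrightarrow> absval (f j i) * \<eta> powi j \<ge> e"
proof -
  let ?F = "{(j, i). e \<le> absval (f j i) * \<eta> powi j}"
  define g where "g = (\<lambda>j i. if (j, i) \<in> ?F then f j i else 0)"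
  have "finite ?F" using assms by (auto simp: null_series_def)
  moreover have "{(j, i). g j i \<noteq> 0} \<subseteq> ?F" by (auto simp: g_def split: if_splits)
  ultimately have "finite_series g" by (auto simp: finite_series_def intro: finite_subset)
  then show ?thesis using assms by (intro that[of g]) (auto simp: g_def gauss_bound_def split: if_splits)
qed

lemma finite_series_null:
  assumes "finite_series f"
  shows "f \<in> null_series \<eta>"
proof -
  have "{(j, i). e \<le> absval (f j i) * \<eta> powi j} \<subseteq> {(j, i). f j i \<noteq> 0}" if "e > 0" for e
    using that by auto
  then show ?thesis using assms by (auto simp: null_series_def finite_series_def intro: finite_subset)
qed

lemma finite_series_induct [consumes 1, case_names zero add]:
  fixes f :: "('n, 'k::complete_discretely_valued_field) series"
  assumes "finite_series f" "P 0"
    and "\<And>a b c f. finite_series f \<Longrightarrow> P f \<Longrightarrow> P (series_monom a b c + f)"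
  shows "P f"
  using assms(1)
proof (induction "card {(j, i). f j i \<noteq> 0}" arbitrary: f rule: less_induct)
  case less
  show ?case
  proof (cases "f = 0")
    case False
    then obtain a b where ab: "f a b \<noteq> 0" by (metis ext zero_fun_apply)
    define g where "g = (\<lambda>j i. if j = a \<and> i = b then 0 else f j i)"
    have sub: "{(j, i). g j i \<noteq> 0} \<subset> {(j, i). f j i \<noteq> 0}" using ab by (auto simp: g_def)
    then have "finite_series g" using less.prems by (auto simp: finite_series_def intro: finite_subset)
    moreover have "card {(j, i). g j i \<noteq> 0} < card {(j, i). f j i \<noteq> 0}"
      using psubset_card_mono[OF _ sub] less.prems by (simp add: finite_series_def)
    ultimately have "P g" using less.hyps by blast
    moreover have "f = series_monom a b (f a b) + g" by (auto simp: g_def series_monom_def fun_eq_iff)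
    ultimately show ?thesis using assms(3) \<open>finite_series g\<close> by metis
  qed (simp add: assms(2))
qed

text \<open>A monomial in finitely many variables has only finitely many factorizations, so the
  inner sums of \<open>series_mult\<close> are finite sums.\<close>

lemma finite_add_pairs: "finite {(b, b' :: 'n::finite \<Rightarrow>\<^sub>0 nat). b + b' = i}"
proof -
  have fin: "finite {b :: 'n \<Rightarrow>\<^sub>0 nat. \<forall>x. Poly_Mapping.lookup b x \<le> Poly_Mapping.lookup i x}"
  proof -
    have "finite (\<Pi>\<^sub>E x\<in>UNIV. {..Poly_Mapping.lookup i x})" by (intro finite_PiE) auto
    moreover have "Poly_Mapping.lookup ` {b. \<forall>x. Poly_Mapping.lookup b x \<le> Poly_Mapping.lookup i x} \<subseteq> (\<Pi>\<^sub>E x\<in>UNIV. {..Poly_Mapping.lookup i x})"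
      by auto
    ultimately have "finite (Poly_Mapping.lookup ` {b. \<forall>x. Poly_Mapping.lookup b x \<le> Poly_Mapping.lookup i x})" by (rule rev_finite_subset)
    then show ?thesis
      by (rule finite_imageD) (simp add: inj_on_def Poly_Mapping.lookup_inject)
  qed
  have "{(b, b'). b + b' = i} \<subseteq> {b. \<forall>x. Poly_Mapping.lookup b x \<le> Poly_Mapping.lookup i x} \<times> {b. \<forall>x. Poly_Mapping.lookup b x \<le> Poly_Mapping.lookup i x}"
    by (auto simp: Poly_Mapping.lookup_add)
  then show ?thesis using fin by (meson finite_SigmaI finite_subset)
qed

text \<open>The share of a product coefficient that comes from the coefficient of \<open>S^a\<close>
  in the first factor. The product is split into these finite sums and one infinite sum over
  \<open>a\<close>.\<close>

definition conv_term ::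
    "('n, 'k::complete_discretely_valued_field) series \<Rightarrow> ('n, 'k) series \<Rightarrow> int \<Rightarrow> ('n \<Rightarrow>\<^sub>0 nat) \<Rightarrow> int \<Rightarrow> 'k" where
  "conv_term f g j i a = (\<Sum>(b, b') | b + b' = i. f a b * g (j - a) b')"

text \<open>Weaker than convergence on a common circle: it also covers products in
  \<open>R_int\<close>, whose elements need not converge at any radius
  \<open>\<eta> < 1\<close>.\<close>

definition convolvable ::
    "('n, 'k::complete_discretely_valued_field) series \<Rightarrow> ('n, 'k) series \<Rightarrow> bool" where
  "convolvable f g \<longleftrightarrow> (\<forall>j i. \<forall>e>0. finite {a. e \<le> absval (conv_term f g j i a)})"

lemma series_mult_conv_term: "(f \<star> g) j i = infsum (conv_term f g j i) UNIV"
  by (simp add: series_mult_def conv_term_def[abs_def])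

lemma convolvable_summable: "convolvable f g \<Longrightarrow> conv_term f g j i summable_on UNIV"
  by (intro nonarch_summable) (auto simp: convolvable_def)

lemma series_mult_commute: "f \<star> g = g \<star> (f :: ('n, 'k::complete_discretely_valued_field) series)"
proof (intro ext)
  fix j i
  have "bij_betw (\<lambda>a. j - a) UNIV (UNIV :: int set)"
    by (rule bij_betw_byWitness[where f' = "\<lambda>a. j - a"]) auto
  then have "infsum (conv_term f g j i) UNIV = infsum (\<lambda>a. conv_term f g j i (j - a)) UNIV"
    by (rule infsum_reindex_bij_betw[symmetric])
  also have "(\<lambda>a. conv_term f g j i (j - a)) = conv_term g f j i"
    unfolding conv_term_def
    by (intro ext sum.reindex_bij_witness[of _ "\<lambda>(x, y). (y, x)" "\<lambda>(x, y). (y, x)"]) (auto simp: add.commute mult.commute)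
  finally show "(f \<star> g) j i = (g \<star> f) j i" by (simp add: series_mult_conv_term)
qed

lemma conv_term_add_left: "conv_term (f + f') g j i a = conv_term f g j i a + conv_term f' g j i a"
  by (simp add: conv_term_def sum.distrib case_prod_unfold distrib_right)

lemma series_mult_add_left:
  assumes "convolvable f g" "convolvable f' g"
  shows "(f + f') \<star> g = f \<star> g + f' \<star> g"
proof (intro ext)
  fix j i
  show "((f + f') \<star> g) j i = (f \<star> g + f' \<star> g) j i"
    using infsum_add[OF convolvable_summable[OF assms(1)] convolvable_summable[OF assms(2)], of j i j i]
    by (simp add: series_mult_conv_term conv_term_add_left[abs_def])
qed

lemma absval_conv_term_le:
  assumes "\<And>b b'. b + b' = i \<Longrightarrow> absval (f a b) * absval (g (j - a) b') \<le> B" "B \<ge> 0"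
  shows "absval (conv_term f g j i a) \<le> B"
  unfolding conv_term_def by (rule absval_sum_le) (use assms in \<open>auto simp: valuation_mult\<close>)

lemma absval_conv_term_ge:
  assumes "e \<le> absval (conv_term f g j i a)" "e > 0"
  shows "\<exists>b b'. b + b' = i \<and> e \<le> absval (f a b) * absval (g (j - a) b')"
proof (rule ccontr)
  assume *: "\<not> ?thesis"
  have "absval (conv_term f g j i a) < e"
    unfolding conv_term_def
  proof (rule absval_sum_less)
    fix x assume "x \<in> {(b, b'). b + b' = i}"
    then show "absval (case x of (b, b') \<Rightarrow> f a b * g (j - a) b') < e"
      using * by (auto simp: valuation_mult not_le)
  qed (rule assms)
  then show False using assms by simp
qed

text \<open>Submultiplicativity of the Gauss norm. It holds also where the product diverges, since
  \<open>infsum\<close> is then 0 and \<open>infsum_absval_le\<close> still applies.\<close>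

lemma gauss_bound_mult:
  assumes "gauss_bound \<eta> f A" "gauss_bound \<eta> g B" "\<eta> > 0"
  shows "gauss_bound \<eta> (f \<star> g) (A * B)"
  unfolding gauss_bound_def
proof (intro allI)
  fix j i
  have AB: "A \<ge> 0" "B \<ge> 0" using assms gauss_bound_nonneg by blast+
  have pos: "\<eta> powi j > 0" using assms by simp
  have "absval (f a b) * absval (g (j - a) b') \<le> A * B / \<eta> powi j" for a b b'
  proof -
    have "(absval (f a b) * \<eta> powi a) * (absval (g (j - a) b') * \<eta> powi (j - a)) \<le> A * B"
      by (intro mult_mono gauss_boundD assms AB) (use assms in auto)
    moreover have E: "\<eta> powi j = \<eta> powi a * \<eta> powi (j - a)"
      using assms by (simp flip: power_int_add)
    ultimately have "absval (f a b) * absval (g (j - a) b') * \<eta> powi j \<le> A * B"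
      unfolding E by (simp add: mult_ac)
    then show ?thesis using pos by (simp add: field_simps)
  qed
  then have "absval ((f \<star> g) j i) \<le> A * B / \<eta> powi j"
    unfolding series_mult_conv_term using AB assms
    by (intro infsum_absval_le absval_conv_term_le) auto
  then show "absval ((f \<star> g) j i) * \<eta> powi j \<le> A * B" using pos by (simp add: field_simps)
qed

text \<open>If a product of weighted coefficients is at least \<open>e\<close> while the factors are
  bounded by \<open>A\<close> and \<open>B\<close>, then the factors are at least
  \<open>e / B\<close> and \<open>e / A\<close>; so each comes from a finite set.\<close>

lemma null_product_finite:
  assumes "f \<in> null_series \<eta>" "g \<in> null_series \<eta>" "\<eta> > 0" "e > 0"
  shows "\<exists>F G. finite F \<and> finite G \<and>
    (\<forall>a b j b'. e \<le> absval (f a b) * absval (g (j - a) b') * \<eta> powi j \<longrightarrow> (a, b) \<in> F \<and> (j - a, b') \<in> G)"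
proof -
  obtain A where A: "A > 0" "gauss_bound \<eta> f A" using null_series_bounded assms by metis
  obtain B where B: "B > 0" "gauss_bound \<eta> g B" using null_series_bounded assms by metis
  show ?thesis
  proof (intro exI conjI allI impI)
    show "finite {(j, i). e / B \<le> absval (f j i) * \<eta> powi j}" "finite {(j, i). e / A \<le> absval (g j i) * \<eta> powi j}"
      using assms A B by (auto simp: null_series_def)
  next
    fix a b j b' assume e: "e \<le> absval (f a b) * absval (g (j - a) b') * \<eta> powi j"
    have E: "\<eta> powi j = \<eta> powi a * \<eta> powi (j - a)" using assms by (simp flip: power_int_add)
    have e': "e \<le> (absval (f a b) * \<eta> powi a) * (absval (g (j - a) b') * \<eta> powi (j - a))"
      using e unfolding E by (simp add: mult_ac)
    have nn: "absval (f a b) * \<eta> powi a \<ge> 0" "absval (g (j - a) b') * \<eta> powi (j - a) \<ge> 0"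
      using assms by auto
    have "e \<le> (absval (f a b) * \<eta> powi a) * B" "e \<le> A * (absval (g (j - a) b') * \<eta> powi (j - a))"
      using e' mult_left_mono[OF gauss_boundD[OF B(2)] nn(1)] mult_right_mono[OF gauss_boundD[OF A(2)] nn(2)]
      by (meson order_trans)+
    then show "(a, b) \<in> {(j, i). e / B \<le> absval (f j i) * \<eta> powi j}"
        "(j - a, b') \<in> {(j, i). e / A \<le> absval (g j i) * \<eta> powi j}"
      using A B by (auto simp: field_simps)
  qed
qed

lemma convolvable_null:
  assumes "f \<in> null_series \<eta>" "g \<in> null_series \<eta>" "\<eta> > 0"
  shows "convolvable f g"
  unfolding convolvable_def
proof safe
  fix j i and e :: real assume "e > 0"
  then have pos: "e * \<eta> powi j > 0" using assms by simp
  from null_product_finite[OF assms pos] obtain F G where FG: "finite F" "finite G"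
    "\<forall>a b j' b'. e * \<eta> powi j \<le> absval (f a b) * absval (g (j' - a) b') * \<eta> powi j' \<longrightarrow> (a, b) \<in> F \<and> (j' - a, b') \<in> G"
    by blast
  have "{a. e \<le> absval (conv_term f g j i a)} \<subseteq> fst ` F"
  proof
    fix a assume "a \<in> {a. e \<le> absval (conv_term f g j i a)}"
    then have "e \<le> absval (conv_term f g j i a)" by simp
    from absval_conv_term_ge[OF this \<open>e > 0\<close>]
    obtain b b' where "e \<le> absval (f a b) * absval (g (j - a) b')" by blast
    then have le: "e * \<eta> powi j \<le> absval (f a b) * absval (g (j - a) b') * \<eta> powi j"
      using assms(3) by (intro mult_right_mono) auto
    have "(a, b) \<in> F" using FG(3)[rule_format, OF le] by (rule conjunct1)
    then show "a \<in> fst ` F" by (rule rev_image_eqI) simp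
  qed
  then show "finite {a. e \<le> absval (conv_term f g j i a)}" by (rule finite_surj[OF FG(1)])
qed

lemma null_series_mult:
  assumes "f \<in> null_series \<eta>" "g \<in> null_series \<eta>" "\<eta> > 0"
  shows "f \<star> g \<in> null_series \<eta>"
  unfolding null_series_def
proof safe
  fix e :: real assume "e > 0"
  then have half: "e / 2 > 0" by simp
  from null_product_finite[OF assms half] obtain F G where FG: "finite F" "finite G"
    "\<forall>a b j b'. e / 2 \<le> absval (f a b) * absval (g (j - a) b') * \<eta> powi j \<longrightarrow> (a, b) \<in> F \<and> (j - a, b') \<in> G"
    by blast
  let ?p = "\<lambda>((a, b), (a', b')). (a + a', b + b')"
  have "{(j, i). e \<le> absval ((f \<star> g) j i) * \<eta> powi j} \<subseteq> ?p ` (F \<times> G)"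
  proof safe
    fix j i assume e: "e \<le> absval ((f \<star> g) j i) * \<eta> powi j"
    have pos: "\<eta> powi j > 0" using assms by simp
    have "\<exists>a. e / 2 / \<eta> powi j \<le> absval (conv_term f g j i a)"
    proof (rule ccontr)
      assume "\<not> ?thesis"
      then have "absval (conv_term f g j i a) \<le> e / 2 / \<eta> powi j" for a by (meson nle_le)
      then have "absval ((f \<star> g) j i) \<le> e / 2 / \<eta> powi j"
        unfolding series_mult_conv_term using \<open>e > 0\<close> pos by (intro infsum_absval_le) auto
      then show False using e \<open>e > 0\<close> pos by (simp add: field_simps)
    qed
    then obtain a where a: "e / 2 / \<eta> powi j \<le> absval (conv_term f g j i a)" by blast
    have "e / 2 / \<eta> powi j > 0" using \<open>e > 0\<close> pos by simp
    from absval_conv_term_ge[OF a this]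
    obtain b b' where ab: "b + b' = i" "e / 2 / \<eta> powi j \<le> absval (f a b) * absval (g (j - a) b')"
      by blast
    then have "(a, b) \<in> F \<and> (j - a, b') \<in> G" using pos by (intro FG(3)[rule_format]) (simp add: field_simps)
    then show "(j, i) \<in> ?p ` (F \<times> G)"
      using ab(1) by (intro image_eqI[of _ _ "((a, b), (j - a, b'))"]) auto
  qed
  then show "finite {(j, i). e \<le> absval ((f \<star> g) j i) * \<eta> powi j}"
    by (rule finite_surj[rotated]) (use FG(1,2) in simp)
qed

lemma finite_series_monom [simp]: "finite_series (series_monom a b c)"
  unfolding finite_series_def
  by (rule finite_subset[of _ "{(a, b)}"]) (auto simp: series_monom_def)

text \<open>Subtraction of exponents is truncated, so \<open>b + (i - b) = i\<close> expresses that
  the monomial with exponent \<open>b\<close> divides the one with exponent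
  \<open>i\<close>.\<close>

lemma series_monom_mult:
  fixes g :: "('n::finite, 'k::complete_discretely_valued_field) series"
  shows "(series_monom a b c \<star> g) j i = (if b + (i - b) = i then c * g (j - a) (i - b) else 0)"
proof -
  have "(series_monom a b c \<star> g) j i = (\<Sum>a'\<in>{a}. conv_term (series_monom a b c) g j i a')"
    unfolding series_mult_conv_term
    by (rule infsum_neutral_finite) (auto simp: conv_term_def series_monom_def intro!: sum.neutral)
  also have "\<dots> = (\<Sum>(b1, b') | b1 + b' = i. if b1 = b then c * g (j - a) b' else 0)"
    by (auto simp: conv_term_def series_monom_def intro!: sum.cong)
  also have "\<dots> = (\<Sum>(b1, b') \<in> (if b + (i - b) = i then {(b, i - b)} else {}). c * g (j - a) b')"
  proof (rule sum.mono_neutral_cong_right)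
    show "finite {(b1, b'). b1 + b' = i}" by (rule finite_add_pairs)
  qed (auto split: if_splits)
  also have "\<dots> = (if b + (i - b) = i then c * g (j - a) (i - b) else 0)" by simp
  finally show ?thesis .
qed

lemma series_one_mult [simp]: "series_one \<star> g = (g :: ('n::finite, 'k::complete_discretely_valued_field) series)"
  by (intro ext) (simp add: series_monom_mult)

lemma series_const_mult: "series_monom 0 0 c \<star> g = scale c (g :: ('n::finite, 'k::complete_discretely_valued_field) series)"
  by (intro ext) (simp add: series_monom_mult scale_def)

text \<open>Multiplication by a monomial only shifts the indices of both sums, so it commutes with
  any convergent product.\<close>

lemma series_monom_assoc:
  fixes g h :: "('n::finite, 'k::complete_discretely_valued_field) series"
  assumes "convolvable g h"
  shows "(series_monom a b c \<star> g) \<star> h = series_monom a b c \<star> (g \<star> h)"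
proof (intro ext)
  fix j i
  let ?m = "series_monom a b c"
  have bij: "bij_betw (\<lambda>x. x + a) UNIV (UNIV :: int set)"
    by (rule bij_betw_byWitness[where f' = "\<lambda>x. x - a"]) auto
  have t: "conv_term (?m \<star> g) h j i (x + a) = (if b + (i - b) = i then c * conv_term g h (j - a) (i - b) x else 0)" for x
  proof -
    have "conv_term (?m \<star> g) h j i (x + a) =
        (\<Sum>(u, u') | u + u' = i. if b + (u - b) = u then c * g x (u - b) * h (j - a - x) u' else 0)"
      unfolding conv_term_def
      by (intro sum.cong) (auto simp: series_monom_mult algebra_simps)
    also have "\<dots> = (\<Sum>(u, u') | u + u' = i \<and> b + (u - b) = u. c * g x (u - b) * h (j - a - x) u')"
      by (rule sum.mono_neutral_cong_right) (auto simp: finite_add_pairs split: if_splits)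
    also have "\<dots> = (if b + (i - b) = i then c * conv_term g h (j - a) (i - b) x else 0)"
    proof (cases "b + (i - b) = i")
      case True
      define i0 where "i0 = i - b"
      have i: "i = b + i0" using True by (simp add: i0_def)
      have "(\<Sum>(u, u') | u + u' = i \<and> b + (u - b) = u. c * g x (u - b) * h (j - a - x) u') =
          (\<Sum>(v, v') | v + v' = i0. c * g x v * h (j - a - x) v')"
        by (rule sum.reindex_bij_witness[of _ "\<lambda>(v, v'). (b + v, v')" "\<lambda>(u, u'). (u - b, u')"])
           (auto simp: i add.assoc, metis add.assoc add_left_cancel)
      then show ?thesis using True
        by (simp add: conv_term_def i0_def sum_distrib_left case_prod_unfold mult.assoc)
    next
      case False
      have "{(u, u'). u + u' = i \<and> b + (u - b) = u} = {}"
      proof safe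
        fix u u' assume "i = u + u'" "b + (u - b) = u"
        then have "i = b + ((u - b) + u')" by (metis add.assoc)
        then show "(u, u') \<in> {}" using False by (metis add_diff_cancel_left')
      qed
      then show ?thesis using False by (metis (no_types, lifting) sum.empty)
    qed
    finally show ?thesis .
  qed
  have "((?m \<star> g) \<star> h) j i = infsum (\<lambda>x. conv_term (?m \<star> g) h j i (x + a)) UNIV"
    unfolding series_mult_conv_term[of "?m \<star> g"] by (rule infsum_reindex_bij_betw[OF bij, symmetric])
  also have "\<dots> = (?m \<star> (g \<star> h)) j i"
    using convolvable_summable[OF assms]
    by (simp add: t series_monom_mult infsum_cmult_right series_mult_conv_term[of g h])
  finally show "((?m \<star> g) \<star> h) j i = (?m \<star> (g \<star> h)) j i" .
qed

lemma series_mult_0_left [simp]: "0 \<star> g = (0 :: ('n, 'k::complete_discretely_valued_field) series)"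
  by (intro ext) (simp add: series_mult_def)

lemma series_mult_0_right [simp]: "g \<star> 0 = (0 :: ('n, 'k::complete_discretely_valued_field) series)"
  by (intro ext) (simp add: series_mult_def)

lemma series_mult_uminus_left: "(- f) \<star> g = - (f \<star> g :: ('n, 'k::complete_discretely_valued_field) series)"
proof (intro ext)
  fix j i
  have "conv_term (- f) g j i = (\<lambda>a. - conv_term f g j i a)"
    by (rule ext) (simp add: conv_term_def fun_Compl_def case_prod_unfold sum_negf)
  then show "((- f) \<star> g) j i = (- (f \<star> g)) j i"
    by (simp add: series_mult_conv_term infsum_uminus fun_Compl_def)
qed

section \<open>Ring laws for series that converge on one circle\<close>

context
  fixes \<eta> :: real
  assumes \<eta>: "\<eta> > 0"
begin

lemma null_mult_add_left:
  assumes "f \<in> null_series \<eta>" "f' \<in> null_series \<eta>" "g \<in> null_series \<eta>"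
  shows "(f + f') \<star> g = f \<star> g + f' \<star> g"
  by (rule series_mult_add_left) (use assms convolvable_null \<eta> in auto)

lemma null_mult_add_right:
  assumes "f \<in> null_series \<eta>" "g \<in> null_series \<eta>" "g' \<in> null_series \<eta>"
  shows "f \<star> (g + g') = f \<star> g + f \<star> g'"
  using null_mult_add_left[OF assms(2,3,1)] by (simp add: series_mult_commute)

lemma null_mult_diff_left:
  assumes "f \<in> null_series \<eta>" "f' \<in> null_series \<eta>" "g \<in> null_series \<eta>"
  shows "(f - f') \<star> g = f \<star> g - f' \<star> g"
  using null_mult_add_left[OF assms(1) null_series_uminus[THEN iffD2, OF assms(2)] assms(3)]
  by (simp only: series_mult_uminus_left add_uminus_conv_diff)

text \<open>For a Laurent polynomial \<open>f\<close> this follows term by term from the monomial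
  case. Both sides depend continuously on \<open>f\<close> for the Gauss norm, and Laurent
  polynomials are dense.\<close>

lemma null_mult_assoc:
  fixes f :: "('n::finite, 'k::complete_discretely_valued_field) series"
  assumes "f \<in> null_series \<eta>" "g \<in> null_series \<eta>" "h \<in> null_series \<eta>"
  shows "(f \<star> g) \<star> h = f \<star> (g \<star> h)"
proof -
  note cl = null_series_mult[OF _ _ \<eta>] null_series_diff[OF _ _ \<eta>]
  have fin: "(f0 \<star> g) \<star> h = f0 \<star> (g \<star> h)" if "finite_series f0" for f0
    using that
  proof (induction f0 rule: finite_series_induct)
    case (add a b c f1)
    have m: "series_monom a b c \<in> null_series \<eta>" "f1 \<in> null_series \<eta>"
      using add by (auto intro: finite_series_null)
    show ?case
      by (simp only: null_mult_add_left cl series_monom_assoc convolvable_null[OF _ _ \<eta>] assms m add.IH)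
  qed (simp only: series_mult_0_left)
  obtain B where B: "B > 0" "gauss_bound \<eta> g B" using null_series_bounded assms by metis
  obtain C where C: "C > 0" "gauss_bound \<eta> h C" using null_series_bounded assms by metis
  have "(f \<star> g) \<star> h - f \<star> (g \<star> h) = 0"
  proof (rule gauss_bound_small_eq_0[OF _ \<eta>])
    fix e :: real assume "e > 0"
    then have "e / (B * C) > 0" using B C by simp
    then obtain f0 where f0: "finite_series f0" "gauss_bound \<eta> (f - f0) (e / (B * C))"
      using null_series_truncate[OF assms(1)] by metis
    have m: "f0 \<in> null_series \<eta>" using f0 by (auto intro: finite_series_null)
    have "(f \<star> g) \<star> h - f \<star> (g \<star> h) = ((f - f0) \<star> g) \<star> h - (f - f0) \<star> (g \<star> h)"
      by (simp only: null_mult_diff_left cl assms m fin[OF f0(1)] diff_diff_eq2 diff_add_cancel)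
    moreover have "gauss_bound \<eta> (((f - f0) \<star> g) \<star> h) (e / (B * C) * B * C)"
      by (intro gauss_bound_mult f0 B C \<eta>)
    moreover have "gauss_bound \<eta> ((f - f0) \<star> (g \<star> h)) (e / (B * C) * (B * C))"
      by (intro gauss_bound_mult f0 B C \<eta>)
    ultimately show "gauss_bound \<eta> ((f \<star> g) \<star> h - f \<star> (g \<star> h)) e"
      using B C gauss_bound_diff[OF _ _ \<eta>] by simp
  qed
  then show ?thesis by simp
qed

end

section \<open>The series rings and their carriers\<close>

text \<open>The Tate algebra over the field, of which \<open>Tate_int\<close> is the unit
  ball.\<close>

definition tate :: "('i \<Rightarrow> 'k::complete_discretely_valued_field) \<Rightarrow> bool" where
  "tate g \<longleftrightarrow> (\<forall>e>0. finite {i. e \<le> absval (g i)})"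

lemma tateD: "tate g \<Longrightarrow> e > 0 \<Longrightarrow> finite {i. e \<le> absval (g i)}"
  by (simp add: tate_def)

lemma null_series_tate:
  assumes "f \<in> null_series \<eta>" "\<eta> > 0"
  shows "tate (f j)"
  unfolding tate_def
proof (intro allI impI)
  fix e :: real assume "e > 0"
  then have "e * \<eta> powi j > 0" using assms by simp
  then have "finite {(j', i). e * \<eta> powi j \<le> absval (f j' i) * \<eta> powi j'}"
    by (rule null_seriesD[OF assms(1)])
  then have "finite (snd ` {(j', i). e * \<eta> powi j \<le> absval (f j' i) * \<eta> powi j'})" by (rule finite_imageI)
  moreover have "{i. e \<le> absval (f j i)} \<subseteq> snd ` {(j', i). e * \<eta> powi j \<le> absval (f j' i) * \<eta> powi j'}"
  proof
    fix i assume "i \<in> {i. e \<le> absval (f j i)}"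
    then have "e * \<eta> powi j \<le> absval (f j i) * \<eta> powi j"
      using assms(2) by (intro mult_right_mono) auto
    then show "i \<in> snd ` {(j', i). e * \<eta> powi j \<le> absval (f j' i) * \<eta> powi j'}"
      by (intro image_eqI[of _ _ "(j, i)"]) auto
  qed
  ultimately show "finite {i. e \<le> absval (f j i)}" by (rule rev_finite_subset)
qed

text \<open>With \<open>null_series_range\<close> and \<open>null_series_tate\<close> as converses
  it separates the two directions of convergence: for given \<open>e\<close> finitely many
  \<open>S\<close>-exponents matter, and for each of them the condition concerns \<open>u\<close>
  only.\<close>

lemma null_seriesI:
  assumes "\<And>j. tate (f j)" "\<eta> > 0"
    and "\<And>e. e > 0 \<Longrightarrow> \<exists>N M. \<forall>j i. j < N \<or> j > M \<longrightarrow> absval (f j i) * \<eta> powi j < e"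
  shows "f \<in> null_series \<eta>"
  unfolding null_series_def
proof safe
  fix e :: real assume "e > 0"
  from assms(3)[OF this] obtain N M where NM: "\<And>j i. j < N \<or> j > M \<Longrightarrow> absval (f j i) * \<eta> powi j < e"
    by blast
  have "{(j, i). e \<le> absval (f j i) * \<eta> powi j} \<subseteq> Sigma {N..M} (\<lambda>j. {i. e / \<eta> powi j \<le> absval (f j i)})"
  proof safe
    fix j i assume e: "e \<le> absval (f j i) * \<eta> powi j"
    then show "j \<in> {N..M}" using NM[of j i] by force
    show "e / \<eta> powi j \<le> absval (f j i)" using e assms(2) by (simp add: field_simps)
  qed
  moreover have "finite (Sigma {N..M} (\<lambda>j. {i. e / \<eta> powi j \<le> absval (f j i)}))"
    using \<open>e > 0\<close> assms(2) by (intro finite_SigmaI tateD assms(1)) auto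
  ultimately show "finite {(j, i). e \<le> absval (f j i) * \<eta> powi j}" by (rule finite_subset)
qed

lemma null_series_range:
  assumes "f \<in> null_series \<eta>" "e > 0"
  shows "\<exists>N M. \<forall>j i. j < N \<or> j > M \<longrightarrow> absval (f j i) * \<eta> powi j < e"
proof -
  let ?A = "fst ` {(j, i). e \<le> absval (f j i) * \<eta> powi j}"
  have "finite ?A" using null_seriesD[OF assms] by (rule finite_imageI)
  then have "?A \<subseteq> {Min ?A..Max ?A}" by (meson Max_ge Min_le atLeastAtMost_iff subsetI)
  then obtain N M where "?A \<subseteq> {N..M}" by blast
  moreover have "j \<in> ?A" if "\<not> absval (f j i) * \<eta> powi j < e" for j i
    using that by (intro image_eqI[of _ _ "(j, i)"]) auto
  ultimately have "\<forall>j i. j < N \<or> j > M \<longrightarrow> absval (f j i) * \<eta> powi j < e" by force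
  then show ?thesis by blast
qed

lemma powi_tends_to_0:
  assumes "0 < \<eta>" "\<eta> < (1::real)" "e > 0"
  shows "\<exists>M. \<forall>j>M. B * \<eta> powi j < e"
proof -
  have "(\<lambda>n. \<bar>B\<bar> * \<eta> ^ n) \<longlonglongrightarrow> \<bar>B\<bar> * 0"
    by (intro tendsto_mult tendsto_const LIMSEQ_realpow_zero) (use assms in auto)
  then have "eventually (\<lambda>n. \<bar>B\<bar> * \<eta> ^ n < e) sequentially"
    by (rule order_tendstoD(2)) (use assms(3) in simp)
  then obtain n where n: "\<bar>B\<bar> * \<eta> ^ n < e" by (auto simp: eventually_sequentially)
  have "B * \<eta> powi j < e" if "j > int n" for j
  proof -
    have "\<eta> powi j \<le> \<eta> powi int n" using that assms by (intro power_int_decreasing) auto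
    then have "\<bar>B\<bar> * \<eta> powi j \<le> \<bar>B\<bar> * \<eta> ^ n" by (intro mult_left_mono) auto
    moreover have "B * \<eta> powi j \<le> \<bar>B\<bar> * \<eta> powi j" using assms by (intro mult_right_mono) auto
    ultimately show ?thesis using n by linarith
  qed
  then show ?thesis by blast
qed

text \<open>For growing radius the negative powers of \<open>S\<close> shrink, and below radius 1
  the bound on the coefficients takes care of the positive ones. So convergence at one radius
  reaches all larger radii below 1.\<close>

lemma null_series_mono_bounded:
  assumes "f \<in> null_series \<eta>" "gauss_bound 1 f B" "0 < \<eta>" "\<eta> \<le> \<eta>'" "\<eta>' < 1"
  shows "f \<in> null_series \<eta>'"
proof (rule null_seriesI)
  show "tate (f j)" for j using null_series_tate assms by blast
  show "\<eta>' > 0" using assms by simp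
  fix e :: real assume "e > 0"
  from null_series_range[OF assms(1) this] obtain N M where
    N: "\<forall>j i. j < N \<or> j > M \<longrightarrow> absval (f j i) * \<eta> powi j < e" by blast
  from powi_tends_to_0[OF \<open>\<eta>' > 0\<close> assms(5) \<open>e > 0\<close>, of B] obtain M' where
    M': "\<forall>j>M'. B * \<eta>' powi j < e" by blast
  have "absval (f j i) * \<eta>' powi j < e" if "j < min N 0" for j i
  proof -
    have "\<eta>' powi j \<le> \<eta> powi j"
    proof -
      have "inverse \<eta>' ^ nat (-j) \<le> inverse \<eta> ^ nat (-j)" using assms by (intro power_mono) auto
      then show ?thesis using that by (simp add: power_int_def)
    qed
    then have "absval (f j i) * \<eta>' powi j \<le> absval (f j i) * \<eta> powi j" by (rule mult_left_mono) simp
    moreover have "absval (f j i) * \<eta> powi j < e" using N that by simp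
    ultimately show ?thesis by linarith
  qed
  moreover have "absval (f j i) * \<eta>' powi j < e" if "j > M'" for j i
  proof -
    have "absval (f j i) \<le> B" using gauss_boundD[OF assms(2), of j i] by simp
    then have "absval (f j i) * \<eta>' powi j \<le> B * \<eta>' powi j" using \<open>\<eta>' > 0\<close> by (intro mult_right_mono) auto
    then show ?thesis using M' that by force
  qed
  ultimately show "\<exists>N M. \<forall>j i. j < N \<or> j > M \<longrightarrow> absval (f j i) * \<eta>' powi j < e" by blast
qed

lemma gauss_bound_1: "gauss_bound 1 f B \<longleftrightarrow> (\<forall>j i. absval (f j i) \<le> B)"
  by (simp add: gauss_bound_def)

text \<open>Applies to the \<open>r h\<close> and to lifts from \<open>R_kappa\<close>: with
  finitely many poles and bounded coefficients, a series converges on the whole punctured open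
  disc.\<close>

lemma null_series_principal:
  assumes "finite_principal_part f" "\<And>j. tate (f j)" "gauss_bound 1 f B" "0 < \<eta>" "\<eta> < 1"
  shows "f \<in> null_series \<eta>"
proof (rule null_seriesI)
  fix e :: real assume "e > 0"
  from assms(1) obtain N where N: "\<And>j. j < N \<Longrightarrow> f j = (\<lambda>i. 0)" by (auto simp: finite_principal_part_def)
  from powi_tends_to_0[OF assms(4,5) \<open>e > 0\<close>, of B] obtain M where
    M: "\<forall>j>M. B * \<eta> powi j < e" by blast
  have "absval (f j i) * \<eta> powi j < e" if "j > M" for j i
  proof -
    have "absval (f j i) * \<eta> powi j \<le> B * \<eta> powi j"
      using assms(4) gauss_boundD[OF assms(3), of j i] by (intro mult_right_mono) auto
    then show ?thesis using M that by force
  qed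
  then show "\<exists>N M. \<forall>j i. j < N \<or> j > M \<longrightarrow> absval (f j i) * \<eta> powi j < e"
    using N \<open>e > 0\<close> by (intro exI[of _ N] exI[of _ M]) auto
qed (use assms in auto)

lemma gauss_norm_le_iff:
  assumes "B \<ge> 0" "\<eta> > 0"
  shows "gauss_norm \<eta> f \<le> ennreal B \<longleftrightarrow> gauss_bound \<eta> f B"
proof -
  have "gauss_norm \<eta> f \<le> ennreal B \<longleftrightarrow> (\<forall>x. (case x of (j, i) \<Rightarrow> ennreal (absval (f j i) * \<eta> powi j)) \<le> ennreal B)"
    unfolding gauss_norm_def by (subst SUP_le_iff) simp
  also have "\<dots> \<longleftrightarrow> (\<forall>j i. ennreal (absval (f j i) * \<eta> powi j) \<le> ennreal B)" by auto
  also have "\<dots> \<longleftrightarrow> gauss_bound \<eta> f B"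
    unfolding gauss_bound_def using assms by (simp add: ennreal_le_iff)
  finally show ?thesis .
qed

lemma ennreal_tendsto_0_iff:
  "((x :: 'a \<Rightarrow> ennreal) \<longlongrightarrow> 0) F \<longleftrightarrow> (\<forall>e>0. eventually (\<lambda>k. x k \<le> ennreal e) F)"
proof
  assume L: "(x \<longlongrightarrow> 0) F"
  show "\<forall>e>0. eventually (\<lambda>k. x k \<le> ennreal e) F"
  proof (intro allI impI)
    fix e :: real assume "e > 0"
    then have "eventually (\<lambda>k. x k < ennreal e) F" by (intro order_tendstoD(2)[OF L]) simp
    then show "eventually (\<lambda>k. x k \<le> ennreal e) F" by (rule eventually_mono) simp
  qed
next
  assume R: "\<forall>e>0. eventually (\<lambda>k. x k \<le> ennreal e) F"
  show "(x \<longlongrightarrow> 0) F"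
  proof (rule order_tendstoI)
    fix a :: ennreal assume "0 < a"
    then obtain b where b: "0 < b" "b < a" using dense by blast
    then obtain e where e: "b = ennreal e" "e > 0"
      by (metis ennreal_cases ennreal_less_zero_iff top.not_eq_extremum not_less_iff_gr_or_eq top_greatest leD)
    show "eventually (\<lambda>k. x k < a) F"
      using R[rule_format, OF e(2)] by (rule eventually_mono) (use b e in auto)
  qed simp
qed

lemma series_ring_simps [simp]:
  "carrier (series_ring C) = C" "f \<otimes>\<^bsub>series_ring C\<^esub> g = f \<star> g" "f \<oplus>\<^bsub>series_ring C\<^esub> g = f + g"
  "\<zero>\<^bsub>series_ring C\<^esub> = 0" "\<one>\<^bsub>series_ring C\<^esub> = series_one"
  by (auto simp: series_ring_def plus_fun_def zero_fun_def series_monom_def)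

text \<open>Associativity and distributivity hold in \<open>null_series \<eta>\<close> as a whole,
  so a subset only has to be closed under the operations.\<close>

lemma series_cring:
  fixes C :: "('n::finite, 'k::complete_discretely_valued_field) series set"
  assumes "\<eta> > 0" "C \<subseteq> null_series \<eta>" "0 \<in> C" "series_one \<in> C"
    and "\<And>f. f \<in> C \<Longrightarrow> - f \<in> C" "\<And>f g. f \<in> C \<Longrightarrow> g \<in> C \<Longrightarrow> f + g \<in> C"
    and "\<And>f g. f \<in> C \<Longrightarrow> g \<in> C \<Longrightarrow> f \<star> g \<in> C"
  shows "cring (series_ring C)"
proof (rule cringI)
  note sub = subsetD[OF assms(2)]
  show "abelian_group (series_ring C)"
  proof (rule abelian_groupI)
    fix f assume "f \<in> carrier (series_ring C)"
    then show "\<exists>g\<in>carrier (series_ring C). g \<oplus>\<^bsub>series_ring C\<^esub> f = \<zero>\<^bsub>series_ring C\<^esub>"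
      using assms(5) by (intro bexI[of _ "- f"]) (simp_all only: series_ring_simps left_minus)
  qed (use assms in \<open>simp_all only: series_ring_simps add.assoc add_0_left\<close>, simp only: add.commute)
  show "comm_monoid (series_ring C)"
    by (rule comm_monoidI)
       (use assms in \<open>simp_all only: series_ring_simps series_one_mult null_mult_assoc[OF assms(1)] sub\<close>,
        simp only: series_mult_commute)
qed (simp only: series_ring_simps null_mult_add_left[OF assms(1)] subsetD[OF assms(2)])

text \<open>By \<open>R_eta_eq\<close> the carrier of \<open>R_eta \<eta>\<close>: functions with
  bounded coefficients on the annulus from radius \<eta> up to 1, encoded by convergence at the
  inner radius alone.\<close>

definition bounded_null_series :: "real \<Rightarrow> ('n, 'k::complete_discretely_valued_field) series set" where
  "bounded_null_series \<eta> = {f \<in> null_series \<eta>. \<exists>B. gauss_bound 1 f B}"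

lemma gauss_bound_series_monom: "absval c * \<eta> powi a \<le> B \<Longrightarrow> 0 \<le> B \<Longrightarrow> gauss_bound \<eta> (series_monom a b c) B"
  by (auto simp: gauss_bound_def series_monom_def)

lemma series_one_null [simp]: "series_one \<in> null_series \<eta>"
  by (simp add: finite_series_null)

lemma bounded_null_series_closed:
  assumes "\<eta> > 0"
  shows "0 \<in> bounded_null_series \<eta>" "series_one \<in> bounded_null_series \<eta>"
    "f \<in> bounded_null_series \<eta> \<Longrightarrow> - f \<in> bounded_null_series \<eta>"
    "f \<in> bounded_null_series \<eta> \<Longrightarrow> g \<in> bounded_null_series \<eta> \<Longrightarrow> f + g \<in> bounded_null_series \<eta>"
    "f \<in> bounded_null_series \<eta> \<Longrightarrow> g \<in> bounded_null_series \<eta> \<Longrightarrow> f \<star> g \<in> bounded_null_series \<eta>"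
    "f \<in> bounded_null_series \<eta> \<Longrightarrow> scale c f \<in> bounded_null_series \<eta>"
proof -
  show "0 \<in> bounded_null_series \<eta>" by (auto simp: bounded_null_series_def intro: exI[of _ 0])
  show "series_one \<in> bounded_null_series \<eta>"
    by (auto simp: bounded_null_series_def intro!: exI[of _ 1] gauss_bound_series_monom)
  show "f \<in> bounded_null_series \<eta> \<Longrightarrow> - f \<in> bounded_null_series \<eta>"
    unfolding bounded_null_series_def by fastforce
  show "f \<in> bounded_null_series \<eta> \<Longrightarrow> g \<in> bounded_null_series \<eta> \<Longrightarrow> f + g \<in> bounded_null_series \<eta>"
  proof -
    assume "f \<in> bounded_null_series \<eta>" "g \<in> bounded_null_series \<eta>"
    then obtain A B where *: "f \<in> null_series \<eta>" "g \<in> null_series \<eta>" "gauss_bound 1 f A" "gauss_bound 1 g B"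
      by (auto simp: bounded_null_series_def)
    then have "gauss_bound 1 f (max A B)" "gauss_bound 1 g (max A B)" by (auto elim: gauss_bound_mono)
    then have "gauss_bound 1 (f + g) (max A B)" by (rule gauss_bound_add) simp
    then show "f + g \<in> bounded_null_series \<eta>" using * assms null_series_add
      unfolding bounded_null_series_def by blast
  qed
  show "f \<in> bounded_null_series \<eta> \<Longrightarrow> g \<in> bounded_null_series \<eta> \<Longrightarrow> f \<star> g \<in> bounded_null_series \<eta>"
    unfolding bounded_null_series_def using gauss_bound_mult[of 1 f _ g] null_series_mult[OF _ _ assms, of f g] by force
  show "f \<in> bounded_null_series \<eta> \<Longrightarrow> scale c f \<in> bounded_null_series \<eta>"
    unfolding bounded_null_series_def using gauss_bound_scale[of 1 f _ c] null_series_scale[of f \<eta> c] by blast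
qed

section \<open>Explicit carriers of the rings\<close>

lemma carrier_annulus_ring:
  assumes "\<alpha> > 0" "\<beta> > 0"
  shows "(annulus_ring (\<alpha>, \<beta>) :: ('n, 'k::complete_discretely_valued_field) series ring) =
    series_ring (null_series \<alpha> \<inter> null_series \<beta>)"
proof -
  have "{f :: ('n, 'k) series. ((\<lambda>(j, i). absval (f j i) * \<alpha> powi j) \<longlongrightarrow> 0) cofinite \<and>
         ((\<lambda>(j, i). absval (f j i) * \<beta> powi j) \<longlongrightarrow> 0) cofinite} = null_series \<alpha> \<inter> null_series \<beta>"
    using assms by (auto simp: null_series_iff_tendsto)
  then show ?thesis by (simp add: annulus_ring_def)
qed

lemma cring_annulus_ring:
  assumes "\<alpha> > 0" "\<beta> > 0"
  shows "cring (annulus_ring (\<alpha>, \<beta>) :: ('n::finite, 'k::complete_discretely_valued_field) series ring)"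
  unfolding carrier_annulus_ring[OF assms]
  by (rule series_cring[of \<alpha>]) (use assms in \<open>auto intro: null_series_add null_series_mult\<close>)

lemma R_int_carrier:
  fixes f :: "('n, 'k::complete_discretely_valued_field) series"
  shows "f \<in> carrier R_int \<longleftrightarrow> gauss_bound 1 f 1 \<and> (\<forall>j. tate (f j)) \<and> (\<forall>e>0. \<exists>N. \<forall>j<N. \<forall>i. absval (f j i) \<le> e)"
proof -
  have T: "g \<in> Tate_int \<longleftrightarrow> (\<forall>i. absval (g i) \<le> 1) \<and> tate g" for g :: "('n \<Rightarrow>\<^sub>0 nat) \<Rightarrow> 'k"
    by (simp add: Tate_int_def tate_def tendsto_iff eventually_cofinite not_less)
  have S: "(SUP i. ennreal (absval (f j i))) \<le> ennreal e \<longleftrightarrow> (\<forall>i. absval (f j i) \<le> e)" if "e > 0" for j e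
    using that by (simp add: SUP_le_iff)
  have "((\<lambda>j. SUP i. ennreal (absval (f j i))) \<longlongrightarrow> 0) at_bot \<longleftrightarrow>
     (\<forall>e>0. eventually (\<lambda>j. \<forall>i. absval (f j i) \<le> e) at_bot)"
    unfolding ennreal_tendsto_0_iff using S by (auto elim!: eventually_mono)
  also have "\<dots> \<longleftrightarrow> (\<forall>e>0. \<exists>N. \<forall>j<N. \<forall>i. absval (f j i) \<le> e)"
    by (simp add: eventually_at_bot_dense)
  finally show ?thesis
    by (auto simp: R_int_def series_ring_def T gauss_bound_1)
qed

lemma R_int_simps [simp]:
  "f \<otimes>\<^bsub>R_int\<^esub> g = f \<star> g" "f \<oplus>\<^bsub>R_int\<^esub> g = f + g" "\<zero>\<^bsub>R_int\<^esub> = 0" "\<one>\<^bsub>R_int\<^esub> = series_one"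
  unfolding R_int_def by (rule series_ring_simps)+

text \<open>For negative \<open>j\<close> the weight \<open>\<eta> powi j\<close> is at least 1, so
  convergence at a radius below 1 forces the coefficients themselves to tend to zero as
  \<open>j\<close> tends to minus infinity.\<close>

lemma bounded_null_series_R_int:
  assumes "f \<in> null_series \<eta>" "gauss_bound 1 f 1" "0 < \<eta>" "\<eta> < 1"
  shows "f \<in> carrier R_int"
  unfolding R_int_carrier
proof (intro conjI allI impI)
  show "tate (f j)" for j using null_series_tate assms by blast
  fix e :: real assume "e > 0"
  from null_series_range[OF assms(1) this] obtain N M where
    N: "\<forall>j i. j < N \<or> j > M \<longrightarrow> absval (f j i) * \<eta> powi j < e" by blast
  have "absval (f j i) \<le> e" if "j < min N 0" for j i
  proof -
    have "1 \<le> \<eta> powi j"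
    proof -
      have "1 \<le> inverse \<eta> ^ nat (-j)" using assms by (intro one_le_power) (simp add: field_simps)
      then show ?thesis using that by (simp add: power_int_def)
    qed
    then have "absval (f j i) * 1 \<le> absval (f j i) * \<eta> powi j" by (rule mult_left_mono) simp
    then show ?thesis using N that by (metis less_imp_le min_less_iff_conj mult_1_right order_trans)
  qed
  then show "\<exists>N. \<forall>j<N. \<forall>i. absval (f j i) \<le> e" by blast
qed (rule assms)

lemma finite_principal_R_int:
  assumes "finite_principal_part f" "\<And>j. tate (f j)" "gauss_bound 1 f 1"
  shows "f \<in> carrier R_int"
  by (rule bounded_null_series_R_int[of f "1/2"]) (use assms null_series_principal[of f 1 "1/2"] in auto)

lemma scale_0 [simp]: "scale 0 f = 0"
  by (auto simp: scale_def fun_eq_iff)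

lemma scale_scale [simp]: "scale a (scale b f) = scale (a * b) f"
  by (simp add: scale_def mult.assoc)

lemma scale_1 [simp]: "scale 1 f = f"
  by (simp add: scale_def)

lemma gauss_bound_scale_iff:
  assumes "c \<noteq> 0"
  shows "gauss_bound \<eta> (scale c f) B \<longleftrightarrow> gauss_bound \<eta> f (B / absval c)"
  using assms by (simp add: gauss_bound_def scale_def valuation_mult field_simps)

lemma exists_large:
  "\<exists>a::'k::complete_discretely_valued_field. a \<noteq> 0 \<and> B \<le> absval a"
proof -
  obtain u :: 'k where u: "0 < absval u" "absval u < 1" using valuation_discrete by blast
  then obtain n where "B < inverse (absval u) ^ n"
    using real_arch_pow[of "inverse (absval u)" B] one_less_inverse by blast
  then have "B \<le> absval (inverse u ^ n)" unfolding absval_power absval_inverse by simp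
  moreover have "inverse u ^ n \<noteq> 0" using u by simp
  ultimately show ?thesis by blast
qed

text \<open>A limit of null series is null. Conversely, a function on the half-open annulus is the
  limit of its truncations in \<open>S\<close>, which have finitely many coefficients in the Tate
  algebra and hence are bounded.\<close>

lemma carrier_Frechet_ring:
  assumes "0 < \<eta>0" "\<eta>0 < 1"
  shows "carrier (Frechet_ring \<eta>0 :: ('n, 'k::complete_discretely_valued_field) series ring) = {f. \<forall>\<eta>\<in>{\<eta>0..<1}. f \<in> null_series \<eta>}"
proof (intro equalityI subsetI)
  fix f :: "('n, 'k) series" assume "f \<in> carrier (Frechet_ring \<eta>0)"
  then have "\<exists>Y :: nat \<Rightarrow> ('n, 'k) series. (\<forall>k. Y k \<in> carrier R_K \<and> finite_principal_part (Y k)) \<and>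
     (\<forall>\<eta>\<in>{\<eta>0..<1}. (\<lambda>k. gauss_norm \<eta> (\<lambda>j i. Y k j i - f j i)) \<longlonglongrightarrow> 0)"
    by (simp add: Frechet_ring_def)
  then obtain Y where Y: "\<forall>k. Y k \<in> carrier R_K \<and> finite_principal_part (Y k)"
    and lim: "\<forall>\<eta>\<in>{\<eta>0..<1}. (\<lambda>k. gauss_norm \<eta> (\<lambda>j i. Y k j i - f j i)) \<longlonglongrightarrow> 0"
    by blast
  have "f \<in> null_series \<eta>" if \<eta>: "\<eta> \<in> {\<eta>0..<1}" for \<eta>
  proof (rule null_series_closed_limit)
    show "\<eta> > 0" using \<eta> assms by simp
    fix e :: real assume "e > 0"
    then obtain k where "gauss_norm \<eta> (\<lambda>j i. Y k j i - f j i) \<le> ennreal e"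
      using lim[rule_format, OF \<eta>] unfolding ennreal_tendsto_0_iff eventually_sequentially by blast
    then have "gauss_bound \<eta> (\<lambda>j i. Y k j i - f j i) e"
      using \<open>e > 0\<close> \<open>\<eta> > 0\<close> by (simp add: gauss_norm_le_iff)
    moreover have "(\<lambda>j i. Y k j i - f j i) = Y k - f" by (simp add: fun_diff_def)
    ultimately have "gauss_bound \<eta> (f - Y k) e" using gauss_bound_diff_commute by metis
    moreover have "Y k \<in> null_series \<eta>"
    proof -
      obtain a g where g: "Y k = scale a g" "g \<in> carrier R_int"
        using Y[rule_format, of k] unfolding R_K_def extend_scalars_def series_ring_simps by blast
      show ?thesis
      proof (cases "a = 0")
        case False
        have "g = scale (inverse a) (Y k)" using False g by simp
        then have "finite_principal_part g"
          using Y unfolding finite_principal_part_def scale_def by (metis mult_zero_right)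
        then have "g \<in> null_series \<eta>"
          using g \<eta> assms by (intro null_series_principal[of g 1]) (auto simp: R_int_carrier)
        then show ?thesis by (simp add: g null_series_scale)
      qed (simp add: g)
    qed
    ultimately show "\<exists>g\<in>null_series \<eta>. gauss_bound \<eta> (f - g) e" by blast
  qed
  then show "f \<in> {f. \<forall>\<eta>\<in>{\<eta>0..<1}. f \<in> null_series \<eta>}" by simp
next
  fix f :: "('n, 'k) series" assume f: "f \<in> {f. \<forall>\<eta>\<in>{\<eta>0..<1}. f \<in> null_series \<eta>}"
  then have f0: "f \<in> null_series \<eta>0" using assms by simp
  \<comment> \<open>Truncation in the \<open>S\<close>-exponent only. Dividing by a constant
    \<open>a\<close> that dominates all remaining coefficients shows that it lies in
    \<open>R_K\<close>.\<close>
  define Y where "Y k = (\<lambda>j i. if \<bar>j\<bar> \<le> int k then f j i else 0)" for k :: nat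
  have "Y k \<in> carrier R_K" for k
  proof -
    obtain B where B: "B > 0" "gauss_bound \<eta>0 f B" using null_series_bounded[OF f0] by blast
    define D where "D = Max ((\<lambda>j. B / \<eta>0 powi j) ` {- int k..int k})"
    obtain a :: 'k where a: "a \<noteq> 0" "max D 0 \<le> absval a" using exists_large by blast
    have le: "absval (Y k j i) \<le> absval a" for j i
    proof (cases "\<bar>j\<bar> \<le> int k")
      case True
      have "absval (f j i) \<le> B / \<eta>0 powi j"
        using gauss_boundD[OF B(2), of j i] assms by (simp add: field_simps)
      also have "\<dots> \<le> D" unfolding D_def
      proof (rule Max_ge)
        show "B / \<eta>0 powi j \<in> (\<lambda>j. B / \<eta>0 powi j) ` {- int k..int k}"
          using True by (intro imageI) (simp add: abs_le_iff)
      qed simp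
      finally show ?thesis using a True by (simp add: Y_def)
    qed (simp add: Y_def)
    have "finite_principal_part (scale (inverse a) (Y k))"
      unfolding finite_principal_part_def by (rule exI[of _ "- int k"]) (auto simp: scale_def Y_def)
    moreover have "tate (scale (inverse a) (Y k) j)" for j
      unfolding tate_def
    proof (intro allI impI)
      fix e :: real assume "e > 0"
      have "{i. e \<le> absval (scale (inverse a) (Y k) j i)} \<subseteq> {i. e * absval a \<le> absval (f j i)}"
      proof
        fix i assume i: "i \<in> {i. e \<le> absval (scale (inverse a) (Y k) j i)}"
        have "absval (scale (inverse a) (Y k) j i) = absval (Y k j i) / absval a"
          by (simp add: scale_def valuation_mult absval_inverse divide_inverse mult.commute)
        also have "\<dots> \<le> absval (f j i) / absval a" by (intro divide_right_mono) (auto simp: Y_def)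
        finally have "e \<le> absval (f j i) / absval a" using i by (meson mem_Collect_eq order_trans)
        then show "i \<in> {i. e * absval a \<le> absval (f j i)}"
          using a(1) by (simp add: le_divide_eq)
      qed
      then show "finite {i. e \<le> absval (scale (inverse a) (Y k) j i)}"
        by (rule finite_subset) (use tateD[OF null_series_tate[OF f0 assms(1)]] a(1) \<open>e > 0\<close> in auto)
    qed
    moreover have "gauss_bound 1 (scale (inverse a) (Y k)) 1"
      unfolding gauss_bound_1 scale_def valuation_mult absval_inverse
      using le a(1) by (simp add: field_simps)
    ultimately have "scale (inverse a) (Y k) \<in> carrier R_int" by (rule finite_principal_R_int)
    moreover have "Y k = scale a (scale (inverse a) (Y k))" using a by simp
    ultimately show ?thesis unfolding R_K_def extend_scalars_def series_ring_simps by blast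
  qed
  moreover have "finite_principal_part (Y k)" for k
    unfolding finite_principal_part_def by (rule exI[of _ "- int k"]) (auto simp: Y_def)
  moreover have "(\<lambda>k. gauss_norm \<eta> (\<lambda>j i. Y k j i - f j i)) \<longlonglongrightarrow> 0" if \<eta>: "\<eta> \<in> {\<eta>0..<1}" for \<eta>
    unfolding ennreal_tendsto_0_iff
  proof (intro allI impI)
    fix e :: real assume "e > 0"
    have "f \<in> null_series \<eta>" using f \<eta> by simp
    from null_series_range[OF this \<open>e > 0\<close>] obtain N M where
      NM: "\<forall>j i. j < N \<or> j > M \<longrightarrow> absval (f j i) * \<eta> powi j < e" by blast
    have "gauss_norm \<eta> (\<lambda>j i. Y k j i - f j i) \<le> ennreal e" if k: "k \<ge> nat (max \<bar>N\<bar> \<bar>M\<bar>)" for k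
    proof -
      have "absval (Y k j i - f j i) * \<eta> powi j \<le> e" for j i
      proof (cases "\<bar>j\<bar> \<le> int k")
        case False
        then have "j < N \<or> j > M" using k by linarith
        then have "absval (f j i) * \<eta> powi j < e" using NM by blast
        then show ?thesis using False by (simp add: Y_def)
      qed (use \<open>e > 0\<close> in \<open>simp add: Y_def\<close>)
      then show ?thesis using \<open>e > 0\<close> \<eta> assms by (subst gauss_norm_le_iff) (auto simp: gauss_bound_def)
    qed
    then show "eventually (\<lambda>k. gauss_norm \<eta> (\<lambda>j i. Y k j i - f j i) \<le> ennreal e) sequentially"
      unfolding eventually_sequentially by blast
  qed
  ultimately show "f \<in> carrier (Frechet_ring \<eta>0)"
    unfolding Frechet_ring_def series_ring_simps by blast
qed

lemma carrier_R_eta_int: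
  assumes "0 < \<eta>0" "\<eta>0 < 1"
  shows "carrier (R_eta_int \<eta>0) = {f \<in> null_series \<eta>0. gauss_bound 1 f 1}"
  unfolding R_eta_int_def series_ring_simps carrier_Frechet_ring[OF assms]
  using assms null_series_mono_bounded[of _ \<eta>0 1] gauss_norm_le_iff[of 1 1] by fastforce

lemma R_eta_eq:
  assumes "0 < \<eta>0" "\<eta>0 < 1"
  shows "(R_eta \<eta>0 :: ('n, 'k::complete_discretely_valued_field) series ring) = series_ring (bounded_null_series \<eta>0)"
proof -
  have "extend_scalars (carrier (R_eta_int \<eta>0)) = (bounded_null_series \<eta>0 :: ('n, 'k) series set)"
  proof (intro equalityI subsetI)
    fix f :: "('n, 'k) series" assume "f \<in> extend_scalars (carrier (R_eta_int \<eta>0))"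
    then obtain a g where g: "f = scale a g" "g \<in> null_series \<eta>0" "gauss_bound 1 g 1"
      by (auto simp: extend_scalars_def carrier_R_eta_int[OF assms])
    then have "g \<in> bounded_null_series \<eta>0" by (auto simp: bounded_null_series_def)
    then show "f \<in> bounded_null_series \<eta>0" using bounded_null_series_closed(6)[OF assms(1)] g by blast
  next
    fix f :: "('n, 'k) series" assume "f \<in> bounded_null_series \<eta>0"
    then obtain B where f: "f \<in> null_series \<eta>0" "gauss_bound 1 f B" by (auto simp: bounded_null_series_def)
    obtain a :: 'k where a: "a \<noteq> 0" "B \<le> absval a" using exists_large by blast
    have "gauss_bound 1 (scale (inverse a) f) 1"
      using gauss_bound_mono[OF f(2) a(2)] a(1)
      by (subst gauss_bound_scale_iff) (simp_all add: absval_inverse divide_inverse)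
    then have "scale (inverse a) f \<in> carrier (R_eta_int \<eta>0)"
      using f null_series_scale by (auto simp: carrier_R_eta_int[OF assms])
    moreover have "f = scale a (scale (inverse a) f)" using a by simp
    ultimately show "f \<in> extend_scalars (carrier (R_eta_int \<eta>0))" unfolding extend_scalars_def by blast
  qed
  then show ?thesis by (simp add: R_eta_def)
qed

lemma cring_R_eta:
  assumes "0 < \<eta>0" "\<eta>0 < 1"
  shows "cring (R_eta \<eta>0 :: ('n::finite, 'k::complete_discretely_valued_field) series ring)"
  unfolding R_eta_eq[OF assms]
proof (rule series_cring[OF assms(1)])
  show "bounded_null_series \<eta>0 \<subseteq> null_series \<eta>0" by (auto simp: bounded_null_series_def)
qed (rule bounded_null_series_closed[OF assms(1)]; assumption)+

section \<open>Cosets and saturation\<close>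

text \<open>Subgroups and cosets for the addition of the type. All the concrete series rings use
  that addition, so ideals and quotient elements of each of them are handled by the same few
  lemmas.\<close>

definition add_closed :: "'a::ab_group_add set \<Rightarrow> bool" where
  "add_closed I \<longleftrightarrow> 0 \<in> I \<and> (\<forall>x\<in>I. \<forall>y\<in>I. x + y \<in> I) \<and> (\<forall>x\<in>I. - x \<in> I)"

definition coset :: "'a::ab_group_add set \<Rightarrow> 'a \<Rightarrow> 'a set" where
  "coset I f = {g. g - f \<in> I}"

lemma add_closedD:
  assumes "add_closed I"
  shows "0 \<in> I" "x \<in> I \<Longrightarrow> y \<in> I \<Longrightarrow> x + y \<in> I" "x \<in> I \<Longrightarrow> - x \<in> I" "x \<in> I \<Longrightarrow> y \<in> I \<Longrightarrow> x - y \<in> I"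
  using assms unfolding add_closed_def by (blast, blast, blast, metis add_uminus_conv_diff)

lemma add_closed_sum:
  assumes "add_closed I" "\<And>h. h \<in> H \<Longrightarrow> f h \<in> I"
  shows "sum f H \<in> I"
  using assms(2)
proof (induction H rule: infinite_finite_induct)
  case (insert h H)
  then show ?case unfolding sum.insert[OF insert.hyps] by (intro add_closedD[OF assms(1)]) blast+
qed (use add_closedD[OF assms(1)] in simp_all)

lemma mem_coset [simp]: "g \<in> coset I f \<longleftrightarrow> g - f \<in> I"
  by (simp add: coset_def)

lemma coset_0 [simp]: "coset I 0 = I"
  by (simp add: coset_def)

lemma coset_eq_iff:
  assumes "add_closed I"
  shows "coset I f = coset I g \<longleftrightarrow> f - g \<in> I"
proof
  assume "coset I f = coset I g"
  then have "f \<in> coset I g" using add_closedD[OF assms] by (metis diff_self mem_coset)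
  then show "f - g \<in> I" by simp
next
  assume *: "f - g \<in> I"
  have "h - f \<in> I \<longleftrightarrow> h - g \<in> I" for h
    using add_closedD(2)[OF assms _ *, of "h - f"] add_closedD(4)[OF assms _ *, of "h - g"] by auto
  then show "coset I f = coset I g" by (simp add: coset_def)
qed

lemma coset_self: "add_closed I \<Longrightarrow> f \<in> coset I f"
  by (simp add: add_closed_def)

lemma coset_image: "(\<lambda>i. i + f) ` I = coset I f"
proof (intro equalityI subsetI)
  fix g assume "g \<in> coset I f"
  then show "g \<in> (\<lambda>i. i + f) ` I" by (intro image_eqI[of _ _ "g - f"]) auto
qed auto

context
  fixes R :: "('a::ab_group_add, 'c) ring_scheme" and I
  assumes ideal: "ideal I R" and add: "\<And>f g. f \<oplus>\<^bsub>R\<^esub> g = f + g"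
begin

lemma a_r_coset_eq_coset: "I +>\<^bsub>R\<^esub> f = coset I f"
proof -
  have "I +>\<^bsub>R\<^esub> f = (\<lambda>i. i + f) ` I" by (auto simp: a_r_coset_def r_coset_def add)
  then show ?thesis by (simp add: coset_image)
qed

lemma ring_zero_eq: "\<zero>\<^bsub>R\<^esub> = 0"
proof -
  interpret ideal I R by (rule ideal)
  have "\<zero>\<^bsub>R\<^esub> + \<zero>\<^bsub>R\<^esub> = \<zero>\<^bsub>R\<^esub>" using l_zero[of "\<zero>\<^bsub>R\<^esub>"] by (simp add: add)
  then show ?thesis by simp
qed

lemma ring_a_inv_eq:
  assumes "x \<in> carrier R" shows "\<ominus>\<^bsub>R\<^esub> x = - x"
proof -
  interpret ideal I R by (rule ideal)
  have "\<ominus>\<^bsub>R\<^esub> x + x = 0" using l_neg[OF assms] by (simp add: add ring_zero_eq)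
  then show ?thesis by (simp add: add_eq_0_iff2)
qed

lemma ideal_add_closed: "add_closed I"
  unfolding add_closed_def
proof (intro conjI ballI)
  interpret ideal I R by (rule ideal)
  show "0 \<in> I" using additive_subgroup.zero_closed[of I R] additive_subgroup_axioms ring_zero_eq by metis
  show "x + y \<in> I" if "x \<in> I" "y \<in> I" for x y using additive_subgroup.a_closed[OF additive_subgroup_axioms, of x y] that by (simp add: add)
  show "- x \<in> I" if "x \<in> I" for x using additive_subgroup.a_inv_closed[OF additive_subgroup_axioms that] ring_a_inv_eq[OF Icarr[OF that]] by simp
qed

lemma carrier_Quot: "carrier (R Quot I) = coset I ` carrier R"
  unfolding FactRing_def A_RCOSETS_def' by (auto simp: a_r_coset_eq_coset)

lemma Quot_mult:
  assumes "f \<in> carrier R" "g \<in> carrier R"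
  shows "coset I f \<otimes>\<^bsub>R Quot I\<^esub> coset I g = coset I (f \<otimes>\<^bsub>R\<^esub> g)"
  using ideal.rcoset_mult_add[OF ideal assms] by (simp add: FactRing_def a_r_coset_eq_coset)

lemma Quot_add:
  assumes "f \<in> carrier R" "g \<in> carrier R"
  shows "coset I f \<oplus>\<^bsub>R Quot I\<^esub> coset I g = coset I (f + g)"
proof -
  interpret ideal I R by (rule ideal)
  show ?thesis using a_rcos_sum[OF assms] by (simp add: FactRing_def a_r_coset_eq_coset add)
qed

lemma Quot_zero: "\<zero>\<^bsub>R Quot I\<^esub> = I"
  by (simp add: FactRing_def)

lemma Quot_one: "\<one>\<^bsub>R Quot I\<^esub> = coset I \<one>\<^bsub>R\<^esub>"
  by (simp add: FactRing_def a_r_coset_eq_coset)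

end

section \<open>Scalars acting on series and on the ideal\<close>

lemma scale_add: "scale c (f + g) = scale c f + scale c g"
  by (simp add: scale_def plus_fun_def distrib_left)

lemma scale_diff: "scale c (f - g) = scale c f - scale c g"
  by (simp add: scale_def fun_diff_def right_diff_distrib)

lemma scale_uminus: "scale c (- f) = - scale c f"
  by (simp add: scale_def fun_Compl_def)

lemma scale_add_left: "scale (a + b) f = scale a f + scale b f"
  by (simp add: scale_def plus_fun_def distrib_right)

lemma scale_minus_left: "scale (- a) f = - scale a f"
  by (simp add: scale_def fun_Compl_def)

lemma scale_zero_right [simp]: "scale c 0 = 0"
  by (simp add: scale_def zero_fun_def)

lemma sum_fun_apply2: "sum f A j i = (\<Sum>x\<in>A. f x j i)"
  by (induction A rule: infinite_finite_induct) simp_all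

lemma R_int_monom: "absval c \<le> 1 \<Longrightarrow> series_monom a b c \<in> carrier R_int"
  by (rule bounded_null_series_R_int[of _ "1/2"])
     (auto intro!: gauss_bound_series_monom finite_series_null)

context
  fixes I :: "('n::finite, 'k::complete_discretely_valued_field) series set"
  assumes ideal: "ideal I R_int"
begin

lemma I_add_closed: "add_closed I"
  by (rule ideal_add_closed[OF ideal]) simp

lemma I_carrier: "f \<in> I \<Longrightarrow> f \<in> carrier R_int"
  using ideal.Icarr[OF ideal] .

lemma I_mult: "f \<in> I \<Longrightarrow> g \<in> carrier R_int \<Longrightarrow> g \<star> f \<in> I"
  using ideal.I_l_closed[OF ideal] by simp

lemma I_scale: "f \<in> I \<Longrightarrow> absval c \<le> 1 \<Longrightarrow> scale c f \<in> I"
  using I_mult[OF _ R_int_monom[of c 0 0]] by (simp add: series_const_mult)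

end

section \<open>Flatness implies that the quotient has no torsion\<close>

context
  fixes I :: "('n::finite, 'k::complete_discretely_valued_field) series set" and u :: 'k
  assumes ideal: "ideal I R_int" and flat: "flat_module integer_ring (quotient_module I)"
    and u: "absval u \<le> 1" "u \<noteq> 0"
begin

text \<open>
  Flatness is applied to multiplication by \<open>u\<close> on the valuation ring: if \<open>u f \<in> I\<close>, then
  \<open>1 \<otimes> f\<close> and \<open>1 \<otimes> 0\<close> have the same image. Modulo \<open>I\<close>, the function \<open>frag_value\<close> below is
  \<open>a \<otimes> f \<mapsto> a f\<close>, so their equality gives \<open>f \<in> I\<close>.
\<close>

definition unit_module :: "('k, 'k) module" where
  "unit_module = \<lparr>carrier = {x. absval x \<le> 1}, mult = (*), one = 1, ring.zero = 0, ring.add = (+), module.smult = (*)\<rparr>"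

lemma unit_module: "Module.module integer_ring unit_module"
proof (rule module.intro)
  have ag: "abelian_group (unit_module)"
  proof (rule abelian_groupI)
    fix x assume "x \<in> carrier unit_module"
    then show "\<exists>y\<in>carrier unit_module. y \<oplus>\<^bsub>unit_module\<^esub> x = \<zero>\<^bsub>unit_module\<^esub>"
      by (intro bexI[of _ "- x"]) (auto simp: unit_module_def)
  qed (auto simp: unit_module_def algebra_simps intro: absval_add_le)
  show "cring (integer_ring :: 'k ring)"
  proof (rule cringI)
    show "abelian_group (integer_ring :: 'k ring)"
    proof (rule abelian_groupI)
      fix x :: 'k assume "x \<in> carrier integer_ring"
      then show "\<exists>y\<in>carrier integer_ring. y \<oplus>\<^bsub>integer_ring\<^esub> x = \<zero>\<^bsub>integer_ring\<^esub>"
        by (intro bexI[of _ "- x"]) (auto simp: integer_ring_def ring_of_type_algebra_def)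
    qed (auto simp: integer_ring_def ring_of_type_algebra_def algebra_simps intro: absval_add_le)
    show "Group.comm_monoid (integer_ring :: 'k ring)"
      by (rule comm_monoidI)
         (auto simp: integer_ring_def ring_of_type_algebra_def algebra_simps valuation_mult intro: mult_le_one)
  qed (auto simp: integer_ring_def ring_of_type_algebra_def algebra_simps)
  show "abelian_group unit_module" by (rule ag)
  show "module_axioms integer_ring unit_module"
    by (rule module_axioms.intro)
       (auto simp: unit_module_def integer_ring_def ring_of_type_algebra_def algebra_simps valuation_mult intro: mult_le_one)
qed

text \<open>A coset is evaluated at an arbitrarily chosen element of it, so the value respects the
  tensor relations only up to \<open>I\<close>; this suffices for a conclusion modulo
  \<open>I\<close>.\<close>

definition frag_value :: "('k \<times> ('n, 'k) series set \<Rightarrow>\<^sub>0 int) \<Rightarrow> ('n, 'k) series" where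
  "frag_value z = (\<Sum>k\<in>Poly_Mapping.keys z. scale (of_int (Poly_Mapping.lookup z k) * fst k) (SOME g. g \<in> snd k))"

lemma frag_value_superset:
  assumes "finite A" "Poly_Mapping.keys z \<subseteq> A"
  shows "frag_value z = (\<Sum>k\<in>A. scale (of_int (Poly_Mapping.lookup z k) * fst k) (SOME g. g \<in> snd k))"
  unfolding frag_value_def
  by (rule sum.mono_neutral_left) (use assms in \<open>auto simp: not_in_keys_iff_lookup_eq_zero\<close>)

lemma frag_value_add: "frag_value (z + w) = frag_value z + frag_value w"
proof -
  let ?A = "Poly_Mapping.keys z \<union> Poly_Mapping.keys w"
  have "Poly_Mapping.keys (z + w) \<subseteq> ?A" by (rule Poly_Mapping.keys_add)
  then have "frag_value (z + w) = (\<Sum>k\<in>?A. scale (of_int (Poly_Mapping.lookup (z + w) k) * fst k) (SOME g. g \<in> snd k))"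
    by (intro frag_value_superset) auto
  also have "\<dots> = (\<Sum>k\<in>?A. scale (of_int (Poly_Mapping.lookup z k) * fst k) (SOME g. g \<in> snd k)
       + scale (of_int (Poly_Mapping.lookup w k) * fst k) (SOME g. g \<in> snd k))"
    by (simp only: Poly_Mapping.lookup_add of_int_add distrib_right scale_add_left)
  also have "\<dots> = frag_value z + frag_value w"
    by (subst sum.distrib) (simp add: frag_value_superset[of ?A])
  finally show ?thesis .
qed

lemma frag_value_0: "frag_value 0 = 0"
  by (simp add: frag_value_def)

lemma frag_value_uminus: "frag_value (- z) = - frag_value z"
  using frag_value_add[of "- z" z] by (simp add: frag_value_0 eq_neg_iff_add_eq_0)

lemma frag_value_diff: "frag_value (z - w) = frag_value z - frag_value w"
  using frag_value_add[of z "- w"] by (simp add: frag_value_uminus)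

lemma frag_value_of: "frag_value (frag_of k) = scale (fst k) (SOME g. g \<in> snd k)"
  by (simp add: frag_value_def)

lemma qm_simps:
  "carrier (quotient_module I) = coset I ` carrier R_int"
  "f \<in> carrier R_int \<Longrightarrow> g \<in> carrier R_int \<Longrightarrow> coset I f \<oplus>\<^bsub>quotient_module I\<^esub> coset I g = coset I (f + g)"
  "f \<in> carrier R_int \<Longrightarrow> absval a \<le> 1 \<Longrightarrow> a \<odot>\<^bsub>quotient_module I\<^esub> coset I f = coset I (scale a f)"
proof -
  have R: "f \<oplus>\<^bsub>R_int\<^esub> g = f + g" for f g :: "('n, 'k) series" by simp
  note q = carrier_Quot[OF ideal R] Quot_add[OF ideal R]
  have s: "x \<oplus>\<^bsub>quotient_module I\<^esub> y = x \<oplus>\<^bsub>R_int Quot I\<^esub> y" for x y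
    by (simp add: quotient_module_def ring.extend_def)
  show "carrier (quotient_module I) = coset I ` carrier R_int"
    using q(1) by (simp add: quotient_module_def ring.extend_def)
  show "f \<in> carrier R_int \<Longrightarrow> g \<in> carrier R_int \<Longrightarrow> coset I f \<oplus>\<^bsub>quotient_module I\<^esub> coset I g = coset I (f + g)"
    using q(2) s by metis
  assume f: "f \<in> carrier R_int" and a: "absval a \<le> 1"
  have "a \<odot>\<^bsub>quotient_module I\<^esub> coset I f = (\<Union>g\<in>coset I f. coset I (scale a g))"
    by (simp add: quotient_module_def ring.extend_def module.fields_def a_r_coset_eq_coset[OF ideal R])
  also have "\<dots> = coset I (scale a f)"
  proof -
    have "coset I (scale a g) = coset I (scale a f)" if "g \<in> coset I f" for g
      using that I_scale[OF ideal _ a, of "g - f"]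
      by (simp only: coset_eq_iff[OF I_add_closed[OF ideal]] scale_diff mem_coset)
    moreover have "f \<in> coset I f" by (rule coset_self[OF I_add_closed[OF ideal]])
    ultimately show ?thesis by blast
  qed
  finally show "a \<odot>\<^bsub>quotient_module I\<^esub> coset I f = coset I (scale a f)" .
qed

abbreviation "FG \<equiv> free_Abelian_group (carrier unit_module \<times> carrier (quotient_module I))"
abbreviation "rels \<equiv> tensor_relations integer_ring unit_module (quotient_module I)"

lemma carrier_integer_ring: "x \<in> carrier integer_ring \<longleftrightarrow> absval (x::'k) \<le> 1"
  by (simp add: integer_ring_def)

lemma um_simps: "x \<in> carrier unit_module \<longleftrightarrow> absval x \<le> 1" "x \<oplus>\<^bsub>unit_module\<^esub> y = x + y" "x \<odot>\<^bsub>unit_module\<^esub> y = x * y"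
  by (simp_all add: unit_module_def)

lemma some_coset:
  fixes f :: "('n, 'k) series"
  assumes "f \<in> carrier R_int"
  shows "(SOME g. g \<in> coset I f) - f \<in> I"
  using someI[of "\<lambda>g. g \<in> coset I f", OF coset_self[OF I_add_closed[OF ideal]]] by simp

lemma quotient_add_closed:
  assumes "y \<in> carrier (quotient_module I)" "y' \<in> carrier (quotient_module I)"
  shows "y \<oplus>\<^bsub>quotient_module I\<^esub> y' \<in> carrier (quotient_module I)"
proof -
  obtain f f' where f: "f \<in> carrier R_int" "f' \<in> carrier R_int" "y = coset I f" "y' = coset I f'"
    using assms unfolding qm_simps by blast
  have "f + f' \<in> carrier R_int" using f ring.ring_simprules(1)[OF ideal.axioms(2)[OF ideal], of f f'] by simp
  then show ?thesis unfolding f qm_simps(2)[OF f(1,2)] unfolding qm_simps by blast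
qed

lemma R_int_scale:
  fixes f :: "('n, 'k) series"
  assumes "f \<in> carrier R_int" "absval a \<le> 1"
  shows "scale a f \<in> carrier R_int"
  using ring.ring_simprules(5)[OF ideal.axioms(2)[OF ideal], of "series_monom 0 0 a" f] assms(1) R_int_monom[OF assms(2), of 0 "0 :: 'n \<Rightarrow>\<^sub>0 nat"]
  by (simp add: series_const_mult)

lemma quotient_smult_closed:
  assumes "y \<in> carrier (quotient_module I)" "absval a \<le> 1"
  shows "a \<odot>\<^bsub>quotient_module I\<^esub> y \<in> carrier (quotient_module I)"
proof -
  obtain f where f: "f \<in> carrier R_int" "y = coset I f" using assms unfolding qm_simps by blast
  show ?thesis unfolding f qm_simps(3)[OF f(1) assms(2)] using R_int_scale[OF f(1) assms(2)] unfolding qm_simps by blast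
qed

lemma frag_diff_carrier:
  assumes "a \<in> carrier FG" "b \<in> carrier FG" shows "a - b \<in> carrier FG"
  using assms keys_diff[of a b] by (auto simp: free_Abelian_group_def)

lemma frag_of_carrier: "x \<in> carrier unit_module \<Longrightarrow> y \<in> carrier (quotient_module I) \<Longrightarrow> frag_of (x, y) \<in> carrier FG"
  by (simp add: free_Abelian_group_def)

lemma rels_gen_carrier:
  "{frag_of (x \<oplus>\<^bsub>unit_module\<^esub> x', y) - frag_of (x, y) - frag_of (x', y) | x x' y.
         x \<in> carrier unit_module \<and> x' \<in> carrier unit_module \<and> y \<in> carrier (quotient_module I)} \<union>
      {frag_of (x, y \<oplus>\<^bsub>quotient_module I\<^esub> y') - frag_of (x, y) - frag_of (x, y') | x y y'.
         x \<in> carrier unit_module \<and> y \<in> carrier (quotient_module I) \<and> y' \<in> carrier (quotient_module I)} \<union>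
      {frag_of (a \<odot>\<^bsub>unit_module\<^esub> x, y) - frag_of (x, a \<odot>\<^bsub>quotient_module I\<^esub> y) | a x y.
         a \<in> carrier integer_ring \<and> x \<in> carrier unit_module \<and> y \<in> carrier (quotient_module I)} \<subseteq> carrier FG"
proof -
  have um: "x \<oplus>\<^bsub>unit_module\<^esub> x' \<in> carrier unit_module" "absval a \<le> 1 \<Longrightarrow> a \<odot>\<^bsub>unit_module\<^esub> x \<in> carrier unit_module"
    if "x \<in> carrier unit_module" "x' \<in> carrier unit_module" for x x' a
    using that by (auto simp: um_simps valuation_mult intro: absval_add_le mult_le_one)
  show ?thesis
    by (intro Un_least subsetI; elim CollectE exE conjE; hypsubst;
        intro frag_diff_carrier frag_of_carrier quotient_add_closed quotient_smult_closed um)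
       (simp_all only: carrier_integer_ring)
qed

text \<open>On a generating relation the value is 0 or an integral combination of differences
  between chosen and actual representatives, and such differences lie in \<open>I\<close>. Inverses
  and sums follow by additivity.\<close>

lemma frag_value_relations:
  assumes "z \<in> rels"
  shows "frag_value z \<in> I"
  using assms unfolding tensor_relations_def
proof (induction rule: generate.induct)
  note cl = add_closedD[OF I_add_closed[OF ideal]]
  have gen: "frag_value h \<in> I" if h: "h \<in> {frag_of (x \<oplus>\<^bsub>unit_module\<^esub> x', y) - frag_of (x, y) - frag_of (x', y) | x x' y.
         x \<in> carrier unit_module \<and> x' \<in> carrier unit_module \<and> y \<in> carrier (quotient_module I)} \<union>
      {frag_of (x, y \<oplus>\<^bsub>quotient_module I\<^esub> y') - frag_of (x, y) - frag_of (x, y') | x y y'.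
         x \<in> carrier unit_module \<and> y \<in> carrier (quotient_module I) \<and> y' \<in> carrier (quotient_module I)} \<union>
      {frag_of (a \<odot>\<^bsub>unit_module\<^esub> x, y) - frag_of (x, a \<odot>\<^bsub>quotient_module I\<^esub> y) | a x y.
         a \<in> carrier integer_ring \<and> x \<in> carrier unit_module \<and> y \<in> carrier (quotient_module I)}" for h
    using h
  proof (elim UnE CollectE exE conjE)
    fix x x' :: 'k and y assume h: "h = frag_of (x \<oplus>\<^bsub>unit_module\<^esub> x', y) - frag_of (x, y) - frag_of (x', y)"
    have "frag_value h = 0"
      unfolding h frag_value_diff frag_value_of um_simps fst_conv snd_conv scale_add_left
      by (simp only: add_diff_cancel_left' diff_self)
    then show ?thesis using cl by metis
  next
    fix x :: 'k and y y' assume h: "h = frag_of (x, y \<oplus>\<^bsub>quotient_module I\<^esub> y') - frag_of (x, y) - frag_of (x, y')"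
      and x: "x \<in> carrier unit_module" and y: "y \<in> carrier (quotient_module I)" "y' \<in> carrier (quotient_module I)"
    obtain f f' where f: "f \<in> carrier R_int" "f' \<in> carrier R_int" "y = coset I f" "y' = coset I f'"
      using y unfolding qm_simps by blast
    have ff: "f + f' \<in> carrier R_int" using f ring.ring_simprules(1)[OF ideal.axioms(2)[OF ideal], of f f'] by simp
    let ?e = "\<lambda>f. (SOME g. g \<in> coset I f)"
    have "?e (f + f') - ?e f - ?e f' = (?e (f + f') - (f + f')) - (?e f - f) - (?e f' - f')"
      by (simp only: algebra_simps)
    also have "\<dots> \<in> I" by (intro cl(4) some_coset f ff)
    finally have "scale x (?e (f + f') - ?e f - ?e f') \<in> I" using I_scale[OF ideal] x by (simp add: um_simps)
    then show ?thesis
      unfolding h frag_value_diff frag_value_of fst_conv snd_conv f qm_simps(2)[OF f(1,2)] scale_diff .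
  next
    fix a x :: 'k and y assume h: "h = frag_of (a \<odot>\<^bsub>unit_module\<^esub> x, y) - frag_of (x, a \<odot>\<^bsub>quotient_module I\<^esub> y)"
      and x: "x \<in> carrier unit_module" and a: "a \<in> carrier integer_ring" and y: "y \<in> carrier (quotient_module I)"
    obtain f where f: "f \<in> carrier R_int" "y = coset I f" using y unfolding qm_simps by blast
    have a1: "absval a \<le> 1" using a by (simp add: carrier_integer_ring)
    have af: "scale a f \<in> carrier R_int" by (rule R_int_scale[OF f(1) a1])
    let ?e = "\<lambda>f. (SOME g. g \<in> coset I f)"
    have "scale a (?e f) - ?e (scale a f) = scale a (?e f - f) - (?e (scale a f) - scale a f)"
      by (simp only: scale_diff diff_diff_eq2 diff_add_cancel)
    also have "\<dots> \<in> I" by (intro cl(4) I_scale[OF ideal] some_coset f af a1)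
    finally have "scale x (scale a (?e f) - ?e (scale a f)) \<in> I" using I_scale[OF ideal] x by (simp add: um_simps)
    then show ?thesis
      unfolding h frag_value_diff frag_value_of fst_conv snd_conv f um_simps qm_simps(3)[OF f(1) a1]
      unfolding scale_diff scale_scale by (simp only: mult.commute)
  qed
  {
    case one
    have "frag_value \<one>\<^bsub>FG\<^esub> \<in> I" using cl(1) by (simp add: frag_value_0)
    then show ?case .
  next
    case (incl h) then show ?case by (rule gen)
  next
    case (inv h)
    have "h \<in> carrier FG"
      by (rule subsetD[OF rels_gen_carrier inv])
    then have "inv\<^bsub>FG\<^esub> h = - h" by simp
    then have "frag_value (inv\<^bsub>FG\<^esub> h) \<in> I" using cl(3)[OF gen[OF inv]] by (simp only: frag_value_uminus)
    then show ?case .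
  next
    case (eng h1 h2)
    have "frag_value (h1 \<otimes>\<^bsub>FG\<^esub> h2) \<in> I" using cl(2)[OF eng.IH] by (simp add: frag_value_add)
    then show ?case .
  }
qed


definition frag_scale :: "('k \<times> ('n, 'k) series set \<Rightarrow>\<^sub>0 int) \<Rightarrow> ('k \<times> ('n, 'k) series set \<Rightarrow>\<^sub>0 int)" where
  "frag_scale = frag_extend (\<lambda>(x, y). frag_of (u * x, y))"

lemma frag_scale_simps:
  "frag_scale 0 = 0" "frag_scale (- z) = - frag_scale z" "frag_scale (z + w) = frag_scale z + frag_scale w"
  "frag_scale (z - w) = frag_scale z - frag_scale w" "frag_scale (frag_of (x, y)) = frag_of (u * x, y)"
  by (simp_all add: frag_scale_def frag_extend_add frag_extend_diff frag_extend_minus)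

text \<open>Multiplying the first entry by \<open>u\<close> turns each kind of generating relation
  into one of the same kind, so the map passes to tensor classes.\<close>

lemma frag_scale_relations:
  assumes "z \<in> rels"
  shows "frag_scale z \<in> rels"
  using assms unfolding tensor_relations_def
proof (induction rule: generate.induct)
  have gen: "frag_scale h \<in> {frag_of (x \<oplus>\<^bsub>unit_module\<^esub> x', y) - frag_of (x, y) - frag_of (x', y) | x x' y.
         x \<in> carrier unit_module \<and> x' \<in> carrier unit_module \<and> y \<in> carrier (quotient_module I)} \<union>
      {frag_of (x, y \<oplus>\<^bsub>quotient_module I\<^esub> y') - frag_of (x, y) - frag_of (x, y') | x y y'.
         x \<in> carrier unit_module \<and> y \<in> carrier (quotient_module I) \<and> y' \<in> carrier (quotient_module I)} \<union>
      {frag_of (a \<odot>\<^bsub>unit_module\<^esub> x, y) - frag_of (x, a \<odot>\<^bsub>quotient_module I\<^esub> y) | a x y.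
         a \<in> carrier integer_ring \<and> x \<in> carrier unit_module \<and> y \<in> carrier (quotient_module I)}"
    if h: "h \<in> {frag_of (x \<oplus>\<^bsub>unit_module\<^esub> x', y) - frag_of (x, y) - frag_of (x', y) | x x' y.
         x \<in> carrier unit_module \<and> x' \<in> carrier unit_module \<and> y \<in> carrier (quotient_module I)} \<union>
      {frag_of (x, y \<oplus>\<^bsub>quotient_module I\<^esub> y') - frag_of (x, y) - frag_of (x, y') | x y y'.
         x \<in> carrier unit_module \<and> y \<in> carrier (quotient_module I) \<and> y' \<in> carrier (quotient_module I)} \<union>
      {frag_of (a \<odot>\<^bsub>unit_module\<^esub> x, y) - frag_of (x, a \<odot>\<^bsub>quotient_module I\<^esub> y) | a x y.
         a \<in> carrier integer_ring \<and> x \<in> carrier unit_module \<and> y \<in> carrier (quotient_module I)}"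
    (is "h \<in> ?A \<union> ?B \<union> ?C") for h
  proof -
    have ux: "u * x \<in> carrier unit_module" if "x \<in> carrier unit_module" for x
      using that u by (simp add: um_simps valuation_mult mult_le_one)
    consider "h \<in> ?A" | "h \<in> ?B" | "h \<in> ?C" using h by blast
    then show ?thesis
    proof cases
      case 1
      then obtain x x' y where h: "h = frag_of (x \<oplus>\<^bsub>unit_module\<^esub> x', y) - frag_of (x, y) - frag_of (x', y)"
        and xy: "x \<in> carrier unit_module" "x' \<in> carrier unit_module" "y \<in> carrier (quotient_module I)" by blast
      have "frag_scale h = frag_of (u * x \<oplus>\<^bsub>unit_module\<^esub> u * x', y) - frag_of (u * x, y) - frag_of (u * x', y)"
        by (simp only: h frag_scale_simps um_simps distrib_left)
      then have "frag_scale h \<in> ?A" using ux xy by blast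
      then show ?thesis by blast
    next
      case 2
      then obtain x y y' where h: "h = frag_of (x, y \<oplus>\<^bsub>quotient_module I\<^esub> y') - frag_of (x, y) - frag_of (x, y')"
        and xy: "x \<in> carrier unit_module" "y \<in> carrier (quotient_module I)" "y' \<in> carrier (quotient_module I)" by blast
      have "frag_scale h = frag_of (u * x, y \<oplus>\<^bsub>quotient_module I\<^esub> y') - frag_of (u * x, y) - frag_of (u * x, y')"
        by (simp only: h frag_scale_simps)
      then have "frag_scale h \<in> ?B" using ux xy by blast
      then show ?thesis by blast
    next
      case 3
      then obtain a x y where h: "h = frag_of (a \<odot>\<^bsub>unit_module\<^esub> x, y) - frag_of (x, a \<odot>\<^bsub>quotient_module I\<^esub> y)"
        and xy: "a \<in> carrier integer_ring" "x \<in> carrier unit_module" "y \<in> carrier (quotient_module I)" by blast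
      have "frag_scale h = frag_of (a \<odot>\<^bsub>unit_module\<^esub> (u * x), y) - frag_of (u * x, a \<odot>\<^bsub>quotient_module I\<^esub> y)"
        by (simp only: h frag_scale_simps um_simps mult.left_commute)
      then have "frag_scale h \<in> ?C" using ux xy by blast
      then show ?thesis by blast
    qed
  qed
  have carr: "h \<in> carrier FG" if "h \<in> {frag_of (x \<oplus>\<^bsub>unit_module\<^esub> x', y) - frag_of (x, y) - frag_of (x', y) | x x' y.
         x \<in> carrier unit_module \<and> x' \<in> carrier unit_module \<and> y \<in> carrier (quotient_module I)} \<union>
      {frag_of (x, y \<oplus>\<^bsub>quotient_module I\<^esub> y') - frag_of (x, y) - frag_of (x, y') | x y y'.
         x \<in> carrier unit_module \<and> y \<in> carrier (quotient_module I) \<and> y' \<in> carrier (quotient_module I)} \<union>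
      {frag_of (a \<odot>\<^bsub>unit_module\<^esub> x, y) - frag_of (x, a \<odot>\<^bsub>quotient_module I\<^esub> y) | a x y.
         a \<in> carrier integer_ring \<and> x \<in> carrier unit_module \<and> y \<in> carrier (quotient_module I)}" for h
    by (rule subsetD[OF rels_gen_carrier that])
  {
    case one show ?case using generate.one[of FG] by (simp add: frag_scale_simps)
  next
    case (incl h) then show ?case by (intro generate.incl gen)
  next
    case (inv h)
    have "inv\<^bsub>FG\<^esub> (frag_scale h) = - frag_scale h"
      using carr[OF gen[OF inv]] by simp
    moreover have "inv\<^bsub>FG\<^esub> h = - h" using carr[OF inv] by simp
    ultimately show ?case using generate.inv[OF gen[OF inv], of FG] by (simp add: frag_scale_simps)
  next
    case (eng h1 h2)
    then show ?case using generate.eng[OF eng.IH] by (simp add: frag_scale_simps)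
  }
qed

lemma coset_smult_u:
  assumes "f \<in> carrier R_int" "scale u f \<in> I"
  shows "u \<odot>\<^bsub>quotient_module I\<^esub> coset I f = I"
proof -
  have "coset I (scale u f) = coset I 0"
    using assms(2) by (simp only: coset_eq_iff[OF I_add_closed[OF ideal]] diff_zero)
  then show ?thesis using qm_simps(3)[OF assms(1) u(1)] by simp
qed

theorem flat_imp_saturated:
  assumes f: "f \<in> carrier R_int" "scale u f \<in> I"
  shows "f \<in> I"
proof -
  note cl = add_closedD[OF I_add_closed[OF ideal]]
  have grp: "Group.group FG" by simp
  have gen_sub: "rels \<subseteq> carrier FG"
    unfolding tensor_relations_def by (rule group.generate_incl[OF grp rels_gen_carrier])
  have sub: "subgroup rels FG"
    unfolding tensor_relations_def by (rule group.generate_is_subgroup[OF grp rels_gen_carrier])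
  have rcl: "z + w \<in> rels" "- z \<in> rels" "0 \<in> rels" if "z \<in> rels" "w \<in> rels" for z w
    using subgroup.m_closed[OF sub that] subgroup.m_inv_closed[OF sub that(1)] subgroup.one_closed[OF sub] gen_sub that
    by (auto simp: subset_iff)
  have rc: "rels #>\<^bsub>FG\<^esub> z = coset rels z" for z
    by (auto simp: r_coset_def simp flip: coset_image)
  have racl: "add_closed rels" unfolding add_closed_def using rcl generate.one by (metis subgroup.one_closed[OF sub] one_free_Abelian_group)
  let ?X = "frag_of (1, coset I f)" and ?Z = "frag_of (1::'k, I)"
  have Icos: "I = coset I 0" by simp
  have zero_carr: "(0 :: ('n, 'k) series) \<in> carrier R_int" using ideal.Icarr[OF ideal cl(1)] .
  have mem: "coset I f \<in> carrier (quotient_module I)" "I \<in> carrier (quotient_module I)"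
    unfolding qm_simps using f zero_carr Icos by blast+
  have XZ: "?X \<in> carrier FG" "?Z \<in> carrier FG"
    using mem by (auto simp: free_Abelian_group_def um_simps)
  have classes: "coset rels ?X \<in> carrier (tensor_product integer_ring unit_module (quotient_module I))"
      "coset rels ?Z \<in> carrier (tensor_product integer_ring unit_module (quotient_module I))"
    using XZ by (auto simp: tensor_product_def FactGroup_def RCOSETS_def rc)
  have tm: "tensor_map integer_ring unit_module (quotient_module I) ((*) u) (coset rels z) = coset rels (frag_scale z)" for z
  proof -
    have "tensor_map integer_ring unit_module (quotient_module I) ((*) u) (coset rels z) =
        (\<Union>w\<in>coset rels z. coset rels (frag_scale w))"
      unfolding tensor_map_def rc frag_scale_def by simp
    moreover have "coset rels (frag_scale w) = coset rels (frag_scale z)" if "w \<in> coset rels z" for w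
      using frag_scale_relations[of "w - z"] that by (simp only: coset_eq_iff[OF racl] frag_scale_simps mem_coset)
    moreover have "z \<in> coset rels z" by (rule coset_self[OF racl])
    ultimately show ?thesis by blast
  qed
  have rel: "frag_of (u * 1, Y) - frag_of (1, u \<odot>\<^bsub>quotient_module I\<^esub> Y) \<in> rels" if "Y \<in> carrier (quotient_module I)" for Y
  proof -
    have "frag_of (u \<odot>\<^bsub>unit_module\<^esub> 1, Y) - frag_of (1, u \<odot>\<^bsub>quotient_module I\<^esub> Y) \<in>
      {frag_of (a \<odot>\<^bsub>unit_module\<^esub> x, y) - frag_of (x, a \<odot>\<^bsub>quotient_module I\<^esub> y) | a x y.
         a \<in> carrier integer_ring \<and> x \<in> carrier unit_module \<and> y \<in> carrier (quotient_module I)}"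
      by (intro CollectI exI[of _ u] exI[of _ 1] exI[of _ Y]) (use that u in \<open>simp add: um_simps carrier_integer_ring\<close>)
    then show ?thesis unfolding tensor_relations_def um_simps by (intro generate.incl) blast
  qed
  have "scale u 0 \<in> I" using cl(1) by simp
  then have "u \<odot>\<^bsub>quotient_module I\<^esub> I = I" using coset_smult_u[OF zero_carr] by simp
  \<comment> \<open>In tensor notation, u (x) f = 1 (x) u f = 1 (x) 0 = u (x) 0, so multiplication
    by \<open>u\<close> identifies the classes of \<open>?X\<close> and \<open>?Z\<close>.\<close>
  then have "frag_of (u * 1, coset I f) - frag_of (1, I) \<in> rels" "frag_of (u * 1, I) - frag_of (1, I) \<in> rels"
    using rel[OF mem(1)] rel[OF mem(2)] coset_smult_u[OF f] by simp_all
  from add_closedD(4)[OF racl this] have "frag_scale ?X - frag_scale ?Z \<in> rels"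
    by (simp only: frag_scale_simps diff_diff_eq2 diff_add_cancel)
  then have "coset rels (frag_scale ?X) = coset rels (frag_scale ?Z)" by (simp only: coset_eq_iff[OF racl])
  then have eq: "tensor_map integer_ring unit_module (quotient_module I) ((*) u) (coset rels ?X) =
      tensor_map integer_ring unit_module (quotient_module I) ((*) u) (coset rels ?Z)" by (simp only: tm)
  have "(*) u \<in> linear_maps integer_ring unit_module unit_module"
    using mult_le_one[OF u(1) absval_nonneg] by (auto simp: linear_maps_def um_simps valuation_mult distrib_left)
  moreover have "inj_on ((*) u) (carrier unit_module)" using u by (auto simp: inj_on_def)
  ultimately have "inj_on (tensor_map integer_ring unit_module (quotient_module I) ((*) u))
      (carrier (tensor_product integer_ring unit_module (quotient_module I)))"
    using flat unit_module unfolding flat_module_def by blast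
  from inj_onD[OF this eq classes] have "?X - ?Z \<in> rels" by (simp only: coset_eq_iff[OF racl])
  then have "frag_value (?X - ?Z) \<in> I" by (rule frag_value_relations)
  then have *: "(SOME g. g \<in> coset I f) - (SOME g. g \<in> I) \<in> I"
    by (simp only: frag_value_diff frag_value_of fst_conv snd_conv scale_1)
  have "(SOME g. g \<in> I) \<in> I" by (rule someI[of "\<lambda>g. g \<in> I", OF cl(1)])
  from cl(2)[OF * this] have "(SOME g. g \<in> coset I f) \<in> I" by simp
  from cl(4)[OF this some_coset[OF f(1)]] show ?thesis by simp
qed

end

lemma ideal_from_add_closed:
  fixes R :: "('a::ab_group_add, 'c) ring_scheme"
  assumes R: "cring R" and add: "\<And>f g. f \<oplus>\<^bsub>R\<^esub> g = f + g" and sub: "I \<subseteq> carrier R" and I: "add_closed I"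
    and mult: "\<And>a x. a \<in> I \<Longrightarrow> x \<in> carrier R \<Longrightarrow> x \<otimes>\<^bsub>R\<^esub> a \<in> I"
  shows "ideal I R"
proof (rule idealI)
  interpret cring R by (rule R)
  show "ring R" by (rule ring_axioms)
  have z: "\<zero>\<^bsub>R\<^esub> = 0"
    using l_zero[of "\<zero>\<^bsub>R\<^esub>"] by (simp add: add)
  have m: "\<ominus>\<^bsub>R\<^esub> x = - x" if "x \<in> carrier R" for x
    using l_neg[OF that] by (simp add: add z add_eq_0_iff2)
  show "subgroup I (add_monoid R)"
  proof (rule subgroup.intro)
    fix x assume x: "x \<in> I"
    have "inv\<^bsub>add_monoid R\<^esub> x = - x" using m[of x] x sub by (auto simp: a_inv_def)
    then show "inv\<^bsub>add_monoid R\<^esub> x \<in> I" using add_closedD(3)[OF I x] by simp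
  qed (use sub add_closedD[OF I] in \<open>simp_all add: add z\<close>)
  fix a x assume ax: "a \<in> I" "x \<in> carrier R"
  show "x \<otimes>\<^bsub>R\<^esub> a \<in> I" using mult[OF ax] .
  then show "a \<otimes>\<^bsub>R\<^esub> x \<in> I" using m_comm[of a x] ax sub by auto
qed

section \<open>Reduction modulo the maximal ideal\<close>

notation fls_nth (infixl "$$" 75)

lemma type_algebra_simps [simp]:
  "carrier (ring_of_type_algebra :: 'a::comm_ring_1 ring) = UNIV"
  "x \<otimes>\<^bsub>ring_of_type_algebra\<^esub> y = x * (y::'a)"
  "x \<oplus>\<^bsub>ring_of_type_algebra\<^esub> y = x + (y::'a)"
  "\<one>\<^bsub>ring_of_type_algebra\<^esub> = (1::'a)"
  "\<zero>\<^bsub>ring_of_type_algebra\<^esub> = (0::'a)"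
  by (simp_all add: ring_of_type_algebra_def)

lemma kcoeff_eqI: "(\<And>j i. kcoeff f (j, i) = kcoeff g (j, i)) \<Longrightarrow> f = g"
  by (auto simp: kcoeff_def fls_eq_iff intro!: poly_mapping_eqI)

lemma kcoeff_simps [simp]:
  "kcoeff 0 e = 0" "kcoeff (f + g) e = kcoeff f e + kcoeff g e"
  by (auto simp: kcoeff_def Poly_Mapping.lookup_add split: prod.splits)

lemma kcoeff_minus [simp]:
  "kcoeff (- f) e = - kcoeff f e" "kcoeff (f - g) e = kcoeff f e - kcoeff g (e :: int \<times> ('n \<Rightarrow>\<^sub>0 nat)) "
  for f g :: "('n, 'r::field) kseries"
  by (auto simp: kcoeff_def Poly_Mapping.lookup_minus split: prod.splits)

lemma kcoeff_1: "kcoeff (1 :: ('n, 'r::field) kseries) (j, i) = (if j = 0 \<and> i = 0 then 1 else 0)"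
  by (auto simp: kcoeff_def lookup_one)

lemma lookup_mult_pairs:
  fixes P Q :: "('n::finite \<Rightarrow>\<^sub>0 nat) \<Rightarrow>\<^sub>0 'r::field"
  shows "Poly_Mapping.lookup (P * Q) i = (\<Sum>(b, b') | b + b' = i. Poly_Mapping.lookup P b * Poly_Mapping.lookup Q b')"
proof -
  have "Poly_Mapping.lookup (P * Q) i =
      Sum_any (\<lambda>(a, b). Poly_Mapping.lookup P a * Poly_Mapping.lookup Q b when i = a + b)"
    by (simp add: times_poly_mapping.rep_eq prod_fun_unfold_prod)
  also have "\<dots> = (\<Sum>(a, b) \<in> {(b, b'). b + b' = i}. Poly_Mapping.lookup P a * Poly_Mapping.lookup Q b when i = a + b)"
    by (rule Sum_any.expand_superset[OF finite_add_pairs]) (auto simp: when_def split: if_splits)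
  also have "\<dots> = (\<Sum>(b, b') | b + b' = i. Poly_Mapping.lookup P b * Poly_Mapping.lookup Q b')"
    by (rule sum.cong) (auto simp: when_def)
  finally show ?thesis .
qed

text \<open>Stated for arbitrary lower bounds instead of subdegrees, so that ranges found before
  reduction can be used for the reductions, whose subdegrees may be larger.\<close>

lemma kcoeff_mult:
  fixes f g :: "('n::finite, 'r::field) kseries"
  assumes "\<And>a. a < A \<Longrightarrow> fls_nth f a = 0" "\<And>a. a < B \<Longrightarrow> fls_nth g a = 0"
  shows "kcoeff (f * g) (j, i) = (\<Sum>a = A..j - B. \<Sum>(b, b') | b + b' = i. kcoeff f (a, b) * kcoeff g (j - a, b'))"
proof -
  let ?U = "{min A (fls_subdegree f)..max (j - B) (j - fls_subdegree g)}"
  have "(f * g) $$ j = (\<Sum>a = fls_subdegree f..j - fls_subdegree g. f $$ a * g $$ (j - a))"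
    by (rule fls_times_nth(2))
  also have "\<dots> = (\<Sum>a\<in>?U. f $$ a * g $$ (j - a))"
  proof (rule sum.mono_neutral_left)
    show "\<forall>a\<in>?U - {fls_subdegree f..j - fls_subdegree g}. f $$ a * g $$ (j - a) = 0"
    proof
      fix a assume "a \<in> ?U - {fls_subdegree f..j - fls_subdegree g}"
      then have "a < fls_subdegree f \<or> j - a < fls_subdegree g" by auto
      then show "f $$ a * g $$ (j - a) = 0" by auto
    qed
  qed auto
  also have "\<dots> = (\<Sum>a = A..j - B. f $$ a * g $$ (j - a))"
  proof (rule sum.mono_neutral_right)
    show "\<forall>a\<in>?U - {A..j - B}. f $$ a * g $$ (j - a) = 0"
    proof
      fix a assume "a \<in> ?U - {A..j - B}"
      then have "a < A \<or> j - a < B" by auto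
      then show "f $$ a * g $$ (j - a) = 0" using assms by auto
    qed
  qed auto
  finally have "kcoeff (f * g) (j, i) = (\<Sum>a = A..j - B. Poly_Mapping.lookup (f $$ a * g $$ (j - a)) i)"
    by (simp add: kcoeff_def lookup_sum)
  then show ?thesis by (simp add: lookup_mult_pairs kcoeff_def)
qed

lemma kcoeff_mult_nonzero:
  fixes f g :: "('n::finite, 'r::field) kseries"
  assumes "kcoeff (f * g) (j, i) \<noteq> 0"
  shows "\<exists>a b b'. b + b' = i \<and> kcoeff f (a, b) \<noteq> 0 \<and> kcoeff g (j - a, b') \<noteq> 0"
proof (rule ccontr)
  assume *: "\<not> ?thesis"
  have "kcoeff (f * g) (j, i) =
    (\<Sum>a = fls_subdegree f..j - fls_subdegree g. \<Sum>(b, b') | b + b' = i. kcoeff f (a, b) * kcoeff g (j - a, b'))"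
    by (rule kcoeff_mult) auto
  also have "\<dots> = 0"
  proof (intro sum.neutral ballI)
    fix a x assume "x \<in> {(b, b'). b + b' = i}"
    then show "(case x of (b, b') \<Rightarrow> kcoeff f (a, b) * kcoeff g (j - a, b')) = 0" using * by auto
  qed
  finally show False using assms by simp
qed

section \<open>Leading exponents and the Groebner basis of the special fibre\<close>

lemma fls_nth_eq_0_iff: "fls_nth f j = 0 \<longleftrightarrow> (\<forall>i. kcoeff f (j, i) = 0)"
  by (auto simp: kcoeff_def intro!: poly_mapping_eqI)

text \<open>The order prefers small \<open>S\<close>-exponents, so the leading monomial sits in the
  lowest coefficient. This is a nonzero polynomial and thus has a largest exponent, although the
  series may be infinite.\<close>

lemma leading_exponent_props:
  fixes f :: "('n::linorder, 'r::field) kseries"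
  assumes "f \<noteq> 0"
  shows "fst (leading_exponent f) = fls_subdegree f" "kcoeff f (leading_exponent f) \<noteq> 0"
    "kcoeff f (fls_subdegree f, i) \<noteq> 0 \<Longrightarrow> i \<le> snd (leading_exponent f)"
proof -
  let ?j = "fls_subdegree f"
  let ?K = "Poly_Mapping.keys (f $$ ?j)"
  have K: "finite ?K" "?K \<noteq> {}" using assms by auto
  let ?e = "(?j, Max ?K)"
  have nz: "kcoeff f ?e \<noteq> 0" using Max_in[OF K] by (simp add: kcoeff_def in_keys_iff)
  have mx: "i \<le> Max ?K" if "kcoeff f (?j, i) \<noteq> 0" for i
    using that K by (intro Max_ge) (auto simp: kcoeff_def in_keys_iff)
  have ge: "monomial_ge ?e e'" if "kcoeff f e' \<noteq> 0" for e'
  proof -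
    obtain j' i' where e': "e' = (j', i')" by (cases e')
    have "?j \<le> j'"
    proof (rule ccontr)
      assume "\<not> ?j \<le> j'"
      then have "f $$ j' = 0" by simp
      then show False using that by (simp add: e' kcoeff_def)
    qed
    then show ?thesis using that mx by (auto simp: monomial_ge_def e')
  qed
  have "leading_exponent f = ?e"
    unfolding leading_exponent_def
  proof (rule the_equality)
    show "kcoeff f ?e \<noteq> 0 \<and> (\<forall>e'. kcoeff f e' \<noteq> 0 \<longrightarrow> monomial_ge ?e e')" using nz ge by blast
    fix e assume e: "kcoeff f e \<noteq> 0 \<and> (\<forall>e'. kcoeff f e' \<noteq> 0 \<longrightarrow> monomial_ge e e')"
    then have "monomial_ge e ?e" "monomial_ge ?e e" using nz ge by blast+
    then show "e = ?e" by (cases e) (auto simp: monomial_ge_def)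
  qed
  then show "fst (leading_exponent f) = ?j" "kcoeff f (leading_exponent f) \<noteq> 0"
    "kcoeff f (?j, i) \<noteq> 0 \<Longrightarrow> i \<le> snd (leading_exponent f)"
    using nz mx by auto
qed

lemma kcoeff_leading_term:
  fixes f :: "('n::linorder, 'r::field) kseries"
  shows "kcoeff (leading_term f) e = (if e = leading_exponent f then kcoeff f e else 0)"
proof -
  obtain j i where l: "leading_exponent f = (j, i)" by (cases "leading_exponent f")
  obtain j' i' where e: "e = (j', i')" by (cases e)
  have lt: "leading_term f = fls_shift (-j) (fls_const (Poly_Mapping.single i (kcoeff f (j, i))))"
    by (simp add: leading_term_def l fls_X_intpow_times_conv_shift)
  show ?thesis
    by (auto simp: lt l e kcoeff_def Poly_Mapping.lookup_single when_def)
qed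

text \<open>Only exponents of \<open>u\<close> are recorded: \<open>S\<close> is invertible in
  \<open>R_kappa\<close>, so divisibility between leading terms does not see the
  \<open>S\<close>-exponents.\<close>

definition leading_ideal :: "('n::linorder, 'r::field) kseries set \<Rightarrow> ('n \<Rightarrow>\<^sub>0 nat) set" where
  "leading_ideal G = {snd (leading_exponent g) + b | g b. g \<in> G}"

lemma cring_R_kappa: "cring (R_kappa :: ('n, 'r::field) kseries ring)"
  by (rule cring_from_type_algebra)

text \<open>The series all of whose \<open>u\<close>-exponents lie in \<open>leading_ideal G\<close>
  form an ideal \<open>T\<close>. It contains the leading terms of \<open>G\<close>, hence the ideal
  that they generate, hence the leading term of \<open>f\<close>.\<close>

lemma Groebner_leading:
  fixes J :: "('n::{finite,linorder}, 'r::field) kseries set"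
  assumes GB: "Groebner_basis J G" and f: "f \<in> J" "f \<noteq> 0"
  shows "snd (leading_exponent f) \<in> leading_ideal G"
proof -
  define T where "T = {x :: ('n, 'r) kseries. \<forall>j i. kcoeff x (j, i) \<noteq> 0 \<longrightarrow> i \<in> leading_ideal G}"
  interpret cring "R_kappa :: ('n, 'r) kseries ring" by (rule cring_R_kappa)
  have "ideal T R_kappa"
  proof (rule ideal_from_add_closed[OF cring_R_kappa])
    have "i \<in> leading_ideal G" if "x \<in> T" "y \<in> T" "kcoeff (x + y) (j, i) \<noteq> 0" for x y j i
    proof -
      have "kcoeff x (j, i) \<noteq> 0 \<or> kcoeff y (j, i) \<noteq> 0" using that(3) by auto
      then show ?thesis using that(1,2) unfolding T_def by blast
    qed
    then have "x + y \<in> T" if "x \<in> T" "y \<in> T" for x y using that by (subst T_def) blast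
    moreover have "- x \<in> T" "0 \<in> T" if "x \<in> T" for x using that by (simp_all add: T_def)
    moreover have "0 \<in> T" by (simp add: T_def)
    ultimately show "add_closed T" unfolding add_closed_def by blast
    fix a x :: "('n, 'r) kseries" assume "a \<in> T"
    have "x * a \<in> T" unfolding T_def
    proof (intro CollectI allI impI)
      fix j i assume "kcoeff (x * a) (j, i) \<noteq> 0"
      from kcoeff_mult_nonzero[OF this]
      obtain j' b b' where b: "b + b' = i" "kcoeff a (j - j', b') \<noteq> 0" by blast
      then have "b' \<in> leading_ideal G" using \<open>a \<in> T\<close> by (auto simp: T_def)
      then obtain g b'' where "g \<in> G" "b' = snd (leading_exponent g) + b''" by (auto simp: leading_ideal_def)
      then have "i = snd (leading_exponent g) + (b'' + b)" using b(1) by (simp add: ac_simps)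
      then show "i \<in> leading_ideal G" using \<open>g \<in> G\<close> unfolding leading_ideal_def by blast
    qed
    then show "x \<otimes>\<^bsub>R_kappa\<^esub> a \<in> T" by simp
  qed auto
  moreover have "leading_term ` G \<subseteq> T"
  proof
    fix x assume "x \<in> leading_term ` G"
    then obtain g where g: "g \<in> G" "x = leading_term g" by blast
    show "x \<in> T" unfolding T_def
    proof (intro CollectI allI impI)
      fix j i assume "kcoeff x (j, i) \<noteq> 0"
      then have "(j, i) = leading_exponent g" by (simp add: g kcoeff_leading_term split: if_splits)
      then have "i = snd (leading_exponent g) + 0" by (metis add_0_right snd_conv)
      then show "i \<in> leading_ideal G" using g(1) unfolding leading_ideal_def by blast
    qed
  qed
  ultimately have "Idl\<^bsub>R_kappa\<^esub> (leading_term ` G) \<subseteq> T" by (rule genideal_minimal)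
  moreover have "leading_term f \<in> Idl\<^bsub>R_kappa\<^esub> (leading_term ` (J - {0}))"
    using f by (intro subsetD[OF genideal_self]) auto
  ultimately have "leading_term f \<in> T" using GB by (auto simp: Groebner_basis_def)
  moreover have "kcoeff (leading_term f) (leading_exponent f) \<noteq> 0"
    using leading_exponent_props(2)[OF f(2)] by (simp add: kcoeff_leading_term)
  ultimately show ?thesis unfolding T_def by (metis (mono_tags, lifting) mem_Collect_eq prod.collapse)
qed

text \<open>Coefficients in \<open>R_int\<close> are small at very negative exponents and at most 1
  elsewhere. Outside a finite range of \<open>a\<close>, one of \<open>a\<close> and
  \<open>j - a\<close> is very negative.\<close>

lemma convolvable_R_int:
  fixes f g :: "('n, 'k::complete_discretely_valued_field) series"
  assumes f: "f \<in> carrier R_int" and g: "g \<in> carrier R_int"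
  shows "convolvable f g"
  unfolding convolvable_def
proof (intro allI impI)
  fix j i and e :: real assume "e > 0"
  then have e2: "e / 2 > 0" by simp
  obtain N where N: "\<forall>a<N. \<forall>i. absval (f a i) \<le> e / 2" using f e2 unfolding R_int_carrier by blast
  obtain M where M: "\<forall>a<M. \<forall>i. absval (g a i) \<le> e / 2" using g e2 unfolding R_int_carrier by blast
  have f1: "absval (f a b) \<le> 1" and g1: "absval (g a b) \<le> 1" for a b
    using f g by (auto simp: R_int_carrier gauss_bound_1)
  have "{a. e \<le> absval (conv_term f g j i a)} \<subseteq> {N..j - M}"
  proof
    fix a assume "a \<in> {a. e \<le> absval (conv_term f g j i a)}"
    then have a: "e \<le> absval (conv_term f g j i a)" by simp
    show "a \<in> {N..j - M}"
    proof (rule ccontr)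
      assume *: "a \<notin> {N..j - M}"
      have "absval (conv_term f g j i a) \<le> e / 2"
      proof (rule absval_conv_term_le)
        fix b b'
        have "a < N \<or> j - a < M" using * unfolding atLeastAtMost_iff by arith
        then consider "a < N" | "j - a < M" by blast
        then show "absval (f a b) * absval (g (j - a) b') \<le> e / 2"
        proof cases
          case 1
          then have "absval (f a b) * absval (g (j - a) b') \<le> e / 2 * 1"
            using N e2 g1 by (intro mult_mono) auto
          then show ?thesis by simp
        next
          case 2
          then have "absval (f a b) * absval (g (j - a) b') \<le> 1 * (e / 2)"
            using M e2 f1 by (intro mult_mono) auto
          then show ?thesis by simp
        qed
      qed (use e2 in simp)
      then show False using a \<open>e > 0\<close> by linarith
    qed
  qed
  then show "finite {a. e \<le> absval (conv_term f g j i a)}" by (rule finite_subset) simp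
qed

section \<open>Residues and coefficientwise reduction\<close>

locale residue_field =
  fixes uK :: "'k::complete_discretely_valued_field" and res :: "'k \<Rightarrow> 'r::field"
  assumes uniformizer: "uniformizer uK" and residue: "residue_map res"
begin

lemma uK: "0 < absval uK" "absval uK < 1" "uK \<noteq> 0"
  using uniformizer by (auto simp: uniformizer_def)

lemma value_group: "(x::'k) \<noteq> 0 \<Longrightarrow> \<exists>k::int. absval x = absval uK powi k"
  using uniformizer by (auto simp: uniformizer_def)

text \<open>Discreteness leaves a gap between \<open>absval uK\<close> and 1. It turns strict bounds
  by 1 into bounds by \<open>absval uK\<close>, and these survive infinite sums and suprema.\<close>

lemma absval_less_1: "absval (x::'k) < 1 \<Longrightarrow> absval x \<le> absval uK"
proof (cases "x = 0")
  case False
  assume less: "absval x < 1"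
  from value_group[OF False] obtain k :: int where k: "absval x = absval uK powi k" by blast
  have "k \<ge> 1"
  proof (rule ccontr)
    assume "\<not> k \<ge> 1"
    then have "1 \<le> inverse (absval uK) ^ nat (-k)" using uK by (intro one_le_power) (simp add: field_simps)
    then show False using less \<open>\<not> k \<ge> 1\<close> by (auto simp: k power_int_def split: if_splits)
  qed
  then have "absval uK powi k \<le> absval uK powi 1" using uK by (intro power_int_decreasing) auto
  then show ?thesis using k by simp
qed (use uK in simp)

lemma res_hom: "res \<in> ring_hom integer_ring ring_of_type_algebra"
  using residue by (simp add: residue_map_def)

lemma integer_ring_simps [simp]:
  "x \<in> carrier integer_ring \<longleftrightarrow> absval (x::'k) \<le> 1" "x \<otimes>\<^bsub>integer_ring\<^esub> y = x * (y::'k)"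
  "x \<oplus>\<^bsub>integer_ring\<^esub> y = x + (y::'k)" "\<one>\<^bsub>integer_ring\<^esub> = (1::'k)"
  by (simp_all add: integer_ring_def ring_of_type_algebra_def)

lemma res_add: "absval x \<le> 1 \<Longrightarrow> absval y \<le> 1 \<Longrightarrow> res (x + y) = res x + res y"
  using ring_hom_add[OF res_hom, of x y] by simp

lemma res_mult: "absval x \<le> 1 \<Longrightarrow> absval y \<le> 1 \<Longrightarrow> res (x * y) = res x * res y"
  using ring_hom_mult[OF res_hom, of x y] by simp

lemma res_1 [simp]: "res 1 = 1"
  using ring_hom_one[OF res_hom] by simp

lemma res_0 [simp]: "res 0 = 0"
proof -
  have "res 0 = res 0 + res 0" using res_add[of 0 0] by simp
  then show ?thesis by (metis add_cancel_right_right)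
qed

lemma res_uminus: "absval x \<le> 1 \<Longrightarrow> res (- x) = - res x"
  using res_add[of x "- x"] by (simp add: eq_neg_iff_add_eq_0 add.commute)

lemma res_diff: "absval x \<le> 1 \<Longrightarrow> absval y \<le> 1 \<Longrightarrow> res (x - y) = res x - res y"
  using res_add[of x "- y"] res_uminus[of y] by simp

lemma res_eq_0_iff: "absval x \<le> 1 \<Longrightarrow> res x = 0 \<longleftrightarrow> absval x < 1"
proof -
  assume x: "absval x \<le> 1"
  have "a_kernel integer_ring ring_of_type_algebra res = {x. absval x < 1}"
    using residue by (simp add: residue_map_def)
  then have "x \<in> a_kernel integer_ring ring_of_type_algebra res \<longleftrightarrow> absval x < 1" by simp
  then show ?thesis using x by (simp add: a_kernel_def')
qed

lemma res_surj: "\<exists>x. absval x \<le> 1 \<and> res x = y"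
proof -
  have "y \<in> res ` carrier integer_ring" using residue by (simp add: residue_map_def)
  then show ?thesis by auto
qed

lemma res_sum:
  assumes "\<And>x. x \<in> A \<Longrightarrow> absval (f x) \<le> 1"
  shows "res (sum f A) = (\<Sum>x\<in>A. res (f x))"
  using assms
proof (induction A rule: infinite_finite_induct)
  case (insert x A)
  have "absval (sum f A) \<le> 1" by (rule absval_sum_le) (use insert in auto)
  then show ?case using insert by (simp add: res_add)
qed simp_all

lemma R_int_le_1: "f \<in> carrier R_int \<Longrightarrow> absval (f j i :: 'k) \<le> 1"
  by (simp add: R_int_carrier gauss_bound_1)

lemma R_int_lower: "f \<in> carrier R_int \<Longrightarrow> \<exists>N. \<forall>j<N. \<forall>i. absval (f j i :: 'k) < 1"
proof -
  assume "f \<in> carrier R_int"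
  then have "\<exists>N. \<forall>j<N. \<forall>i. absval (f j i) \<le> 1 / 2" unfolding R_int_carrier by (metis half_gt_zero_iff zero_less_one)
  then obtain N where N: "\<forall>j<N. \<forall>i. absval (f j i) \<le> 1 / 2" by blast
  have "absval (f j i) < 1" if "j < N" for j i
    using N[rule_format, OF that, of i] by simp
  then show ?thesis by blast
qed

lemma kcoeff_reduce:
  assumes f: "f \<in> carrier R_int"
  shows "kcoeff (reduce res f) (j, i) = res (f j i)"
proof -
  have fin: "finite {i. res (f j i) \<noteq> 0}" for j
  proof -
    have "{i. res (f j i) \<noteq> 0} \<subseteq> {i. 1 \<le> absval (f j i)}"
      using res_eq_0_iff R_int_le_1[OF f] by (auto simp: not_less[symmetric])
    moreover have "finite {i. 1 \<le> absval (f j i)}" using f by (intro tateD) (auto simp: R_int_carrier)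
    ultimately show ?thesis by (rule finite_subset)
  qed
  then have l: "Poly_Mapping.lookup (Abs_poly_mapping (\<lambda>i. res (f j i))) = (\<lambda>i. res (f j i))" for j
    by (simp add: Abs_poly_mapping_inverse)
  obtain N where N: "\<forall>j<N. \<forall>i. absval (f j i) < 1" using R_int_lower[OF f] by blast
  have "Abs_poly_mapping (\<lambda>i. res (f j i)) = 0" if "j < N" for j
    using N that res_eq_0_iff R_int_le_1[OF f] by (intro poly_mapping_eqI) (simp add: l)
  then have "fls_nth (reduce res f) j = Abs_poly_mapping (\<lambda>i. res (f j i))" for j
    unfolding reduce_def by (intro nth_Abs_fls_lower_bound[of N]) auto
  then show ?thesis by (simp add: kcoeff_def l)
qed

lemma reduce_add:
  assumes "f \<in> carrier R_int" "g \<in> carrier R_int" "f + g \<in> carrier R_int"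
  shows "reduce res (f + g) = reduce res f + reduce res g"
  by (rule kcoeff_eqI) (simp add: kcoeff_reduce assms res_add R_int_le_1)

lemma reduce_one: "reduce res series_one = 1"
proof (rule kcoeff_eqI)
  fix j :: int and i :: "'x \<Rightarrow>\<^sub>0 nat"
  show "kcoeff (reduce res series_one) (j, i) = kcoeff 1 (j, i)"
    using kcoeff_reduce[OF R_int_monom[of "1::'k" 0 "0 :: 'x \<Rightarrow>\<^sub>0 nat"], of j i]
    by (simp add: kcoeff_1 series_monom_def)
qed

lemma reduce_uminus:
  assumes "f \<in> carrier R_int" "- f \<in> carrier R_int"
  shows "reduce res (- f) = - reduce res f"
  by (rule kcoeff_eqI) (simp add: kcoeff_reduce assms res_uminus R_int_le_1)

lemma reduce_diff:
  assumes "f \<in> carrier R_int" "g \<in> carrier R_int" "f - g \<in> carrier R_int"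
  shows "reduce res (f - g) = reduce res f - reduce res g"
  by (rule kcoeff_eqI) (simp add: kcoeff_reduce assms res_diff R_int_le_1)

text \<open>Outside the range from \<open>N\<close> to \<open>j - M\<close> one factor is in the
  maximal ideal. By the gap below 1 the infinite sum of those terms is at most
  \<open>absval uK\<close> and disappears in the residue field; the rest is a finite sum, on which
  \<open>res\<close> is additive.\<close>

lemma reduce_mult:
  fixes f g :: "('n::finite, 'k) series"
  assumes f: "f \<in> carrier R_int" and g: "g \<in> carrier R_int" and fg: "f \<star> g \<in> carrier R_int"
  shows "reduce res (f \<star> g) = reduce res f * reduce res g"
proof (rule kcoeff_eqI)
  fix j :: int and i :: "'n \<Rightarrow>\<^sub>0 nat"
  obtain N where N: "\<forall>j<N. \<forall>i. absval (f j i) < 1" using R_int_lower[OF f] by blast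
  obtain M where M: "\<forall>j<M. \<forall>i. absval (g j i) < 1" using R_int_lower[OF g] by blast
  have f1: "absval (f a b) \<le> 1" and g1: "absval (g a b) \<le> 1" for a b
    using f g by (auto simp: R_int_carrier gauss_bound_1)
  let ?A = "{N..j - M}"
  let ?t = "conv_term f g j i"
  let ?x = "\<lambda>a. if a \<in> ?A then 0 else ?t a" and ?y = "\<lambda>a. if a \<in> ?A then ?t a else 0"
  have fin: "finite {a. e \<le> absval (?t a)}" if "e > 0" for e
    using convolvable_R_int[OF f g] that by (simp add: convolvable_def)
  have xs: "?x summable_on UNIV"
  proof (rule nonarch_summable)
    fix e :: real assume "e > 0"
    show "finite {a. e \<le> absval (?x a)}"
      by (rule finite_subset[OF _ fin[OF \<open>e > 0\<close>]]) (use \<open>e > 0\<close> in auto)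
  qed
  have ys: "?y summable_on UNIV"
  proof (rule nonarch_summable)
    fix e :: real assume "e > 0"
    show "finite {a. e \<le> absval (?y a)}"
      by (rule finite_subset[of _ ?A]) (use \<open>e > 0\<close> in \<open>auto split: if_splits\<close>)
  qed
  have "?t = (\<lambda>a. ?x a + ?y a)" by auto
  then have "infsum ?t UNIV = infsum (\<lambda>a. ?x a + ?y a) UNIV" by (rule arg_cong)
  also have "\<dots> = infsum ?x UNIV + infsum ?y UNIV" by (rule infsum_add[OF xs ys])
  also have "infsum ?y UNIV = sum ?y ?A" by (rule infsum_neutral_finite) auto
  finally have eq: "(f \<star> g) j i = infsum ?x UNIV + sum ?t ?A"
    by (simp add: series_mult_conv_term)
  have small: "absval (?t a) \<le> absval uK" if "a \<notin> ?A" for a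
  proof (rule absval_conv_term_le)
    fix b b'
    have *: "absval (f a b * g (j - a) b') < 1"
    proof -
      have "a < N \<or> j - a < M" using that unfolding atLeastAtMost_iff by arith
      then consider "a < N" | "j - a < M" by blast
      then show ?thesis
      proof cases
        case 1
        then have "absval (f a b) < 1" using N by blast
        moreover have "absval (f a b) * absval (g (j - a) b') \<le> absval (f a b) * 1"
          by (intro mult_left_mono g1) simp
        ultimately show ?thesis by (simp add: valuation_mult)
      next
        case 2
        then have "absval (g (j - a) b') < 1" using M by blast
        moreover have "absval (f a b) * absval (g (j - a) b') \<le> 1 * absval (g (j - a) b')"
          by (intro mult_right_mono f1) simp
        ultimately show ?thesis by (simp add: valuation_mult)
      qed
    qed
    show "absval (f a b) * absval (g (j - a) b') \<le> absval uK"
      using absval_less_1[OF *] by (simp only: valuation_mult)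
  qed simp
  have "absval (infsum ?x UNIV) \<le> absval uK"
    by (rule infsum_absval_le) (use small in auto)
  then have x0: "absval (infsum ?x UNIV) < 1" using uK by linarith
  have t1: "absval (f a b * g a' b') \<le> 1" for a b a' b'
    using f1 g1 by (simp add: valuation_mult mult_le_one)
  have c1: "absval (?t a) \<le> 1" for a
    by (rule absval_conv_term_le) (use t1 in \<open>simp_all add: valuation_mult\<close>)
  have s1: "absval (sum ?t ?A) \<le> 1" by (rule absval_sum_le) (use c1 in auto)
  have "kcoeff (reduce res (f \<star> g)) (j, i) = res (infsum ?x UNIV + sum ?t ?A)"
    using kcoeff_reduce[OF fg] by (simp only: eq)
  also have "\<dots> = res (sum ?t ?A)" using x0 s1 res_add res_eq_0_iff by simp
  also have "\<dots> = (\<Sum>a\<in>?A. res (?t a))" by (rule res_sum) (rule c1)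
  also have "\<dots> = (\<Sum>a\<in>?A. \<Sum>(b, b') | b + b' = i. res (f a b) * res (g (j - a) b'))"
  proof (rule sum.cong[OF refl])
    fix a
    have "res (?t a) = (\<Sum>x | fst x + snd x = i. res (f a (fst x) * g (j - a) (snd x)))"
      unfolding conv_term_def case_prod_unfold by (rule res_sum) (rule t1)
    then show "res (?t a) = (\<Sum>(b, b') | b + b' = i. res (f a b) * res (g (j - a) b'))"
      by (simp add: case_prod_unfold res_mult f1 g1)
  qed
  also have "\<dots> = kcoeff (reduce res f * reduce res g) (j, i)"
  proof (subst kcoeff_mult[of N _ M])
    show "reduce res f $$ a = 0" if "a < N" for a
      using N that f1 res_eq_0_iff by (simp add: fls_nth_eq_0_iff kcoeff_reduce f)
    show "reduce res g $$ a = 0" if "a < M" for a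
      using M that g1 res_eq_0_iff by (simp add: fls_nth_eq_0_iff kcoeff_reduce g)
  qed (simp add: kcoeff_reduce f g)
  finally show "kcoeff (reduce res (f \<star> g)) (j, i) = kcoeff (reduce res f * reduce res g) (j, i)" .
qed

lemma reduce_eq_0_iff:
  assumes "f \<in> carrier R_int"
  shows "reduce res f = 0 \<longleftrightarrow> gauss_bound 1 f (absval uK)"
proof
  assume r: "reduce res f = 0"
  have "absval (f j i) \<le> absval uK" for j i
  proof -
    have "res (f j i) = 0" using kcoeff_reduce[OF assms, of j i] r by simp
    then show ?thesis using res_eq_0_iff[OF R_int_le_1[OF assms]] absval_less_1 by blast
  qed
  then show "gauss_bound 1 f (absval uK)" by (simp add: gauss_bound_1)
next
  assume b: "gauss_bound 1 f (absval uK)"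
  show "reduce res f = 0"
  proof (rule kcoeff_eqI)
    fix j i
    have "absval (f j i) < 1" using b uK by (auto simp: gauss_bound_1 intro: le_less_trans)
    then have "res (f j i) = 0" using res_eq_0_iff[of "f j i"] by simp
    then show "kcoeff (reduce res f) (j, i) = kcoeff 0 (j, i)" using kcoeff_reduce[OF assms] by simp
  qed
qed

text \<open>A set-theoretic section of \<open>res\<close>; its nonzero values are units. Sending 0
  to 0 makes lifts keep the support, so they inherit finite principal parts and normality.\<close>

definition sect :: "'r \<Rightarrow> 'k" where
  "sect y = (if y = 0 then 0 else SOME x. absval x \<le> 1 \<and> res x = y)"

lemma sect: "absval (sect y) \<le> 1" "res (sect y) = y" "sect 0 = 0"
proof -
  have "absval (SOME x. absval x \<le> 1 \<and> res x = y) \<le> 1 \<and> res (SOME x. absval x \<le> 1 \<and> res x = y) = y"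
    by (rule someI_ex[OF res_surj])
  then show "absval (sect y) \<le> 1" "res (sect y) = y" "sect 0 = 0" by (auto simp: sect_def)
qed

lemma absval_sect: "y \<noteq> 0 \<Longrightarrow> absval (sect y) = 1"
  using sect(1,2)[of y] res_eq_0_iff[of "sect y"] by fastforce

definition lift_kseries :: "('n, 'r) kseries \<Rightarrow> ('n, 'k) series" where
  "lift_kseries x = (\<lambda>j i. sect (kcoeff x (j, i)))"

lemma lift_kseries_props:
  fixes x :: "('n, 'r) kseries"
  shows "finite_principal_part (lift_kseries x)" "tate (lift_kseries x j)" "gauss_bound 1 (lift_kseries x) 1"
    "lift_kseries x \<in> carrier R_int" "reduce res (lift_kseries x) = x"
proof -
  show f: "finite_principal_part (lift_kseries x)"
    unfolding finite_principal_part_def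
    by (rule exI[of _ "fls_subdegree x"]) (auto simp: lift_kseries_def kcoeff_def sect)
  show t: "tate (lift_kseries x j)" for j
    unfolding tate_def
  proof (intro allI impI)
    fix e :: real assume "e > 0"
    have "{i. e \<le> absval (lift_kseries x j i)} \<subseteq> Poly_Mapping.keys (x $$ j)"
      using \<open>e > 0\<close> by (auto simp: lift_kseries_def kcoeff_def in_keys_iff sect)
    then show "finite {i. e \<le> absval (lift_kseries x j i)}" by (rule finite_subset) simp
  qed
  show b: "gauss_bound 1 (lift_kseries x) 1" by (simp add: gauss_bound_1 lift_kseries_def sect)
  show c: "lift_kseries x \<in> carrier R_int" by (rule finite_principal_R_int[OF f t b])
  show "reduce res (lift_kseries x) = x"
    by (rule kcoeff_eqI) (simp add: kcoeff_reduce[OF c], simp add: lift_kseries_def sect)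
qed

lemma lift_kseries_null: "0 < \<eta> \<Longrightarrow> \<eta> < 1 \<Longrightarrow> lift_kseries x \<in> null_series \<eta>"
  by (rule null_series_principal[OF lift_kseries_props(1-3)])

lemma lift_kseries_nonzero: "lift_kseries x j i \<noteq> 0 \<longleftrightarrow> kcoeff x (j, i) \<noteq> 0"
proof -
  have "sect y \<noteq> 0 \<longleftrightarrow> y \<noteq> 0" for y
    using absval_sect[of y] sect(3) by (metis absval_0 zero_neq_one)
  then show ?thesis by (simp add: lift_kseries_def)
qed

lemma absval_lift_kseries: "kcoeff x (j, i) \<noteq> 0 \<Longrightarrow> absval (lift_kseries x j i) = 1"
  by (simp add: lift_kseries_def absval_sect)

end

section \<open>Division by the lifted Groebner basis\<close>

text \<open>With finitely many variables, exponents are lists of a fixed length, compared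
  lexicographically from the smallest index on.\<close>

lemma wf_exponents: "wf {(x, y :: 'n::{finite,linorder} \<Rightarrow>\<^sub>0 nat). x < y}"
proof -
  let ?ks = "sorted_list_of_set (UNIV :: 'n set)"
  let ?f = "\<lambda>x :: 'n \<Rightarrow>\<^sub>0 nat. map (Poly_Mapping.lookup x) ?ks"
  have "(?f x, ?f y) \<in> lexn less_than (length ?ks)" if xy: "x < y" for x y :: "'n \<Rightarrow>\<^sub>0 nat"
  proof -
    obtain k where k: "Poly_Mapping.lookup x k < Poly_Mapping.lookup y k"
      "\<And>k'. k' < k \<Longrightarrow> Poly_Mapping.lookup x k' = Poly_Mapping.lookup y k'"
      using less_fun_def[of "Poly_Mapping.lookup x" "Poly_Mapping.lookup y"] xy
      unfolding less_poly_mapping.rep_eq by blast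
    have "k \<in> set ?ks" by simp
    then obtain as bs where ks: "?ks = as @ k # bs" by (meson split_list)
    have "sorted_wrt (<) (as @ k # bs)" by (metis ks strict_sorted_list_of_set)
    then have "\<forall>a\<in>set as. a < k" by (simp add: sorted_wrt_append)
    then have "map (Poly_Mapping.lookup x) as = map (Poly_Mapping.lookup y) as" using k(2) by simp
    then show ?thesis unfolding lexn_conv ks using k(1)
      by (intro CollectI case_prodI conjI exI[of _ "map (Poly_Mapping.lookup x) as"]
          exI[of _ "Poly_Mapping.lookup x k"] exI[of _ "Poly_Mapping.lookup y k"]
          exI[of _ "map (Poly_Mapping.lookup x) bs"] exI[of _ "map (Poly_Mapping.lookup y) bs"]) simp_all
  qed
  then have "{(x, y :: 'n \<Rightarrow>\<^sub>0 nat). x < y} \<subseteq> inv_image (lexn less_than (length ?ks)) ?f" by auto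
  then show ?thesis by (rule wf_subset[rotated]) (intro wf_inv_image wf_lexn wf_less_than)
qed

text \<open>Multiplication in the Tate algebra, that is, for series in \<open>u\<close> with
  \<open>S\<close> left out.\<close>

definition pconv :: "(('n \<Rightarrow>\<^sub>0 nat) \<Rightarrow> 'k::complete_discretely_valued_field) \<Rightarrow> (('n \<Rightarrow>\<^sub>0 nat) \<Rightarrow> 'k) \<Rightarrow> ('n \<Rightarrow>\<^sub>0 nat) \<Rightarrow> 'k" where
  "pconv q s i = (\<Sum>(b, b') | b + b' = i. q b * s b')"

lemma pconv_add: "pconv (\<lambda>i. q i + q' i) s i = pconv q s i + pconv q' s i"
  by (simp add: pconv_def case_prod_unfold distrib_right sum.distrib)

lemma pconv_scale: "pconv (\<lambda>i. c * q i) s i = c * pconv q s i"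
  by (simp add: pconv_def case_prod_unfold sum_distrib_left mult.assoc)

lemma pconv_0: "pconv (\<lambda>i. 0) s i = 0"
  by (simp add: pconv_def)

lemma pconv_monom:
  fixes s :: "('n::finite \<Rightarrow>\<^sub>0 nat) \<Rightarrow> 'k::complete_discretely_valued_field"
  shows "pconv (\<lambda>i. if i = b then c else 0) s i = (if b + (i - b) = i then c * s (i - b) else 0)"
proof -
  have "pconv (\<lambda>i. if i = b then c else 0) s i =
      (\<Sum>(b1, b') \<in> (if b + (i - b) = i then {(b, i - b)} else {}). c * s b')"
    unfolding pconv_def
  proof (rule sum.mono_neutral_cong_right)
    show "finite {(b1, b'). b1 + b' = i}" by (rule finite_add_pairs)
  qed (auto split: if_splits)
  then show ?thesis by simp
qed

lemma tate_finite: "finite {i. g i \<noteq> 0} \<Longrightarrow> tate g"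
  unfolding tate_def
proof (intro allI impI)
  fix e :: real assume "finite {i. g i \<noteq> 0}" "e > 0"
  then show "finite {i. e \<le> absval (g i)}" by (rule_tac finite_subset[of _ "{i. g i \<noteq> 0}"]) auto
qed

lemma tate_max:
  assumes "tate g" "g i1 \<noteq> 0"
  shows "\<exists>i0. g i0 \<noteq> 0 \<and> (\<forall>i. absval (g i) \<le> absval (g i0))"
proof -
  let ?S = "{i. absval (g i1) \<le> absval (g i)}"
  have fin: "finite ?S" using assms by (intro tateD) auto
  have ne: "?S \<noteq> {}" by auto
  let ?M = "Max ((\<lambda>i. absval (g i)) ` ?S)"
  have "?M \<in> (\<lambda>i. absval (g i)) ` ?S" using fin ne by (intro Max_in) auto
  then obtain i0 where i0: "i0 \<in> ?S" "?M = absval (g i0)" by blast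
  have "absval (g i) \<le> absval (g i0)" for i
  proof (cases "i \<in> ?S")
    case True
    then have "absval (g i) \<le> ?M" using fin by (intro Max_ge) auto
    then show ?thesis using i0 by simp
  qed (use i0 in auto)
  moreover have "g i0 \<noteq> 0" using i0(1) assms(2) by (auto simp: )
  ultimately show ?thesis by blast
qed

lemma tate_scale: "tate g \<Longrightarrow> tate (\<lambda>i. c * g i)"
proof (cases "c = 0")
  case False
  assume g: "tate g"
  show ?thesis unfolding tate_def
  proof (intro allI impI)
    fix e :: real assume "e > 0"
    then have "finite {i. e / absval c \<le> absval (g i)}" using False by (intro tateD[OF g]) auto
    moreover have "{i. e \<le> absval (c * g i)} = {i. e / absval c \<le> absval (g i)}"
      using False by (auto simp: valuation_mult field_simps)
    ultimately show "finite {i. e \<le> absval (c * g i)}" by simp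
  qed
qed (simp add: tate_def)

section \<open>The lifted Groebner basis and normal series\<close>

locale groebner_lift = residue_field uK res
  for uK :: "'k::complete_discretely_valued_field" and res :: "'k \<Rightarrow> 'r::field" +
  fixes I :: "('n::{finite,linorder}, 'k) series set" and r :: "nat \<Rightarrow> ('n, 'k) series" and m :: nat
  assumes ideal: "ideal I R_int"
    and saturated: "\<And>f. f \<in> carrier R_int \<Longrightarrow> scale uK f \<in> I \<Longrightarrow> f \<in> I"
    and Groebner: "Groebner_basis (I_kappa res I) ((\<lambda>h. reduce res (r h)) ` {1..m})"
    and r_I: "\<And>h. h \<in> {1..m} \<Longrightarrow> r h \<in> I"
    and r_principal: "\<And>h. h \<in> {1..m} \<Longrightarrow> finite_principal_part (r h)"
begin

abbreviation H where "H \<equiv> {1..m}"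

definition L :: "('n \<Rightarrow>\<^sub>0 nat) set" where
  "L = leading_ideal ((\<lambda>h. reduce res (r h)) ` H)"

text \<open>Reducedness with respect to the leading exponents, as usual for Groebner bases, but with
  infinitely many terms allowed and no condition on the \<open>S\<close>-exponents.\<close>

definition normal :: "('n, 'k) series \<Rightarrow> bool" where
  "normal f \<longleftrightarrow> (\<forall>j i. f j i \<noteq> 0 \<longrightarrow> i \<notin> L)"

definition jI :: int where "jI = minimal_exponent m r"

lemma r_R_int: "h \<in> H \<Longrightarrow> r h \<in> carrier R_int"
  using I_carrier[OF ideal] r_I by blast

lemma jI: "jI \<le> 0" "h \<in> H \<Longrightarrow> r h j i \<noteq> 0 \<Longrightarrow> jI \<le> j"
proof -
  let ?S = "insert 0 {j. \<exists>h\<in>H. \<exists>i. r h j i \<noteq> 0}"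
  have "bdd_below ?S"
  proof -
    have "\<forall>h\<in>H. \<exists>N. \<forall>j<N. r h j = (\<lambda>i. 0)" using r_principal by (simp add: finite_principal_part_def)
    then obtain N where N: "\<forall>h\<in>H. \<forall>j<N h. r h j = (\<lambda>i. 0)" by metis
    show ?thesis
    proof (rule bdd_belowI)
      fix x assume "x \<in> ?S"
      then consider "x = 0" | h i where "h \<in> H" "r h x i \<noteq> 0" by blast
      then show "Min (insert 0 (N ` H)) \<le> x"
      proof cases
        case 2
        then have "N h \<le> x" using N by (metis not_le)
        moreover have "Min (insert 0 (N ` H)) \<le> N h" using 2 by (intro Min_le) auto
        ultimately show ?thesis by simp
      qed simp
    qed
  qed
  then show "jI \<le> 0" "h \<in> H \<Longrightarrow> r h j i \<noteq> 0 \<Longrightarrow> jI \<le> j"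
    unfolding jI_def minimal_exponent_def by (auto intro!: cInf_lower)
qed

lemma r_reduce: 
  assumes "h \<in> H"
  shows "reduce res (r h) \<noteq> 0" "fls_subdegree (reduce res (r h)) = 0"
proof -
  show nz: "reduce res (r h) \<noteq> 0" using Groebner assms unfolding Groebner_basis_def by force
  have "fst (leading_exponent (reduce res (r h))) = 0" using Groebner assms unfolding Groebner_basis_def by blast
  then show "fls_subdegree (reduce res (r h)) = 0" using leading_exponent_props(1)[OF nz] by simp
qed

text \<open>The leading term of the reduction has \<open>S\<close>-exponent 0, and leading means
  lowest in \<open>S\<close>; so the negative part of \<open>r h\<close> vanishes in the reduction.
  The resulting factor \<open>uK\<close> offsets the poles in every division step.\<close>

lemma r_negative: "h \<in> H \<Longrightarrow> j < 0 \<Longrightarrow> absval (r h j i) \<le> absval uK"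
proof -
  assume h: "h \<in> H" and j: "j < 0"
  have "reduce res (r h) $$ j = 0" using r_reduce(2)[OF h] j by simp
  then have "res (r h j i) = 0" using kcoeff_reduce[OF r_R_int[OF h], of j i] by (simp add: fls_nth_eq_0_iff)
  then show ?thesis using res_eq_0_iff[OF R_int_le_1[OF r_R_int[OF h]]] absval_less_1 by blast
qed

lemma r_le_1: "h \<in> H \<Longrightarrow> absval (r h j i) \<le> 1"
  using R_int_le_1[OF r_R_int] .

lemma r_null: "h \<in> H \<Longrightarrow> 0 < \<eta> \<Longrightarrow> \<eta> < 1 \<Longrightarrow> r h \<in> null_series \<eta>"
  by (rule null_series_principal[of _ 1]) (use r_principal r_R_int in \<open>auto simp: R_int_carrier\<close>)

definition lead :: "nat \<Rightarrow> 'n \<Rightarrow>\<^sub>0 nat" where "lead h = snd (leading_exponent (reduce res (r h)))"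

lemma lead:
  assumes "h \<in> H"
  shows "absval (r h 0 (lead h)) = 1" "absval (r h 0 i) = 1 \<Longrightarrow> i \<le> lead h"
proof -
  note nz = r_reduce(1)[OF assms] and c = kcoeff_reduce[OF r_R_int[OF assms]]
  have e: "leading_exponent (reduce res (r h)) = (0, lead h)"
    using leading_exponent_props(1)[OF nz] r_reduce(2)[OF assms] by (simp add: lead_def prod_eq_iff)
  have "kcoeff (reduce res (r h)) (0, lead h) \<noteq> 0" using leading_exponent_props(2)[OF nz] e by simp
  then have "\<not> absval (r h 0 (lead h)) < 1" using res_eq_0_iff[OF r_le_1[OF assms]] c by auto
  then show "absval (r h 0 (lead h)) = 1" using r_le_1[OF assms] by (meson leD le_imp_less_or_eq less_eq_real_def)
  assume "absval (r h 0 i) = 1"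
  then have "kcoeff (reduce res (r h)) (0, i) \<noteq> 0" using res_eq_0_iff[OF r_le_1[OF assms]] c by auto
  then show "i \<le> lead h" using leading_exponent_props(3)[OF nz, of i] r_reduce(2)[OF assms] by (simp add: lead_def)
qed

lemma L_iff: "i \<in> L \<longleftrightarrow> (\<exists>h\<in>H. \<exists>b. i = lead h + b)"
  unfolding L_def leading_ideal_def lead_def by blast

lemma cring_R_int_ideal: "ring (R_int :: ('n, 'k) series ring)"
  using ideal by (rule ideal.axioms(2))

lemma R_int_closed:
  assumes "f \<in> carrier R_int" "g \<in> carrier (R_int :: ('n, 'k) series ring)"
  shows "f + g \<in> carrier R_int" "f \<star> g \<in> carrier R_int" "- f \<in> carrier R_int" "f - g \<in> carrier R_int"
proof -
  interpret R: ring "R_int :: ('n, 'k) series ring" by (rule cring_R_int_ideal)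
  have *: "f + g \<in> carrier R_int" "f \<star> g \<in> carrier R_int"
    if "f \<in> carrier R_int" "g \<in> carrier R_int" for f g :: "('n, 'k) series"
    using R.add.m_closed[OF that] R.m_closed[OF that] by simp_all
  have m: "- f \<in> carrier R_int" if "f \<in> carrier R_int" for f :: "('n, 'k) series"
    using *(2)[OF R_int_monom[of "-1" 0 "0::'n \<Rightarrow>\<^sub>0 nat"] that] by (simp add: series_const_mult scale_minus_left)
  show "f + g \<in> carrier R_int" "f \<star> g \<in> carrier R_int" by (rule *[OF assms])+
  show "- f \<in> carrier R_int" by (rule m[OF assms(1)])
  show "f - g \<in> carrier R_int" using *(1)[OF assms(1) m[OF assms(2)]] by simp
qed

lemma I_kappa_ideal: "ideal (I_kappa res I) R_kappa"
proof (rule ideal_from_add_closed[OF cring_R_kappa])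
  note cl = add_closedD[OF I_add_closed[OF ideal]] and car = I_carrier[OF ideal]
  show "add_closed (I_kappa res I)"
    unfolding add_closed_def I_kappa_def
  proof (intro conjI ballI)
    have "reduce res (0 :: ('n, 'k) series) = 0"
      by (rule kcoeff_eqI) (simp add: kcoeff_reduce car[OF cl(1)])
    then show "0 \<in> reduce res ` I" using cl(1) by (metis image_eqI)
  next
    fix x y assume "x \<in> reduce res ` I" "y \<in> reduce res ` I"
    then obtain f g where fg: "f \<in> I" "g \<in> I" "x = reduce res f" "y = reduce res g" by blast
    then have "x + y = reduce res (f + g)" using reduce_add[of f g] car cl(2) by simp
    then show "x + y \<in> reduce res ` I" using cl(2)[OF fg(1,2)] by blast
  next
    fix x assume "x \<in> reduce res ` I"
    then obtain f where f: "f \<in> I" "x = reduce res f" by blast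
    then have "- x = reduce res (- f)" using reduce_uminus[of f] car cl(3) by simp
    then show "- x \<in> reduce res ` I" using cl(3)[OF f(1)] by blast
  qed
  fix a x assume "a \<in> I_kappa res I"
  then obtain f where f: "f \<in> I" "a = reduce res f" by (auto simp: I_kappa_def)
  let ?x = "lift_kseries x :: ('n, 'k) series"
  have "?x \<star> f \<in> I" by (rule I_mult[OF ideal f(1) lift_kseries_props(4)])
  moreover have "reduce res (?x \<star> f) = x * a"
    using reduce_mult[OF lift_kseries_props(4) car[OF f(1)] car[OF calculation]] f(2) by (simp add: lift_kseries_props)
  ultimately show "x \<otimes>\<^bsub>R_kappa\<^esub> a \<in> I_kappa res I" by (simp add: I_kappa_def) (metis image_eqI)
qed auto

lemma I_kappa_leading: "x \<in> I_kappa res I \<Longrightarrow> x \<noteq> 0 \<Longrightarrow> snd (leading_exponent x) \<in> L"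
  unfolding L_def by (rule Groebner_leading[OF Groebner])

text \<open>The largest power of \<open>uK\<close> dividing \<open>g\<close> is removed; there is
  one because the powers of \<open>absval uK\<close> fall below any nonzero coefficient. What
  remains has a nonzero reduction.\<close>

lemma R_int_unit_part:
  fixes g :: "('n, 'k) series"
  assumes g: "g \<in> carrier R_int" "g \<noteq> 0"
  shows "\<exists>k g'. g = scale (uK ^ k) g' \<and> g' \<in> carrier R_int \<and> \<not> gauss_bound 1 g' (absval uK)"
proof -
  obtain j i where ji: "g j i \<noteq> 0" using g(2) by (metis ext zero_fun_apply)
  have "\<exists>n. \<not> gauss_bound 1 g (absval uK ^ n)"
  proof -
    have "(\<lambda>n. absval uK ^ n) \<longlonglongrightarrow> 0" using uK by (intro LIMSEQ_realpow_zero) auto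
    then have "eventually (\<lambda>n. absval uK ^ n < absval (g j i)) sequentially"
      by (rule order_tendstoD(2)) (use ji in simp)
    then obtain n where "absval uK ^ n < absval (g j i)" by (auto simp: eventually_sequentially)
    then have "\<not> gauss_bound 1 g (absval uK ^ n)" by (auto simp: gauss_bound_1 not_le)
    then show ?thesis by blast
  qed
  define n where "n = (LEAST n. \<not> gauss_bound 1 g (absval uK ^ n))"
  have n: "\<not> gauss_bound 1 g (absval uK ^ n)" unfolding n_def using \<open>\<exists>n. _ n\<close> by (rule LeastI_ex)
  have "n \<noteq> 0" using n g(1) by (auto simp: R_int_carrier intro: gr0I)
  then obtain k where k: "n = Suc k" by (cases n) auto
  have "gauss_bound 1 g (absval uK ^ k)"
    using not_less_Least[of k "\<lambda>n. \<not> gauss_bound 1 g (absval uK ^ n)"] k by (simp add: n_def)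
  define g' where "g' = scale (inverse (uK ^ k)) g"
  have eq: "g = scale (uK ^ k) g'" using uK by (simp add: g'_def)
  have b1: "gauss_bound 1 g' 1"
    using \<open>gauss_bound 1 g (absval uK ^ k)\<close> uK unfolding g'_def
    by (subst gauss_bound_scale_iff) (auto simp: absval_inverse absval_power divide_inverse)
  have "\<not> gauss_bound 1 g' (absval uK)"
    using n gauss_bound_scale[of 1 g' "absval uK" "uK ^ k"] by (auto simp: k eq[symmetric] absval_power mult.commute)
  moreover have "g' \<in> carrier R_int"
    unfolding R_int_carrier
  proof (intro conjI allI impI b1)
    show "tate (g' j)" for j
      unfolding g'_def scale_def using g(1) by (intro tate_scale) (simp add: R_int_carrier)
    fix e :: real assume "e > 0"
    then have "e * absval (uK ^ k) > 0" using uK by simp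
    then obtain N where N: "\<forall>j<N. \<forall>i. absval (g j i) \<le> e * absval (uK ^ k)"
      using g(1) unfolding R_int_carrier by blast
    have "absval (g' j i) \<le> e" if "j < N" for j i
    proof -
      have "absval (g j i) \<le> e * absval (uK ^ k)" using N that by blast
      moreover have "absval (g' j i) = absval (g j i) / absval (uK ^ k)"
        by (simp add: g'_def scale_def valuation_mult absval_inverse divide_inverse mult.commute)
      moreover have "absval (uK ^ k) > 0" using uK by simp
      ultimately show ?thesis by (simp add: divide_le_eq)
    qed
    then show "\<exists>N. \<forall>j<N. \<forall>i. absval (g' j i) \<le> e" by blast
  qed
  ultimately show ?thesis using eq by blast
qed

lemma saturated_power: "scale (uK ^ k) f \<in> I \<Longrightarrow> f \<in> carrier R_int \<Longrightarrow> f \<in> I"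
proof (induction k)
  case (Suc k)
  have "absval (uK ^ k) \<le> 1" using uK by (simp add: absval_power power_le_one)
  then have "scale (uK ^ k) f \<in> carrier R_int"
    using R_int_closed(2)[OF R_int_monom[of "uK ^ k" 0 "0::'n \<Rightarrow>\<^sub>0 nat"] Suc.prems(2)] by (simp add: series_const_mult)
  moreover have "scale uK (scale (uK ^ k) f) \<in> I" using Suc.prems(1) by simp
  ultimately have "scale (uK ^ k) f \<in> I" by (rule saturated)
  then show ?case by (rule Suc.IH) (rule Suc.prems)
qed simp

text \<open>A nonzero element of \<open>I_kappa\<close> has its leading exponent in
  \<open>L\<close>, while the exponents of a normal series avoid \<open>L\<close>.\<close>

lemma normal_unit_not_in_I_kappa:
  assumes "g \<in> carrier R_int" "normal g" "reduce res g \<in> I_kappa res I"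
  shows "reduce res g = 0"
proof (rule ccontr)
  assume nz: "reduce res g \<noteq> 0"
  obtain j i where e: "leading_exponent (reduce res g) = (j, i)" by (cases "leading_exponent (reduce res g)")
  have "kcoeff (reduce res g) (j, i) \<noteq> 0" using leading_exponent_props(2)[OF nz] e by simp
  then have "g j i \<noteq> 0" using kcoeff_reduce[OF assms(1)] res_0 by metis
  moreover have "i \<in> L" using I_kappa_leading[OF assms(3) nz] e by simp
  ultimately show False using assms(2) by (auto simp: normal_def)
qed

text \<open>Division by powers of \<open>uK\<close> stays in the ideal by \<open>saturated\<close>.
  After it, a nonzero series would have a nonzero reduction that lies in \<open>I_kappa\<close> and
  has only exponents outside \<open>L\<close>.\<close>

theorem normal_in_ideal_eq_0:
  assumes "normal f" "f \<in> extend_scalars I"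
  shows "f = 0"
proof (rule ccontr)
  assume "f \<noteq> 0"
  obtain a g where g: "f = scale a g" "g \<in> I" using assms(2) by (auto simp: extend_scalars_def)
  have a: "a \<noteq> 0" using \<open>f \<noteq> 0\<close> g(1) scale_0 by metis
  have "g \<noteq> 0" using \<open>f \<noteq> 0\<close> g(1) scale_zero_right by metis
  from R_int_unit_part[OF I_carrier[OF ideal g(2)] this] obtain k g' where
    g': "g = scale (uK ^ k) g'" "g' \<in> carrier R_int" "\<not> gauss_bound 1 g' (absval uK)" by blast
  have "g' \<in> I" using saturated_power[of k g'] g' g(2) by simp
  moreover have "normal g'"
    unfolding normal_def
  proof (intro allI impI)
    fix j i assume "g' j i \<noteq> 0"
    then have "f j i \<noteq> 0" using a uK by (simp add: g g' scale_def)
    then show "i \<notin> L" using assms(1) by (auto simp: normal_def)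
  qed
  ultimately have "reduce res g' = 0"
    using normal_unit_not_in_I_kappa[OF g'(2)] by (auto simp: I_kappa_def)
  then show False using reduce_eq_0_iff[OF g'(2)] g'(3) by blast
qed

text \<open>Division with remainder up to an error in the maximal ideal. Quotients and remainder
  have finite support, although the divisors \<open>r h 0\<close> may be infinite series.\<close>

definition pdiv :: "(('n \<Rightarrow>\<^sub>0 nat) \<Rightarrow> 'k) \<Rightarrow> bool" where
  "pdiv p \<longleftrightarrow> (\<exists>q n. (\<forall>h. finite {i. q h i \<noteq> 0}) \<and> finite {i. n i \<noteq> 0} \<and> (\<forall>i. n i \<noteq> 0 \<longrightarrow> i \<notin> L) \<and>
     (\<forall>h i. absval (q h i) \<le> 1) \<and> (\<forall>i. absval (n i) \<le> 1) \<and>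
     (\<forall>i. absval (p i - (\<Sum>h\<in>H. pconv (q h) (r h 0) i) - n i) < 1))"

lemma pdiv_add:
  assumes "pdiv p" "pdiv p'"
  shows "pdiv (\<lambda>i. p i + p' i)"
proof -
  obtain q n where q: "\<forall>h. finite {i. q h i \<noteq> 0}" "finite {i. n i \<noteq> 0}" "\<forall>i. n i \<noteq> 0 \<longrightarrow> i \<notin> L"
     "\<forall>h i. absval (q h i) \<le> 1" "\<forall>i. absval (n i) \<le> 1"
     "\<forall>i. absval (p i - (\<Sum>h\<in>H. pconv (q h) (r h 0) i) - n i) < 1"
    using assms(1) unfolding pdiv_def by blast
  obtain q' n' where q': "\<forall>h. finite {i. q' h i \<noteq> 0}" "finite {i. n' i \<noteq> 0}" "\<forall>i. n' i \<noteq> 0 \<longrightarrow> i \<notin> L"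
     "\<forall>h i. absval (q' h i) \<le> 1" "\<forall>i. absval (n' i) \<le> 1"
     "\<forall>i. absval (p' i - (\<Sum>h\<in>H. pconv (q' h) (r h 0) i) - n' i) < 1"
    using assms(2) unfolding pdiv_def by blast
  show ?thesis unfolding pdiv_def
  proof (intro exI conjI allI impI)
    show "finite {i. q h i + q' h i \<noteq> 0}" for h
      by (rule finite_subset[of _ "{i. q h i \<noteq> 0} \<union> {i. q' h i \<noteq> 0}"]) (use q q' in auto)
    show "finite {i. n i + n' i \<noteq> 0}"
      by (rule finite_subset[of _ "{i. n i \<noteq> 0} \<union> {i. n' i \<noteq> 0}"]) (use q q' in auto)
    show "i \<notin> L" if "n i + n' i \<noteq> 0" for i
    proof -
      have "n i \<noteq> 0 \<or> n' i \<noteq> 0" using that by auto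
      then show ?thesis using q(3) q'(3) by blast
    qed
    show "absval (q h i + q' h i) \<le> 1" for h i using q(4) q'(4) by (intro absval_add_le) auto
    show "absval (n i + n' i) \<le> 1" for i using q(5) q'(5) by (intro absval_add_le) auto
    fix i
    have "p i + p' i - (\<Sum>h\<in>H. pconv (\<lambda>i. q h i + q' h i) (r h 0) i) - (n i + n' i) =
      (p i - (\<Sum>h\<in>H. pconv (q h) (r h 0) i) - n i) + (p' i - (\<Sum>h\<in>H. pconv (q' h) (r h 0) i) - n' i)"
      by (simp add: pconv_add sum.distrib algebra_simps)
    also have "absval \<dots> < 1" using q(6) q'(6) by (intro absval_add_less) auto
    finally show "absval (p i + p' i - (\<Sum>h\<in>H. pconv (\<lambda>i. q h i + q' h i) (r h 0) i) - (n i + n' i)) < 1" .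
  qed
qed

lemma pdiv_scale:
  assumes "pdiv p" "absval c \<le> 1"
  shows "pdiv (\<lambda>i. c * p i)"
proof -
  obtain q n where q: "\<forall>h. finite {i. q h i \<noteq> 0}" "finite {i. n i \<noteq> 0}" "\<forall>i. n i \<noteq> 0 \<longrightarrow> i \<notin> L"
     "\<forall>h i. absval (q h i) \<le> 1" "\<forall>i. absval (n i) \<le> 1"
     "\<forall>i. absval (p i - (\<Sum>h\<in>H. pconv (q h) (r h 0) i) - n i) < 1"
    using assms(1) unfolding pdiv_def by blast
  show ?thesis unfolding pdiv_def
  proof (intro exI conjI allI impI)
    show "finite {i. c * q h i \<noteq> 0}" for h
      by (rule finite_subset[of _ "{i. q h i \<noteq> 0}"]) (use q in auto)
    show "finite {i. c * n i \<noteq> 0}"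
      by (rule finite_subset[of _ "{i. n i \<noteq> 0}"]) (use q in auto)
    show "i \<notin> L" if "c * n i \<noteq> 0" for i using that q(3) by auto
    show "absval (c * q h i) \<le> 1" for h i using q(4) assms(2) by (simp add: valuation_mult mult_le_one)
    show "absval (c * n i) \<le> 1" for i using q(5) assms(2) by (simp add: valuation_mult mult_le_one)
    fix i
    let ?e = "p i - (\<Sum>h\<in>H. pconv (q h) (r h 0) i) - n i"
    have "c * p i - (\<Sum>h\<in>H. pconv (\<lambda>i. c * q h i) (r h 0) i) - c * n i = c * ?e"
      by (simp add: pconv_scale sum_distrib_left algebra_simps)
    moreover have "absval c * absval ?e \<le> 1 * absval ?e" by (rule mult_right_mono[OF assms(2)]) simp
    ultimately show "absval (c * p i - (\<Sum>h\<in>H. pconv (\<lambda>i. c * q h i) (r h 0) i) - c * n i) < 1"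
      using q(6)[rule_format, of i] by (simp add: valuation_mult)
  qed
qed

lemma pdiv_small: "(\<And>i. absval (p i) < 1) \<Longrightarrow> pdiv p"
  unfolding pdiv_def by (intro exI[of _ "\<lambda>h i. 0"] exI[of _ "\<lambda>i. 0"]) (simp add: pconv_0)

lemma pdiv_sum:
  assumes "\<And>x. x \<in> S \<Longrightarrow> pdiv (p x)"
  shows "pdiv (\<lambda>i. \<Sum>x\<in>S. p x i)"
  using assms
proof (induction S rule: infinite_finite_induct)
  case (insert x S)
  have "pdiv (\<lambda>i. p x i + (\<Sum>x\<in>S. p x i))" using insert by (intro pdiv_add) auto
  then show ?case using insert.hyps by simp
qed (auto intro: pdiv_small)

text \<open>Only the finitely many coefficients of absolute value 1 have to be divided; the rest
  counts as error.\<close>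

lemma pdiv_decompose:
  assumes "tate p" "\<And>i. absval (p i) \<le> 1" "\<And>i. absval (p i) = 1 \<Longrightarrow> pdiv (\<lambda>i'. if i' = i then 1 else 0)"
  shows "pdiv p"
proof -
  let ?S = "{i. 1 \<le> absval (p i)}"
  have fin: "finite ?S" using assms(1) by (rule tateD) simp
  have S: "absval (p i) = 1" if "i \<in> ?S" for i using that assms(2)[of i] by simp
  have "pdiv (\<lambda>i'. \<Sum>i\<in>?S. p i * (if i' = i then 1 else 0))"
    by (intro pdiv_sum pdiv_scale assms(2,3)) (rule S)
  moreover have "pdiv (\<lambda>i'. if i' \<in> ?S then 0 else p i')" by (rule pdiv_small) auto
  ultimately have "pdiv (\<lambda>i'. (\<Sum>i\<in>?S. p i * (if i' = i then 1 else 0)) + (if i' \<in> ?S then 0 else p i'))"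
    by (rule pdiv_add)
  moreover have "(\<Sum>i\<in>?S. p i * (if i' = i then 1 else 0)) + (if i' \<in> ?S then 0 else p i') = p i'" for i'
    using fin by (simp add: if_distrib[of "\<lambda>x. _ * x"] sum.delta cong: if_cong)
  ultimately show ?thesis by simp
qed

text \<open>Well-founded induction on the exponent: for \<open>i\<close> in \<open>L\<close>, a
  shifted and normalized \<open>r h 0\<close> has coefficient 1 at \<open>i\<close>, and its other
  coefficients of absolute value 1 sit at smaller exponents, by the choice of
  \<open>lead h\<close>.\<close>

lemma pdiv_monom: "pdiv (\<lambda>i'. if i' = i then 1 else 0)"
proof (induction i rule: wf_induct_rule[OF wf_exponents])
  case (1 i)
  show ?case
  proof (cases "i \<in> L")
    case False
    show ?thesis unfolding pdiv_def
      by (intro exI[of _ "\<lambda>h i. 0"] exI[of _ "\<lambda>i'. if i' = i then 1 else 0"]) (use False in \<open>auto simp: pconv_0\<close>)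
  next
    case True
    then obtain h b where h: "h \<in> H" "i = lead h + b" by (auto simp: L_iff)
    define a where "a = inverse (r h 0 (lead h))"
    have a: "absval a = 1" "a * r h 0 (lead h) = 1"
      using lead(1)[OF h(1)] by (auto simp: a_def absval_inverse intro!: left_inverse)
    define s where "s = pconv (\<lambda>i. if i = b then a else 0) (r h 0)"
    have s: "s i' = (if b + (i' - b) = i' then a * r h 0 (i' - b) else 0)" for i'
      unfolding s_def by (rule pconv_monom)
    have s1: "absval (s i') \<le> 1" for i' using r_le_1[OF h(1)] a by (simp add: s valuation_mult)
    have si: "s i = 1" using a(2) by (simp add: s h(2) add.commute)
    have slt: "i' < i" if "absval (s i') = 1" "i' \<noteq> i" for i'
    proof -
      have i': "b + (i' - b) = i'" "absval (r h 0 (i' - b)) = 1" using that(1) a(1)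
        by (auto simp: s valuation_mult split: if_splits)
      then have "i' - b \<le> lead h" using lead(2)[OF h(1)] by blast
      moreover have "i' - b \<noteq> lead h" using i'(1) that(2) h(2) by (metis add.commute)
      ultimately have "b + (i' - b) < b + lead h" by (intro add_strict_left_mono) simp
      then show ?thesis using i'(1) h(2) by (simp add: add.commute)
    qed
    have ts: "tate s"
      unfolding tate_def
    proof (intro allI impI)
      fix e :: real assume "e > 0"
      have "{i'. e \<le> absval (s i')} \<subseteq> (\<lambda>x. b + x) ` {x. e \<le> absval (r h 0 x)}"
      proof
        fix i' assume "i' \<in> {i'. e \<le> absval (s i')}"
        then have "b + (i' - b) = i'" "e \<le> absval (r h 0 (i' - b))"
          using \<open>e > 0\<close> a(1) by (auto simp: s valuation_mult split: if_splits)
        then show "i' \<in> (\<lambda>x. b + x) ` {x. e \<le> absval (r h 0 x)}" by (intro image_eqI[of _ _ "i' - b"]) auto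
      qed
      moreover have "finite {x. e \<le> absval (r h 0 x)}"
        using r_R_int[OF h(1)] \<open>e > 0\<close> by (intro tateD) (auto simp: R_int_carrier)
      ultimately show "finite {i'. e \<le> absval (s i')}" by (meson finite_imageI finite_subset)
    qed
    have "pdiv s" unfolding pdiv_def
    proof (intro exI conjI allI impI)
      fix h' i'
      show "finite {i'. (if h' = h \<and> i' = b then a else 0) \<noteq> 0}" by (rule finite_subset[of _ "{b}"]) auto
      show "absval (if h' = h \<and> i' = b then a else 0) \<le> 1" using a by simp
      have "(\<Sum>h'\<in>H. pconv (\<lambda>i'. if h' = h \<and> i' = b then a else 0) (r h' 0) i') = (\<Sum>h'\<in>H. if h' = h then s i' else 0)"
        by (rule sum.cong[OF refl]) (simp add: s_def pconv_0)
      also have "\<dots> = s i'" using h(1) by simp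
      finally show "absval (s i' - (\<Sum>h'\<in>H. pconv (\<lambda>i'. if h' = h \<and> i' = b then a else 0) (r h' 0) i') - 0) < 1"
        by simp
    qed auto
    moreover have "pdiv (\<lambda>i'. (-1) * (if i' = i then 0 else s i'))"
    proof (rule pdiv_scale[OF pdiv_decompose])
      show "tate (\<lambda>i'. if i' = i then 0 else s i')"
        unfolding tate_def
      proof (intro allI impI)
        fix e :: real assume "e > 0"
        show "finite {i'. e \<le> absval (if i' = i then 0 else s i')}"
          by (rule finite_subset[OF _ tateD[OF ts \<open>e > 0\<close>]]) (use \<open>e > 0\<close> in \<open>auto split: if_splits\<close>)
      qed
      show "absval (if i' = i then 0 else s i') \<le> 1" for i' using s1 by simp
      fix i' assume "absval (if i' = i then 0 else s i') = 1"
      then have "i' < i" using slt by (auto split: if_splits)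
      then show "pdiv (\<lambda>x. if x = i' then 1 else 0)" using 1 by simp
    qed simp
    ultimately have "pdiv (\<lambda>i'. s i' + (-1) * (if i' = i then 0 else s i'))" by (rule pdiv_add)
    moreover have "s i' + (-1) * (if i' = i then 0 else s i') = (if i' = i then 1 else 0)" for i'
      using si by simp
    ultimately show ?thesis by simp
  qed
qed

lemma pdiv_all: "tate p \<Longrightarrow> (\<And>i. absval (p i) \<le> 1) \<Longrightarrow> pdiv p"
  by (rule pdiv_decompose) (auto intro: pdiv_monom)

text \<open>Scaling by a coefficient of maximal size reduces to the integral case. The quantifier
  over \<open>B\<close> stands for the maximum norm; it lets a single choice of \<open>q\<close> and
  \<open>n\<close> be estimated at all radii.\<close>

lemma tate_division:
  assumes "tate p"
  shows "\<exists>q n. (\<forall>h. finite {i. q h i \<noteq> 0}) \<and> finite {i. n i \<noteq> 0} \<and> (\<forall>i. n i \<noteq> 0 \<longrightarrow> i \<notin> L) \<and>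
     (\<forall>B. (\<forall>i. absval (p i) \<le> B) \<longrightarrow> (\<forall>h i. absval (q h i) \<le> B) \<and> (\<forall>i. absval (n i) \<le> B) \<and>
       (\<forall>i. absval (p i - (\<Sum>h\<in>H. pconv (q h) (r h 0) i) - n i) \<le> absval uK * B))"
proof (cases "\<exists>i. p i \<noteq> 0")
  case False
  have "B \<ge> 0" if "\<forall>i. absval (p i) \<le> B" for B using that absval_nonneg order_trans by blast
  then show ?thesis using False
    by (intro exI[of _ "\<lambda>h i. 0"] exI[of _ "\<lambda>i. 0"]) (auto simp: pconv_0)
next
  case True
  then obtain i0 where i0: "p i0 \<noteq> 0" "\<forall>i. absval (p i) \<le> absval (p i0)" using tate_max[OF assms] by blast
  define c where "c = p i0"
  have c: "c \<noteq> 0" "absval c > 0" using i0 by (auto simp: c_def)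
  have "pdiv (\<lambda>i. inverse c * p i)"
  proof (rule pdiv_all[OF tate_scale[OF assms]])
    fix i
    have "absval (p i) \<le> absval c" using i0(2) by (simp add: c_def)
    then show "absval (inverse c * p i) \<le> 1"
      using mult_left_mono[of "absval (p i)" "absval c" "inverse (absval c)"] c
      by (simp add: valuation_mult absval_inverse)
  qed
  then obtain q n where q: "\<forall>h. finite {i. q h i \<noteq> 0}" "finite {i. n i \<noteq> 0}" "\<forall>i. n i \<noteq> 0 \<longrightarrow> i \<notin> L"
     "\<forall>h i. absval (q h i) \<le> 1" "\<forall>i. absval (n i) \<le> 1"
     "\<forall>i. absval (inverse c * p i - (\<Sum>h\<in>H. pconv (q h) (r h 0) i) - n i) < 1"
    unfolding pdiv_def by blast
  show ?thesis
  proof (intro exI[of _ "\<lambda>h i. c * q h i"] exI[of _ "\<lambda>i. c * n i"] conjI allI impI)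
    show "finite {i. c * q h i \<noteq> 0}" for h using q(1) c by simp
    show "finite {i. c * n i \<noteq> 0}" using q(2) c by simp
    show "i \<notin> L" if "c * n i \<noteq> 0" for i using that q(3) by auto
    fix B assume B: "\<forall>i. absval (p i) \<le> B"
    then have cB: "absval c \<le> B" by (simp add: c_def)
    have le: "absval (c * x) \<le> B" if "absval x \<le> 1" for x
      using mult_left_mono[OF that, of "absval c"] cB by (simp add: valuation_mult)
    show "absval (c * q h i) \<le> B" for h i using le q(4) by blast
    show "absval (c * n i) \<le> B" for i using le q(5) by blast
    fix i
    let ?e = "inverse c * p i - (\<Sum>h\<in>H. pconv (q h) (r h 0) i) - n i"
    have "p i - (\<Sum>h\<in>H. pconv (\<lambda>i. c * q h i) (r h 0) i) - c * n i = c * ?e"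
      using c by (simp add: pconv_scale sum_distrib_left right_diff_distrib)
    moreover have "absval (c * ?e) \<le> absval uK * B"
      unfolding valuation_mult mult.commute[of "absval c"]
      by (rule mult_mono[OF absval_less_1 cB]) (use q(6) in auto)
    ultimately show "absval (p i - (\<Sum>h\<in>H. pconv (\<lambda>i. c * q h i) (r h 0) i) - c * n i) \<le> absval uK * B" by simp
  qed
qed

end

section \<open>One division step for Laurent series and its iteration\<close>

lemma conv_term_diagonal: "conv_term f g j i j = pconv (f j) (g 0) i"
  by (simp add: conv_term_def pconv_def)

lemma gauss_bound_levelD:
  assumes "gauss_bound \<eta> f B" "\<eta> > 0"
  shows "absval (f j i) \<le> B * \<eta> powi (- j)"
  using gauss_boundD[OF assms(1), of j i] assms(2) by (simp add: power_int_minus field_simps)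

text \<open>The hypothesis \<open>le\<close> compares the maximum norms of the coefficients of each
  power of \<open>S\<close>, in the form in which \<open>tate_division\<close> supplies such
  estimates.\<close>

lemma null_series_dominated:
  assumes f: "f \<in> null_series \<eta>" and \<eta>: "\<eta> > 0" and g: "\<And>j. tate (g j)"
    and le: "\<And>j B. (\<forall>i. absval (f j i) \<le> B) \<Longrightarrow> (\<forall>i. absval (g j i) \<le> B)"
  shows "g \<in> null_series \<eta>"
proof (rule null_seriesI[OF g \<eta>])
  fix e :: real assume "e > 0"
  then have e2: "e / 2 > 0" by simp
  from null_series_range[OF f this] obtain N M where
    NM: "\<forall>j i. j < N \<or> j > M \<longrightarrow> absval (f j i) * \<eta> powi j < e / 2" by blast
  have "absval (g j i) * \<eta> powi j < e" if j: "j < N \<or> j > M" for j i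
  proof -
    have pos: "\<eta> powi j > 0" using \<eta> by simp
    have "\<forall>i. absval (f j i) \<le> e / 2 / \<eta> powi j"
    proof
      fix i
      have "absval (f j i) * \<eta> powi j < e / 2" using NM j by blast
      then show "absval (f j i) \<le> e / 2 / \<eta> powi j" using pos by (simp only: pos_le_divide_eq less_imp_le)
    qed
    then have "absval (g j i) \<le> e / 2 / \<eta> powi j" using le by blast
    then have "absval (g j i) * \<eta> powi j \<le> e / 2" using pos by (simp only: pos_le_divide_eq)
    then show ?thesis using \<open>e > 0\<close> by linarith
  qed
  then show "\<exists>N M. \<forall>j i. j < N \<or> j > M \<longrightarrow> absval (g j i) * \<eta> powi j < e" by blast
qed

lemma gauss_bound_dominated:
  assumes f: "gauss_bound \<eta> f B" and \<eta>: "\<eta> > 0"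
    and le: "\<And>j B. (\<forall>i. absval (f j i) \<le> B) \<Longrightarrow> (\<forall>i. absval (g j i) \<le> B)"
  shows "gauss_bound \<eta> g B"
  unfolding gauss_bound_def
proof (intro allI)
  fix j i
  have pos: "\<eta> powi j > 0" using \<eta> by simp
  have "\<forall>i. absval (f j i) \<le> B / \<eta> powi j"
    using gauss_boundD[OF f, of j] pos by (simp only: pos_le_divide_eq) simp
  then have "absval (g j i) \<le> B / \<eta> powi j" using le by blast
  then show "absval (g j i) * \<eta> powi j \<le> B" using pos by (simp only: pos_le_divide_eq)
qed

text \<open>The limit is built coefficientwise from convergence at one radius \<alpha>. Estimates at
  any other radius then pass to it, including the case \<open>\<rho>' = 1\<close>, where the
  increments are merely bounded.\<close>

lemma series_limit:
  fixes x :: "nat \<Rightarrow> ('n, 'k::complete_discretely_valued_field) series"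
  assumes \<alpha>: "\<alpha> > 0" and \<rho>: "0 \<le> \<rho>" "\<rho> < 1" and step: "\<And>n. gauss_bound \<alpha> (x (Suc n) - x n) (M * \<rho> ^ n)"
  shows "\<exists>l. (\<forall>j i. (\<lambda>n. x n j i) \<longlonglongrightarrow> l j i) \<and>
    (\<forall>\<eta> B. (\<forall>n. gauss_bound \<eta> (x n) B) \<longrightarrow> gauss_bound \<eta> l B) \<and>
    (\<forall>\<eta> M' \<rho>'. \<eta> > 0 \<longrightarrow> 0 \<le> \<rho>' \<longrightarrow> \<rho>' \<le> 1 \<longrightarrow> (\<forall>n. gauss_bound \<eta> (x (Suc n) - x n) (M' * \<rho>' ^ n)) \<longrightarrow>
       (\<forall>n. gauss_bound \<eta> (l - x n) (M' * \<rho>' ^ n)))"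
proof -
  have "convergent (\<lambda>n. x n j i)" for j i
  proof (rule nonarch_lim[OF _ \<rho>])
    fix n
    have "absval ((x (Suc n) - x n) j i) \<le> M * \<rho> ^ n * \<alpha> powi (- j)"
      by (rule gauss_bound_levelD[OF step \<alpha>])
    then show "absval (x (Suc n) j i - x n j i) \<le> (M * \<alpha> powi (- j)) * \<rho> ^ n" by (simp add: mult_ac)
  qed
  then have "\<forall>j i. \<exists>l. (\<lambda>n. x n j i) \<longlonglongrightarrow> l" by (simp add: convergent_def)
  then obtain l where l: "\<forall>j i. (\<lambda>n. x n j i) \<longlonglongrightarrow> l j i" by metis
  have bnd: "gauss_bound \<eta> (l - y) B" if "\<forall>n\<ge>N. gauss_bound \<eta> (x n - y) B" "\<eta> > 0" for \<eta> y B N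
    unfolding gauss_bound_def
  proof (intro allI)
    fix j i
    have pos: "\<eta> powi j > 0" using that(2) by simp
    have "absval (l j i - y j i) \<le> B / \<eta> powi j"
    proof (rule absval_lim_le[OF l[rule_format]])
      fix n assume "n \<ge> N"
      then have "gauss_bound \<eta> (x n - y) B" using that(1) by blast
      from gauss_boundD[OF this, of j i] show "absval (x n j i - y j i) \<le> B / \<eta> powi j"
        using pos by (simp add: pos_le_divide_eq)
    qed
    then show "absval ((l - y) j i) * \<eta> powi j \<le> B" using pos by (simp add: pos_le_divide_eq)
  qed
  have 1: "gauss_bound \<eta> l B" if "\<forall>n. gauss_bound \<eta> (x n) B" for \<eta> B
    unfolding gauss_bound_def
  proof (intro allI)
    fix j i
    have "(\<lambda>n. absval (x n j i) * \<eta> powi j) \<longlonglongrightarrow> absval (l j i) * \<eta> powi j"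
      using tendsto_mult[OF tendsto_dist[OF l[rule_format, of j i] tendsto_const[of 0]] tendsto_const[of "\<eta> powi j"]]
      by (simp add: dist_absval)
    then show "absval (l j i) * \<eta> powi j \<le> B"
      by (rule LIMSEQ_le_const2) (use that gauss_boundD in blast)
  qed
  have 2: "gauss_bound \<eta> (l - x n) (M' * \<rho>' ^ n)"
    if st: "\<forall>n. gauss_bound \<eta> (x (Suc n) - x n) (M' * \<rho>' ^ n)" and p: "\<eta> > 0" "0 \<le> \<rho>'" "\<rho>' \<le> 1" for \<eta> M' \<rho>' n
  proof (rule bnd[OF _ p(1), of n])
    have M': "M' \<ge> 0" using gauss_bound_nonneg[OF st[rule_format, of 0] p(1)] by simp
    have "gauss_bound \<eta> (x (n + k) - x n) (M' * \<rho>' ^ n)" for k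
    proof (induction k)
      case (Suc k)
      have "M' * \<rho>' ^ (n + k) \<le> M' * \<rho>' ^ n"
        by (intro mult_left_mono power_decreasing) (use p M' in auto)
      then have "gauss_bound \<eta> (x (Suc (n + k)) - x (n + k)) (M' * \<rho>' ^ n)"
        using st gauss_bound_mono by blast
      from gauss_bound_add[OF this Suc p(1)]
      have "gauss_bound \<eta> (x (n + Suc k) - x n) (M' * \<rho>' ^ n)"
      proof -
        have "x (n + Suc k) - x n = (x (Suc (n + k)) - x (n + k)) + (x (n + k) - x n)" by (simp add: fun_eq_iff)
        then show ?thesis using \<open>gauss_bound \<eta> (_ + _) _\<close> by (simp only:)
      qed
      then show ?case .
    next
      case 0
      have "M' * \<rho>' ^ n \<ge> 0" using M' p by simp
      then have "gauss_bound \<eta> (x (n + 0) - x n) (M' * \<rho>' ^ n)" by (simp only: add_0_right diff_self gauss_bound_0)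
      then show ?case .
    qed
    then show "\<forall>k\<ge>n. gauss_bound \<eta> (x k - x n) (M' * \<rho>' ^ n)" by (metis le_Suc_ex)
  qed
  show ?thesis using l 1 2 by blast
qed

lemma diff_regroup: "f - (a + b) - v = f - a - n - b - (v - (n :: 'a::ab_group_add))"
  by (simp add: algebra_simps)

context groebner_lift
begin

text \<open>The coefficient of each power of \<open>S\<close> is divided on its own, and only by the
  \<open>S\<close>-free parts \<open>r h 0\<close>; the other parts of the \<open>r h\<close> go
  into the error that \<open>step_error\<close> estimates.\<close>

definition step :: "('n, 'k) series \<Rightarrow> (nat \<Rightarrow> ('n, 'k) series) \<Rightarrow> ('n, 'k) series \<Rightarrow> bool" where
  "step f g \<nu> \<longleftrightarrow> (\<forall>h j. tate (g h j)) \<and> (\<forall>j. tate (\<nu> j)) \<and> normal \<nu> \<and>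
    (\<forall>h j B. (\<forall>i. absval (f j i) \<le> B) \<longrightarrow> (\<forall>i. absval (g h j i) \<le> B)) \<and>
    (\<forall>j B. (\<forall>i. absval (f j i) \<le> B) \<longrightarrow> (\<forall>i. absval (\<nu> j i) \<le> B)) \<and>
    (\<forall>j B. (\<forall>i. absval (f j i) \<le> B) \<longrightarrow>
      (\<forall>i. absval (f j i - (\<Sum>h\<in>H. pconv (g h j) (r h 0) i) - \<nu> j i) \<le> absval uK * B))"

lemma step_exists:
  assumes "\<And>j. tate (f j)"
  shows "\<exists>g \<nu>. step f g \<nu>"
proof -
  have "\<forall>j. \<exists>q n. (\<forall>h. finite {i. q h i \<noteq> 0}) \<and> finite {i. n i \<noteq> 0} \<and> (\<forall>i. n i \<noteq> 0 \<longrightarrow> i \<notin> L) \<and>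
     (\<forall>B. (\<forall>i. absval (f j i) \<le> B) \<longrightarrow> (\<forall>h i. absval (q h i) \<le> B) \<and> (\<forall>i. absval (n i) \<le> B) \<and>
       (\<forall>i. absval (f j i - (\<Sum>h\<in>H. pconv (q h) (r h 0) i) - n i) \<le> absval uK * B))"
    using tate_division[OF assms] by blast
  from choice[OF this] obtain Q where "\<forall>j. \<exists>n. (\<forall>h. finite {i. Q j h i \<noteq> 0}) \<and> finite {i. n i \<noteq> 0} \<and> (\<forall>i. n i \<noteq> 0 \<longrightarrow> i \<notin> L) \<and>
     (\<forall>B. (\<forall>i. absval (f j i) \<le> B) \<longrightarrow> (\<forall>h i. absval (Q j h i) \<le> B) \<and> (\<forall>i. absval (n i) \<le> B) \<and>
       (\<forall>i. absval (f j i - (\<Sum>h\<in>H. pconv (Q j h) (r h 0) i) - n i) \<le> absval uK * B))" by blast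
  from choice[OF this] obtain N where QN: "\<forall>j. (\<forall>h. finite {i. Q j h i \<noteq> 0}) \<and> finite {i. N j i \<noteq> 0} \<and> (\<forall>i. N j i \<noteq> 0 \<longrightarrow> i \<notin> L) \<and>
     (\<forall>B. (\<forall>i. absval (f j i) \<le> B) \<longrightarrow> (\<forall>h i. absval (Q j h i) \<le> B) \<and> (\<forall>i. absval (N j i) \<le> B) \<and>
       (\<forall>i. absval (f j i - (\<Sum>h\<in>H. pconv (Q j h) (r h 0) i) - N j i) \<le> absval uK * B))" by blast
  have "step f (\<lambda>h j. Q j h) N"
    unfolding step_def normal_def
  proof (intro conjI allI impI)
    show "tate (Q j h)" "tate (N j)" for h j using QN by (intro tate_finite; blast)+
  qed (use QN in blast)+
  then show ?thesis by blast
qed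

text \<open>The error of a step has three sources: the division of a single coefficient gives
  \<open>absval uK\<close>, the negative part of \<open>r h\<close> gives \<open>absval uK\<close>
  times at most \<open>\<eta> powi jI\<close>, and the positive part at most \<eta>. Since
  \<open>jI \<le> 0\<close>, the second factor covers the first.\<close>

definition contraction :: "real \<Rightarrow> real" where
  "contraction \<eta> = max (absval uK * \<eta> powi jI) \<eta>"

lemma contraction_bounds:
  assumes "0 < \<eta>" "\<eta> \<le> 1"
  shows "0 < contraction \<eta>" "absval uK \<le> contraction \<eta>" "\<eta> \<le> contraction \<eta>"
    "absval uK * \<eta> powi jI \<le> contraction \<eta>"
proof -
  have "1 \<le> \<eta> powi jI"
  proof -
    have "1 \<le> inverse \<eta> ^ nat (- jI)" using assms by (intro one_le_power) (simp add: field_simps)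
    then show ?thesis using jI(1) by (cases "jI = 0") (auto simp: power_int_def)
  qed
  then have "absval uK * 1 \<le> absval uK * \<eta> powi jI" by (rule mult_left_mono) simp
  then show "absval uK \<le> contraction \<eta>" by (simp add: contraction_def)
qed (use assms in \<open>auto simp: contraction_def\<close>)

lemma step_error:
  assumes st: "step f g \<nu>" and f: "f \<in> null_series \<alpha>" and \<alpha>: "0 < \<alpha>" "\<alpha> < 1"
    and B: "gauss_bound \<eta> f B" and \<eta>: "0 < \<eta>" "\<eta> \<le> 1"
  shows "gauss_bound \<eta> (f - (\<Sum>h\<in>H. g h \<star> r h) - \<nu>) (contraction \<eta> * B)"
  unfolding gauss_bound_def
proof (intro allI)
  fix j i
  note cb = contraction_bounds[OF \<eta>]
  have B0: "B \<ge> 0" using gauss_bound_nonneg[OF B \<eta>(1)] .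
  have g_null: "g h \<in> null_series \<alpha>" for h
    by (rule null_series_dominated[OF f \<alpha>(1)]) (use st in \<open>unfold step_def, blast+\<close>)
  define E where "E = contraction \<eta> * B * \<eta> powi (- j)"
  have pos: "\<eta> powi j > 0" "\<eta> powi (- j) > 0" using \<eta> by auto
  have E0: "E \<ge> 0" unfolding E_def using cb(1) B0 pos by simp
  have fl: "\<forall>i. absval (f j i) \<le> B * \<eta> powi (- j)" for j using gauss_bound_levelD[OF B \<eta>(1)] by blast
  have gl: "absval (g h j i) \<le> B * \<eta> powi (- j)" for h j i using st fl unfolding step_def by blast
  have main: "absval (f j i - (\<Sum>h\<in>H. pconv (g h j) (r h 0) i) - \<nu> j i) \<le> E"
  proof -
    have "absval (f j i - (\<Sum>h\<in>H. pconv (g h j) (r h 0) i) - \<nu> j i) \<le> absval uK * (B * \<eta> powi (- j))"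
      using st fl[of j] unfolding step_def by blast
    also have "\<dots> \<le> contraction \<eta> * (B * \<eta> powi (- j))" using cb(2) B0 pos by (intro mult_right_mono) auto
    finally show ?thesis by (simp add: E_def mult.assoc)
  qed
  have rest: "absval ((g h \<star> r h) j i - pconv (g h j) (r h 0) i) \<le> E" if h: "h \<in> H" for h
  proof -
    let ?t = "conv_term (g h) (r h) j i"
    \<comment> \<open>The diagonal term \<open>a = j\<close> is the one that the step accounts for.
      What remains pairs \<open>g h\<close> with the parts of \<open>r h\<close> of nonzero
      \<open>S\<close>-exponent.\<close>
    let ?x = "\<lambda>a. if a = j then 0 else ?t a" and ?y = "\<lambda>a. if a = j then ?t j else 0"
    have conv: "convolvable (g h) (r h)" by (rule convolvable_null[OF g_null r_null[OF h \<alpha>] \<alpha>(1)])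
    have xs: "?x summable_on UNIV"
    proof (rule nonarch_summable)
      fix e :: real assume "e > 0"
      then have "finite {a. e \<le> absval (?t a)}" using conv by (simp add: convolvable_def)
      then show "finite {a. e \<le> absval (?x a)}" by (rule rev_finite_subset) (use \<open>e > 0\<close> in \<open>auto split: if_splits\<close>)
    qed
    have ys: "?y summable_on UNIV"
    proof (rule nonarch_summable)
      fix e :: real assume "e > 0"
      show "finite {a. e \<le> absval (?y a)}" by (rule finite_subset[of _ "{j}"]) (use \<open>e > 0\<close> in \<open>auto split: if_splits\<close>)
    qed
    have "?t = (\<lambda>a. ?x a + ?y a)" by auto
    then have "infsum ?t UNIV = infsum (\<lambda>a. ?x a + ?y a) UNIV" by (rule arg_cong)
    also have "\<dots> = infsum ?x UNIV + infsum ?y UNIV" by (rule infsum_add[OF xs ys])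
    also have "infsum ?y UNIV = sum ?y {j}" by (rule infsum_neutral_finite) auto
    finally have "(g h \<star> r h) j i - pconv (g h j) (r h 0) i = infsum ?x UNIV"
      by (simp add: series_mult_conv_term conv_term_diagonal)
    moreover have "absval (infsum ?x UNIV) \<le> E"
    proof (rule infsum_absval_le[OF _ E0])
      fix a
      have "absval (?t a) \<le> E" if "a \<noteq> j"
      proof (rule absval_conv_term_le[OF _ E0])
        fix b b'
        have ee: "\<eta> powi (- a) = \<eta> powi (j - a) * \<eta> powi (- j)" using \<eta> by (simp flip: power_int_add)
        \<comment> \<open>The exponent of \<open>S\<close> in \<open>r h\<close> is
          \<open>j - a\<close>. If it is positive, a factor \<eta> is gained. If it is negative, the
          coefficient of \<open>r h\<close> is divisible by \<open>uK\<close>, and it is 0 unless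
          the exponent is at least \<open>jI\<close>.\<close>
        consider "a < j" | "a > j" "r h (j - a) b' = 0" | "a > j" "r h (j - a) b' \<noteq> 0" using \<open>a \<noteq> j\<close> by force
        then show "absval (g h a b) * absval (r h (j - a) b') \<le> E"
        proof cases
          case 1
          have "\<eta> powi (j - a) \<le> \<eta> powi 1" using 1 \<eta> by (intro power_int_decreasing) auto
          then have le: "\<eta> powi (j - a) \<le> contraction \<eta>" using cb(3) by simp
          have "absval (g h a b) * absval (r h (j - a) b') \<le> (B * \<eta> powi (- a)) * 1"
            using gl r_le_1[OF h] B0 \<eta> by (intro mult_mono) auto
          also have "\<dots> = \<eta> powi (j - a) * (B * \<eta> powi (- j))" by (simp add: ee mult_ac)
          also have "\<dots> \<le> contraction \<eta> * (B * \<eta> powi (- j))" using le B0 pos by (intro mult_right_mono) auto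
          finally show ?thesis by (simp add: E_def mult.assoc)
        next
          case 2
          then show ?thesis using E0 by simp
        next
          case 3
          have "jI \<le> j - a" by (rule jI(2)[OF h 3(2)])
          then have "\<eta> powi (j - a) \<le> \<eta> powi jI" using \<eta> by (intro power_int_decreasing) auto
          then have "absval uK * \<eta> powi (j - a) \<le> absval uK * \<eta> powi jI" by (rule mult_left_mono) simp
          then have le: "absval uK * \<eta> powi (j - a) \<le> contraction \<eta>" using cb(4) by linarith
          have "absval (g h a b) * absval (r h (j - a) b') \<le> (B * \<eta> powi (- a)) * absval uK"
            using gl r_negative[OF h, of "j - a"] 3 B0 \<eta> by (intro mult_mono) auto
          also have "\<dots> = (absval uK * \<eta> powi (j - a)) * (B * \<eta> powi (- j))" by (simp add: ee mult_ac)
          also have "\<dots> \<le> contraction \<eta> * (B * \<eta> powi (- j))" using le B0 pos by (intro mult_right_mono) auto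
          finally show ?thesis by (simp add: E_def mult.assoc)
        qed
      qed
      then show "absval (?x a) \<le> E" using E0 by simp
    qed
    ultimately show ?thesis by simp
  qed
  have "(f - (\<Sum>h\<in>H. g h \<star> r h) - \<nu>) j i = (f j i - (\<Sum>h\<in>H. pconv (g h j) (r h 0) i) - \<nu> j i)
      - (\<Sum>h\<in>H. (g h \<star> r h) j i - pconv (g h j) (r h 0) i)"
    by (simp add: sum_fun_apply2 sum_subtractf)
  also have "absval \<dots> \<le> E"
    by (intro absval_diff_le main absval_sum_le rest E0)
  finally have "absval ((f - (\<Sum>h\<in>H. g h \<star> r h) - \<nu>) j i) * \<eta> powi j \<le> E * \<eta> powi j"
    using pos by (intro mult_right_mono) auto
  also have "E * \<eta> powi j = contraction \<eta> * B" using \<eta> by (simp add: E_def power_int_minus)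
  finally show "absval ((f - (\<Sum>h\<in>H. g h \<star> r h) - \<nu>) j i) * \<eta> powi j \<le> contraction \<eta> * B" .
qed

lemma step_null:
  assumes st: "step f g \<nu>" and f: "f \<in> null_series \<eta>" and \<eta>: "0 < \<eta>" "\<eta> < 1"
  shows "g h \<in> null_series \<eta>" "\<nu> \<in> null_series \<eta>" "f - (\<Sum>h\<in>H. g h \<star> r h) - \<nu> \<in> null_series \<eta>"
proof -
  show g: "g h \<in> null_series \<eta>" for h
    by (rule null_series_dominated[OF f \<eta>(1)]) (use st in \<open>unfold step_def, blast+\<close>)
  show n: "\<nu> \<in> null_series \<eta>"
    by (rule null_series_dominated[OF f \<eta>(1)]) (use st in \<open>unfold step_def, blast+\<close>)
  show "f - (\<Sum>h\<in>H. g h \<star> r h) - \<nu> \<in> null_series \<eta>"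
    by (intro null_series_diff null_series_sum null_series_mult f g n r_null \<eta>)
qed

lemma step_bound:
  assumes st: "step f g \<nu>" and f: "gauss_bound \<eta> f B" and \<eta>: "0 < \<eta>"
  shows "gauss_bound \<eta> (g h) B" "gauss_bound \<eta> \<nu> B"
  by (rule gauss_bound_dominated[OF f \<eta>]; use st in \<open>unfold step_def, blast\<close>)+

lemma normal_0: "normal 0" by (simp add: normal_def)

lemma normal_add: "normal f \<Longrightarrow> normal g \<Longrightarrow> normal (f + g)"
  unfolding normal_def plus_fun_apply by (metis add.right_neutral)

lemma normal_uminus: "normal f \<Longrightarrow> normal (- f)"
  by (simp add: normal_def)

lemma normal_diff: "normal f \<Longrightarrow> normal g \<Longrightarrow> normal (f - g)"
  using normal_add[OF _ normal_uminus, of f g] by simp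

lemma normal_sum: "(\<And>x. x \<in> A \<Longrightarrow> normal (f x)) \<Longrightarrow> normal (sum f A)"
proof (induction A rule: infinite_finite_induct)
  case (insert x A)
  have "normal (f x + sum f A)" using insert by (intro normal_add) auto
  then have "normal (sum f (insert x A))" by (simp only: sum.insert[OF insert.hyps])
  then show ?case .
qed (simp_all add: normal_0)

lemma sum_mult_add:
  assumes "\<And>h. h \<in> H \<Longrightarrow> f h \<in> null_series \<eta>" "\<And>h. h \<in> H \<Longrightarrow> g h \<in> null_series \<eta>" "0 < \<eta>" "\<eta> < 1"
  shows "(\<Sum>h\<in>H. (f h + g h) \<star> r h) = (\<Sum>h\<in>H. f h \<star> r h) + (\<Sum>h\<in>H. g h \<star> r h)"
proof -
  have "(\<Sum>h\<in>H. (f h + g h) \<star> r h) = (\<Sum>h\<in>H. f h \<star> r h + g h \<star> r h)"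
    by (rule sum.cong[OF refl]) (rule null_mult_add_left[OF assms(3,1,2) r_null[OF _ assms(3,4)]])
  then show ?thesis by (simp only: sum.distrib)
qed

text \<open>The step is iterated on the remainders \<open>F n\<close>, and quotients and normal
  parts are summed. The choice of a step ignores the radius, so one \<open>g\<close> and one \<nu>
  converge wherever the contraction factor is below 1. The bounds ask only for a factor at most 1,
  which includes radius 1.\<close>

theorem division:
  assumes f: "f \<in> null_series \<alpha>" and \<alpha>: "0 < \<alpha>" "\<alpha> < 1" "absval uK * \<alpha> powi jI < 1"
  shows "\<exists>g \<nu>. normal \<nu> \<and> f = (\<Sum>h\<in>H. g h \<star> r h) + \<nu> \<and>
    (\<forall>\<eta>. 0 < \<eta> \<longrightarrow> \<eta> < 1 \<longrightarrow> absval uK * \<eta> powi jI < 1 \<longrightarrow> f \<in> null_series \<eta> \<longrightarrow>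
       (\<forall>h. g h \<in> null_series \<eta>) \<and> \<nu> \<in> null_series \<eta>) \<and>
    (\<forall>\<eta> B. 0 < \<eta> \<longrightarrow> \<eta> \<le> 1 \<longrightarrow> absval uK * \<eta> powi jI \<le> 1 \<longrightarrow> gauss_bound \<eta> f B \<longrightarrow>
       (\<forall>h. gauss_bound \<eta> (g h) B) \<and> gauss_bound \<eta> \<nu> B)"
proof -
  have "\<forall>f. \<exists>g \<nu>. (\<forall>j. tate (f j)) \<longrightarrow> step f g \<nu>" using step_exists by blast
  from choice[OF this] obtain G where "\<forall>f. \<exists>\<nu>. (\<forall>j. tate (f j)) \<longrightarrow> step f (G f) \<nu>" by blast
  from choice[OF this] obtain N where GN: "\<forall>f. (\<forall>j. tate (f j)) \<longrightarrow> step f (G f) (N f)" by blast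
  define F where "F n = ((\<lambda>f. f - (\<Sum>h\<in>H. G f h \<star> r h) - N f) ^^ n) f" for n
  have F0: "F 0 = f" and FS: "F (Suc n) = F n - (\<Sum>h\<in>H. G (F n) h \<star> r h) - N (F n)" for n
    by (simp_all add: F_def)
  have st: "step (F n) (G (F n)) (N (F n))" if "F n \<in> null_series \<alpha>" for n
    using GN null_series_tate[OF that \<alpha>(1)] by blast
  have Fn\<alpha>: "F n \<in> null_series \<alpha>" for n
  proof (induction n)
    case 0 then show ?case using f by (simp add: F0)
  next
    case (Suc n) then show ?case using step_null(3)[OF st[OF Suc] Suc \<alpha>(1,2)] by (simp only: FS)
  qed
  note st = st[OF Fn\<alpha>]
  have Fn: "F n \<in> null_series \<eta>" if "0 < \<eta>" "\<eta> < 1" "f \<in> null_series \<eta>" for n \<eta>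
  proof (induction n)
    case 0 then show ?case using that by (simp add: F0)
  next
    case (Suc n) then show ?case using step_null(3)[OF st Suc that(1,2)] by (simp only: FS)
  qed
  have Fb: "gauss_bound \<eta> (F n) (B * contraction \<eta> ^ n)" if "0 < \<eta>" "\<eta> \<le> 1" "gauss_bound \<eta> f B" for n \<eta> B
  proof (induction n)
    case 0 then show ?case using that by (simp add: F0)
  next
    case (Suc n)
    have "gauss_bound \<eta> (F (Suc n)) (B * contraction \<eta> ^ Suc n)"
      using step_error[OF st Fn\<alpha> \<alpha>(1,2) Suc that(1,2)] by (simp only: FS power_Suc mult_ac)
    then show ?case .
  qed
  have c1: "contraction \<eta> < 1" if "\<eta> < 1" "absval uK * \<eta> powi jI < 1" for \<eta> using that by (simp add: contraction_def)
  have c1': "contraction \<eta> \<le> 1" if "\<eta> \<le> 1" "absval uK * \<eta> powi jI \<le> 1" for \<eta> using that by (simp add: contraction_def)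
  have c0: "contraction \<eta> \<ge> 0" if "0 < \<eta>" "\<eta> \<le> 1" for \<eta> using contraction_bounds(1)[OF that] by simp
  define GS where "GS h n = (\<Sum>k<n. G (F k) h)" for h n
  define NS where "NS n = (\<Sum>k<n. N (F k))" for n
  have GSS: "GS h (Suc n) - GS h n = G (F n) h" and NSS: "NS (Suc n) - NS n = N (F n)" for h n
    by (simp_all only: GS_def NS_def lessThan_Suc sum.insert finite_lessThan lessThan_iff less_irrefl not_False_eq_True add_diff_cancel)
  obtain B\<alpha> where B\<alpha>: "B\<alpha> > 0" "gauss_bound \<alpha> f B\<alpha>" using null_series_bounded[OF f] by blast
  have \<alpha>1: "\<alpha> \<le> 1" using \<alpha> by simp
  have inc: "gauss_bound \<eta> (GS h (Suc n) - GS h n) (B * contraction \<eta> ^ n)"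
      "gauss_bound \<eta> (NS (Suc n) - NS n) (B * contraction \<eta> ^ n)"
    if "0 < \<eta>" "\<eta> \<le> 1" "gauss_bound \<eta> f B" for \<eta> B h n
    unfolding GSS NSS by (rule step_bound[OF st Fb[OF that] that(1)])+
  note ca = c0[OF \<alpha>(1) \<alpha>1] c1[OF \<alpha>(2,3)]
  have "\<forall>h. \<exists>l. (\<forall>j i. (\<lambda>n. GS h n j i) \<longlonglongrightarrow> l j i) \<and>
    (\<forall>\<eta> B. (\<forall>n. gauss_bound \<eta> (GS h n) B) \<longrightarrow> gauss_bound \<eta> l B) \<and>
    (\<forall>\<eta> M' \<rho>'. \<eta> > 0 \<longrightarrow> 0 \<le> \<rho>' \<longrightarrow> \<rho>' \<le> 1 \<longrightarrow> (\<forall>n. gauss_bound \<eta> (GS h (Suc n) - GS h n) (M' * \<rho>' ^ n)) \<longrightarrow>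
       (\<forall>n. gauss_bound \<eta> (l - GS h n) (M' * \<rho>' ^ n)))"
  proof
    fix h
    have inch: "gauss_bound \<alpha> (GS h (Suc n) - GS h n) (B\<alpha> * contraction \<alpha> ^ n)" for n
      by (rule inc(1)[OF \<alpha>(1) \<alpha>1 B\<alpha>(2)])
    show "\<exists>l. (\<forall>j i. (\<lambda>n. GS h n j i) \<longlonglongrightarrow> l j i) \<and>
      (\<forall>\<eta> B. (\<forall>n. gauss_bound \<eta> (GS h n) B) \<longrightarrow> gauss_bound \<eta> l B) \<and>
      (\<forall>\<eta> M' \<rho>'. \<eta> > 0 \<longrightarrow> 0 \<le> \<rho>' \<longrightarrow> \<rho>' \<le> 1 \<longrightarrow> (\<forall>n. gauss_bound \<eta> (GS h (Suc n) - GS h n) (M' * \<rho>' ^ n)) \<longrightarrow>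
         (\<forall>n. gauss_bound \<eta> (l - GS h n) (M' * \<rho>' ^ n)))"
      by (rule series_limit[where x = "GS h", OF \<alpha>(1) ca inch])
  qed
  from choice[OF this] obtain g where g: "\<And>h \<eta> B. (\<forall>n. gauss_bound \<eta> (GS h n) B) \<Longrightarrow> gauss_bound \<eta> (g h) B"
    "\<And>h \<eta> M' \<rho>' n. \<eta> > 0 \<Longrightarrow> 0 \<le> \<rho>' \<Longrightarrow> \<rho>' \<le> 1 \<Longrightarrow> (\<forall>n. gauss_bound \<eta> (GS h (Suc n) - GS h n) (M' * \<rho>' ^ n)) \<Longrightarrow>
       gauss_bound \<eta> (g h - GS h n) (M' * \<rho>' ^ n)" by blast
  have incN: "gauss_bound \<alpha> (NS (Suc n) - NS n) (B\<alpha> * contraction \<alpha> ^ n)" for n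
    by (rule inc(2)[OF \<alpha>(1) \<alpha>1 B\<alpha>(2)])
  from series_limit[where x = NS, OF \<alpha>(1) ca incN]
  obtain \<nu> where \<nu>: "\<And>j i. (\<lambda>n. NS n j i) \<longlonglongrightarrow> \<nu> j i"
    "\<And>\<eta> B. (\<forall>n. gauss_bound \<eta> (NS n) B) \<Longrightarrow> gauss_bound \<eta> \<nu> B"
    "\<And>\<eta> M' \<rho>' n. \<eta> > 0 \<Longrightarrow> 0 \<le> \<rho>' \<Longrightarrow> \<rho>' \<le> 1 \<Longrightarrow> (\<forall>n. gauss_bound \<eta> (NS (Suc n) - NS n) (M' * \<rho>' ^ n)) \<Longrightarrow>
       gauss_bound \<eta> (\<nu> - NS n) (M' * \<rho>' ^ n)" by blast
  have gb: "gauss_bound \<eta> (g h) B" "gauss_bound \<eta> \<nu> B"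
    if \<eta>: "0 < \<eta>" "\<eta> \<le> 1" "absval uK * \<eta> powi jI \<le> 1" and B: "gauss_bound \<eta> f B" for \<eta> B h
  proof -
    have B0: "B \<ge> 0" using gauss_bound_nonneg[OF B \<eta>(1)] .
    have "B * contraction \<eta> ^ n \<le> B" for n
      using mult_left_mono[OF power_le_one[OF c0[OF \<eta>(1,2)] c1'[OF \<eta>(2,3)]] B0] by simp
    then have FB: "gauss_bound \<eta> (F n) B" for n using gauss_bound_mono[OF Fb[OF \<eta>(1,2) B]] by blast
    show "gauss_bound \<eta> (g h) B"
      by (rule g(1)) (use step_bound(1)[OF st FB \<eta>(1)] B0 \<eta>(1) in \<open>auto simp: GS_def intro!: gauss_bound_sum\<close>)
    show "gauss_bound \<eta> \<nu> B"
      by (rule \<nu>(2)) (use step_bound(2)[OF st FB \<eta>(1)] B0 \<eta>(1) in \<open>auto simp: NS_def intro!: gauss_bound_sum\<close>)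
  qed
  have app: "gauss_bound \<eta> (g h - GS h n) (B * contraction \<eta> ^ n)" "gauss_bound \<eta> (\<nu> - NS n) (B * contraction \<eta> ^ n)"
    if \<eta>: "0 < \<eta>" "\<eta> \<le> 1" "absval uK * \<eta> powi jI \<le> 1" and B: "gauss_bound \<eta> f B" for \<eta> B h n
    by (intro g(2) \<nu>(3) allI inc \<eta> B c0 c1')+
  have small: "\<exists>n. B * contraction \<eta> ^ n \<le> e" if "0 < \<eta>" "\<eta> < 1" "absval uK * \<eta> powi jI < 1" "e > 0" for \<eta> B e
  proof -
    have "(\<lambda>n. B * contraction \<eta> ^ n) \<longlonglongrightarrow> B * 0"
      using c0[of \<eta>] c1[OF that(2,3)] that by (intro tendsto_mult tendsto_const LIMSEQ_realpow_zero) auto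
    then have "eventually (\<lambda>n. B * contraction \<eta> ^ n < e) sequentially"
      by (rule order_tendstoD(2)) (use that in simp)
    then show ?thesis by (auto simp: eventually_sequentially intro: less_imp_le)
  qed
  have GSn: "GS h n \<in> null_series \<eta>" and NSn: "NS n \<in> null_series \<eta>"
    if \<eta>: "0 < \<eta>" "\<eta> < 1" "f \<in> null_series \<eta>" for \<eta> h n
    unfolding GS_def NS_def by (intro null_series_sum step_null[OF st] Fn \<eta>)+
  have gn: "g h \<in> null_series \<eta>" "\<nu> \<in> null_series \<eta>"
    if \<eta>: "0 < \<eta>" "\<eta> < 1" "absval uK * \<eta> powi jI < 1" "f \<in> null_series \<eta>" for \<eta> h
  proof -
    obtain B where B: "B > 0" "gauss_bound \<eta> f B" using null_series_bounded[OF \<eta>(4)] by blast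
    have \<eta>': "\<eta> \<le> 1" "absval uK * \<eta> powi jI \<le> 1" using \<eta> by auto
    show "g h \<in> null_series \<eta>"
    proof (rule null_series_closed_limit[OF _ \<eta>(1)])
      fix e :: real assume "e > 0"
      from small[OF \<eta>(1-3) this] obtain n where "B * contraction \<eta> ^ n \<le> e" by blast
      then have "gauss_bound \<eta> (g h - GS h n) e" by (rule gauss_bound_mono[OF app(1)[OF \<eta>(1) \<eta>' B(2)]])
      then show "\<exists>y\<in>null_series \<eta>. gauss_bound \<eta> (g h - y) e" using GSn[OF \<eta>(1,2,4)] by blast
    qed
    show "\<nu> \<in> null_series \<eta>"
    proof (rule null_series_closed_limit[OF _ \<eta>(1)])
      fix e :: real assume "e > 0"
      from small[OF \<eta>(1-3) this] obtain n where "B * contraction \<eta> ^ n \<le> e" by blast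
      then have "gauss_bound \<eta> (\<nu> - NS n) e" by (rule gauss_bound_mono[OF app(2)[OF \<eta>(1) \<eta>' B(2)]])
      then show "\<exists>y\<in>null_series \<eta>. gauss_bound \<eta> (\<nu> - y) e" using NSn[OF \<eta>(1,2,4)] by blast
    qed
  qed
  have "normal \<nu>"
    unfolding normal_def
  proof (intro allI impI notI)
    fix j i assume nz: "\<nu> j i \<noteq> 0" and iL: "i \<in> L"
    have "NS n j i = 0" for n
    proof -
      have "normal (NS n)" unfolding NS_def by (rule normal_sum) (use st in \<open>auto simp: step_def\<close>)
      then show ?thesis using iL by (auto simp: normal_def)
    qed
    then have "(\<lambda>n. 0) \<longlonglongrightarrow> \<nu> j i" using \<nu>(1)[of j i] by simp
    then have "\<nu> j i = 0" by (simp add: LIMSEQ_const_iff)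
    then show False using nz by simp
  qed
  \<comment> \<open>The partial sums divide \<open>f\<close> exactly up to the remainder
    \<open>F n\<close>, which tends to zero at \<alpha>; the division identity is the limit of this
    one.\<close>
  have tele: "F n = f - (\<Sum>h\<in>H. GS h n \<star> r h) - NS n" for n
  proof (induction n)
    case 0
    have "F 0 = f - (\<Sum>h\<in>H. GS h 0 \<star> r h) - NS 0" by (simp add: F0 GS_def NS_def)
    then show ?case .
  next
    case (Suc n)
    have "(\<Sum>h\<in>H. GS h (Suc n) \<star> r h) = (\<Sum>h\<in>H. (GS h n + G (F n) h) \<star> r h)"
      using GSS by (simp only: add_diff_cancel_left'[symmetric] diff_eq_eq add.commute)
    also have "\<dots> = (\<Sum>h\<in>H. GS h n \<star> r h) + (\<Sum>h\<in>H. G (F n) h \<star> r h)"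
      by (rule sum_mult_add[OF _ _ \<alpha>(1,2)]) (intro GSn f \<alpha> step_null[OF st] Fn\<alpha>)+
    finally have 1: "(\<Sum>h\<in>H. GS h (Suc n) \<star> r h) = (\<Sum>h\<in>H. GS h n \<star> r h) + (\<Sum>h\<in>H. G (F n) h \<star> r h)" .
    have 2: "NS (Suc n) = NS n + N (F n)" using NSS by (simp only: diff_eq_eq add.commute)
    have "F (Suc n) = f - (\<Sum>h\<in>H. GS h (Suc n) \<star> r h) - NS (Suc n)"
      unfolding FS Suc 1 2 by (simp only: diff_diff_eq2 diff_diff_eq add_ac)
    then show ?case .
  qed
  have eq: "f = (\<Sum>h\<in>H. g h \<star> r h) + \<nu>"
  proof -
    have "f - (\<Sum>h\<in>H. g h \<star> r h) - \<nu> = 0"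
    proof (rule gauss_bound_small_eq_0[OF _ \<alpha>(1)])
      fix e :: real assume e: "e > 0"
      have "\<forall>h. \<exists>C. C > 0 \<and> (h \<in> H \<longrightarrow> gauss_bound \<alpha> (r h) C)"
      proof
        fix h show "\<exists>C. C > 0 \<and> (h \<in> H \<longrightarrow> gauss_bound \<alpha> (r h) C)"
        proof (cases "h \<in> H")
          case True
          obtain C where "C > 0" "gauss_bound \<alpha> (r h) C" using null_series_bounded[OF r_null[OF True \<alpha>(1,2)]] by blast
          then show ?thesis by blast
        qed (auto intro: exI[of _ 1])
      qed
      then obtain C where C: "\<And>h. C h > 0" "\<And>h. h \<in> H \<Longrightarrow> gauss_bound \<alpha> (r h) (C h)" by metis
      \<comment> \<open>A common bound for the \<open>r h\<close> at \<alpha>. The summand 1 makes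
        the same estimate usable for the errors that no \<open>r h\<close> multiplies.\<close>
      define D where "D = 1 + (\<Sum>h\<in>H. C h)"
      have CD: "C h \<le> D" if "h \<in> H" for h
        unfolding D_def using member_le_sum[OF that, of C] C(1) by (simp add: less_imp_le add_increasing)
      have D1: "D \<ge> 1" unfolding D_def using C(1) by (simp add: sum_nonneg less_imp_le)
      from small[OF \<alpha> e, of "B\<alpha> * D"] obtain n where n: "B\<alpha> * D * contraction \<alpha> ^ n \<le> e" by blast
      let ?c = "B\<alpha> * contraction \<alpha> ^ n"
      have c0': "?c \<ge> 0" using B\<alpha> ca by simp
      have ce: "?c * D \<le> e" using n by (simp add: mult_ac)
      have ce1: "?c \<le> e" using mult_left_mono[OF D1 c0'] ce by simp
      have \<alpha>2: "absval uK * \<alpha> powi jI \<le> 1" using \<alpha>(3) by simp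
      have s: "(\<Sum>h\<in>H. g h \<star> r h) = (\<Sum>h\<in>H. GS h n \<star> r h) + (\<Sum>h\<in>H. (g h - GS h n) \<star> r h)"
        by (subst sum_mult_add[OF _ _ \<alpha>(1,2), symmetric])
           (auto intro!: GSn f \<alpha> gn null_series_diff simp del: plus_fun_apply)
      have "f - (\<Sum>h\<in>H. g h \<star> r h) - \<nu> = F n - (\<Sum>h\<in>H. (g h - GS h n) \<star> r h) - (\<nu> - NS n)"
        unfolding tele s by (rule diff_regroup)
      moreover have "gauss_bound \<alpha> (F n) e" by (rule gauss_bound_mono[OF Fb[OF \<alpha>(1) \<alpha>1 B\<alpha>(2)] ce1])
      moreover have "gauss_bound \<alpha> (\<nu> - NS n) e" by (rule gauss_bound_mono[OF app(2)[OF \<alpha>(1) \<alpha>1 \<alpha>2 B\<alpha>(2)] ce1])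
      moreover have "gauss_bound \<alpha> (\<Sum>h\<in>H. (g h - GS h n) \<star> r h) e"
      proof (rule gauss_bound_sum[OF _ \<alpha>(1)])
        fix h assume h: "h \<in> H"
        have "gauss_bound \<alpha> ((g h - GS h n) \<star> r h) (?c * C h)"
          by (rule gauss_bound_mult[OF app(1)[OF \<alpha>(1) \<alpha>1 \<alpha>2 B\<alpha>(2)] C(2)[OF h] \<alpha>(1)])
        moreover have "?c * C h \<le> e" using mult_left_mono[OF CD[OF h] c0'] ce by simp
        ultimately show "gauss_bound \<alpha> ((g h - GS h n) \<star> r h) e" by (rule gauss_bound_mono)
      qed (use e in simp)
      ultimately show "gauss_bound \<alpha> (f - (\<Sum>h\<in>H. g h \<star> r h) - \<nu>) e"
        using gauss_bound_diff[OF gauss_bound_diff[OF _ _ \<alpha>(1)] _ \<alpha>(1)] by (simp only:)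
    qed
    then show ?thesis by (simp only: diff_diff_eq right_minus_eq)
  qed
  show ?thesis using \<open>normal \<nu>\<close> eq gn gb by blast
qed

end

section \<open>Normal forms and ideal membership\<close>

lemma scale_mult_left:
  fixes f :: "('n::finite, 'k::complete_discretely_valued_field) series"
  assumes "f \<in> null_series \<eta>" "g \<in> null_series \<eta>" "\<eta> > 0"
  shows "scale c f \<star> g = scale c (f \<star> g)"
  using null_mult_assoc[OF assms(3), of "series_monom 0 0 c" f g] assms
  by (simp add: series_const_mult finite_series_null)

lemma R_int_scaleI:
  fixes g :: "('n, 'k::complete_discretely_valued_field) series"
  assumes g: "g \<in> carrier R_int" and b: "gauss_bound 1 (scale a g) 1"
  shows "scale a g \<in> carrier R_int"
  unfolding R_int_carrier
proof (intro conjI allI impI b)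
  show "tate (scale a g j)" for j
    unfolding scale_def using g by (intro tate_scale) (simp add: R_int_carrier)
  fix e :: real assume "e > 0"
  show "\<exists>N. \<forall>j<N. \<forall>i. absval (scale a g j i) \<le> e"
  proof (cases "a = 0")
    case False
    then have "e / absval a > 0" using \<open>e > 0\<close> by simp
    then obtain N where N: "\<forall>j<N. \<forall>i. absval (g j i) \<le> e / absval a" using g unfolding R_int_carrier by blast
    have "absval (scale a g j i) \<le> e" if "j < N" for j i
    proof -
      have "absval (g j i) \<le> e / absval a" using N that by blast
      then have "absval (g j i) * absval a \<le> e" using False by (simp add: pos_le_divide_eq)
      then show ?thesis by (simp add: scale_def valuation_mult mult.commute)
    qed
    then show ?thesis by blast
  qed (use \<open>e > 0\<close> in auto)
qed

lemma series_mult_support: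
  assumes "\<And>j i. j < A \<Longrightarrow> f j i = 0" "\<And>j i. j < B \<Longrightarrow> g j i = 0" "j < A + B"
  shows "(f \<star> g) j i = (0 :: 'k::complete_discretely_valued_field)"
proof -
  have "conv_term f g j i a = 0" for a
    unfolding conv_term_def
  proof (rule sum.neutral, rule ballI)
    fix x :: "('a \<Rightarrow>\<^sub>0 nat) \<times> ('a \<Rightarrow>\<^sub>0 nat)"
    have "a < A \<or> j - a < B" using assms(3) by arith
    then show "(case x of (b, b') \<Rightarrow> f a b * g (j - a) b') = 0"
      using assms(1,2) by (cases x) auto
  qed
  then have "conv_term f g j i = (\<lambda>a. 0)" by (rule ext)
  then show ?thesis by (simp add: series_mult_conv_term)
qed

text \<open>Translates the order of a pole into size at radius \<eta>: the powers of a number at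
  most 1 are largest at the lowest exponent.\<close>

lemma gauss_bound_from_support:
  assumes "gauss_bound 1 f B" "\<And>j i. j < J \<Longrightarrow> f j i = 0" "0 < \<eta>" "\<eta> \<le> 1" "B \<ge> 0"
  shows "gauss_bound \<eta> f (B * \<eta> powi J)"
  unfolding gauss_bound_def
proof (intro allI)
  fix j i
  show "absval (f j i) * \<eta> powi j \<le> B * \<eta> powi J"
  proof (cases "j < J")
    case False
    then have "\<eta> powi j \<le> \<eta> powi J" using assms by (intro power_int_decreasing) auto
    moreover have "absval (f j i) \<le> B" using gauss_boundD[OF assms(1), of j i] by simp
    ultimately show ?thesis using assms by (intro mult_mono) auto
  qed (use assms in simp)
qed

context groebner_lift
begin

section \<open>Combinations of the lifted basis and uniqueness of normal forms\<close>

definition combination :: "(nat \<Rightarrow> ('n, 'k) series) \<Rightarrow> ('n, 'k) series" where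
  "combination a = (\<Sum>h\<in>H. a h \<star> r h)"

lemma combination_add:
  assumes "\<And>h. h \<in> H \<Longrightarrow> a h \<in> null_series \<eta>" "\<And>h. h \<in> H \<Longrightarrow> b h \<in> null_series \<eta>" "0 < \<eta>" "\<eta> < 1"
  shows "combination (\<lambda>h. a h + b h) = combination a + combination b"
  unfolding combination_def by (rule sum_mult_add[OF assms])

lemma combination_uminus: "combination (\<lambda>h. - a h) = - combination a"
  unfolding combination_def by (simp only: series_mult_uminus_left sum_negf)

lemma combination_diff:
  assumes "\<And>h. h \<in> H \<Longrightarrow> a h \<in> null_series \<eta>" "\<And>h. h \<in> H \<Longrightarrow> b h \<in> null_series \<eta>" "0 < \<eta>" "\<eta> < 1"
  shows "combination (\<lambda>h. a h - b h) = combination a - combination b"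
  using combination_add[of a \<eta> "\<lambda>h. - b h"] assms by (simp only: combination_uminus null_series_uminus add_uminus_conv_diff)

lemma combination_mult:
  assumes "\<And>h. h \<in> H \<Longrightarrow> a h \<in> null_series \<eta>" "x \<in> null_series \<eta>" "0 < \<eta>" "\<eta> < 1"
  shows "x \<star> combination a = combination (\<lambda>h. x \<star> a h)"
proof -
  have "x \<star> (\<Sum>h\<in>A. a h \<star> r h) = (\<Sum>h\<in>A. x \<star> (a h \<star> r h))" if "finite A" "A \<subseteq> H" for A
    using that
  proof (induction A)
    case (insert h A)
    have "x \<star> (\<Sum>h\<in>insert h A. a h \<star> r h) = x \<star> (a h \<star> r h + (\<Sum>h\<in>A. a h \<star> r h))"
      by (simp only: sum.insert[OF insert.hyps])
    also have "\<dots> = x \<star> (a h \<star> r h) + x \<star> (\<Sum>h\<in>A. a h \<star> r h)"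
      by (rule null_mult_add_right[OF assms(3,2)])
         (use insert.prems in \<open>auto intro!: null_series_mult null_series_sum assms r_null\<close>)
    also have "\<dots> = (\<Sum>h\<in>insert h A. x \<star> (a h \<star> r h))"
      using insert by (simp only: sum.insert[OF insert.hyps]) simp
    finally show ?case .
  next
    case empty
    have "x \<star> (\<Sum>h\<in>{}. a h \<star> r h) = (\<Sum>h\<in>{}. x \<star> (a h \<star> r h))"
      by (simp only: sum.empty series_mult_0_right)
    then show ?case .
  qed
  from this[of H] have "x \<star> combination a = (\<Sum>h\<in>H. x \<star> (a h \<star> r h))" by (simp add: combination_def)
  also have "\<dots> = (\<Sum>h\<in>H. (x \<star> a h) \<star> r h)"
    by (rule sum.cong[OF refl]) (rule null_mult_assoc[symmetric, OF assms(3,2,1) r_null[OF _ assms(3,4)]])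
  finally show ?thesis by (simp add: combination_def)
qed

lemma combination_null:
  assumes "\<And>h. h \<in> H \<Longrightarrow> a h \<in> null_series \<eta>" "0 < \<eta>" "\<eta> < 1"
  shows "combination a \<in> null_series \<eta>"
  unfolding combination_def by (intro null_series_sum null_series_mult assms r_null)

lemma r_gauss_bound_1: "h \<in> H \<Longrightarrow> gauss_bound 1 (r h) 1"
  using r_le_1 by (simp add: gauss_bound_1)

lemma combination_bounded:
  assumes "\<And>h. h \<in> H \<Longrightarrow> a h \<in> bounded_null_series \<eta>" "0 < \<eta>" "\<eta> < 1"
  shows "combination a \<in> bounded_null_series \<eta>"
proof -
  have "r h \<in> bounded_null_series \<eta>" if "h \<in> H" for h
    using r_null[OF that assms(2,3)] r_gauss_bound_1[OF that] by (auto simp: bounded_null_series_def)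
  then have t: "a h \<star> r h \<in> bounded_null_series \<eta>" if "h \<in> H" for h
    using assms that bounded_null_series_closed(5) by blast
  have "(\<Sum>h\<in>A. a h \<star> r h) \<in> bounded_null_series \<eta>" if "finite A" "A \<subseteq> H" for A
    using that
  proof (induction A)
    case (insert h A)
    have "(\<Sum>h\<in>insert h A. a h \<star> r h) \<in> bounded_null_series \<eta>"
      unfolding sum.insert[OF insert.hyps]
      by (rule bounded_null_series_closed(4)[OF assms(2) t insert.IH]) (use insert.prems in auto)
    then show ?case .
  next
    case empty
    have "(\<Sum>h\<in>{}. a h \<star> r h) \<in> bounded_null_series \<eta>"
      using bounded_null_series_closed(1)[OF assms(2)] by (simp only: sum.empty)
    then show ?case .
  qed
  from this[of H] show ?thesis by (simp add: combination_def)
qed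

lemma extend_scalars_add_closed: "add_closed (extend_scalars I)"
  unfolding add_closed_def
proof (intro conjI ballI)
  note cl = add_closedD[OF I_add_closed[OF ideal]]
  have "0 = scale 1 (0 :: ('n, 'k) series)" by simp
  then show "0 \<in> extend_scalars I" unfolding extend_scalars_def using cl(1) by blast
  show "- x \<in> extend_scalars I" if x: "x \<in> extend_scalars I" for x
  proof -
    obtain a f where "x = scale a f" "f \<in> I" using x unfolding extend_scalars_def by blast
    then have "- x = scale a (- f)" "- f \<in> I" using cl(3) by (simp_all only: scale_uminus)
    then show ?thesis unfolding extend_scalars_def by blast
  qed
  fix x y assume "x \<in> extend_scalars I" "y \<in> extend_scalars I"
  then obtain a f b g where fg: "x = scale a f" "f \<in> I" "y = scale b g" "g \<in> I"
    unfolding extend_scalars_def by blast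
  \<comment> \<open>A common denominator for the two scalars.\<close>
  obtain c :: 'k where c: "c \<noteq> 0" "max (absval a) (absval b) \<le> absval c" using exists_large by blast
  have "x + y = scale c (scale (a / c) f + scale (b / c) g)" using c fg by (simp add: scale_add)
  moreover have "scale (a / c) f + scale (b / c) g \<in> I"
    using c fg by (intro cl(2) I_scale[OF ideal]) (simp_all add: absval_divide)
  ultimately show "x + y \<in> extend_scalars I" unfolding extend_scalars_def by blast
qed

lemma combination_extend_scalars:
  assumes "\<And>h. h \<in> H \<Longrightarrow> a h \<in> bounded_null_series \<eta>" "0 < \<eta>" "\<eta> < 1"
  shows "combination a \<in> extend_scalars I"
  unfolding combination_def
proof (rule add_closed_sum[OF extend_scalars_add_closed])
  fix h assume h: "h \<in> H"
  obtain B where B: "gauss_bound 1 (a h) B" "a h \<in> null_series \<eta>"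
    using assms(1)[OF h] by (auto simp: bounded_null_series_def)
  obtain c :: 'k where c: "c \<noteq> 0" "B \<le> absval c" using exists_large by blast
  let ?a = "scale (inverse c) (a h)"
  have "gauss_bound 1 ?a 1"
    using gauss_bound_mono[OF B(1) c(2)] c(1)
    by (subst gauss_bound_scale_iff) (simp_all add: absval_inverse divide_inverse)
  then have "?a \<in> carrier R_int"
    using bounded_null_series_R_int[OF null_series_scale[OF B(2)]] assms(2,3) by blast
  then have "?a \<star> r h \<in> I" using I_mult[OF ideal r_I[OF h]] by blast
  moreover have "a h \<star> r h = scale c (?a \<star> r h)"
    using scale_mult_left[OF null_series_scale[OF B(2), of "inverse c"] r_null[OF h assms(2,3)] assms(2), of c] c by simp
  ultimately show "a h \<star> r h \<in> extend_scalars I" unfolding extend_scalars_def by blast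
qed

text \<open>A power of \<open>uK\<close> makes the scalar in front of the element of
  \<open>I\<close> integral, and \<open>saturated_power\<close> removes that power again.\<close>

lemma extend_scalars_integral:
  assumes "f \<in> extend_scalars I" "gauss_bound 1 f 1"
  shows "f \<in> I"
proof -
  obtain a g where g: "f = scale a g" "g \<in> I" using assms(1) by (auto simp: extend_scalars_def)
  have fR: "f \<in> carrier R_int" using R_int_scaleI[OF I_carrier[OF ideal g(2)]] assms(2) g(1) by blast
  have "\<exists>k. absval (uK ^ k * a) \<le> 1"
  proof -
    have "(\<lambda>k. absval uK ^ k * absval a) \<longlonglongrightarrow> 0 * absval a"
      by (intro tendsto_mult tendsto_const LIMSEQ_realpow_zero) (use uK in auto)
    then have "eventually (\<lambda>k. absval uK ^ k * absval a < 1) sequentially"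
      by (rule order_tendstoD(2)) simp
    then show ?thesis by (auto simp: eventually_sequentially valuation_mult absval_power intro: less_imp_le)
  qed
  then obtain k where "absval (uK ^ k * a) \<le> 1" by blast
  then have "scale (uK ^ k * a) g \<in> I" by (rule I_scale[OF ideal g(2)])
  then have "scale (uK ^ k) f \<in> I" by (simp add: g(1))
  then show ?thesis by (rule saturated_power[OF _ fR])
qed

lemma r_bounds: "0 < \<alpha> \<Longrightarrow> \<alpha> < 1 \<Longrightarrow> \<exists>D\<ge>1. \<forall>h\<in>H. gauss_bound \<alpha> (r h) D"
proof -
  assume \<alpha>: "0 < \<alpha>" "\<alpha> < 1"
  have "\<forall>h. \<exists>C. C > 0 \<and> (h \<in> H \<longrightarrow> gauss_bound \<alpha> (r h) C)"
  proof
    fix h show "\<exists>C. C > 0 \<and> (h \<in> H \<longrightarrow> gauss_bound \<alpha> (r h) C)"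
    proof (cases "h \<in> H")
      case True
      obtain C where "C > 0" "gauss_bound \<alpha> (r h) C" using null_series_bounded[OF r_null[OF True \<alpha>]] by blast
      then show ?thesis by blast
    qed (auto intro: exI[of _ 1])
  qed
  then obtain C where C: "\<And>h. C h > 0" "\<And>h. h \<in> H \<Longrightarrow> gauss_bound \<alpha> (r h) (C h)" by metis
  let ?D = "1 + (\<Sum>h\<in>H. C h)"
  have "gauss_bound \<alpha> (r h) ?D" if "h \<in> H" for h
  proof (rule gauss_bound_mono[OF C(2)[OF that]])
    show "C h \<le> ?D" using member_le_sum[OF that, of C] C(1) by (simp add: less_imp_le add_increasing)
  qed
  moreover have "?D \<ge> 1" using C(1) by (simp add: sum_nonneg less_imp_le)
  ultimately show ?thesis by blast
qed

text \<open>The positive radii with \<open>contraction \<eta> < 1\<close>, where division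
  converges.\<close>

definition admissible :: "real \<Rightarrow> bool" where
  "admissible \<eta> \<longleftrightarrow> 0 < \<eta> \<and> \<eta> < 1 \<and> absval uK * \<eta> powi jI < 1"

lemma division_admissible:
  assumes f: "f \<in> null_series \<alpha>" and \<alpha>: "admissible \<alpha>"
  shows "\<exists>g \<nu>. normal \<nu> \<and> f = combination g + \<nu> \<and>
    (\<forall>\<eta>. admissible \<eta> \<longrightarrow> f \<in> null_series \<eta> \<longrightarrow> (\<forall>h. g h \<in> null_series \<eta>) \<and> \<nu> \<in> null_series \<eta>) \<and>
    (\<forall>\<eta> B. admissible \<eta> \<longrightarrow> gauss_bound \<eta> f B \<longrightarrow> (\<forall>h. gauss_bound \<eta> (g h) B) \<and> gauss_bound \<eta> \<nu> B) \<and>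
    (\<forall>B. gauss_bound 1 f B \<longrightarrow> (\<forall>h. gauss_bound 1 (g h) B) \<and> gauss_bound 1 \<nu> B)"
proof -
  have "0 < \<alpha>" "\<alpha> < 1" "absval uK * \<alpha> powi jI < 1" using \<alpha> by (auto simp: admissible_def)
  from division[OF f this] obtain g \<nu> where g: "normal \<nu>" "f = (\<Sum>h\<in>H. g h \<star> r h) + \<nu>"
    "\<forall>\<eta>. 0 < \<eta> \<longrightarrow> \<eta> < 1 \<longrightarrow> absval uK * \<eta> powi jI < 1 \<longrightarrow> f \<in> null_series \<eta> \<longrightarrow>
       (\<forall>h. g h \<in> null_series \<eta>) \<and> \<nu> \<in> null_series \<eta>"
    "\<forall>\<eta> B. 0 < \<eta> \<longrightarrow> \<eta> \<le> 1 \<longrightarrow> absval uK * \<eta> powi jI \<le> 1 \<longrightarrow> gauss_bound \<eta> f B \<longrightarrow>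
       (\<forall>h. gauss_bound \<eta> (g h) B) \<and> gauss_bound \<eta> \<nu> B" by blast
  have b: "(\<forall>h. gauss_bound \<eta> (g h) B) \<and> gauss_bound \<eta> \<nu> B"
    if "admissible \<eta>" "gauss_bound \<eta> f B" for \<eta> B
    using g(4)[rule_format, of \<eta> B] that by (simp add: admissible_def)
  have b1: "(\<forall>h. gauss_bound 1 (g h) B) \<and> gauss_bound 1 \<nu> B" if "gauss_bound 1 f B" for B
    using g(4)[rule_format, of 1 B] that uK by simp
  show ?thesis using g(1,2,3) b b1 unfolding combination_def admissible_def by blast
qed

lemma division_bounded:
  assumes f: "f \<in> bounded_null_series \<alpha>" and \<alpha>: "admissible \<alpha>"
  shows "\<exists>g \<nu>. normal \<nu> \<and> f = combination g + \<nu> \<and> (\<forall>h. g h \<in> bounded_null_series \<alpha>) \<and> \<nu> \<in> bounded_null_series \<alpha> \<and>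
    (\<forall>B. gauss_bound 1 f B \<longrightarrow> (\<forall>h. gauss_bound 1 (g h) B) \<and> gauss_bound 1 \<nu> B) \<and>
    (\<forall>\<eta> B. admissible \<eta> \<longrightarrow> gauss_bound \<eta> f B \<longrightarrow> (\<forall>h. gauss_bound \<eta> (g h) B) \<and> gauss_bound \<eta> \<nu> B)"
proof -
  obtain B where fB: "f \<in> null_series \<alpha>" "gauss_bound 1 f B" using f by (auto simp: bounded_null_series_def)
  from division_admissible[OF fB(1) \<alpha>] obtain g \<nu> where g: "normal \<nu>" "f = combination g + \<nu>"
    "\<forall>\<eta>. admissible \<eta> \<longrightarrow> f \<in> null_series \<eta> \<longrightarrow> (\<forall>h. g h \<in> null_series \<eta>) \<and> \<nu> \<in> null_series \<eta>"
    "\<forall>\<eta> B. admissible \<eta> \<longrightarrow> gauss_bound \<eta> f B \<longrightarrow> (\<forall>h. gauss_bound \<eta> (g h) B) \<and> gauss_bound \<eta> \<nu> B"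
    "\<forall>B. gauss_bound 1 f B \<longrightarrow> (\<forall>h. gauss_bound 1 (g h) B) \<and> gauss_bound 1 \<nu> B" by blast
  have "g h \<in> bounded_null_series \<alpha>" "\<nu> \<in> bounded_null_series \<alpha>" for h
    unfolding bounded_null_series_def using g(3,5) fB \<alpha> by blast+
  then show ?thesis using g by blast
qed

lemma normal_bounded_combination_eq_0:
  assumes "normal \<nu>" "\<nu> = combination g" "\<And>h. h \<in> H \<Longrightarrow> g h \<in> bounded_null_series \<alpha>" "0 < \<alpha>" "\<alpha> < 1"
  shows "\<nu> = 0"
  using normal_in_ideal_eq_0[OF assms(1)] combination_extend_scalars[OF assms(3,4,5)] assms(2) by simp

text \<open>
  The coefficients of \<open>a\<close> may be unbounded, so the ideal \<open>I\<close> says nothing about this combination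
  directly; it is approximated by one with finitely many terms.
\<close>

theorem normal_combination_eq_0:
  assumes \<nu>: "normal \<nu>" "\<nu> \<in> null_series \<alpha>" and eq: "\<nu> = combination a"
    and a: "\<And>h. h \<in> H \<Longrightarrow> a h \<in> null_series \<alpha>" and \<alpha>: "admissible \<alpha>"
  shows "\<nu> = 0"
proof (rule gauss_bound_small_eq_0)
  have \<alpha>': "0 < \<alpha>" "\<alpha> < 1" using \<alpha> by (auto simp: admissible_def)
  show "\<alpha> > 0" by (rule \<alpha>')
  fix e :: real assume e: "e > 0"
  obtain D where D: "D \<ge> 1" "\<forall>h\<in>H. gauss_bound \<alpha> (r h) D" using r_bounds[OF \<alpha>'] by blast
  from null_series_truncate[OF \<nu>(2) e] obtain \<nu>' where \<nu>': "finite_series \<nu>'" "gauss_bound \<alpha> (\<nu> - \<nu>') e"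
    "\<forall>j i. \<nu>' j i = \<nu> j i \<or> \<nu>' j i = 0" by metis
  have eD: "e / D > 0" using e D by simp
  have "\<forall>h. \<exists>b. h \<in> H \<longrightarrow> finite_series b \<and> gauss_bound \<alpha> (a h - b) (e / D)"
    using null_series_truncate[OF a eD] by metis
  from choice[OF this] obtain b where b: "\<And>h. h \<in> H \<Longrightarrow> finite_series (b h)"
    "\<And>h. h \<in> H \<Longrightarrow> gauss_bound \<alpha> (a h - b h) (e / D)" by blast
  have fin: "f \<in> bounded_null_series \<alpha>" if "finite_series f" for f :: "('n, 'k) series"
  proof -
    have "f \<in> null_series 1" using that by (rule finite_series_null)
    then obtain B where "gauss_bound 1 f B" using null_series_bounded by blast
    then show ?thesis using finite_series_null[OF that] unfolding bounded_null_series_def by blast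
  qed
  have bn: "b h \<in> null_series \<alpha>" if "h \<in> H" for h using b(1)[OF that] by (rule finite_series_null)
  have cb: "combination b \<in> bounded_null_series \<alpha>"
    by (rule combination_bounded[OF _ \<alpha>']) (rule fin[OF b(1)])
  \<comment> \<open>\<open>?y\<close> is bounded because only finite series enter, apart from the
    \<open>r h\<close>, and small at \<alpha> because it is a difference of truncation errors. Its
    normal form turns out to be \<open>\<nu>'\<close>, which is therefore small as well.\<close>
  let ?y = "\<nu>' - combination b"
  have yb: "?y \<in> bounded_null_series \<alpha>"
    using bounded_null_series_closed(4)[OF \<alpha>'(1) fin[OF \<nu>'(1)] bounded_null_series_closed(3)[OF \<alpha>'(1) cb]] by simp
  have "combination (\<lambda>h. a h - b h) = combination a - combination b"
    by (rule combination_diff[OF a bn \<alpha>'])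
  then have "?y = combination (\<lambda>h. a h - b h) - (\<nu> - \<nu>')" using eq by simp
  moreover have "gauss_bound \<alpha> (combination (\<lambda>h. a h - b h)) e"
    unfolding combination_def
  proof (rule gauss_bound_sum[OF _ \<alpha>'(1)])
    fix h assume h: "h \<in> H"
    have "gauss_bound \<alpha> ((a h - b h) \<star> r h) (e / D * D)"
      by (rule gauss_bound_mult[OF b(2)[OF h] _ \<alpha>'(1)]) (use D h in blast)
    then show "gauss_bound \<alpha> ((a h - b h) \<star> r h) e" using D(1) by simp
  qed (use e in simp)
  ultimately have ye: "gauss_bound \<alpha> ?y e" using gauss_bound_diff[OF _ \<nu>'(2) \<alpha>'(1)] by (simp only:)
  from division_bounded[OF yb \<alpha>] obtain g \<mu> where g: "normal \<mu>" "?y = combination g + \<mu>"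
    "\<forall>h. g h \<in> bounded_null_series \<alpha>"
    "\<forall>\<eta> B. admissible \<eta> \<longrightarrow> gauss_bound \<eta> ?y B \<longrightarrow> (\<forall>h. gauss_bound \<eta> (g h) B) \<and> gauss_bound \<eta> \<mu> B" by blast
  have gn: "g h \<in> null_series \<alpha>" for h using g(3) by (simp add: bounded_null_series_def)
  have "normal \<nu>'" unfolding normal_def
  proof (intro allI impI)
    fix j i assume "\<nu>' j i \<noteq> 0"
    then have "\<nu> j i \<noteq> 0" using \<nu>'(3) by metis
    then show "i \<notin> L" using \<nu>(1) by (simp add: normal_def)
  qed
  then have "normal (\<nu>' - \<mu>)" using g(1) by (rule normal_diff)
  moreover have "\<nu>' - \<mu> = combination (\<lambda>h. g h + b h)"
    using g(2) combination_add[OF gn bn \<alpha>'] by (simp add: algebra_simps)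
  ultimately have "\<nu>' - \<mu> = 0"
    by (rule normal_bounded_combination_eq_0[where \<alpha> = \<alpha>])
       (use g(3) fin[OF b(1)] \<alpha>' in \<open>auto intro!: bounded_null_series_closed(4)\<close>)
  then have "gauss_bound \<alpha> \<nu>' e" using g(4) ye \<alpha> by simp
  from gauss_bound_add[OF \<nu>'(2) this \<alpha>'(1)] show "gauss_bound \<alpha> \<nu> e" by simp
qed

lemma normal_form_unique:
  assumes "normal \<nu>" "\<nu> \<in> null_series \<alpha>" "normal \<nu>'" "\<nu>' \<in> null_series \<alpha>"
    and "\<nu> - \<nu>' = combination a" "\<And>h. h \<in> H \<Longrightarrow> a h \<in> null_series \<alpha>" "admissible \<alpha>"
  shows "\<nu> = \<nu>'"
proof -
  have "\<nu> - \<nu>' = 0"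
    by (rule normal_combination_eq_0[OF normal_diff[OF assms(1,3)] null_series_diff[OF assms(2,4)] assms(5,6,7)])
       (use assms(7) in \<open>auto simp: admissible_def\<close>)
  then show ?thesis by simp
qed

lemma I_kappa_add_closed: "add_closed (I_kappa res I)"
  by (rule ideal_add_closed[OF I_kappa_ideal]) simp

lemma I_kappa_mult: "x \<in> I_kappa res I \<Longrightarrow> y * x \<in> I_kappa res I"
  using ideal.I_l_closed[OF I_kappa_ideal, of x y] by simp

lemma combination_in_I:
  assumes "\<And>h. h \<in> H \<Longrightarrow> g h \<in> carrier R_int"
  shows "combination g \<in> I"
  unfolding combination_def
  by (rule add_closed_sum[OF I_add_closed[OF ideal]]) (rule I_mult[OF ideal r_I assms])

text \<open>Replacing quotients and remainder by the lifts of their reductions changes the identity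
  by a multiple of \<open>uK\<close>. In exchange the poles are controlled exactly: the quotients of
  \<open>division\<close> are only small at exponents below \<open>J\<close>, those here are
  zero.\<close>

lemma digit_division:
  assumes f: "f \<in> carrier R_int" "\<And>j i. j < J \<Longrightarrow> f j i = 0" and \<alpha>: "admissible \<alpha>"
  shows "\<exists>g \<mu> e. (\<forall>h. g h \<in> carrier R_int \<and> finite_principal_part (g h)) \<and>
    f = combination g + lift_kseries \<mu> + scale uK e \<and>
    (\<forall>h j i. j < J \<longrightarrow> g h j i = 0) \<and> (\<forall>j i. j < J \<longrightarrow> kcoeff \<mu> (j, i) = 0) \<and>
    e \<in> carrier R_int \<and> (\<forall>j i. j < J + jI \<longrightarrow> e j i = 0) \<and>
    normal (lift_kseries \<mu>) \<and> reduce res f - \<mu> \<in> I_kappa res I \<and>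
    (reduce res f \<in> I_kappa res I \<longrightarrow> \<mu> = 0)"
proof -
  have \<alpha>': "0 < \<alpha>" "\<alpha> < 1" "\<alpha> \<le> 1" using \<alpha> by (auto simp: admissible_def)
  have f1: "gauss_bound 1 f 1" using f(1) by (simp add: R_int_carrier)
  have "finite_principal_part f" unfolding finite_principal_part_def
    by (rule exI[of _ J]) (use f(2) in auto)
  then have fn: "f \<in> null_series \<alpha>"
    by (rule null_series_principal[OF _ _ f1 \<alpha>'(1,2)]) (use f(1) in \<open>simp add: R_int_carrier\<close>)
  then have fb: "f \<in> bounded_null_series \<alpha>" using f1 by (auto simp: bounded_null_series_def)
  from division_bounded[OF fb \<alpha>] obtain g \<nu> where g: "normal \<nu>" "f = combination g + \<nu>"
    "\<forall>h. g h \<in> bounded_null_series \<alpha>" "\<nu> \<in> bounded_null_series \<alpha>"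
    "\<forall>B. gauss_bound 1 f B \<longrightarrow> (\<forall>h. gauss_bound 1 (g h) B) \<and> gauss_bound 1 \<nu> B"
    "\<forall>\<eta> B. admissible \<eta> \<longrightarrow> gauss_bound \<eta> f B \<longrightarrow> (\<forall>h. gauss_bound \<eta> (g h) B) \<and> gauss_bound \<eta> \<nu> B" by blast
  have gn: "g h \<in> null_series \<alpha>" "\<nu> \<in> null_series \<alpha>" for h using g(3,4) by (auto simp: bounded_null_series_def)
  have g1: "gauss_bound 1 (g h) 1" "gauss_bound 1 \<nu> 1" for h using g(5) f1 by blast+
  have gR: "g h \<in> carrier R_int" "\<nu> \<in> carrier R_int" for h
    using bounded_null_series_R_int[OF gn(1) g1(1) \<alpha>'(1,2)] bounded_null_series_R_int[OF gn(2) g1(2) \<alpha>'(1,2)] by blast+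
  have ga: "gauss_bound \<alpha> (g h) (\<alpha> powi J)" "gauss_bound \<alpha> \<nu> (\<alpha> powi J)" for h
    using g(6) \<alpha> gauss_bound_from_support[OF f1 f(2) \<alpha>'(1,3)] by simp_all
  \<comment> \<open>A series of \<alpha>-norm at most \<open>\<alpha> powi J\<close> has
    coefficients below 1 at all exponents \<open>j < J\<close>, so its reduction starts at
    \<open>J\<close> or later.\<close>
  have low: "kcoeff (reduce res x) (j, i) = 0" if x: "x \<in> carrier R_int" "gauss_bound \<alpha> x (\<alpha> powi J)" and j: "j < J" for x :: "('n, 'k) series" and j i
  proof -
    have "absval (x j i) * \<alpha> powi j \<le> \<alpha> powi J" by (rule gauss_boundD[OF x(2)])
    also have "\<alpha> powi J < \<alpha> powi j" using \<alpha>' j by (intro power_int_strict_decreasing) auto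
    finally have "absval (x j i) < 1" using \<alpha>' by simp
    then show ?thesis using res_eq_0_iff[of "x j i"] by (simp add: kcoeff_reduce[OF x(1)])
  qed
  define G where "G h = lift_kseries (reduce res (g h))" for h
  define \<mu> where "\<mu> = reduce res \<nu>"
  have GR: "G h \<in> carrier R_int" "finite_principal_part (G h)" for h by (auto simp: G_def lift_kseries_props)
  have Gn: "G h \<in> null_series \<alpha>" for h unfolding G_def by (rule lift_kseries_null[OF \<alpha>'(1,2)])
  have G0: "G h j i = 0" if "j < J" for h j i
    using low[OF gR(1) ga(1) that] by (simp add: G_def lift_kseries_def sect)
  have \<mu>0: "kcoeff \<mu> (j, i) = 0" if "j < J" for j i
    unfolding \<mu>_def by (rule low[OF gR(2) ga(2) that])
  have close: "gauss_bound 1 (x - lift_kseries (reduce res x)) (absval uK)" if "x \<in> carrier R_int" for x :: "('n, 'k) series"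
  proof -
    have d: "x - lift_kseries (reduce res x) \<in> carrier R_int" by (rule R_int_closed(4)[OF that lift_kseries_props(4)])
    have "reduce res (x - lift_kseries (reduce res x)) = 0"
      using reduce_diff[OF that lift_kseries_props(4) d] by (simp add: lift_kseries_props)
    then show ?thesis using reduce_eq_0_iff[OF d] by blast
  qed
  define d where "d = f - combination G - lift_kseries \<mu>"
  have cG: "combination G \<in> I" by (rule combination_in_I[OF GR(1)])
  have dR: "d \<in> carrier R_int"
    unfolding d_def by (intro R_int_closed f(1) I_carrier[OF ideal cG] lift_kseries_props)
  have "d = combination (\<lambda>h. g h - G h) + (\<nu> - lift_kseries \<mu>)"
    using combination_diff[OF gn(1) Gn \<alpha>'(1,2)] by (simp add: d_def g(2) algebra_simps)
  moreover have "gauss_bound 1 (combination (\<lambda>h. g h - G h)) (absval uK)"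
    unfolding combination_def
  proof (rule gauss_bound_sum)
    fix h assume "h \<in> H"
    have "gauss_bound 1 ((g h - G h) \<star> r h) (absval uK * 1)"
      unfolding G_def by (rule gauss_bound_mult[OF close[OF gR(1)] r_gauss_bound_1[OF \<open>h \<in> H\<close>]]) simp
    then show "gauss_bound 1 ((g h - G h) \<star> r h) (absval uK)" by simp
  qed auto
  ultimately have d1: "gauss_bound 1 d (absval uK)"
    using gauss_bound_add[OF _ close[OF gR(2)]] by (simp add: \<mu>_def)
  define e where "e = scale (inverse uK) d"
  have de: "d = scale uK e" using uK by (simp add: e_def)
  have "gauss_bound 1 e 1" unfolding e_def
    using d1 uK by (subst gauss_bound_scale_iff) (simp_all add: absval_inverse divide_inverse)
  then have eR: "e \<in> carrier R_int" unfolding e_def by (rule R_int_scaleI[OF dR])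
  have d0: "d j i = 0" if "j < J + jI" for j i
  proof -
    have jJ: "j < J" using that jI(1) by simp
    have "(G h \<star> r h) j i = 0" if "h \<in> H" for h
      by (rule series_mult_support[of J _ jI]) (use G0 jI(2)[OF that] \<open>j < J + jI\<close> in \<open>auto simp: not_le[symmetric]\<close>)
    then have "combination G j i = 0" by (simp add: combination_def sum_fun_apply2)
    then show ?thesis using f(2)[OF jJ] \<mu>0[OF jJ] by (simp add: d_def lift_kseries_def sect)
  qed
  have nm: "normal (lift_kseries \<mu>)"
    unfolding normal_def
  proof (intro allI impI)
    fix j i assume "lift_kseries \<mu> j i \<noteq> 0"
    then have "kcoeff \<mu> (j, i) \<noteq> 0" by (simp add: lift_kseries_nonzero)
    then have "\<nu> j i \<noteq> 0" unfolding \<mu>_def kcoeff_reduce[OF gR(2)] using res_0 by metis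
    then show "i \<notin> L" using g(1) by (simp add: normal_def)
  qed
  have cg: "combination g \<in> I" by (rule combination_in_I[OF gR(1)])
  have rf: "reduce res f = reduce res (combination g) + \<mu>"
    unfolding \<mu>_def g(2) by (rule reduce_add[OF I_carrier[OF ideal cg] gR(2)]) (use f(1) g(2) in simp)
  have "reduce res f - \<mu> \<in> I_kappa res I" using cg by (simp add: rf I_kappa_def)
  moreover have "\<mu> = 0" if "reduce res f \<in> I_kappa res I"
  proof -
    have "\<mu> = reduce res f - reduce res (combination g)" by (simp add: rf)
    also have "\<dots> \<in> I_kappa res I"
      using add_closedD(4)[OF I_kappa_add_closed that] cg by (simp add: I_kappa_def)
    finally show ?thesis using normal_unit_not_in_I_kappa[OF gR(2) g(1)] by (simp add: \<mu>_def)
  qed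
  moreover have "f = combination G + lift_kseries \<mu> + scale uK e"
    unfolding de[symmetric] d_def by (simp add: algebra_simps)
  moreover have "e j i = 0" if "j < J + jI" for j i
    using d0[OF that] by (simp add: e_def scale_def)
  ultimately show ?thesis using GR G0 \<mu>0 eR nm
    by (intro exI[of _ G] exI[of _ \<mu>] exI[of _ e]) blast
qed

end

section \<open>The ring of bounded overconvergent series\<close>

lemma bounded_null_series_mono:
  "f \<in> bounded_null_series \<eta> \<Longrightarrow> 0 < \<eta> \<Longrightarrow> \<eta> \<le> \<eta>' \<Longrightarrow> \<eta>' < 1 \<Longrightarrow> f \<in> bounded_null_series \<eta>'"
  unfolding bounded_null_series_def using null_series_mono_bounded by blast

text \<open>The union over all radii is made a type in order to have the ring laws without side conditions.\<close>

typedef (overloaded) ('n, 'k) oseries =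
  "{f :: ('n::finite, 'k::complete_discretely_valued_field) series. \<exists>\<eta>. 0 < \<eta> \<and> \<eta> < 1 \<and> f \<in> bounded_null_series \<eta>}"
  morphisms rep_o Abs_o
proof -
  have "0 \<in> bounded_null_series (1/2)" by (rule bounded_null_series_closed) simp
  then show ?thesis by (intro exI[of _ 0] CollectI exI[of _ "1/2"]) simp
qed

setup_lifting type_definition_oseries

lemma oseries_common:
  assumes "\<exists>\<eta>. 0 < \<eta> \<and> \<eta> < 1 \<and> f \<in> bounded_null_series \<eta>" "\<exists>\<eta>. 0 < \<eta> \<and> \<eta> < 1 \<and> g \<in> bounded_null_series \<eta>"
  shows "\<exists>\<eta>. 0 < \<eta> \<and> \<eta> < 1 \<and> f \<in> bounded_null_series \<eta> \<and> g \<in> bounded_null_series \<eta>"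
proof -
  obtain a b where ab: "0 < a" "a < 1" "f \<in> bounded_null_series a" "0 < b" "b < 1" "g \<in> bounded_null_series b"
    using assms by blast
  have "f \<in> bounded_null_series (max a b)" by (rule bounded_null_series_mono[OF ab(3,1)]) (use ab in auto)
  moreover have "g \<in> bounded_null_series (max a b)" by (rule bounded_null_series_mono[OF ab(6,4)]) (use ab in auto)
  ultimately show ?thesis using ab by (intro exI[of _ "max a b"]) auto
qed

lemma oseries_closed:
  assumes "\<exists>\<eta>. 0 < \<eta> \<and> \<eta> < 1 \<and> f \<in> bounded_null_series \<eta>" "\<exists>\<eta>. 0 < \<eta> \<and> \<eta> < 1 \<and> g \<in> bounded_null_series \<eta>"
  shows "\<exists>\<eta>. 0 < \<eta> \<and> \<eta> < 1 \<and> f + g \<in> bounded_null_series \<eta>"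
    "\<exists>\<eta>. 0 < \<eta> \<and> \<eta> < 1 \<and> f + - g \<in> bounded_null_series \<eta>"
    "\<exists>\<eta>. 0 < \<eta> \<and> \<eta> < 1 \<and> f \<star> g \<in> bounded_null_series \<eta>"
proof -
  obtain \<eta> where \<eta>: "0 < \<eta>" "\<eta> < 1" "f \<in> bounded_null_series \<eta>" "g \<in> bounded_null_series \<eta>"
    using oseries_common[OF assms] by blast
  note cl = bounded_null_series_closed[OF \<eta>(1)]
  show "\<exists>\<eta>. 0 < \<eta> \<and> \<eta> < 1 \<and> f + g \<in> bounded_null_series \<eta>" using cl(4)[OF \<eta>(3,4)] \<eta>(1,2) by blast
  show "\<exists>\<eta>. 0 < \<eta> \<and> \<eta> < 1 \<and> f + - g \<in> bounded_null_series \<eta>" using cl(4)[OF \<eta>(3) cl(3)[OF \<eta>(4)]] \<eta>(1,2) by blast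
  show "\<exists>\<eta>. 0 < \<eta> \<and> \<eta> < 1 \<and> f \<star> g \<in> bounded_null_series \<eta>" using cl(5)[OF \<eta>(3,4)] \<eta>(1,2) by blast
qed

instantiation oseries :: (finite, complete_discretely_valued_field) comm_ring_1
begin

lift_definition zero_oseries :: "('a, 'b) oseries" is 0
  by (rule exI[of _ "1/2"]) (use bounded_null_series_closed(1)[of "1/2"] in simp)

lift_definition one_oseries :: "('a, 'b) oseries" is series_one
  by (rule exI[of _ "1/2"]) (use bounded_null_series_closed(2)[of "1/2"] in simp)

lift_definition uminus_oseries :: "('a, 'b) oseries \<Rightarrow> ('a, 'b) oseries" is "\<lambda>f. - f"
  using bounded_null_series_closed(3) by blast

lift_definition plus_oseries :: "('a, 'b) oseries \<Rightarrow> ('a, 'b) oseries \<Rightarrow> ('a, 'b) oseries" is "\<lambda>f g. f + g"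
  by (rule oseries_closed(1))

lift_definition minus_oseries :: "('a, 'b) oseries \<Rightarrow> ('a, 'b) oseries \<Rightarrow> ('a, 'b) oseries" is "\<lambda>f g. f + - g"
  by (rule oseries_closed(2))

lift_definition times_oseries :: "('a, 'b) oseries \<Rightarrow> ('a, 'b) oseries \<Rightarrow> ('a, 'b) oseries" is "\<lambda>f g. f \<star> g"
  by (rule oseries_closed(3))

lemma rep_o_common_radius:
  fixes x y z :: "('a, 'b) oseries"
  shows "\<exists>\<eta>>0. rep_o x \<in> null_series \<eta> \<and> rep_o y \<in> null_series \<eta> \<and> rep_o z \<in> null_series \<eta>"
proof -
  have ex: "\<exists>\<eta>. 0 < \<eta> \<and> \<eta> < 1 \<and> rep_o x \<in> bounded_null_series \<eta>" for x :: "('a, 'b) oseries"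
    using rep_o[of x] by simp
  obtain a where a: "0 < a" "a < 1" "rep_o x \<in> bounded_null_series a" "rep_o y \<in> bounded_null_series a"
    using oseries_common[OF ex[of x] ex[of y]] by blast
  obtain b where b: "0 < b" "b < 1" "rep_o z \<in> bounded_null_series b" using ex[of z] by blast
  let ?c = "max a b"
  have "rep_o x \<in> bounded_null_series ?c" "rep_o y \<in> bounded_null_series ?c"
    by (rule bounded_null_series_mono[OF a(3,1)] bounded_null_series_mono[OF a(4,1)]; use a b in simp)+
  moreover have "rep_o z \<in> bounded_null_series ?c"
    by (rule bounded_null_series_mono[OF b(3,1)]) (use a b in simp_all)
  ultimately show ?thesis using a by (intro exI[of _ ?c]) (simp add: bounded_null_series_def)
qed

instance
proof
  fix a b c :: "('a, 'b) oseries"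
  obtain \<eta> where \<eta>: "\<eta> > 0" "rep_o a \<in> null_series \<eta>" "rep_o b \<in> null_series \<eta>" "rep_o c \<in> null_series \<eta>"
    using rep_o_common_radius by blast
  note ri = rep_o_inject[THEN iffD1]
  show "a + b + c = a + (b + c)" by (rule ri) (simp only: plus_oseries.rep_eq add.assoc)
  show "a + b = b + a" by (rule ri) (simp only: plus_oseries.rep_eq add.commute)
  show "0 + a = a" by (rule ri) (simp only: plus_oseries.rep_eq zero_oseries.rep_eq add_0_left)
  show "- a + a = 0" by (rule ri) (simp only: plus_oseries.rep_eq zero_oseries.rep_eq uminus_oseries.rep_eq left_minus)
  show "a - b = a + - b" by (rule ri) (simp only: plus_oseries.rep_eq minus_oseries.rep_eq uminus_oseries.rep_eq)
  show "a * b * c = a * (b * c)" by (rule ri) (simp only: times_oseries.rep_eq null_mult_assoc[OF \<eta>])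
  show "a * b = b * a" by (rule ri) (simp only: times_oseries.rep_eq series_mult_commute)
  show "1 * a = a" by (rule ri) (simp only: times_oseries.rep_eq one_oseries.rep_eq series_one_mult)
  show "(a + b) * c = a * c + b * c"
    by (rule ri) (simp only: times_oseries.rep_eq plus_oseries.rep_eq null_mult_add_left[OF \<eta>])
  show "(0 :: ('a, 'b) oseries) \<noteq> 1"
  proof
    assume "(0 :: ('a, 'b) oseries) = 1"
    then have "rep_o (0 :: ('a, 'b) oseries) 0 0 = rep_o 1 0 0" by simp
    then show False by (simp add: series_monom_def zero_oseries.rep_eq one_oseries.rep_eq)
  qed
qed

end

lemma rep_o_simps:
  "rep_o (x + y) = rep_o x + rep_o y" "rep_o (x * y) = rep_o x \<star> rep_o y" "rep_o (- x) = - rep_o x"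
  "rep_o 0 = 0" "rep_o 1 = series_one" "rep_o (x - y) = rep_o x - rep_o y"
  by (simp_all only: plus_oseries.rep_eq times_oseries.rep_eq uminus_oseries.rep_eq zero_oseries.rep_eq
      one_oseries.rep_eq minus_oseries.rep_eq add_uminus_conv_diff)

lemma rep_o_Abs:
  "f \<in> bounded_null_series \<eta> \<Longrightarrow> 0 < \<eta> \<Longrightarrow> \<eta> < 1 \<Longrightarrow> rep_o (Abs_o f) = f"
  by (rule Abs_o_inverse) blast

definition obound :: "real \<Rightarrow> ('n::finite, 'k::complete_discretely_valued_field) oseries \<Rightarrow> real \<Rightarrow> bool" where
  "obound \<eta> x B \<longleftrightarrow> gauss_bound \<eta> (rep_o x) B"

lemma obound_0: "B \<ge> 0 \<Longrightarrow> obound \<eta> 0 B"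
  by (simp add: obound_def rep_o_simps)

lemma obound_1: "obound \<eta> 1 1"
  by (simp add: obound_def rep_o_simps gauss_bound_series_monom)

lemma obound_add: "obound \<eta> x B \<Longrightarrow> obound \<eta> y B \<Longrightarrow> \<eta> > 0 \<Longrightarrow> obound \<eta> (x + y) B"
  by (simp add: obound_def rep_o_simps(1) gauss_bound_add del: plus_fun_apply)

lemma obound_diff: "obound \<eta> x B \<Longrightarrow> obound \<eta> y B \<Longrightarrow> \<eta> > 0 \<Longrightarrow> obound \<eta> (x - y) B"
  by (simp add: obound_def rep_o_simps(6) gauss_bound_diff)

lemma obound_mult: "obound \<eta> x A \<Longrightarrow> obound \<eta> y B \<Longrightarrow> \<eta> > 0 \<Longrightarrow> obound \<eta> (x * y) (A * B)"
  by (simp add: obound_def rep_o_simps(2) gauss_bound_mult)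

lemma obound_mono: "obound \<eta> x A \<Longrightarrow> A \<le> B \<Longrightarrow> obound \<eta> x B"
  unfolding obound_def by (rule gauss_bound_mono)

lemma obound_of_nat: "\<eta> > 0 \<Longrightarrow> obound \<eta> (of_nat n) 1"
  by (induction n) (auto intro!: obound_add obound_1 obound_0)

lemma obound_numeral_mult: "obound \<eta> x B \<Longrightarrow> \<eta> > 0 \<Longrightarrow> obound \<eta> (numeral n * x) B"
  using obound_mult[OF obound_of_nat[of \<eta> "numeral n"], of x B] by simp

lemma obound_numeral: "\<eta> > 0 \<Longrightarrow> obound \<eta> (numeral n) 1"
  using obound_of_nat[of \<eta> "numeral n"] by simp

lemma obound_power: "obound \<eta> x B \<Longrightarrow> \<eta> > 0 \<Longrightarrow> obound \<eta> (x ^ n) (B ^ n)"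
  by (induction n) (auto intro: obound_1 obound_mult)

lemma obound_nonneg: "obound \<eta> x B \<Longrightarrow> \<eta> > 0 \<Longrightarrow> B \<ge> 0"
  unfolding obound_def by (rule gauss_bound_nonneg)

definition onull :: "real \<Rightarrow> ('n::finite, 'k::complete_discretely_valued_field) oseries \<Rightarrow> bool" where
  "onull \<eta> x \<longleftrightarrow> rep_o x \<in> bounded_null_series \<eta>"

lemma onull_closed:
  assumes "\<eta> > 0"
  shows "onull \<eta> 0" "onull \<eta> 1" "onull \<eta> x \<Longrightarrow> onull \<eta> y \<Longrightarrow> onull \<eta> (x + y)"
    "onull \<eta> x \<Longrightarrow> onull \<eta> y \<Longrightarrow> onull \<eta> (x * y)" "onull \<eta> x \<Longrightarrow> onull \<eta> y \<Longrightarrow> onull \<eta> (x - y)"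
proof -
  note cl = bounded_null_series_closed[OF assms]
  show "onull \<eta> 0" "onull \<eta> 1" using cl(1,2) by (simp_all only: onull_def rep_o_simps)
  show "onull \<eta> x \<Longrightarrow> onull \<eta> y \<Longrightarrow> onull \<eta> (x + y)" "onull \<eta> x \<Longrightarrow> onull \<eta> y \<Longrightarrow> onull \<eta> (x * y)"
    using cl(4,5) by (simp_all only: onull_def rep_o_simps)
  assume "onull \<eta> x" "onull \<eta> y"
  then have "rep_o x + - rep_o y \<in> bounded_null_series \<eta>" unfolding onull_def by (intro cl(4) cl(3))
  then show "onull \<eta> (x - y)" by (simp only: onull_def rep_o_simps add_uminus_conv_diff)
qed

lemma onull_of_nat: "\<eta> > 0 \<Longrightarrow> onull \<eta> (of_nat n)"
  by (induction n) (auto intro!: onull_closed)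

lemma onull_numeral: "\<eta> > 0 \<Longrightarrow> onull \<eta> (numeral n)"
  using onull_of_nat[of \<eta> "numeral n"] by simp

lemma obound_sum: "\<eta> > 0 \<Longrightarrow> B \<ge> 0 \<Longrightarrow> (\<And>x. x \<in> A \<Longrightarrow> obound \<eta> (f x) B) \<Longrightarrow> obound \<eta> (sum f A) B"
  by (induction A rule: infinite_finite_induct) (auto intro!: obound_add obound_0)

lemma onull_R_int: "onull \<eta> x \<Longrightarrow> 0 < \<eta> \<Longrightarrow> \<eta> < 1 \<Longrightarrow> obound 1 x 1 \<Longrightarrow> rep_o x \<in> carrier R_int"
  unfolding onull_def bounded_null_series_def obound_def by (rule bounded_null_series_R_int) auto

section \<open>Lifting idempotents\<close>

text \<open>Newton's iteration for \<open>x\<^sup>2 - x\<close>; \<open>d\<close> collects the part of \<open>e\<^sup>2 - e\<close> that lies in the ideal.\<close>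

lemma newton_identity:
  fixes e h d :: "'a::comm_ring_1"
  assumes "e * e = e + h + d"
  shows "(e + (1 - 2 * e) * h) * (e + (1 - 2 * e) * h) =
    (e + (1 - 2 * e) * h) + h * h * (4 * h - 3) + d * ((1 - 2 * h) * (1 - 2 * h))"
proof -
  have "(e + (1 - 2 * e) * h) * (e + (1 - 2 * e) * h) =
      e * e + 2 * h * e - 4 * h * (e * e) + h * h - 4 * h * h * e + 4 * h * h * (e * e)"
    by (simp add: algebra_simps)
  also have "\<dots> = (e + (1 - 2 * e) * h) + h * h * (4 * h - 3) + d * ((1 - 2 * h) * (1 - 2 * h))"
    unfolding assms by (simp add: algebra_simps)
  finally show ?thesis .
qed

text \<open>Convergence takes place at \<alpha>, where \<open>h\<close> has norm below 1; at radius
  1 only bounds are propagated. When \<open>q < 1\<close>, the bound on \<open>E - e\<close> ensures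
  that lift and start have the same reduction.\<close>

theorem idempotent_lift:
  fixes e h d :: "('n::finite, 'k::complete_discretely_valued_field) oseries"
  assumes \<alpha>: "0 < \<alpha>" "\<alpha> < 1" and eq: "e * e = e + h + d"
    and on: "onull \<alpha> e" "onull \<alpha> h" "onull \<alpha> d"
    and b1: "obound 1 e 1" "obound 1 h q" "obound 1 d 1" and q: "q \<le> 1"
    and th: "obound \<alpha> h \<theta>" "\<theta> < 1"
  shows "\<exists>E P. onull \<alpha> E \<and> onull \<alpha> P \<and> obound 1 E 1 \<and> obound 1 P 1 \<and> obound 1 (E - e) q \<and> E * E = E + d * P"
proof -
  define next_h where "next_h h = h * h * (4 * h - 3)" for h :: "('n, 'k) oseries"
  \<comment> \<open>The factor \<open>1 - 2 * e\<close> replaces division by the derivative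
    \<open>2 * e - 1\<close>, whose square is 1 modulo \<open>e * e - e\<close>. The third component
    collects the factors by which the ideal part is multiplied, so that it stays a multiple of the
    original \<open>d\<close>.\<close>
  define it where "it = rec_nat (e, h, 1) (\<lambda>_ (e, h, P). (e + (1 - 2 * e) * h, next_h h, P * ((1 - 2 * h) * (1 - 2 * h))))"
  define es where "es n = fst (it n)" for n
  define hs where "hs n = fst (snd (it n))" for n
  define Ps where "Ps n = snd (snd (it n))" for n
  have init: "es 0 = e" "hs 0 = h" "Ps 0 = 1" by (simp_all add: es_def hs_def Ps_def it_def)
  have stp: "es (Suc n) = es n + (1 - 2 * es n) * hs n" "hs (Suc n) = next_h (hs n)"
    "Ps (Suc n) = Ps n * ((1 - 2 * hs n) * (1 - 2 * hs n))" for n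
    by (simp_all add: es_def hs_def Ps_def it_def case_prod_unfold)
  have on_n: "onull \<alpha> (es n) \<and> onull \<alpha> (hs n) \<and> onull \<alpha> (Ps n)" for n
  proof (induction n)
    case (Suc n)
    then show ?case unfolding stp next_h_def
      by (intro conjI onull_closed onull_numeral \<alpha>(1)) auto
  qed (auto simp: init on onull_closed \<alpha>)
  have eq_n: "es n * es n = es n + hs n + d * Ps n" for n
  proof (induction n)
    case (Suc n)
    show ?case using newton_identity[OF Suc] unfolding stp next_h_def by (simp only: mult.assoc)
  qed (simp add: init eq)
  have \<theta>0: "\<theta> \<ge> 0" using obound_nonneg[OF th(1) \<alpha>(1)] .
  have q0: "q \<ge> 0" using obound_nonneg[OF b1(2)] by simp
  have hb: "obound \<eta> (next_h x) (t * t)" if "obound \<eta> x t" "t \<le> 1" "\<eta> > 0" for \<eta> x t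
  proof -
    have "obound \<eta> (4 * x - 3) 1"
      by (intro obound_diff obound_numeral that obound_numeral_mult obound_mono[OF that(1,2)])
    then have "obound \<eta> (next_h x) (t * t * 1)" unfolding next_h_def by (intro obound_mult that)
    then show ?thesis by simp
  qed
  \<comment> \<open>The decay is quadratic, but the geometric rate that \<open>series_limit\<close>
    asks for is enough.\<close>
  have h\<alpha>: "obound \<alpha> (hs n) (\<theta> * \<theta> ^ n)" for n
  proof (induction n)
    case (Suc n)
    have le: "\<theta> * \<theta> ^ n \<le> \<theta>" using \<theta>0 th(2) by (intro mult_left_le power_le_one) auto
    then have le: "\<theta> * \<theta> ^ n \<le> \<theta>" "\<theta> * \<theta> ^ n \<le> 1" using th(2) by linarith+
    have "obound \<alpha> (hs (Suc n)) ((\<theta> * \<theta> ^ n) * (\<theta> * \<theta> ^ n))"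
      unfolding stp by (rule hb[OF Suc le(2) \<alpha>(1)])
    moreover have "(\<theta> * \<theta> ^ n) * (\<theta> * \<theta> ^ n) \<le> \<theta> * (\<theta> * \<theta> ^ n)"
      using le(1) \<theta>0 by (intro mult_right_mono) auto
    ultimately show ?case by (auto intro: obound_mono simp: mult_ac)
  qed (simp add: init th)
  have h1: "obound 1 (hs n) q" for n
  proof (induction n)
    case (Suc n)
    have "obound 1 (hs (Suc n)) (q * q)" unfolding stp by (rule hb[OF Suc q]) simp
    then show ?case using q q0 by (auto elim!: obound_mono simp: mult_left_le)
  qed (simp add: init b1)
  have \<theta>n: "\<theta> * \<theta> ^ n \<le> 1" for n
    using mult_le_one[of \<theta> "\<theta> ^ n"] power_le_one[of \<theta> n] \<theta>0 th(2) by simp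
  have h\<alpha>1: "obound \<alpha> (hs n) 1" for n
    by (rule obound_mono[OF h\<alpha> \<theta>n])
  have h11: "obound 1 (hs n) 1" for n using obound_mono[OF h1 q] .
  have two\<alpha>: "obound \<alpha> (1 - 2 * hs n) 1" and two1: "obound 1 (1 - 2 * hs n) 1" for n
    by (intro obound_diff obound_1 obound_numeral_mult h\<alpha>1 h11 \<alpha>(1) zero_less_one)+
  have P\<alpha>: "obound \<alpha> (Ps n) 1" for n
  proof (induction n)
    case (Suc n)
    have "obound \<alpha> (Ps (Suc n)) (1 * (1 * 1))" unfolding stp by (intro obound_mult Suc two\<alpha> \<alpha>)
    then show ?case by simp
  qed (simp add: init obound_1)
  have P1: "obound 1 (Ps n) 1" for n
  proof (induction n)
    case (Suc n)
    have "obound 1 (Ps (Suc n)) (1 * (1 * 1))" unfolding stp by (intro obound_mult Suc two1 zero_less_one)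
    then show ?case by simp
  qed (simp add: init obound_1)
  have e1: "obound 1 (es n) 1" for n
  proof (induction n)
    case (Suc n)
    have "obound 1 ((1 - 2 * es n) * hs n) (1 * 1)"
      by (intro obound_mult obound_diff obound_1 obound_numeral_mult Suc h11 zero_less_one)
    then show ?case unfolding stp using Suc by (intro obound_add) auto
  qed (simp add: init b1)
  obtain M0 where M0: "gauss_bound \<alpha> (rep_o e) M0"
    using on(1) null_series_bounded unfolding onull_def bounded_null_series_def by blast
  define M where "M = max 1 M0"
  have M: "M \<ge> 1" "obound \<alpha> e M" using M0 gauss_bound_mono unfolding obound_def M_def by fastforce+
  \<comment> \<open>The estimate is made for \<open>1 - 2 * es n\<close> because this quantity is
    multiplicative along the iteration: each step multiplies it by \<open>1 - 2 * hs n\<close>, of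
    norm at most 1.\<close>
  have t\<alpha>: "obound \<alpha> (1 - 2 * es n) M" for n
  proof (induction n)
    case 0
    show ?case unfolding init
      by (intro obound_diff obound_mono[OF obound_1 M(1)] obound_numeral_mult M(2) \<alpha>(1))
  next
    case (Suc n)
    have "1 - 2 * es (Suc n) = (1 - 2 * es n) * (1 - 2 * hs n)" unfolding stp by (simp add: algebra_simps)
    then show ?case using obound_mult[OF Suc two\<alpha> \<alpha>(1)] by simp
  qed
  have de: "es (Suc n) - es n = (1 - 2 * es n) * hs n" for n unfolding stp by simp
  have dP: "Ps (Suc n) - Ps n = 4 * (Ps n * (hs n * (hs n - 1)))" for n unfolding stp by (simp add: algebra_simps)
  have de\<alpha>: "gauss_bound \<alpha> (rep_o (es (Suc n)) - rep_o (es n)) (M * \<theta> * \<theta> ^ n)" for n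
    using obound_mult[OF t\<alpha> h\<alpha> \<alpha>(1), of n n] unfolding de[symmetric] obound_def by (simp only: rep_o_simps mult.assoc)
  have de1: "gauss_bound 1 (rep_o (es (Suc n)) - rep_o (es n)) (q * 1 ^ n)" for n
  proof -
    have "obound 1 ((1 - 2 * es n) * hs n) (1 * q)"
      by (intro obound_mult obound_diff obound_1 obound_numeral_mult e1 h1 zero_less_one)
    then show ?thesis unfolding de[symmetric] obound_def by (simp only: rep_o_simps power_one mult_1_right mult_1_left)
  qed
  have dP\<alpha>: "gauss_bound \<alpha> (rep_o (Ps (Suc n)) - rep_o (Ps n)) (\<theta> * \<theta> ^ n)" for n
  proof -
    have "obound \<alpha> (4 * (Ps n * (hs n * (hs n - 1)))) (1 * (\<theta> * \<theta> ^ n * 1))"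
      by (intro obound_numeral_mult obound_mult obound_diff P\<alpha> h\<alpha> h\<alpha>1 obound_1 \<alpha>(1))
    then show ?thesis unfolding dP[symmetric] obound_def by (simp only: rep_o_simps mult_1_right mult_1_left)
  qed
  from series_limit[where x = "\<lambda>n. rep_o (es n)", OF \<alpha>(1) \<theta>0 th(2) de\<alpha>]
  obtain E where E: "\<And>\<eta> B. (\<forall>n. gauss_bound \<eta> (rep_o (es n)) B) \<Longrightarrow> gauss_bound \<eta> E B"
    "\<And>\<eta> M' \<rho>' n. \<eta> > 0 \<Longrightarrow> 0 \<le> \<rho>' \<Longrightarrow> \<rho>' \<le> 1 \<Longrightarrow> (\<forall>n. gauss_bound \<eta> (rep_o (es (Suc n)) - rep_o (es n)) (M' * \<rho>' ^ n)) \<Longrightarrow>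
       gauss_bound \<eta> (E - rep_o (es n)) (M' * \<rho>' ^ n)" by blast
  from series_limit[where x = "\<lambda>n. rep_o (Ps n)", OF \<alpha>(1) \<theta>0 th(2) dP\<alpha>]
  obtain P where P: "\<And>\<eta> B. (\<forall>n. gauss_bound \<eta> (rep_o (Ps n)) B) \<Longrightarrow> gauss_bound \<eta> P B"
    "\<And>\<eta> M' \<rho>' n. \<eta> > 0 \<Longrightarrow> 0 \<le> \<rho>' \<Longrightarrow> \<rho>' \<le> 1 \<Longrightarrow> (\<forall>n. gauss_bound \<eta> (rep_o (Ps (Suc n)) - rep_o (Ps n)) (M' * \<rho>' ^ n)) \<Longrightarrow>
       gauss_bound \<eta> (P - rep_o (Ps n)) (M' * \<rho>' ^ n)" by blast
  have E\<alpha>: "gauss_bound \<alpha> (E - rep_o (es n)) (M * \<theta> * \<theta> ^ n)" for n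
    by (rule E(2)[OF \<alpha>(1) \<theta>0]) (use th(2) de\<alpha> in auto)
  have P\<alpha>': "gauss_bound \<alpha> (P - rep_o (Ps n)) (\<theta> * \<theta> ^ n)" for n
    by (rule P(2)[OF \<alpha>(1) \<theta>0]) (use th(2) dP\<alpha> in auto)
  have E0: "gauss_bound 1 (E - rep_o (es 0)) (q * 1 ^ 0)" by (rule E(2)) (use de1 in auto)
  have E1: "gauss_bound 1 E 1" and P11: "gauss_bound 1 P 1" using e1 P1 E(1) P(1) unfolding obound_def by blast+
  have small: "\<exists>n. C * \<theta> ^ n \<le> x" if "x > 0" for C x
  proof -
    have "(\<lambda>n. C * \<theta> ^ n) \<longlonglongrightarrow> C * 0"
      using \<theta>0 th(2) by (intro tendsto_mult tendsto_const LIMSEQ_realpow_zero) auto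
    then have "eventually (\<lambda>n. C * \<theta> ^ n < x) sequentially"
      by (rule order_tendstoD(2)) (use that in simp)
    then show ?thesis by (auto simp: eventually_sequentially intro: less_imp_le)
  qed
  have En: "E \<in> null_series \<alpha>"
  proof (rule null_series_closed_limit[OF _ \<alpha>(1)])
    fix x :: real assume "x > 0"
    then obtain n where "M * \<theta> * \<theta> ^ n \<le> x" using small by blast
    then show "\<exists>g\<in>null_series \<alpha>. gauss_bound \<alpha> (E - g) x"
      using gauss_bound_mono[OF E\<alpha>] on_n[of n] unfolding onull_def bounded_null_series_def by blast
  qed
  have Pn: "P \<in> null_series \<alpha>"
  proof (rule null_series_closed_limit[OF _ \<alpha>(1)])
    fix x :: real assume "x > 0"
    then obtain n where "\<theta> * \<theta> ^ n \<le> x" using small by blast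
    then show "\<exists>g\<in>null_series \<alpha>. gauss_bound \<alpha> (P - g) x"
      using gauss_bound_mono[OF P\<alpha>'] on_n[of n] unfolding onull_def bounded_null_series_def by blast
  qed
  have Eb: "E \<in> bounded_null_series \<alpha>" and Pb: "P \<in> bounded_null_series \<alpha>"
    using En E1 Pn P11 by (auto simp: bounded_null_series_def)
  define E' P' where "E' = Abs_o E" and "P' = Abs_o P"
  have rE: "rep_o E' = E" and rP: "rep_o P' = P"
    unfolding E'_def P'_def by (rule rep_o_Abs[OF Eb \<alpha>] rep_o_Abs[OF Pb \<alpha>])+
  have oE: "obound \<alpha> (E' - es n) (M * \<theta> * \<theta> ^ n)" "obound \<alpha> (P' - Ps n) (\<theta> * \<theta> ^ n)" for n
    using E\<alpha> P\<alpha>' by (simp_all only: obound_def rep_o_simps rE rP)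
  have EM: "obound \<alpha> E' M"
  proof -
    have "obound \<alpha> ((E' - es 0) + e) M"
      by (intro obound_add M \<alpha>(1) obound_mono[OF oE(1)]) (use M(1) th(2) in simp)
    then show ?thesis by (simp add: init)
  qed
  have esM: "obound \<alpha> (es n) M" for n
  proof -
    have "M * \<theta> * \<theta> ^ n \<le> M" using mult_left_mono[OF \<theta>n, of M n] M(1) by (simp add: mult.assoc)
    from obound_diff[OF EM obound_mono[OF oE(1) this] \<alpha>(1)] show ?thesis by simp
  qed
  obtain D where D: "D \<ge> 1" "obound \<alpha> d D"
  proof -
    obtain D0 where "gauss_bound \<alpha> (rep_o d) D0"
      using on(3) null_series_bounded unfolding onull_def bounded_null_series_def by blast
    then have "obound \<alpha> d (max 1 D0)" unfolding obound_def by (rule gauss_bound_mono) simp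
    then show ?thesis by (rule that[rotated]) simp
  qed
  have "rep_o (E' * E' - E' - d * P') = 0"
  proof (rule gauss_bound_small_eq_0[OF _ \<alpha>(1)])
    fix x :: real assume x: "x > 0"
    obtain n where n: "(M * M * D) * \<theta> ^ n \<le> x" using small[OF x] by blast
    have MD: "1 \<le> M * M" "1 \<le> M * D" "M * M \<le> M * M * D" "D \<le> M * M * D" "M \<le> M * M * D" "1 \<le> M * M * D"
    proof -
      show 1: "1 \<le> M * M" using mult_mono[OF M(1) M(1)] M(1) by simp
      show "1 \<le> M * D" using mult_mono[OF M(1) D(1)] M(1) by simp
      show 2: "M * M \<le> M * M * D" using mult_left_mono[OF D(1), of "M * M"] 1 by simp
      show "D \<le> M * M * D" using mult_right_mono[OF 1, of D] D(1) by simp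
      have "M \<le> M * M" using mult_left_mono[OF M(1), of M] M(1) by simp
      then show "M \<le> M * M * D" "1 \<le> M * M * D" using 1 2 by linarith+
    qed
    have t1: "\<theta> * \<theta> ^ n \<le> \<theta> ^ n" using \<theta>0 th(2) mult_right_mono[of \<theta> 1 "\<theta> ^ n"] by simp
    have le: "C * (\<theta> * \<theta> ^ n) \<le> x" if "0 \<le> C" "C \<le> M * M * D" for C
    proof -
      have "C * (\<theta> * \<theta> ^ n) \<le> (M * M * D) * \<theta> ^ n" using that t1 \<theta>0 by (intro mult_mono) auto
      then show ?thesis using n by linarith
    qed
    \<comment> \<open>Every summand contains one of the errors \<open>E' - es n\<close>,
      \<open>P' - Ps n\<close> and \<open>hs n\<close>, all of which are small at \<alpha>.\<close>
    have "E' * E' - E' - d * P' = (E' - es n) * (E' + es n) - (E' - es n) - d * (P' - Ps n) + hs n"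
      using eq_n[of n] by (simp add: algebra_simps)
    also have "obound \<alpha> \<dots> x"
    proof (rule obound_add[OF obound_diff[OF obound_diff[OF _ _ \<alpha>(1)] _ \<alpha>(1)] _ \<alpha>(1)])
      have "obound \<alpha> ((E' - es n) * (E' + es n)) (M * \<theta> * \<theta> ^ n * M)"
        by (intro obound_mult obound_add oE EM esM \<alpha>(1))
      then show "obound \<alpha> ((E' - es n) * (E' + es n)) x"
        by (rule obound_mono) (use le[of "M * M"] MD(1,3) in \<open>simp add: mult_ac\<close>)
      show "obound \<alpha> (E' - es n) x"
        by (rule obound_mono[OF oE(1)]) (use le[of M] MD(5) M(1) in \<open>simp add: mult_ac\<close>)
      have "obound \<alpha> (d * (P' - Ps n)) (D * (\<theta> * \<theta> ^ n))" by (intro obound_mult oE D \<alpha>(1))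
      then show "obound \<alpha> (d * (P' - Ps n)) x"
        by (rule obound_mono) (use le[of D] MD(4) D(1) in simp)
      show "obound \<alpha> (hs n) x"
        by (rule obound_mono[OF h\<alpha>]) (use le[of 1] MD(6) in simp)
    qed
    finally show "gauss_bound \<alpha> (rep_o (E' * E' - E' - d * P')) x" by (simp only: obound_def)
  qed
  then have "rep_o (E' * E' - E' - d * P') = rep_o 0" by (simp only: rep_o_simps(4))
  then have "E' * E' - E' - d * P' = 0" by (rule rep_o_inject[THEN iffD1])
  then have "E' * E' = E' + d * P'" by (simp add: algebra_simps)
  moreover have "onull \<alpha> E'" "onull \<alpha> P'" using Eb Pb by (simp_all only: onull_def rE rP)
  moreover have "obound 1 E' 1" "obound 1 P' 1" using E1 P11 by (simp_all only: obound_def rE rP)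
  moreover have "obound 1 (E' - e) q" using E0 by (simp only: obound_def rep_o_simps rE init power_0 mult_1_right)
  ultimately show ?thesis by blast
qed

lemma gauss_bound_powers_eq_0:
  assumes "\<And>k. gauss_bound 1 f (b ^ Suc k)" "0 \<le> b" "b < 1"
  shows "f = 0"
proof (rule gauss_bound_small_eq_0)
  fix e :: real assume "e > 0"
  have "(\<lambda>k. b ^ k) \<longlonglongrightarrow> 0" using assms by (intro LIMSEQ_realpow_zero) auto
  then have "eventually (\<lambda>k. b ^ k < e) sequentially" by (rule order_tendstoD(2)) (use \<open>e > 0\<close> in simp)
  then obtain k where "b ^ k < e" by (auto simp: eventually_sequentially)
  moreover have "b ^ Suc k \<le> b ^ k" using assms by (intro power_decreasing) auto
  ultimately show "gauss_bound 1 f e" by (intro gauss_bound_mono[OF assms(1)[of k]]) simp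
qed simp

text \<open>Fekete's lemma in multiplicative form, with the infimum of the roots as limit. It makes
  the \<open>lim\<close> in \<open>spectral_norm\<close> a true limit.\<close>

lemma fekete_convergent:
  fixes a :: "nat \<Rightarrow> real"
  assumes nn: "\<And>n. a n \<ge> 0" and sub: "\<And>m n. a (m + n) \<le> a m * a n"
  shows "convergent (\<lambda>n. root n (a n))"
proof -
  let ?S = "(\<lambda>n. root n (a n)) ` {1..}"
  define l where "l = Inf ?S"
  have rn: "root n (a n) \<ge> 0" for n using nn by (cases "n = 0") auto
  have bdd: "bdd_below ?S" by (rule bdd_belowI[of _ 0]) (use rn in auto)
  have lb: "l \<le> root n (a n)" if "n \<ge> 1" for n
    unfolding l_def using that bdd by (intro cInf_lower) auto
  have pow: "a (q * n + s) \<le> a q ^ n * a s" for q n s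
  proof (induction n)
    case (Suc n)
    have "a (q * Suc n + s) = a (q + (q * n + s))" by (simp add: algebra_simps)
    also have "\<dots> \<le> a q * a (q * n + s)" by (rule sub)
    also have "\<dots> \<le> a q * (a q ^ n * a s)" using Suc nn by (intro mult_left_mono) auto
    finally show ?case by (simp add: mult_ac)
  qed simp
  have "(\<lambda>n. root n (a n)) \<longlonglongrightarrow> l"
  proof (rule order_tendstoI)
    fix x assume "x < l"
    have "x < root n (a n)" if "n \<ge> 1" for n using lb[OF that] \<open>x < l\<close> by linarith
    then show "eventually (\<lambda>n. x < root n (a n)) sequentially"
      unfolding eventually_sequentially by blast
  next
    fix x assume "l < x"
    then obtain b where b: "l < b" "b < x" using dense by blast
    obtain y where "y \<in> ?S" "y < b" using b(1) cInf_lessD[of ?S b] unfolding l_def by auto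
    then obtain q where q: "q \<ge> 1" "root q (a q) < b" by auto
    have b0: "b > 0" using q(2) rn[of q] by linarith
    have aq: "a q \<le> b ^ q"
    proof -
      have "root q (a q) ^ q \<le> b ^ q" using q rn by (intro power_mono) auto
      then show ?thesis using q nn by simp
    qed
    \<comment> \<open>Writing \<open>n = q * t + s\<close> leaves the factors \<open>a s\<close> and
      \<open>(1 / b) ^ s\<close> with \<open>s < q\<close>. \<open>M\<close> and
      \<open>K ^ q\<close> bound them, and the n-th root of the constant \<open>C\<close> tends to
      1.\<close>
    define M where "M = Max (insert 1 (a ` {..<q}))"
    have M: "M \<ge> 1" "\<And>s. s < q \<Longrightarrow> a s \<le> M" unfolding M_def by (auto intro!: Max_ge)
    define K where "K = max 1 (1 / b)"
    have K: "K \<ge> 1" "1 / b \<le> K" by (auto simp: K_def)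
    define C where "C = M * K ^ q"
    have C: "C > 0" using M K by (simp add: C_def)
    have le: "root n (a n) \<le> b * root n C" if "n \<ge> 1" for n
    proof -
      define s t where "s = n mod q" and "t = n div q"
      have n: "n = q * t + s" and sq: "s < q" using q(1) by (auto simp: s_def t_def)
      have "a n \<le> a q ^ t * a s" unfolding n by (rule pow)
      also have "\<dots> \<le> (b ^ q) ^ t * M" using aq M(2)[OF sq] nn b0 by (intro mult_mono power_mono) auto
      also have "(b ^ q) ^ t = b ^ n * (1 / b) ^ s" using b0 by (simp add: n power_add power_mult power_divide)
      also have "\<dots> \<le> b ^ n * K ^ q"
      proof (rule mult_left_mono)
        have "(1 / b) ^ s \<le> K ^ s" using K b0 by (intro power_mono) auto
        also have "\<dots> \<le> K ^ q" using K sq by (intro power_increasing) auto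
        finally show "(1 / b) ^ s \<le> K ^ q" .
      qed (use b0 in simp)
      finally have "a n \<le> b ^ n * K ^ q * M" using M by simp
      then have "a n \<le> b ^ n * C" by (simp add: C_def mult_ac)
      then have "root n (a n) \<le> root n (b ^ n * C)" using that by simp
      also have "\<dots> = b * root n C" using that b0 by (simp add: real_root_mult real_root_power_cancel)
      finally show ?thesis .
    qed
    have "(\<lambda>n. b * root n C) \<longlonglongrightarrow> b * 1" by (intro tendsto_mult tendsto_const LIMSEQ_root_const C)
    then have "eventually (\<lambda>n. b * root n C < x) sequentially" by (rule order_tendstoD(2)) (use b in simp)
    then show "eventually (\<lambda>n. root n (a n) < x) sequentially"
      using eventually_ge_at_top[of 1] by eventually_elim (use le in force)
  qed
  then show ?thesis by (rule convergentI)
qed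

lemma kgauss_norm_eq:
  assumes "0 < \<sigma>" "\<sigma> < 1"
  shows "kgauss_norm \<sigma> x = (if x = 0 then 0 else \<sigma> powi fls_subdegree x)"
proof (cases "x = 0")
  case False
  have "Sup (insert 0 {\<sigma> powi j | j i. kcoeff x (j, i) \<noteq> 0}) = \<sigma> powi fls_subdegree x"
  proof (rule cSup_eq_maximum)
    have "x $$ fls_subdegree x \<noteq> 0" using False by simp
    then obtain i where "kcoeff x (fls_subdegree x, i) \<noteq> 0" using fls_nth_eq_0_iff by blast
    then show "\<sigma> powi fls_subdegree x \<in> insert 0 {\<sigma> powi j | j i. kcoeff x (j, i) \<noteq> 0}" by blast
    fix y assume "y \<in> insert 0 {\<sigma> powi j | j i. kcoeff x (j, i) \<noteq> 0}"
    then consider "y = 0" | j i where "y = \<sigma> powi j" "kcoeff x (j, i) \<noteq> 0" by blast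
    then show "y \<le> \<sigma> powi fls_subdegree x"
    proof cases
      case 2
      have "x $$ j \<noteq> 0" using 2(2) fls_nth_eq_0_iff by blast
      then have "fls_subdegree x \<le> j" by (rule fls_subdegree_leI)
      then show ?thesis unfolding 2(1) using assms by (intro power_int_decreasing) auto
    qed (use assms in simp)
  qed
  then show ?thesis using False by (simp add: kgauss_norm_def)
qed (simp add: kgauss_norm_def)

lemma kgauss_norm_mult:
  fixes x y :: "('n::{finite,linorder}, 'r::field) kseries"
  assumes "0 < \<sigma>" "\<sigma> < 1"
  shows "kgauss_norm \<sigma> (x * y) \<le> kgauss_norm \<sigma> x * kgauss_norm \<sigma> y"
proof (cases "x * y = 0")
  case True
  then show ?thesis using assms by (simp add: kgauss_norm_eq)
next
  case False
  then have nz: "x \<noteq> 0" "y \<noteq> 0" by auto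
  have "fls_subdegree x + fls_subdegree y \<le> fls_subdegree (x * y)"
    by (rule fls_subdegree_geI[OF False]) (rule fls_times_nth_eq0)
  then have "\<sigma> powi fls_subdegree (x * y) \<le> \<sigma> powi (fls_subdegree x + fls_subdegree y)"
    using assms by (intro power_int_decreasing) auto
  then show ?thesis using nz False assms by (simp add: kgauss_norm_eq power_int_add)
qed

section \<open>Uniqueness and integrality of idempotents\<close>

context groebner_lift
begin

lemma onull_I_mult:
  assumes "rep_o a \<in> I" "onull \<alpha> w" "obound 1 w 1" "0 < \<alpha>" "\<alpha> < 1"
  shows "rep_o (w * a) \<in> I"
  using I_mult[OF ideal assms(1) onull_R_int[OF assms(2,4,5,3)]] by (simp only: rep_o_simps)

lemma extend_scalars_incl: "f \<in> I \<Longrightarrow> f \<in> extend_scalars I"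
  unfolding extend_scalars_def by (intro CollectI exI[of _ 1] exI[of _ f]) simp

lemma extend_scalars_scale: "f \<in> extend_scalars I \<Longrightarrow> scale c f \<in> extend_scalars I"
  unfolding extend_scalars_def by force

lemma rep_diff_I:
  assumes "rep_o x \<in> I" "rep_o y \<in> I"
  shows "rep_o (x - y) \<in> I" "rep_o (x + y) \<in> I"
  using add_closedD(2,4)[OF I_add_closed[OF ideal] assms] by (simp_all only: rep_o_simps)

text \<open>Integral input gives integral quotients, so the difference lies in \<open>I\<close>
  itself and not only in its extension of scalars.\<close>

lemma integral_division:
  assumes \<alpha>: "admissible \<alpha>" and z: "onull \<alpha> z" "obound 1 z 1"
  shows "\<exists>n. onull \<alpha> n \<and> normal (rep_o n) \<and> rep_o (z - n) \<in> I \<and> (\<forall>B. obound 1 z B \<longrightarrow> obound 1 n B)"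
proof -
  have \<alpha>': "0 < \<alpha>" "\<alpha> < 1" using \<alpha> by (auto simp: admissible_def)
  from division_bounded[OF z(1)[unfolded onull_def] \<alpha>] obtain g \<nu> where g: "normal \<nu>" "rep_o z = combination g + \<nu>"
    "\<forall>h. g h \<in> bounded_null_series \<alpha>" "\<nu> \<in> bounded_null_series \<alpha>"
    "\<forall>B. gauss_bound 1 (rep_o z) B \<longrightarrow> (\<forall>h. gauss_bound 1 (g h) B) \<and> gauss_bound 1 \<nu> B" by blast
  have rn: "rep_o (Abs_o \<nu>) = \<nu>" by (rule rep_o_Abs[OF g(4) \<alpha>'])
  have "g h \<in> carrier R_int" for h
    using g(3,5) z(2) bounded_null_series_R_int[OF _ _ \<alpha>'] unfolding obound_def bounded_null_series_def by blast
  then have "combination g \<in> I" by (rule combination_in_I)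
  then have "rep_o (z - Abs_o \<nu>) \<in> I" by (simp add: rep_o_simps rn g(2))
  then show ?thesis using g(1,4,5) rn unfolding onull_def obound_def
    by (intro exI[of _ "Abs_o \<nu>"]) simp
qed

lemma normal_oseries_unique:
  assumes "normal (rep_o x)" "normal (rep_o y)" "rep_o (x - y) \<in> extend_scalars I"
  shows "x = y"
proof -
  have "normal (rep_o (x - y))" using normal_diff[OF assms(1,2)] by (simp only: rep_o_simps)
  then have "rep_o (x - y) = rep_o 0" using normal_in_ideal_eq_0[OF _ assms(3)] by (simp only: rep_o_simps(4))
  then have "x - y = 0" by (rule rep_o_inject[THEN iffD1])
  then show ?thesis by simp
qed

text \<open>The difference \<open>z\<close> of two idempotents satisfies \<open>z\<^sup>3 = z\<close>, so once its normal form is divisible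
  by the uniformizer it is infinitely divisible.\<close>

lemma idempotent_unique:
  fixes x y :: "('n, 'k) oseries"
  assumes \<alpha>: "admissible \<alpha>" and x: "onull \<alpha> x" "obound 1 x 1" "rep_o (x * x - x) \<in> I"
    and y: "onull \<alpha> y" "obound 1 y 1" "rep_o (y * y - y) \<in> I"
    and r: "reduce res (rep_o x) - reduce res (rep_o y) \<in> I_kappa res I"
  shows "rep_o (x - y) \<in> I"
proof -
  have \<alpha>': "0 < \<alpha>" "\<alpha> < 1" using \<alpha> by (auto simp: admissible_def)
  let ?z = "x - y"
  have z: "onull \<alpha> ?z" "obound 1 ?z 1" by (intro onull_closed obound_diff x y \<alpha>' zero_less_one)+
  have int: "rep_o w \<in> carrier R_int" if "onull \<alpha> w" "obound 1 w 1" for w :: "('n, 'k) oseries"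
    using onull_R_int[OF that(1) \<alpha>' that(2)] .
  \<comment> \<open>Explicit integral cofactors express \<open>z^3 - z\<close> through the two
    idempotent equations.\<close>
  have "?z * ?z * ?z - ?z = (1 + x - 3 * y) * (x * x - x) - (1 + y - 3 * x) * (y * y - y)"
    by (simp add: algebra_simps)
  moreover have "rep_o ((1 + x - 3 * y) * (x * x - x) - (1 + y - 3 * x) * (y * y - y)) \<in> I"
  proof (rule rep_diff_I(1))
    show "rep_o ((1 + x - 3 * y) * (x * x - x)) \<in> I"
      by (rule onull_I_mult[OF x(3) _ _ \<alpha>'])
        (intro onull_closed onull_numeral obound_diff obound_add obound_1 obound_numeral_mult x y \<alpha>' zero_less_one)+
    show "rep_o ((1 + y - 3 * x) * (y * y - y)) \<in> I"
      by (rule onull_I_mult[OF y(3) _ _ \<alpha>'])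
        (intro onull_closed onull_numeral obound_diff obound_add obound_1 obound_numeral_mult x y \<alpha>' zero_less_one)+
  qed
  ultimately have z3: "rep_o (?z * ?z * ?z - ?z) \<in> I" by simp
  from integral_division[OF \<alpha> z] obtain n where n: "onull \<alpha> n" "normal (rep_o n)" "rep_o (?z - n) \<in> I"
    "\<forall>B. obound 1 ?z B \<longrightarrow> obound 1 n B" by blast
  have n1: "obound 1 n 1" using n(4) z(2) by blast
  \<comment> \<open>Modulo \<open>I\<close>, \<open>n\<close> is congruent to \<open>z\<close>,
    hence to \<open>z^3\<close> and to \<open>n^3\<close>. So \<open>n\<close> is also the normal
    form of its own cube, and division does not increase the bound.\<close>
  have cube: "obound 1 n (B * B * B)" if "obound 1 n B" "B \<le> 1" for B
  proof -
    have nnn: "onull \<alpha> (n * n * n)" "obound 1 (n * n * n) (B * B * B)"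
      by (intro onull_closed obound_mult that n \<alpha>' zero_less_one)+
    have "obound 1 (n * n * n) (1 * 1 * 1)" by (intro obound_mult n1 zero_less_one)
    then have "obound 1 (n * n * n) 1" by simp
    from integral_division[OF \<alpha> nnn(1) this] obtain k where k: "normal (rep_o k)" "rep_o (n * n * n - k) \<in> I"
      "\<forall>B. obound 1 (n * n * n) B \<longrightarrow> obound 1 k B" by blast
    have "rep_o ((?z * ?z + ?z * n + n * n) * (?z - n)) \<in> I"
    proof (rule onull_I_mult[OF n(3) _ _ \<alpha>'])
      have "obound 1 (?z * ?z + ?z * n + n * n) (1 * 1)" by (intro obound_add obound_mult z n1 zero_less_one)
      then show "obound 1 (?z * ?z + ?z * n + n * n) 1" by simp
    qed (intro onull_closed z n \<alpha>')
    from rep_diff_I(2)[OF rep_diff_I(1)[OF this z3] k(2)]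
    have "rep_o ((?z * ?z + ?z * n + n * n) * (?z - n) - (?z * ?z * ?z - ?z) + (n * n * n - k)) \<in> I" .
    moreover have "(?z * ?z + ?z * n + n * n) * (?z - n) - (?z * ?z * ?z - ?z) + (n * n * n - k) = ?z - k"
      by (simp add: algebra_simps)
    ultimately have "rep_o (?z - k) \<in> I" by simp
    from rep_diff_I(1)[OF this n(3)] have "rep_o (n - k) \<in> I" by simp
    then have "n = k" by (intro normal_oseries_unique n k extend_scalars_incl)
    then show ?thesis using k(3) nnn(2) by blast
  qed
  have rz: "reduce res (rep_o ?z) \<in> I_kappa res I"
    using r reduce_diff[OF int[OF x(1,2)] int[OF y(1,2)]] int[OF z] by (simp only: rep_o_simps)
  have nR: "rep_o n \<in> carrier R_int" by (rule int[OF n(1) n1])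
  have zn: "onull \<alpha> (?z - n)" "obound 1 (?z - n) 1" by (intro onull_closed obound_diff x y n n1 \<alpha>' zero_less_one)+
  have "reduce res (rep_o n) = reduce res (rep_o ?z) - reduce res (rep_o (?z - n))"
    using reduce_diff[OF int[OF z] nR] int[OF zn] by (simp add: rep_o_simps)
  moreover have "reduce res (rep_o (?z - n)) \<in> I_kappa res I" using n(3) unfolding I_kappa_def by blast
  ultimately have "reduce res (rep_o n) \<in> I_kappa res I"
    using add_closedD(4)[OF I_kappa_add_closed rz] by simp
  then have "reduce res (rep_o n) = 0" by (rule normal_unit_not_in_I_kappa[OF nR n(2)])
  then have b0: "obound 1 n (absval uK)" using reduce_eq_0_iff[OF nR] by (simp add: obound_def)
  \<comment> \<open>Cubing a bound that is at most \<open>absval uK\<close> improves it by at least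
    one more factor \<open>absval uK\<close>.\<close>
  have "obound 1 n (absval uK ^ Suc k)" for k
  proof (induction k)
    case (Suc k)
    let ?B = "absval uK ^ Suc k"
    have B: "0 \<le> ?B" "?B \<le> 1" "?B \<le> absval uK" using uK
      by (simp_all add: power_le_one mult_le_one mult_left_le)
    have "?B * ?B * ?B \<le> absval uK * ?B"
      using B mult_mono[OF mult_left_le[OF B(2,1)] B(3)] by (metis mult.commute)
    then show ?case using obound_mono[OF cube[OF Suc B(2)]] by simp
  qed (use b0 in simp)
  then have "rep_o n = 0" using uK unfolding obound_def by (intro gauss_bound_powers_eq_0[of _ "absval uK"]) auto
  then have "n = 0" using rep_o_inject[of n 0] by (simp add: rep_o_simps)
  then show ?thesis using n(3) by simp
qed

lemma extend_scalars_mult: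
  assumes "rep_o a \<in> extend_scalars I"
  shows "rep_o (w * a) \<in> extend_scalars I"
proof -
  obtain c f where f: "rep_o a = scale c f" "f \<in> I" using assms by (auto simp: extend_scalars_def)
  obtain \<eta> where \<eta>: "0 < \<eta>" "\<eta> < 1" "rep_o w \<in> bounded_null_series \<eta>" "rep_o a \<in> bounded_null_series \<eta>"
    using oseries_common[of "rep_o w" "rep_o a"] rep_o[of w] rep_o[of a] by blast
  have n: "rep_o w \<in> null_series \<eta>" "rep_o a \<in> null_series \<eta>" using \<eta> by (auto simp: bounded_null_series_def)
  obtain B where B: "gauss_bound 1 (rep_o w) B" using \<eta>(3) by (auto simp: bounded_null_series_def)
  obtain d :: 'k where d: "d \<noteq> 0" "B \<le> absval d" using exists_large by blast
  show ?thesis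
  proof (cases "c = 0")
    case True
    then have "rep_o a = 0" using f(1) by simp
    then have "rep_o (w * a) = 0" by (simp only: rep_o_simps series_mult_0_right)
    then show ?thesis using add_closedD(1)[OF extend_scalars_add_closed] by (simp only:)
  next
    case False
    let ?w = "scale (inverse d) (rep_o w)"
    have "gauss_bound 1 ?w 1"
      using gauss_bound_mono[OF B d(2)] d(1)
      by (subst gauss_bound_scale_iff) (simp_all add: absval_inverse divide_inverse)
    then have "?w \<in> carrier R_int" by (rule bounded_null_series_R_int[OF null_series_scale[OF n(1)] _ \<eta>(1,2)])
    then have "?w \<star> f \<in> I" by (rule I_mult[OF ideal f(2)])
    moreover have fe: "f = scale (inverse c) (rep_o a)" using f(1) False by simp
    moreover have "?w \<star> f = scale (inverse d) (rep_o w \<star> f)"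
      unfolding fe by (rule scale_mult_left[OF n(1) null_series_scale[OF n(2)] \<eta>(1)])
    moreover have "rep_o w \<star> f = scale (inverse c) (rep_o w \<star> rep_o a)"
      unfolding fe using scale_mult_left[OF n(2,1) \<eta>(1), of "inverse c"] by (simp only: series_mult_commute)
    ultimately have "scale (inverse d * inverse c) (rep_o w \<star> rep_o a) \<in> I" by simp
    from extend_scalars_scale[OF extend_scalars_incl[OF this], of "d * c"]
    moreover have "d * c * (inverse d * inverse c) = 1" using d(1) False by (simp add: field_simps)
    ultimately have "rep_o w \<star> rep_o a \<in> extend_scalars I" by simp
    then show ?thesis by (simp only: rep_o_simps)
  qed
qed

lemma rep_diff_extend:
  assumes "rep_o x \<in> extend_scalars I" "rep_o y \<in> extend_scalars I"
  shows "rep_o (x - y) \<in> extend_scalars I" "rep_o (x + y) \<in> extend_scalars I"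
  using add_closedD(2,4)[OF extend_scalars_add_closed assms] by (simp_all only: rep_o_simps)

lemma division_oseries:
  assumes \<alpha>: "admissible \<alpha>" and z: "onull \<alpha> z"
  shows "\<exists>n. onull \<alpha> n \<and> normal (rep_o n) \<and> rep_o (z - n) \<in> extend_scalars I \<and>
    (\<forall>\<eta> B. admissible \<eta> \<longrightarrow> obound \<eta> z B \<longrightarrow> obound \<eta> n B) \<and> (\<forall>B. obound 1 z B \<longrightarrow> obound 1 n B)"
proof -
  have \<alpha>': "0 < \<alpha>" "\<alpha> < 1" using \<alpha> by (auto simp: admissible_def)
  from division_bounded[OF z[unfolded onull_def] \<alpha>] obtain g \<nu> where g: "normal \<nu>" "rep_o z = combination g + \<nu>"
    "\<forall>h. g h \<in> bounded_null_series \<alpha>" "\<nu> \<in> bounded_null_series \<alpha>"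
    "\<forall>B. gauss_bound 1 (rep_o z) B \<longrightarrow> (\<forall>h. gauss_bound 1 (g h) B) \<and> gauss_bound 1 \<nu> B"
    "\<forall>\<eta> B. admissible \<eta> \<longrightarrow> gauss_bound \<eta> (rep_o z) B \<longrightarrow> (\<forall>h. gauss_bound \<eta> (g h) B) \<and> gauss_bound \<eta> \<nu> B" by blast
  have rn: "rep_o (Abs_o \<nu>) = \<nu>" by (rule rep_o_Abs[OF g(4) \<alpha>'])
  have "combination g \<in> extend_scalars I" by (rule combination_extend_scalars[OF _ \<alpha>']) (use g(3) in blast)
  then have "rep_o (z - Abs_o \<nu>) \<in> extend_scalars I" by (simp add: rep_o_simps rn g(2))
  then show ?thesis using g(1,4,5,6) rn unfolding onull_def obound_def
    by (intro exI[of _ "Abs_o \<nu>"]) simp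
qed

lemma R_kappa_add: "f \<oplus>\<^bsub>R_kappa\<^esub> g = f + (g :: ('n, 'r) kseries)" by simp

lemma A_kappa_simps:
  "carrier (A_kappa res I) = range (coset (I_kappa res I))"
  "coset (I_kappa res I) x \<otimes>\<^bsub>A_kappa res I\<^esub> coset (I_kappa res I) y = coset (I_kappa res I) (x * y)"
  "coset (I_kappa res I) x \<oplus>\<^bsub>A_kappa res I\<^esub> coset (I_kappa res I) y = coset (I_kappa res I) (x + y)"
  "\<one>\<^bsub>A_kappa res I\<^esub> = coset (I_kappa res I) 1" "\<zero>\<^bsub>A_kappa res I\<^esub> = I_kappa res I"
  using carrier_Quot[OF I_kappa_ideal R_kappa_add] Quot_mult[OF I_kappa_ideal R_kappa_add, of x y]
    Quot_add[OF I_kappa_ideal R_kappa_add, of x y] Quot_one[OF I_kappa_ideal R_kappa_add] Quot_zero[OF I_kappa_ideal R_kappa_add]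
  by (simp_all add: A_kappa_def)

lemma A_kappa_pow:
  "coset (I_kappa res I) x [^]\<^bsub>A_kappa res I\<^esub> (k::nat) = coset (I_kappa res I) (x ^ k)"
proof -
  interpret Q: monoid "A_kappa res I"
    unfolding A_kappa_def using ideal.quotient_is_ring[OF I_kappa_ideal] by (rule ring.is_monoid)
  show ?thesis by (induction k) (simp_all add: A_kappa_simps mult.commute)
qed

text \<open>If the normal form \<open>n\<close> were not integral, the first integral multiple
  \<open>y = uK^k n\<close> would have a nonzero reduction. But \<open>y^2 = uK^k y\<close> modulo
  the ideal with \<open>k > 0\<close>, so this reduction squares to zero in \<open>A_kappa\<close>;
  the ring being reduced, it lies in \<open>I_kappa\<close>, which contradicts normality.\<close>

lemma integral_idempotent:
  assumes red: "reduced_ring (A_kappa res I)" and \<alpha>: "admissible \<alpha>" and x: "onull \<alpha> x"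
    and id: "rep_o (x * x - x) \<in> extend_scalars I"
  shows "\<exists>n. onull \<alpha> n \<and> obound 1 n 1 \<and> rep_o (x - n) \<in> extend_scalars I"
proof -
  have \<alpha>': "0 < \<alpha>" "\<alpha> < 1" using \<alpha> by (auto simp: admissible_def)
  from division_oseries[OF \<alpha> x] obtain n where n: "onull \<alpha> n" "normal (rep_o n)" "rep_o (x - n) \<in> extend_scalars I" by blast
  have "rep_o ((x * x - x) - (x + n - 1) * (x - n)) \<in> extend_scalars I"
    by (intro rep_diff_extend id extend_scalars_mult n)
  moreover have "(x * x - x) - (x + n - 1) * (x - n) = n * n - n" by (simp add: algebra_simps)
  ultimately have nn: "rep_o (n * n - n) \<in> extend_scalars I" by simp
  have "obound 1 n 1"
  proof (rule ccontr)
    assume not1: "\<not> obound 1 n 1"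
    let ?s = "\<lambda>k. scale (uK ^ k) (rep_o n)"
    obtain B where B: "gauss_bound 1 (rep_o n) B" using n(1) by (auto simp: onull_def bounded_null_series_def)
    have "\<exists>k. gauss_bound 1 (?s k) 1"
    proof -
      have "(\<lambda>k. absval uK ^ k * B) \<longlonglongrightarrow> 0 * B"
        by (intro tendsto_mult tendsto_const LIMSEQ_realpow_zero) (use uK in auto)
      then have "eventually (\<lambda>k. absval uK ^ k * B < 1) sequentially" by (rule order_tendstoD(2)) simp
      then obtain k where "absval uK ^ k * B < 1" by (auto simp: eventually_sequentially)
      then show ?thesis using gauss_bound_mono[OF gauss_bound_scale[OF B, of "uK ^ k"], of 1] by (auto simp: absval_power)
    qed
    define k where "k = (LEAST k. gauss_bound 1 (?s k) 1)"
    have k: "gauss_bound 1 (?s k) 1" unfolding k_def by (rule LeastI_ex) fact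
    have "k \<noteq> 0" using k not1 by (auto simp: obound_def intro: gr0I)
    then obtain l where l: "k = Suc l" by (cases k) auto
    have notl: "\<not> gauss_bound 1 (?s l) 1"
      using not_less_Least[of l "\<lambda>k. gauss_bound 1 (?s k) 1"] l by (simp add: k_def)
    define c where "c = Abs_o (series_monom 0 0 (uK ^ k) :: ('n, 'k) series)"
    have mb: "series_monom 0 0 (uK ^ k) \<in> bounded_null_series \<alpha>"
      unfolding bounded_null_series_def
      by (auto intro!: exI[of _ "absval (uK ^ k)"] gauss_bound_series_monom finite_series_null)
    have rc: "rep_o c = series_monom 0 0 (uK ^ k)" unfolding c_def by (rule rep_o_Abs[OF mb \<alpha>'])
    have oc: "onull \<alpha> c" using mb by (simp add: onull_def rc)
    have c1: "obound 1 c (absval uK)"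
    proof -
      have "absval uK ^ k \<le> absval uK ^ 1" using uK \<open>k \<noteq> 0\<close> by (intro power_decreasing) auto
      then show ?thesis unfolding obound_def rc by (intro gauss_bound_series_monom) (simp_all add: absval_power)
    qed
    let ?y = "c * n"
    have ry: "rep_o ?y = ?s k" by (simp add: rep_o_simps rc series_const_mult)
    have y: "onull \<alpha> ?y" "obound 1 ?y 1" using k by (auto simp: obound_def ry intro!: onull_closed oc n \<alpha>')
    have cy: "onull \<alpha> (c * ?y)" "obound 1 (c * ?y) (absval uK)"
      using obound_mult[OF c1 y(2)] by (auto intro!: onull_closed oc y n \<alpha>')
    have yy: "onull \<alpha> (?y * ?y)" "obound 1 (?y * ?y) 1"
      using obound_mult[OF y(2) y(2)] by (auto intro!: onull_closed oc n \<alpha>')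
    have cy1: "obound 1 (c * ?y) 1" by (rule obound_mono[OF cy(2)]) (use uK in simp)
    have "rep_o (c * c * (n * n - n)) \<in> extend_scalars I" by (rule extend_scalars_mult[OF nn])
    moreover have "c * c * (n * n - n) = ?y * ?y - c * ?y" by (simp add: algebra_simps)
    ultimately have "rep_o (?y * ?y - c * ?y) \<in> extend_scalars I" by simp
    moreover have d: "onull \<alpha> (?y * ?y - c * ?y)" "obound 1 (?y * ?y - c * ?y) 1"
      by (intro onull_closed obound_diff yy cy1 oc n \<alpha>' zero_less_one)+
    ultimately have dI: "rep_o (?y * ?y - c * ?y) \<in> I"
      unfolding obound_def by (intro extend_scalars_integral)
    note int = onull_R_int[OF _ \<alpha>']
    have yR: "rep_o ?y \<in> carrier R_int" by (rule int[OF y])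
    have "reduce res (rep_o (?y * ?y - c * ?y)) = reduce res (rep_o (?y * ?y)) - reduce res (rep_o (c * ?y))"
      using reduce_diff[OF int[OF yy] int[OF cy(1) cy1]] int[OF d] by (simp only: rep_o_simps(6))
    also have "reduce res (rep_o (c * ?y)) = 0"
      using reduce_eq_0_iff[OF int[OF cy(1) cy1]] cy(2) by (simp add: obound_def)
    also have "reduce res (rep_o (?y * ?y)) = reduce res (rep_o ?y) * reduce res (rep_o ?y)"
      using reduce_mult[OF yR yR] int[OF yy] by (simp only: rep_o_simps(2))
    finally have "reduce res (rep_o ?y) ^ 2 \<in> I_kappa res I"
      using dI unfolding I_kappa_def by (metis diff_zero image_eqI power2_eq_square)
    then have "coset (I_kappa res I) (reduce res (rep_o ?y)) [^]\<^bsub>A_kappa res I\<^esub> (2::nat) = \<zero>\<^bsub>A_kappa res I\<^esub>"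
      using coset_eq_iff[OF I_kappa_add_closed, of "reduce res (rep_o ?y) ^ 2" 0] by (simp add: A_kappa_pow A_kappa_simps)
    then have "coset (I_kappa res I) (reduce res (rep_o ?y)) = \<zero>\<^bsub>A_kappa res I\<^esub>"
      using red unfolding reduced_ring_def A_kappa_simps by blast
    then have "reduce res (rep_o ?y) \<in> I_kappa res I"
      using coset_eq_iff[OF I_kappa_add_closed, of "reduce res (rep_o ?y)" 0] by (simp add: A_kappa_simps)
    moreover have "normal (rep_o ?y)"
      using n(2) uK unfolding normal_def ry scale_def by auto
    ultimately have "reduce res (rep_o ?y) = 0" by (intro normal_unit_not_in_I_kappa[OF yR])
    then have "gauss_bound 1 (?s k) (absval uK)" using reduce_eq_0_iff[OF yR] by (simp add: ry)
    moreover have "?s k = scale uK (?s l)" by (simp add: l)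
    ultimately have "gauss_bound 1 (scale uK (?s l)) (absval uK)" by (simp only:)
    then have "gauss_bound 1 (?s l) 1" using uK gauss_bound_scale_iff[OF uK(3), of 1 "?s l" "absval uK"] by simp
    then show False using notl by blast
  qed
  then show ?thesis using n by blast
qed

end

section \<open>Quotient and spectral norms\<close>

lemma powr_eq_powi: "x > 0 \<Longrightarrow> x powr real_of_int j = x powi (j :: int)" for x :: real
  by (simp add: powr_real_of_int' power_int_def)

locale spectral_lift = groebner_lift uK res I r m
  for uK :: "'k::complete_discretely_valued_field" and res :: "'k \<Rightarrow> 'r::field"
    and I :: "('n::{finite,linorder}, 'k) series set" and r :: "nat \<Rightarrow> ('n, 'k) series" and m :: nat +
  fixes p :: nat and \<sigma> c \<eta>0 :: real
  assumes CHAR: "CHAR('r) = p" "p > 0" and absval_p: "absval (of_nat p :: 'k) = 1 / real p"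
    and reduced: "reduced_ring (A_kappa res I)"
    and \<sigma>: "0 < \<sigma>" "\<sigma> < 1" and c: "c > 0"
    and spectral: "\<And>Y. Y \<in> carrier (A_kappa res I) \<Longrightarrow>
           quotient_norm \<sigma> Y \<le> \<sigma> powr (- c) * spectral_norm \<sigma> (A_kappa res I) Y"
    and radius: "absval uK powr (1 / (- real_of_int jI + real p * c)) < \<eta>0" and \<eta>0_less_1: "\<eta>0 < 1"
begin

lemma prime_p: "Factorial_Ring.prime p"
  using prime_CHAR_semidom[where 'a = 'r] CHAR by simp

lemma p_ge_2: "p \<ge> 2"
  using prime_p by (rule prime_ge_2_nat)

lemma absval_p_le: "absval (of_nat p :: 'k) \<le> absval uK"
  by (rule absval_less_1) (use p_ge_2 in \<open>simp add: absval_p\<close>)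

lemma \<eta>0_pos: "\<eta>0 > 0"
  using radius powr_ge_zero[of "absval uK" "1 / (- real_of_int jI + real p * c)"] by linarith

text \<open>The lower bound on \<eta>0, raised to the power \<open>pc - jI\<close>; the convergence
  estimates use it in this form.\<close>

lemma radius_powr:
  assumes "\<eta>0 \<le> \<eta>" "\<eta> < 1"
  shows "absval uK * \<eta> powi jI < \<eta> powr (real p * c)"
proof -
  let ?D = "- real_of_int jI + real p * c"
  have "real p * c > 0" using CHAR(2) c by simp
  then have D: "?D > 0" using jI(1) by linarith
  have \<eta>: "\<eta> > 0" using assms \<eta>0_pos by linarith
  have "absval uK = (absval uK powr (1 / ?D)) powr ?D" using uK D by (simp add: powr_powr)
  also have "\<dots> < \<eta> powr ?D" using radius assms D by (intro powr_less_mono2) auto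
  also have "\<eta> powr ?D = \<eta> powr (- real_of_int jI) * \<eta> powr (real p * c)" by (rule powr_add)
  finally have "absval uK * \<eta> powr real_of_int jI <
      (\<eta> powr (- real_of_int jI) * \<eta> powr (real p * c)) * \<eta> powr real_of_int jI"
    using \<eta> by (intro mult_strict_right_mono) auto
  also have "\<dots> = \<eta> powr (real p * c)" using \<eta> by (simp add: powr_minus)
  finally show ?thesis by (simp add: powr_eq_powi \<eta>)
qed

lemma radius_admissible: "\<eta>0 \<le> \<eta> \<Longrightarrow> \<eta> < 1 \<Longrightarrow> admissible \<eta>"
proof -
  assume \<eta>: "\<eta>0 \<le> \<eta>" "\<eta> < 1"
  have "\<eta> powr (real p * c) \<le> 1" using \<eta> \<eta>0_pos c by (intro powr_le1) auto
  then show ?thesis using radius_powr[OF \<eta>] \<eta> \<eta>0_pos by (simp add: admissible_def)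
qed

section \<open>Quotient norm and spectral norm on representatives\<close>

definition qn :: "('n, 'r) kseries \<Rightarrow> real" where
  "qn x = quotient_norm \<sigma> (coset (I_kappa res I) x)"

lemma kgauss_nonneg: "kgauss_norm \<sigma> (x :: ('n, 'r) kseries) \<ge> 0"
  using \<sigma> by (simp add: kgauss_norm_eq)

lemma qn_le: "y - x \<in> I_kappa res I \<Longrightarrow> qn x \<le> kgauss_norm \<sigma> y"
  unfolding qn_def quotient_norm_def
  by (rule cInf_lower) (auto intro!: bdd_belowI[of _ 0] kgauss_nonneg)

lemma qn_ge: "(\<And>y. y - x \<in> I_kappa res I \<Longrightarrow> B \<le> kgauss_norm \<sigma> y) \<Longrightarrow> B \<le> qn x"
  unfolding qn_def quotient_norm_def
proof (rule cInf_greatest)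
  show "kgauss_norm \<sigma> ` coset (I_kappa res I) x \<noteq> {}" using coset_self[OF I_kappa_add_closed, of x] by blast
qed auto

lemma qn_nonneg: "qn x \<ge> 0"
  by (rule qn_ge) (rule kgauss_nonneg)

text \<open>The infimum is taken in one factor at a time; a factor of norm 0 is treated apart
  because the argument divides by it.\<close>

lemma qn_mult: "qn (x * y) \<le> qn x * qn y"
proof -
  have 1: "qn (x * y) \<le> kgauss_norm \<sigma> x' * kgauss_norm \<sigma> y'"
    if "x' - x \<in> I_kappa res I" "y' - y \<in> I_kappa res I" for x' y'
  proof -
    have "x' * y' - x * y = y' * (x' - x) + x * (y' - y)" by (simp add: algebra_simps)
    also have "\<dots> \<in> I_kappa res I" by (intro add_closedD(2)[OF I_kappa_add_closed] I_kappa_mult that)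
    finally have "qn (x * y) \<le> kgauss_norm \<sigma> (x' * y')" by (rule qn_le)
    also have "\<dots> \<le> kgauss_norm \<sigma> x' * kgauss_norm \<sigma> y'" by (rule kgauss_norm_mult[OF \<sigma>])
    finally show ?thesis .
  qed
  have 2: "qn (x * y) \<le> kgauss_norm \<sigma> x' * qn y" if x': "x' - x \<in> I_kappa res I" for x'
  proof (cases "kgauss_norm \<sigma> x' = 0")
    case True
    have "qn (x * y) \<le> kgauss_norm \<sigma> x' * kgauss_norm \<sigma> y"
      by (rule 1[OF x']) (use add_closedD(1)[OF I_kappa_add_closed] in simp)
    then show ?thesis using True by simp
  next
    case False
    then have pos: "kgauss_norm \<sigma> x' > 0" using kgauss_nonneg[of x'] by linarith
    have "qn (x * y) / kgauss_norm \<sigma> x' \<le> qn y"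
      by (rule qn_ge) (use 1[OF x'] pos in \<open>simp add: divide_le_eq mult.commute\<close>)
    then show ?thesis using pos by (simp add: divide_le_eq mult.commute)
  qed
  show ?thesis
  proof (cases "qn y = 0")
    case True
    have "qn (x * y) \<le> kgauss_norm \<sigma> x * qn y"
      by (rule 2) (use add_closedD(1)[OF I_kappa_add_closed] in simp)
    then show ?thesis using True by simp
  next
    case False
    then have pos: "qn y > 0" using qn_nonneg[of y] by linarith
    have "qn (x * y) / qn y \<le> qn x"
      by (rule qn_ge) (use 2 pos in \<open>simp add: divide_le_eq\<close>)
    then show ?thesis using pos by (simp add: divide_le_eq)
  qed
qed

definition sp :: "('n, 'r) kseries \<Rightarrow> real" where
  "sp x = lim (\<lambda>k. root k (qn (x ^ k)))"

lemma qn_le_sp: "qn x \<le> \<sigma> powr (- c) * sp x"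
  using spectral[of "coset (I_kappa res I) x"]
  by (simp add: A_kappa_simps(1) spectral_norm_def A_kappa_pow qn_def sp_def)

text \<open>The limit is computed along the multiples of \<open>n\<close>, where submultiplicativity
  bounds every root by the first one.\<close>

lemma sp_le:
  assumes "n \<ge> 1"
  shows "sp x \<le> root n (qn (x ^ n))"
proof -
  have "convergent (\<lambda>k. root k (qn (x ^ k)))"
    by (rule fekete_convergent) (use qn_mult in \<open>auto simp: qn_nonneg power_add\<close>)
  then have lim: "(\<lambda>k. root k (qn (x ^ k))) \<longlonglongrightarrow> sp x" by (simp add: convergent_LIMSEQ_iff sp_def)
  have sm: "strict_mono (\<lambda>k. n * k)" using assms by (auto simp: strict_mono_def)
  have sub: "(\<lambda>k. root (n * k) (qn (x ^ (n * k)))) \<longlonglongrightarrow> sp x"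
    using LIMSEQ_subseq_LIMSEQ[OF lim sm] by (simp add: o_def)
  have pw: "qn (x ^ (n * Suc k)) \<le> qn (x ^ n) ^ Suc k" for k
  proof (induction k)
    case (Suc k)
    have "qn (x ^ (n * Suc (Suc k))) = qn (x ^ n * x ^ (n * Suc k))" by (simp flip: power_add)
    also have "\<dots> \<le> qn (x ^ n) * qn (x ^ (n * Suc k))" by (rule qn_mult)
    also have "\<dots> \<le> qn (x ^ n) * qn (x ^ n) ^ Suc k" using Suc qn_nonneg by (intro mult_left_mono) auto
    finally show ?case by simp
  qed simp
  have "root (n * k) (qn (x ^ (n * k))) \<le> root n (qn (x ^ n))" if k: "k \<ge> 1" for k
  proof -
    obtain l where l: "k = Suc l" using k by (cases k) auto
    have "root (n * k) (qn (x ^ (n * k))) \<le> root (n * k) (qn (x ^ n) ^ k)"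
      using pw[of l] assms k by (simp add: l)
    also have "\<dots> = root n (root k (qn (x ^ n) ^ k))" by (simp add: real_root_mult_exp)
    also have "\<dots> = root n (qn (x ^ n))" using k qn_nonneg by (simp add: real_root_power_cancel)
    finally show ?thesis .
  qed
  then show ?thesis by (intro LIMSEQ_le_const2[OF sub]) blast
qed

text \<open>All positive powers of an idempotent class have the same quotient norm, so the roots
  tend to 1 when that norm is positive. The spectral bound then limits the quotient norm by
  \<open>\<sigma> powr (- c)\<close>.\<close>

lemma good_representative:
  assumes "x * x - x \<in> I_kappa res I"
  shows "\<exists>y. y - x \<in> I_kappa res I \<and> (\<forall>j i. real_of_int j < - c \<longrightarrow> kcoeff y (j, i) = 0)"
proof (rule ccontr)
  assume *: "\<not> ?thesis"
  \<comment> \<open>The largest integer strictly below \<open>- c\<close>. Without a good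
    representative every Gauss norm in the class is at least \<open>\<sigma> powi J\<close>, which
    exceeds \<open>\<sigma> powr (- c)\<close>.\<close>
  define J where "J = \<lceil>- c\<rceil> - 1"
  have J: "real_of_int j < - c \<longleftrightarrow> j \<le> J" for j unfolding J_def using less_ceiling_iff[of j "- c"] by linarith
  have pow: "x ^ Suc k - x \<in> I_kappa res I" for k
  proof (induction k)
    case 0 then show ?case using add_closedD(1)[OF I_kappa_add_closed] by simp
  next
    case (Suc k)
    have "x ^ Suc (Suc k) - x = x * (x ^ Suc k - x) + (x * x - x)" by (simp add: algebra_simps)
    also have "\<dots> \<in> I_kappa res I" by (intro add_closedD(2)[OF I_kappa_add_closed] I_kappa_mult Suc assms)
    finally show ?case .
  qed
  have qeq: "qn (x ^ Suc k) = qn x" for k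
    unfolding qn_def using coset_eq_iff[OF I_kappa_add_closed] pow[of k] by metis
  have "\<sigma> powi J \<le> qn x"
  proof (rule qn_ge)
    fix y assume y: "y - x \<in> I_kappa res I"
    then obtain j i where ji: "real_of_int j < - c" "kcoeff y (j, i) \<noteq> 0" using * by blast
    then have "y $$ j \<noteq> 0" using fls_nth_eq_0_iff by blast
    then have "fls_subdegree y \<le> j" "y \<noteq> 0" by (auto intro: fls_subdegree_leI)
    then show "\<sigma> powi J \<le> kgauss_norm \<sigma> y" using \<sigma> ji(1) J[of j]
      by (simp add: kgauss_norm_eq power_int_decreasing)
  qed
  then have q: "qn x > 0" using \<sigma> by (smt (verit) zero_less_power_int)
  have "(\<lambda>k. root (Suc k) (qn x)) \<longlonglongrightarrow> 1" using LIMSEQ_Suc[OF LIMSEQ_root_const[OF q]] by simp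
  then have "(\<lambda>k. root (Suc k) (qn (x ^ Suc k))) \<longlonglongrightarrow> 1" by (simp only: qeq)
  then have "(\<lambda>k. root k (qn (x ^ k))) \<longlonglongrightarrow> 1" by (rule LIMSEQ_imp_Suc)
  then have "sp x = 1" unfolding sp_def by (rule limI)
  then have "\<sigma> powi J \<le> \<sigma> powr (- c)" using qn_le_sp[of x] \<open>\<sigma> powi J \<le> qn x\<close> by simp
  moreover have "\<sigma> powr (- c) < \<sigma> powr real_of_int J" using J[of J] \<sigma> by (intro powr_less_mono') auto
  ultimately show False using \<sigma> by (simp add: powr_eq_powi)
qed

lemma minimal_exponent_exists:
  fixes f :: "('n, 'k) series"
  assumes "finite_series f" "f \<noteq> 0"
  shows "\<exists>J. (\<forall>j i. j < J \<longrightarrow> f j i = 0) \<and> (\<exists>i. f J i \<noteq> 0)"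
proof -
  let ?S = "fst ` {(j, i). f j i \<noteq> 0}"
  have fin: "finite ?S" using assms(1) by (simp add: finite_series_def)
  obtain j i where ji: "f j i \<noteq> 0" using assms(2) by (metis ext zero_fun_apply)
  then have ne: "?S \<noteq> {}" by force
  have "Min ?S \<in> ?S" using fin ne by (rule Min_in)
  then obtain x where "x \<in> {(j, i). f j i \<noteq> 0}" "Min ?S = fst x" by blast
  then have "\<exists>i. f (Min ?S) i \<noteq> 0" by (intro exI[of _ "snd x"]) (simp add: case_prod_unfold)
  moreover have "f j i = 0" if "j < Min ?S" for j i
  proof (rule ccontr)
    assume "f j i \<noteq> 0"
    then have "j \<in> ?S" by (intro image_eqI[of _ _ "(j, i)"]) simp_all
    then have "Min ?S \<le> j" by (rule Min_le[OF fin])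
    then show False using that by simp
  qed
  ultimately show ?thesis by blast
qed

text \<open>A normal series minimizes the Gauss norm in its class, so the quotient norm of its
  reduction is at least \<open>\<sigma>^J\<close>. By the spectral bound the p-th power then has
  quotient norm at least \<open>\<sigma>^(p (c + J))\<close>, and no representative \<mu> of it can
  start at a higher exponent.\<close>

lemma power_normal_form_exponent:
  assumes x: "x \<in> carrier R_int" "normal x" "\<And>j i. j < J \<Longrightarrow> x j i = 0" and lead: "absval (x J i1) = 1"
    and \<mu>: "\<mu> - reduce res x ^ p \<in> I_kappa res I"
  shows "\<exists>j i. kcoeff \<mu> (j, i) \<noteq> 0 \<and> real_of_int j \<le> real p * (c + real_of_int J)"
proof -
  let ?x = "reduce res x"
  have xlow: "kcoeff ?x (j, i) = 0" if "j < J" for j i using x(3)[OF that] by (simp add: kcoeff_reduce[OF x(1)])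
  have xJ: "kcoeff ?x (J, i1) \<noteq> 0" using lead res_eq_0_iff[of "x J i1"] by (simp add: kcoeff_reduce[OF x(1)])
  have "\<sigma> powi J \<le> qn ?x"
  proof (rule qn_ge)
    fix y assume y: "y - ?x \<in> I_kappa res I"
    show "\<sigma> powi J \<le> kgauss_norm \<sigma> y"
    proof (rule ccontr)
      assume not: "\<not> ?thesis"
      have ylow: "kcoeff y (j, i) = 0" if "j \<le> J" for j i
      proof (rule ccontr)
        assume "kcoeff y (j, i) \<noteq> 0"
        then have "y $$ j \<noteq> 0" using fls_nth_eq_0_iff by blast
        then have "fls_subdegree y \<le> j" "y \<noteq> 0" by (auto intro: fls_subdegree_leI)
        then show False using not \<sigma> that by (simp add: kgauss_norm_eq power_int_decreasing)
      qed
      \<comment> \<open>If \<open>y\<close> started above \<open>J\<close>, the difference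
        \<open>y - ?x\<close> would lie in \<open>I_kappa\<close> and have its leading exponent
        among the exponents of the normal series \<open>x\<close>.\<close>
      let ?i = "y - ?x"
      have i1: "kcoeff ?i (J, i1) \<noteq> 0" using ylow[of J i1] xJ by simp
      then have nz: "?i \<noteq> 0" using kcoeff_simps(1) by metis
      have nJ: "?i $$ J \<noteq> 0" using i1 fls_nth_eq_0_iff by blast
      have "?i $$ j = 0" if "j < J" for j
      proof -
        have "kcoeff ?i (j, i) = 0" for i using ylow[of j i] xlow[of j i] that by simp
        then show ?thesis using fls_nth_eq_0_iff by blast
      qed
      then have sub: "fls_subdegree ?i = J" using nJ by (intro fls_subdegree_eqI) auto
      obtain i0 where i0: "leading_exponent ?i = (J, i0)"
        using leading_exponent_props(1)[OF nz] sub by (metis prod.collapse)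
      have "kcoeff ?i (J, i0) \<noteq> 0" using leading_exponent_props(2)[OF nz] i0 by simp
      then have "kcoeff ?x (J, i0) \<noteq> 0" using ylow[of J i0] by simp
      then have "x J i0 \<noteq> 0" using kcoeff_reduce[OF x(1)] res_0 by metis
      moreover have "i0 \<in> L" using I_kappa_leading[OF y nz] i0 by simp
      ultimately show False using x(2) by (simp add: normal_def)
    qed
  qed
  also have "qn ?x \<le> \<sigma> powr (- c) * sp ?x" by (rule qn_le_sp)
  also have "\<dots> \<le> \<sigma> powr (- c) * root p (qn (?x ^ p))" using CHAR(2) by (intro mult_left_mono sp_le) auto
  finally have "\<sigma> powr c * \<sigma> powi J \<le> \<sigma> powr c * (\<sigma> powr (- c) * root p (qn (?x ^ p)))"
    by (intro mult_left_mono) auto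
  also have "\<sigma> powr c * \<sigma> powi J = \<sigma> powr (c + real_of_int J)" using \<sigma> by (simp add: powr_add powr_eq_powi)
  also have "\<sigma> powr c * (\<sigma> powr (- c) * root p (qn (?x ^ p))) = root p (qn (?x ^ p))"
    using \<sigma> by (simp add: powr_minus)
  finally have le: "\<sigma> powr (c + real_of_int J) \<le> root p (qn (?x ^ p))" .
  have "(\<sigma> powr (c + real_of_int J)) ^ p \<le> root p (qn (?x ^ p)) ^ p" using le by (intro power_mono) auto
  also have "\<dots> = qn (?x ^ p)" using CHAR(2) qn_nonneg by simp
  also have "\<dots> \<le> kgauss_norm \<sigma> \<mu>" by (rule qn_le[OF \<mu>])
  finally have le2: "\<sigma> powr (real p * (c + real_of_int J)) \<le> kgauss_norm \<sigma> \<mu>"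
    using \<sigma> by (simp add: powr_power mult.commute)
  moreover have "\<sigma> powr (real p * (c + real_of_int J)) > 0" using \<sigma> by simp
  ultimately have nz: "\<mu> \<noteq> 0" using \<sigma> by (auto simp: kgauss_norm_eq)
  then have le3: "\<sigma> powr (real p * (c + real_of_int J)) \<le> \<sigma> powr real_of_int (fls_subdegree \<mu>)"
    using le2 \<sigma> by (simp add: kgauss_norm_eq powr_eq_powi)
  have "real_of_int (fls_subdegree \<mu>) \<le> real p * (c + real_of_int J)"
  proof (rule ccontr)
    assume "\<not> ?thesis"
    then have "\<sigma> powr real_of_int (fls_subdegree \<mu>) < \<sigma> powr (real p * (c + real_of_int J))"
      using \<sigma> by (intro powr_less_mono') auto
    then show False using le3 by simp
  qed
  moreover obtain i where "kcoeff \<mu> (fls_subdegree \<mu>, i) \<noteq> 0"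
    using nz fls_nth_eq_0_iff[of \<mu> "fls_subdegree \<mu>"] by auto
  ultimately show ?thesis by blast
qed

theorem idempotent_lift_exists:
  assumes x: "x * x - x \<in> I_kappa res I"
  shows "\<exists>E. onull \<eta>0 E \<and> obound 1 E 1 \<and> rep_o (E * E - E) \<in> I \<and> reduce res (rep_o E) - x \<in> I_kappa res I"
proof -
  have adm: "admissible \<eta>0" using radius_admissible \<eta>0_less_1 by simp
  have \<eta>: "0 < \<eta>0" "\<eta>0 < 1" "\<eta>0 \<le> 1" using \<eta>0_pos \<eta>0_less_1 by auto
  note cl = add_closedD[OF I_kappa_add_closed]
  from good_representative[OF x] obtain y where y: "y - x \<in> I_kappa res I"
    "\<forall>j i. real_of_int j < - c \<longrightarrow> kcoeff y (j, i) = 0" by blast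
  \<comment> \<open>A lower bound for the exponents of \<open>y\<close>. Squaring at worst doubles
    it, and since \<open>J \<le> 0\<close> the linear term causes no lower exponent.\<close>
  define J where "J = \<lceil>- c\<rceil>"
  have J: "J \<le> 0" "- c \<le> real_of_int J" unfolding J_def using c by auto
  have ylow: "kcoeff y (j, i) = 0" if "j < J" for j i
    using y(2) that unfolding J_def by (simp add: less_ceiling_iff)
  let ?l = "lift_kseries y :: ('n, 'k) series"
  have lb: "?l \<in> bounded_null_series \<eta>0"
    using lift_kseries_null[OF \<eta>(1,2)] lift_kseries_props(3) unfolding bounded_null_series_def by blast
  define e where "e = Abs_o ?l"
  have re: "rep_o e = ?l" unfolding e_def by (rule rep_o_Abs[OF lb \<eta>(1,2)])
  have e: "onull \<eta>0 e" "obound 1 e 1" using lb lift_kseries_props(3) by (simp_all only: onull_def obound_def re)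
  have ee: "onull \<eta>0 (e * e)" "obound 1 (e * e) 1" using obound_mult[OF e(2) e(2)] by (auto intro!: onull_closed e \<eta>)
  let ?f = "rep_o (e * e - e)"
  note int = onull_R_int[OF _ \<eta>(1,2)]
  have fo: "onull \<eta>0 (e * e - e)" "obound 1 (e * e - e) 1" by (intro onull_closed obound_diff e ee \<eta> zero_less_one)+
  have fR: "?f \<in> carrier R_int" by (rule int[OF fo])
  have flow: "?f j i = 0" if "j < 2 * J" for j i
  proof -
    have l0: "?l j i = 0" if "j < J" for j i using ylow[OF that] by (simp add: lift_kseries_def sect)
    have "(?l \<star> ?l) j i = 0" by (rule series_mult_support[of J _ J]) (use l0 that in auto)
    moreover have "?l j i = 0" using l0 that J(1) by simp
    ultimately show ?thesis by (simp add: rep_o_simps re)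
  qed
  have "reduce res ?f = reduce res (rep_o (e * e)) - reduce res (rep_o e)"
    using reduce_diff[OF int[OF ee] int[OF e]] fR by (simp only: rep_o_simps(6))
  also have "reduce res (rep_o (e * e)) = y * y"
    using reduce_mult[OF int[OF e] int[OF e]] int[OF ee] by (simp only: rep_o_simps(2) re lift_kseries_props(5))
  finally have "reduce res ?f = y * y - y" by (simp only: re lift_kseries_props(5))
  also have "y * y - y = (y + x - 1) * (y - x) + (x * x - x)" by (simp add: algebra_simps)
  also have "\<dots> \<in> I_kappa res I" by (intro cl(2) I_kappa_mult y x)
  finally have rf: "reduce res ?f \<in> I_kappa res I" .
  \<comment> \<open>The reduction of \<open>e * e - e\<close> is in \<open>I_kappa\<close>, so the
    digit \<mu> vanishes: the defect is an element of the ideal plus \<open>uK\<close> times an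
    integral series without exponents below \<open>2 * J + jI\<close>.\<close>
  from digit_division[OF fR flow adm] obtain g \<mu> \<epsilon> where g: "\<forall>h. g h \<in> carrier R_int \<and> finite_principal_part (g h)"
    "?f = combination g + lift_kseries \<mu> + scale uK \<epsilon>" "\<epsilon> \<in> carrier R_int" "\<forall>j i. j < 2 * J + jI \<longrightarrow> \<epsilon> j i = 0"
    "reduce res ?f \<in> I_kappa res I \<longrightarrow> \<mu> = 0" by blast
  have gb: "g h \<in> bounded_null_series \<eta>0" for h
    using g(1) null_series_principal[of "g h" 1 \<eta>0] \<eta> unfolding bounded_null_series_def by (auto simp: R_int_carrier)
  have cb: "combination g \<in> bounded_null_series \<eta>0" by (rule combination_bounded[OF gb \<eta>(1,2)])
  have l0: "lift_kseries \<mu> = (0 :: ('n, 'k) series)"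
    using g(5) rf by (intro ext) (simp add: lift_kseries_def sect)
  have feq: "?f = combination g + scale uK \<epsilon>" using g(2) l0 by simp
  have \<epsilon>1: "gauss_bound 1 \<epsilon> 1" using g(3) by (simp add: R_int_carrier)
  have sb: "scale uK \<epsilon> \<in> bounded_null_series \<eta>0"
  proof -
    have "scale uK \<epsilon> = ?f + - combination g" using feq by simp
    then show ?thesis using fo(1) cb bounded_null_series_closed(3,4)[OF \<eta>(1)] unfolding onull_def by metis
  qed
  define h d where "h = Abs_o (scale uK \<epsilon>)" and "d = Abs_o (combination g)"
  have rh: "rep_o h = scale uK \<epsilon>" and rd: "rep_o d = combination g"
    unfolding h_def d_def by (rule rep_o_Abs[OF sb \<eta>(1,2)] rep_o_Abs[OF cb \<eta>(1,2)])+
  have "rep_o (e * e) = rep_o (e + h + d)"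
    using feq by (simp only: rep_o_simps rh rd) (simp add: algebra_simps)
  then have eq: "e * e = e + h + d" by (rule rep_o_inject[THEN iffD1])
  have h1: "obound 1 h (absval uK)" using gauss_bound_scale[OF \<epsilon>1, of uK] by (simp add: obound_def rh)
  have cI: "combination g \<in> I" by (rule combination_in_I) (use g(1) in blast)
  have d1: "obound 1 d 1" using I_carrier[OF ideal cI] by (simp add: obound_def rd R_int_carrier)
  \<comment> \<open>The size of the defect at \<eta>0, one uniformizer against the poles. It is
    below 1 by \<open>radius_powr\<close>, because \<open>2 * c \<le> real p * c\<close>.\<close>
  define \<theta> where "\<theta> = absval uK * \<eta>0 powi (2 * J + jI)"
  have h\<eta>: "obound \<eta>0 h \<theta>" unfolding obound_def rh \<theta>_def
    by (rule gauss_bound_from_support) (use gauss_bound_scale[OF \<epsilon>1, of uK] g(4) \<eta> in \<open>auto simp: scale_def\<close>)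
  have \<theta>1: "\<theta> < 1"
  proof -
    have "\<theta> = (absval uK * \<eta>0 powi jI) * \<eta>0 powi (2 * J)" using \<eta> by (simp add: \<theta>_def power_int_add mult_ac)
    also have "\<dots> < \<eta>0 powr (real p * c) * \<eta>0 powi (2 * J)"
      using radius_powr[of \<eta>0] \<eta> by (intro mult_strict_right_mono) auto
    also have "\<dots> = \<eta>0 powr (real p * c + real_of_int (2 * J))" using \<eta> powr_eq_powi[of \<eta>0 "2 * J"] by (simp add: powr_add)
    also have "\<dots> \<le> 1"
    proof (rule powr_le1)
      have "2 * c \<le> real p * c" using p_ge_2 c by (intro mult_right_mono) auto
      then show "0 \<le> real p * c + real_of_int (2 * J)" using J(2) by simp
    qed (use \<eta> in auto)
    finally show ?thesis .
  qed
  have on: "onull \<eta>0 h" "onull \<eta>0 d" using sb cb by (simp_all only: onull_def rh rd)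
  from idempotent_lift[OF \<eta>(1,2) eq e(1) on e(2) h1 d1 less_imp_le[OF uK(2)] h\<eta> \<theta>1]
  obtain E P where E: "onull \<eta>0 E" "onull \<eta>0 P" "obound 1 E 1" "obound 1 P 1" "obound 1 (E - e) (absval uK)" "E * E = E + d * P" by blast
  have "rep_o (P * d) \<in> I" by (rule onull_I_mult[OF _ E(2,4) \<eta>(1,2)]) (simp add: rd cI)
  then have "rep_o (E * E - E) \<in> I" using E(6) by (simp add: mult.commute)
  moreover have "reduce res (rep_o E) - x \<in> I_kappa res I"
  proof -
    have Ee: "onull \<eta>0 (E - e)" "obound 1 (E - e) 1"
      using obound_mono[OF E(5)] uK by (auto intro!: onull_closed E e \<eta>)
    have "reduce res (rep_o (E - e)) = 0"
      using reduce_eq_0_iff[OF int[OF Ee]] E(5) by (simp add: obound_def)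
    moreover have "reduce res (rep_o (E - e)) = reduce res (rep_o E) - reduce res (rep_o e)"
      using reduce_diff[OF int[OF E(1,3)] int[OF e]] int[OF Ee] by (simp only: rep_o_simps(6))
    ultimately have "reduce res (rep_o E) = y" by (simp add: re lift_kseries_props(5))
    then show ?thesis using y(1) by simp
  qed
  ultimately show ?thesis using E(1,3) by blast
qed

end

section \<open>Normal forms of \<open>p\<close>-th powers\<close>

lemma null_series_add_closed: "\<eta> > 0 \<Longrightarrow> add_closed (null_series \<eta>)"
  unfolding add_closed_def by (intro conjI ballI null_series_add null_series_uminus[THEN iffD2] null_series_0)

lemma gauss_bound_attained:
  assumes f: "f \<in> null_series \<eta>" and not: "\<not> gauss_bound \<eta> f B" and B: "B \<ge> 0"
  shows "\<exists>j i. B < absval (f j i) * \<eta> powi j \<and> gauss_bound \<eta> f (absval (f j i) * \<eta> powi j)"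
proof -
  let ?v = "\<lambda>(j, i). absval (f j i) * \<eta> powi j"
  obtain j i where ji: "B < ?v (j, i)" using not by (auto simp: gauss_bound_def not_le)
  let ?F = "{x. ?v (j, i) \<le> ?v x}"
  have fin: "finite ?F" using null_seriesD[OF f, of "?v (j, i)"] ji B by (simp add: case_prod_unfold)
  have "?F \<noteq> {}" by auto
  then have "Max (?v ` ?F) \<in> ?v ` ?F" using fin by (intro Max_in) auto
  then obtain x where x: "x \<in> ?F" "Max (?v ` ?F) = ?v x" by blast
  have "?v y \<le> ?v x" for y
  proof (cases "y \<in> ?F")
    case True
    then have "?v y \<le> Max (?v ` ?F)" using fin by (intro Max_ge) auto
    then show ?thesis using x(2) by (simp only:)
  next
    case False
    then have "?v y \<le> ?v (j, i)" by simp
    also have "\<dots> \<le> ?v x" using x(1) by simp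
    finally show ?thesis .
  qed
  then have "?v (j', i') \<le> ?v x" for j' i' .
  then have "gauss_bound \<eta> f (?v x)" unfolding gauss_bound_def case_prod_conv by (intro allI)
  moreover have "B < ?v x" using ji x(1) by auto
  moreover obtain j' i' where "x = (j', i')" by (cases x)
  ultimately have "B < absval (f j' i') * \<eta> powi j' \<and> gauss_bound \<eta> f (absval (f j' i') * \<eta> powi j')" by simp
  then show ?thesis by blast
qed

text \<open>Powers for \<open>series_mult\<close>: on functions \<open>^\<close> would be pointwise,
  and \<open>oseries\<close> contains only bounded series, while an analytic function may have
  unbounded coefficients.\<close>

definition spow :: "('n, 'k::complete_discretely_valued_field) series \<Rightarrow> nat \<Rightarrow> ('n, 'k) series" where
  "spow f n = ((\<star>) f ^^ n) series_one"

lemma spow_simps: "spow f 0 = series_one" "spow f (Suc n) = f \<star> spow f n"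
  by (simp_all add: spow_def)

context
  fixes \<eta> :: real assumes \<eta>: "\<eta> > 0"
begin

lemma spow_null: "f \<in> null_series \<eta> \<Longrightarrow> spow f n \<in> null_series \<eta>"
  for f :: "('n::finite, 'k::complete_discretely_valued_field) series"
proof -
  assume f: "f \<in> null_series \<eta>"
  have "spow f n \<in> null_series \<eta>"
  proof (induct n)
    case 0 show ?case unfolding spow_simps by (rule finite_series_null[OF finite_series_monom])
  next
    case (Suc n) show ?case unfolding spow_simps by (rule null_series_mult[OF f Suc \<eta>])
  qed
  then show ?thesis .
qed

lemma spow_bound: "gauss_bound \<eta> f M \<Longrightarrow> gauss_bound \<eta> (spow f n) (M ^ n)"
proof (induct n)
  case 0 show ?case unfolding spow_simps by (rule gauss_bound_series_monom) simp_all
next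
  case (Suc n) show ?case unfolding spow_simps power_Suc by (rule gauss_bound_mult[OF Suc(2) Suc(1)[OF Suc(2)] \<eta>])
qed

text \<open>Telescoping by \<open>f^(n+1) - g^(n+1) = (f^n - g^n) f + (f - g) g^n\<close>; the
  condition \<open>M \<ge> 1\<close> lets the second summand be absorbed.\<close>

lemma spow_diff_bound:
  fixes f g :: "('n::finite, 'k::complete_discretely_valued_field) series"
  assumes f: "f \<in> null_series \<eta>" "gauss_bound \<eta> f M" and g: "g \<in> null_series \<eta>" "gauss_bound \<eta> g M"
    and d: "gauss_bound \<eta> (f - g) \<delta>" and M: "M \<ge> 1"
  shows "gauss_bound \<eta> (spow f n - spow g n) (\<delta> * M ^ n)"
proof (induct n)
  case 0
  show ?case using gauss_bound_nonneg[OF d \<eta>] by (simp only: spow_simps diff_self gauss_bound_0 power_0 mult_1_right)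
next
  case (Suc n)
  note sn = spow_null[OF f(1), of n] spow_null[OF g(1), of n]
  have tri: "x - z = (x - y) + (y - z)" for x y z :: "('n, 'k) series" by simp
  have "f \<star> spow f n - g \<star> spow g n = (spow f n - spow g n) \<star> f + (f - g) \<star> spow g n"
    using null_mult_diff_left[OF \<eta> sn f(1)] null_mult_diff_left[OF \<eta> f(1) g(1) sn(2)]
      tri[of "spow f n \<star> f" "g \<star> spow g n" "spow g n \<star> f"]
    by (simp only: series_mult_commute[of "spow f n" f] series_mult_commute[of "spow g n" f])
  then have eq: "spow f (Suc n) - spow g (Suc n) = (spow f n - spow g n) \<star> f + (f - g) \<star> spow g n"
    by (simp only: spow_simps)
  have M0: "\<delta> * M ^ n \<le> \<delta> * M ^ Suc n"
    using gauss_bound_nonneg[OF d \<eta>] M by (intro mult_left_mono power_increasing) auto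
  have 1: "gauss_bound \<eta> ((spow f n - spow g n) \<star> f) (\<delta> * M ^ Suc n)"
    using gauss_bound_mult[OF Suc f(2) \<eta>] by (simp only: power_Suc mult_ac)
  have 2: "gauss_bound \<eta> ((f - g) \<star> spow g n) (\<delta> * M ^ Suc n)"
    by (rule gauss_bound_mono[OF gauss_bound_mult[OF d spow_bound[OF g(2)] \<eta>] M0])
  show ?case unfolding eq by (rule gauss_bound_add[OF 1 2 \<eta>])
qed

lemma spow_scale:
  fixes f :: "('n::finite, 'k::complete_discretely_valued_field) series"
  assumes f: "f \<in> null_series \<eta>"
  shows "spow (scale a f) n = scale (a ^ n) (spow f n)"
proof -
  have "spow (scale a f) n = scale (a ^ n) (spow f n)"
  proof (induct n)
    case 0 show ?case by (simp only: spow_simps power_0 scale_1)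
  next
    case (Suc n)
    have "spow (scale a f) (Suc n) = scale a f \<star> scale (a ^ n) (spow f n)" by (simp only: spow_simps Suc)
    also have "\<dots> = scale a (scale (a ^ n) (spow f n) \<star> f)"
      using scale_mult_left[OF f null_series_scale[OF spow_null[OF f]] \<eta>] by (simp only: series_mult_commute)
    also have "\<dots> = scale a (scale (a ^ n) (spow f n \<star> f))"
      by (simp only: scale_mult_left[OF spow_null[OF f] f \<eta>])
    also have "\<dots> = scale (a ^ Suc n) (spow f (Suc n))" by (simp only: scale_scale spow_simps power_Suc series_mult_commute)
    finally show ?case .
  qed
  then show ?thesis .
qed

end

lemma rep_o_power: "rep_o (x ^ n) = spow (rep_o x) n"
proof -
  have "rep_o (x ^ n) = spow (rep_o x) n"
  proof (induct n)
    case 0 show ?case by (simp only: power_0 spow_simps rep_o_simps)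
  next
    case (Suc n) show ?case by (simp only: power_Suc spow_simps rep_o_simps Suc)
  qed
  then show ?thesis .
qed

lemma rep_o_sum: "rep_o (sum f A) = (\<Sum>x\<in>A. rep_o (f x))"
proof (induct A rule: infinite_finite_induct)
  case (insert x A) show ?case by (simp only: sum.insert[OF insert(1,2)] rep_o_simps insert(3))
qed (simp_all only: sum.infinite sum.empty rep_o_simps not_False_eq_True)

lemma spow_support:
  assumes "\<And>j i. j < J \<Longrightarrow> f j i = 0" "j < int n * J"
  shows "spow f n j i = (0 :: 'k::complete_discretely_valued_field)"
  using assms(2)
proof (induct n arbitrary: j i)
  case 0 then show ?case by (simp add: spow_simps series_monom_def)
next
  case (Suc n)
  show ?case unfolding spow_simps
    by (rule series_mult_support[of J _ "int n * J"]) (use assms(1) Suc in \<open>simp_all add: algebra_simps\<close>)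
qed

lemma rep_o_of_nat: "rep_o (of_nat n :: ('n::finite, 'k::complete_discretely_valued_field) oseries) = series_monom 0 0 (of_nat n)"
proof (induct n)
  case 0 show ?case by (intro ext) (simp add: rep_o_simps series_monom_def)
next
  case (Suc n) show ?case unfolding of_nat_Suc rep_o_simps Suc by (intro ext) (simp add: series_monom_def)
qed

lemma obound_of_nat_absval: "obound \<eta> (of_nat n :: ('n::finite, 'k::complete_discretely_valued_field) oseries) (absval (of_nat n :: 'k))"
  unfolding obound_def rep_o_of_nat by (rule gauss_bound_series_monom) simp_all

context groebner_lift
begin

text \<open>The ideal generated by the \<open>r h\<close> with coefficients in \<open>C\<close>. The
  same facts serve for \<open>C\<close> the series on a circle, those on a closed annulus and the
  bounded ones.\<close>

definition combos :: "('n, 'k) series set \<Rightarrow> ('n, 'k) series set" where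
  "combos C = {combination a | a. \<forall>h\<in>H. a h \<in> C}"

lemma combosI: "(\<And>h. h \<in> H \<Longrightarrow> a h \<in> C) \<Longrightarrow> combination a \<in> combos C"
  unfolding combos_def by blast

lemma combos_mono: "C \<subseteq> D \<Longrightarrow> combos C \<subseteq> combos D"
  unfolding combos_def by blast

context
  fixes C :: "('n, 'k) series set" and \<eta> :: real assumes C: "add_closed C" "C \<subseteq> null_series \<eta>" and \<eta>: "0 < \<eta>" "\<eta> < 1"
begin

lemma combos_add_closed: "add_closed (combos C)"
proof -
  note cl = add_closedD[OF C(1)]
  have "combination (\<lambda>h. 0) = 0" by (simp add: combination_def)
  moreover have "combination (\<lambda>h. 0) \<in> combos C" by (rule combosI) (rule cl(1))
  ultimately have 0: "0 \<in> combos C" by simp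
  have "x + y \<in> combos C" if xy: "x \<in> combos C" "y \<in> combos C" for x y
  proof -
    obtain a b where ab: "x = combination a" "\<forall>h\<in>H. a h \<in> C" "y = combination b" "\<forall>h\<in>H. b h \<in> C"
      using xy unfolding combos_def by blast
    have "x + y = combination (\<lambda>h. a h + b h)" unfolding ab(1,3)
      by (rule combination_add[symmetric, of a \<eta> b]) (use ab C(2) \<eta> in auto)
    moreover have "combination (\<lambda>h. a h + b h) \<in> combos C" by (rule combosI) (use ab cl(2) in blast)
    ultimately show ?thesis by (simp only:)
  qed
  moreover have "- x \<in> combos C" if x: "x \<in> combos C" for x
  proof -
    obtain a where a: "x = combination a" "\<forall>h\<in>H. a h \<in> C" using x unfolding combos_def by blast
    have "combination (\<lambda>h. - a h) \<in> combos C" by (rule combosI) (use a cl(3) in blast)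
    then show ?thesis unfolding a(1) combination_uminus .
  qed
  ultimately show ?thesis using 0 unfolding add_closed_def by blast
qed

lemma combos_mult:
  assumes "x \<in> null_series \<eta>" "\<And>y. y \<in> C \<Longrightarrow> x \<star> y \<in> C" "f \<in> combos C"
  shows "x \<star> f \<in> combos C"
proof -
  obtain a where a: "f = combination a" "\<forall>h\<in>H. a h \<in> C" using assms(3) unfolding combos_def by blast
  have "x \<star> f = combination (\<lambda>h. x \<star> a h)" unfolding a(1)
    by (rule combination_mult[OF _ assms(1) \<eta>]) (use a(2) C(2) in blast)
  moreover have "combination (\<lambda>h. x \<star> a h) \<in> combos C" by (rule combosI) (use a(2) assms(2) in blast)
  ultimately show ?thesis by (simp only:)
qed

lemma combos_null: "combos C \<subseteq> null_series \<eta>"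
proof
  fix f assume "f \<in> combos C"
  then obtain a where a: "f = combination a" "\<forall>h\<in>H. a h \<in> C" unfolding combos_def by blast
  show "f \<in> null_series \<eta>" unfolding a(1) by (rule combination_null[OF _ \<eta>]) (use a(2) C(2) in blast)
qed

lemma normal_form_unique_combos:
  assumes "admissible \<eta>" "normal \<nu>" "\<nu> \<in> null_series \<eta>" "normal \<nu>'" "\<nu>' \<in> null_series \<eta>" "\<nu> - \<nu>' \<in> combos C"
  shows "\<nu> = \<nu>'"
proof -
  obtain a where a: "\<nu> - \<nu>' = combination a" "\<forall>h\<in>H. a h \<in> C" using assms(6) unfolding combos_def by blast
  show ?thesis by (rule normal_form_unique[OF assms(2-5) a(1) _ assms(1)]) (use a(2) C(2) in blast)
qed

end

lemma combos_scale:
  assumes "0 < \<eta>" "\<eta> < 1" "f \<in> combos (null_series \<eta>)"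
  shows "scale a f \<in> combos (null_series \<eta>)"
proof -
  have m: "series_monom 0 0 a \<in> null_series \<eta>" by (rule finite_series_null[OF finite_series_monom])
  have "series_monom 0 0 a \<star> f \<in> combos (null_series \<eta>)"
    by (rule combos_mult[OF null_series_add_closed[OF assms(1)] subset_refl assms(1,2) m _ assms(3)])
      (rule null_series_mult[OF m _ assms(1)])
  then show ?thesis unfolding series_const_mult .
qed

lemma spow_reduce:
  fixes y :: "('n, 'k) series"
  assumes y: "y \<in> carrier R_int"
  shows "spow y n \<in> carrier R_int \<and> reduce res (spow y n) = reduce res y ^ n"
proof (induct n)
  case 0
  show ?case unfolding spow_simps by (simp add: R_int_monom reduce_one)
next
  case (Suc n)
  have "y \<star> spow y n \<in> carrier R_int" using R_int_closed(2)[OF y] Suc by blast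
  then show ?case using reduce_mult[OF y] Suc by (simp add: spow_simps)
qed

end

context spectral_lift
begin

text \<open>The middle binomial coefficients are divisible by \<open>p\<close>, and \<open>p\<close>
  has absolute value at most \<open>absval uK\<close>. So p-th powers are additive up to this
  relative error, although the base field has characteristic 0.\<close>

lemma freshman:
  fixes x :: "'i \<Rightarrow> ('n, 'k) oseries"
  assumes \<eta>: "\<eta> > 0" and x: "\<And>k. k \<in> A \<Longrightarrow> obound \<eta> (x k) M" and M: "M \<ge> 0" and A: "finite A"
  shows "obound \<eta> ((\<Sum>k\<in>A. x k) ^ p - (\<Sum>k\<in>A. x k ^ p)) (absval uK * M ^ p)"
  using A x
proof (induct A)
  case empty
  have "(0 :: ('n, 'k) oseries) ^ p = 0" by (rule zero_power[OF CHAR(2)])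
  then show ?case using M by (simp add: obound_0)
next
  case (insert a A)
  let ?b = "\<Sum>k\<in>A. x k"
  have B: "absval uK * M ^ p \<ge> 0" using M by simp
  have b: "obound \<eta> ?b M" by (rule obound_sum[OF \<eta> M]) (use insert in auto)
  have a: "obound \<eta> (x a) M" using insert by simp
  let ?t = "\<lambda>k. of_nat (p choose k) * x a ^ k * ?b ^ (p - k)"
  have "(x a + ?b) ^ p = (\<Sum>k\<le>p. ?t k)" by (rule binomial_ring)
  also have "{..p} = insert 0 (insert p {1..<p})" using CHAR(2) by auto
  also have "(\<Sum>k\<in>\<dots>. ?t k) = ?b ^ p + (x a ^ p + (\<Sum>k\<in>{1..<p}. ?t k))" using CHAR(2) by simp
  finally have eq: "(x a + ?b) ^ p - (x a ^ p + (\<Sum>k\<in>A. x k ^ p)) =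
      (\<Sum>k\<in>{1..<p}. ?t k) + (?b ^ p - (\<Sum>k\<in>A. x k ^ p))" by simp
  have mid: "obound \<eta> (\<Sum>k\<in>{1..<p}. ?t k) (absval uK * M ^ p)"
  proof (rule obound_sum[OF \<eta> B])
    fix k assume k: "k \<in> {1..<p}"
    then have "p dvd p choose k" by (intro dvd_choose_prime prime_p) auto
    then obtain l where l: "p choose k = p * l" by blast
    have "absval (of_nat (p choose k) :: 'k) \<le> absval uK * 1"
      unfolding l of_nat_mult valuation_mult by (intro mult_mono absval_p_le absval_of_nat_le_1) auto
    then have "obound \<eta> (of_nat (p choose k) :: ('n, 'k) oseries) (absval uK)"
      using obound_mono[OF obound_of_nat_absval] by simp
    then have "obound \<eta> (?t k) (absval uK * M ^ k * M ^ (p - k))" by (intro obound_mult obound_power a b \<eta>)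
    moreover have "M ^ k * M ^ (p - k) = M ^ p" using k by (simp flip: power_add)
    ultimately show "obound \<eta> (?t k) (absval uK * M ^ p)" by (simp only: mult.assoc)
  qed
  have "obound \<eta> ((x a + ?b) ^ p - (x a ^ p + (\<Sum>k\<in>A. x k ^ p))) (absval uK * M ^ p)"
    unfolding eq by (rule obound_add[OF mid _ \<eta>]) (use insert in auto)
  then show ?case using insert by simp
qed

text \<open>As all nonzero coefficients of \<open>x\<close> have the same absolute value, rescaling
  makes it integral with a reduction of the same support, and
  \<open>power_normal_form_exponent\<close> applies to the leading digit \<mu> of its p-th
  power.\<close>

lemma level_power:
  assumes fin: "finite_series x" and nz: "x \<noteq> 0" and norm: "normal x"
    and val: "\<And>j i. x j i \<noteq> 0 \<Longrightarrow> absval (x j i) = absval uK powi k"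
    and M: "gauss_bound \<eta> x M" and \<eta>: "\<eta>0 \<le> \<eta>" "\<eta> < 1"
  shows "\<exists>\<mu> E. E \<in> null_series \<eta> \<and> gauss_bound \<eta> E (absval uK * \<eta> powi jI * M ^ p) \<and> normal (lift_kseries \<mu>) \<and>
    spow x p - scale (uK powi (k * int p)) (lift_kseries \<mu>) - E \<in> combos (null_series \<eta>) \<and>
    (\<forall>j i. x j i \<noteq> 0 \<longrightarrow> (\<exists>j0 i0. kcoeff \<mu> (j0, i0) \<noteq> 0 \<and> real_of_int j0 \<le> real p * (c + real_of_int j)))"
proof -
  have adm: "admissible \<eta>" by (rule radius_admissible[OF \<eta>])
  have \<eta>': "0 < \<eta>" "\<eta> \<le> 1" using \<eta> \<eta>0_pos by auto
  define q where "q = absval uK"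
  have q: "0 < q" "q < 1" using uK by (auto simp: q_def)
  from minimal_exponent_exists[OF fin nz] obtain J i1 where J: "\<And>j i. j < J \<Longrightarrow> x j i = 0" "x J i1 \<noteq> 0" by blast
  define y where "y = scale (uK powi (- k)) x"
  have xy: "x = scale (uK powi k) y" unfolding y_def scale_scale using uK by (simp add: power_int_minus)
  have yval: "absval (y j i) = 1" if "x j i \<noteq> 0" for j i
    using val[OF that] uK by (simp add: y_def scale_def valuation_mult absval_inverse absval_power_int power_int_minus)
  have y0: "y j i = 0" if "x j i = 0" for j i using that by (simp add: y_def scale_def)
  have ylow: "\<And>j i. j < J \<Longrightarrow> y j i = 0" using J(1) y0 by blast
  have y1: "gauss_bound 1 y 1" unfolding gauss_bound_1 using yval y0 by (metis absval_0 order_refl zero_le_one)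
  have yfin: "finite_series y"
    unfolding finite_series_def by (rule finite_subset[OF _ fin[unfolded finite_series_def]]) (use y0 in auto)
  have yn: "y \<in> null_series \<eta>" by (rule finite_series_null[OF yfin])
  have yR: "y \<in> carrier R_int" by (rule bounded_null_series_R_int[OF yn y1 \<eta>'(1) \<eta>(2)])
  have ynorm: "normal y" using norm y0 unfolding normal_def by blast
  note sp = spow_reduce[OF yR, of p]
  have slow: "spow y p j i = 0" if "j < int p * J" for j i by (rule spow_support[of J y j p i]) (use ylow that in blast)+
  from digit_division[of "spow y p" "int p * J", OF sp[THEN conjunct1] slow adm] obtain g \<mu> e where
    g: "\<forall>h. g h \<in> carrier R_int \<and> finite_principal_part (g h)"
    "spow y p = combination g + lift_kseries \<mu> + scale uK e" "e \<in> carrier R_int"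
    "\<forall>j i. j < int p * J + jI \<longrightarrow> e j i = 0" "normal (lift_kseries \<mu>)" "reduce res (spow y p) - \<mu> \<in> I_kappa res I" by blast
  have gn: "g h \<in> null_series \<eta>" for h
    using g(1) null_series_principal[of "g h" 1 \<eta>] \<eta> \<eta>' by (auto simp: R_int_carrier)
  have e1: "gauss_bound 1 e 1" "\<And>j. tate (e j)" using g(3) by (auto simp: R_int_carrier)
  have "finite_principal_part e" unfolding finite_principal_part_def
    by (rule exI[of _ "int p * J + jI"]) (use g(4) in auto)
  then have en: "e \<in> null_series \<eta>" by (rule null_series_principal[OF _ e1(2,1) \<eta>'(1) \<eta>(2)])
  define u where "u = uK powi (k * int p)"
  have u: "(uK powi k) ^ p = u" unfolding u_def by (simp add: power_int_mult)
  let ?E = "scale (u * uK) e"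
  have "spow x p = scale u (spow y p)" unfolding xy u[symmetric] by (rule spow_scale[OF \<eta>'(1) yn])
  also have "\<dots> = scale u (combination g) + scale u (lift_kseries \<mu>) + ?E"
    unfolding g(2) scale_add scale_scale ..
  finally have "spow x p - scale u (lift_kseries \<mu>) - ?E = scale u (combination g)" by (simp add: algebra_simps)
  moreover have "scale u (combination g) \<in> combos (null_series \<eta>)"
    by (intro combos_scale \<eta>' \<eta>(2) combosI gn)
  ultimately have A: "spow x p - scale u (lift_kseries \<mu>) - ?E \<in> combos (null_series \<eta>)" by (simp only:)
  have "gauss_bound \<eta> e (1 * \<eta> powi (int p * J + jI))"
    by (rule gauss_bound_from_support[OF e1(1)]) (use g(4) \<eta>' in auto)
  from gauss_bound_scale[OF this, of "u * uK"]
  have "gauss_bound \<eta> ?E (absval (u * uK) * \<eta> powi (int p * J + jI))" by simp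
  \<comment> \<open>The lowest coefficient of \<open>x\<close> gives
    \<open>q powi k * \<eta> powi J \<le> M\<close>, and its p-th power pays for the exponent
    \<open>int p * J\<close>; only \<open>q * \<eta> powi jI\<close> is left.\<close>
  moreover have "absval (u * uK) * \<eta> powi (int p * J + jI) \<le> q * \<eta> powi jI * M ^ p"
  proof -
    have "q powi k * \<eta> powi J \<le> M" using gauss_boundD[OF M, of J i1] val[OF J(2)] by (simp add: q_def)
    then have "(q powi k * \<eta> powi J) ^ p \<le> M ^ p" using q \<eta>' by (intro power_mono) auto
    then have "(q * \<eta> powi jI) * (q powi k * \<eta> powi J) ^ p \<le> (q * \<eta> powi jI) * M ^ p"
      using q \<eta>' by (intro mult_left_mono) auto
    moreover have "absval (u * uK) * \<eta> powi (int p * J + jI) = (q * \<eta> powi jI) * (q powi k * \<eta> powi J) ^ p"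
      using \<eta>' by (simp add: valuation_mult u_def absval_power_int absval_power q_def power_int_add power_mult_distrib power_int_mult mult.commute[of "int p"])
    ultimately show ?thesis by simp
  qed
  ultimately have B: "gauss_bound \<eta> ?E (q * \<eta> powi jI * M ^ p)" by (rule gauss_bound_mono)
  have "\<mu> - reduce res y ^ p \<in> I_kappa res I"
    using add_closedD(3)[OF I_kappa_add_closed g(6)] sp by simp
  from power_normal_form_exponent[OF yR ynorm ylow yval[OF J(2)] this]
  obtain j0 i0 where j0: "kcoeff \<mu> (j0, i0) \<noteq> 0" "real_of_int j0 \<le> real p * (c + real_of_int J)" by blast
  have D: "\<exists>j0 i0. kcoeff \<mu> (j0, i0) \<noteq> 0 \<and> real_of_int j0 \<le> real p * (c + real_of_int j)" if "x j i \<noteq> 0" for j i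
  proof -
    have "J \<le> j" using J(1) that not_le by blast
    then have "real p * (c + real_of_int J) \<le> real p * (c + real_of_int j)" by (intro mult_left_mono) auto
    then show ?thesis using j0 order_trans by blast
  qed
  show ?thesis
    by (rule exI[of _ \<mu>], rule exI[of _ ?E])
      (use null_series_scale[OF en, of "u * uK"] A B D g(5) in \<open>simp only: u_def q_def, blast\<close>)
qed

text \<open>Among the nonzero terms a single one has maximal absolute value; by the ultrametric
  inequality it decides the absolute value of the sum, which therefore bounds every term.\<close>

lemma absval_sum_distinct:
  fixes t :: "'i \<Rightarrow> 'k"
  assumes A: "finite A" and b: "b \<in> A" and tb: "t b \<noteq> 0"
    and inj: "inj_on (\<lambda>k. absval (t k)) {k \<in> A. t k \<noteq> 0}"
  shows "absval (t b) \<le> absval (sum t A)"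
proof -
  let ?B = "{k \<in> A. t k \<noteq> 0}"
  have fin: "finite ?B" "?B \<noteq> {}" using A b tb by auto
  then have "Max ((\<lambda>k. absval (t k)) ` ?B) \<in> (\<lambda>k. absval (t k)) ` ?B" by (intro Max_in) auto
  then obtain d where d: "d \<in> ?B" "Max ((\<lambda>k. absval (t k)) ` ?B) = absval (t d)" by blast
  have le: "absval (t k) \<le> absval (t d)" if "k \<in> ?B" for k
    unfolding d(2)[symmetric] using fin that by (intro Max_ge) auto
  have "absval (sum t (A - {d})) < absval (t d)"
  proof (rule absval_sum_less)
    fix k assume k: "k \<in> A - {d}"
    show "absval (t k) < absval (t d)"
    proof (cases "t k = 0")
      case True then show ?thesis using d(1) by simp
    next
      case False
      then have "k \<in> ?B" using k by simp
      then show ?thesis using le[of k] inj d(1) k by (fastforce simp: inj_on_def order.order_iff_strict)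
    qed
  qed (use d(1) in simp)
  then have "absval (t d + sum t (A - {d})) = absval (t d)" by (rule absval_add_eq)
  moreover have "sum t A = t d + sum t (A - {d})" using A d(1) by (intro sum.remove) auto
  ultimately show ?thesis using le[of b] b tb by simp
qed

text \<open>
  Were \<open>M\<close>, the maximum of \<open>|\<nu>|\<close>, larger, then \<open>|\<nu>\<^sup>p|\<close> would be at least
  \<open>\<eta>\<^bsup>pc\<^esup> M\<^sup>p > M\<close>. To see this, \<open>\<nu>\<close> is split by the absolute values of its coefficients; the
  leading digits of the normal forms of the \<open>p\<close>-th powers of the parts have different absolute values,
  so they do not cancel.
\<close>

theorem power_fixed_bound:
  assumes \<eta>: "\<eta>0 \<le> \<eta>" "\<eta> < 1" and \<nu>: "normal \<nu>" "\<nu> \<in> null_series \<eta>"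
    and fixed: "spow \<nu> p - \<nu> \<in> combos (null_series \<eta>)"
  shows "gauss_bound \<eta> \<nu> (\<eta> powr (- (real p * c / real (p - 1))))"
proof (rule ccontr)
  let ?N = "null_series \<eta> :: ('n, 'k) series set"
  \<comment> \<open>Solves \<open>M = \<eta>^(pc) M^p\<close> for \<open>M = \<eta>^(-C)\<close>;
    above this value the p-th power outgrows \<open>M\<close>.\<close>
  define C where "C = real p * c / real (p - 1)"
  define q where "q = absval uK"
  assume "\<not> ?thesis"
  then have not: "\<not> gauss_bound \<eta> \<nu> (\<eta> powr (- C))" by (simp add: C_def)
  have q: "0 < q" "q < 1" using uK by (auto simp: q_def)
  have adm: "admissible \<eta>" by (rule radius_admissible[OF \<eta>])
  have \<eta>': "0 < \<eta>" "\<eta> \<le> 1" using \<eta> \<eta>0_pos by auto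
  have C: "C > 0" using p_ge_2 c by (simp add: C_def)
  from gauss_bound_attained[OF \<nu>(2) not] obtain js ss where js:
    "\<eta> powr (- C) < absval (\<nu> js ss) * \<eta> powi js" "gauss_bound \<eta> \<nu> (absval (\<nu> js ss) * \<eta> powi js)" by auto
  define M where "M = absval (\<nu> js ss) * \<eta> powi js"
  have "1 \<le> \<eta> powr (- C)" using \<eta>' C by (simp add: powr_minus one_le_inverse powr_le1)
  then have M: "M > 1" "\<eta> powr (- C) < M" "gauss_bound \<eta> \<nu> M" using js by (auto simp: M_def)
  define \<tau> where "\<tau> = \<eta> powr (real p * c) * M ^ p"
  have \<tau>: "M < \<tau>"
  proof -
    have "(\<eta> powr (- C)) ^ (p - 1) < M ^ (p - 1)" using M p_ge_2 by (intro power_strict_mono) auto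
    moreover have "(\<eta> powr (- C)) ^ (p - 1) = \<eta> powr (- (real p * c))"
      using \<eta>' p_ge_2 by (simp add: powr_power C_def)
    ultimately have "\<eta> powr (real p * c) * \<eta> powr (- (real p * c)) < \<eta> powr (real p * c) * M ^ (p - 1)"
      using \<eta>' by (intro mult_strict_left_mono) auto
    then have "1 < \<eta> powr (real p * c) * M ^ (p - 1)" using \<eta>' by (simp add: powr_minus)
    then have "1 * M < (\<eta> powr (real p * c) * M ^ (p - 1)) * M" using M by (intro mult_strict_right_mono) auto
    also have "\<dots> = \<tau>" using CHAR(2) by (simp add: \<tau>_def power_eq_if)
    finally show ?thesis by simp
  qed
  define \<theta> where "\<theta> = q * \<eta> powi jI"
  have \<theta>: "0 < \<theta>" "\<theta> < \<eta> powr (real p * c)" using radius_powr[OF \<eta>] q \<eta>' by (auto simp: \<theta>_def q_def)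
  have "\<eta> powr (real p * c) \<le> 1" using \<eta>' c by (intro powr_le1) auto
  then have \<theta>1: "\<theta> < 1" using \<theta> by linarith
  have "q * 1 \<le> q * \<eta> powi jI"
  proof -
    have "\<eta> powi 0 \<le> \<eta> powi jI" using \<eta>' jI(1) by (intro power_int_decreasing) auto
    then show "q * 1 \<le> q * \<eta> powi jI" using q by (intro mult_left_mono) auto
  qed
  then have q\<theta>: "q \<le> \<theta>" by (simp add: \<theta>_def)
  have \<theta>\<tau>: "\<theta> * M ^ p < \<tau>" unfolding \<tau>_def using \<theta>(2) M(1) by (intro mult_strict_right_mono) auto
  \<comment> \<open>Dropping coefficients below \<theta> makes the splitting by absolute values
    finite. As \<open>\<theta> < 1 < M\<close>, the maximal coefficient survives, and the p-th power
    changes by no more than the other errors.\<close>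
  obtain \<nu>' where \<nu>': "finite_series \<nu>'" "gauss_bound \<eta> (\<nu> - \<nu>') \<theta>" "\<And>j i. \<nu>' j i = \<nu> j i \<or> \<nu>' j i = 0"
    using null_series_truncate[OF \<nu>(2) \<theta>(1)] by metis
  have \<nu>'s: "\<nu>' js ss = \<nu> js ss"
  proof (rule ccontr)
    assume "\<nu>' js ss \<noteq> \<nu> js ss"
    then have "\<nu>' js ss = 0" using \<nu>'(3) by blast
    then have "M \<le> \<theta>" using gauss_boundD[OF \<nu>'(2), of js ss] by (simp add: M_def)
    then show False using M \<theta>1 by linarith
  qed
  have \<nu>'M: "gauss_bound \<eta> \<nu>' M"
    unfolding gauss_bound_def
  proof (intro allI)
    fix j i show "absval (\<nu>' j i) * \<eta> powi j \<le> M"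
      using \<nu>'(3)[of j i] gauss_boundD[OF M(3), of j i] M(1) by auto
  qed
  have \<nu>'n: "\<nu>' \<in> ?N" by (rule finite_series_null[OF \<nu>'(1)])
  define v where "v x = (SOME k. absval x = q powi k)" for x :: 'k
  have v: "absval x = q powi v x" if "x \<noteq> 0" for x
    unfolding v_def q_def by (rule someI_ex[OF value_group[OF that]])
  define Ks where "Ks = (\<lambda>(j, i). v (\<nu>' j i)) ` {(j, i). \<nu>' j i \<noteq> 0}"
  have Ks: "finite Ks" unfolding Ks_def using \<nu>'(1) unfolding finite_series_def by (rule finite_imageI)
  have in_Ks: "v (\<nu>' j i) \<in> Ks" if "\<nu>' j i \<noteq> 0" for j i
    unfolding Ks_def using that by (intro image_eqI[of _ _ "(j, i)"]) auto
  define xs where "xs k = (\<lambda>j i. if \<nu>' j i \<noteq> 0 \<and> v (\<nu>' j i) = k then \<nu>' j i else 0)" for k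
  have xs_sum: "\<nu>' = (\<Sum>k\<in>Ks. xs k)"
  proof (intro ext)
    fix j i
    show "\<nu>' j i = (\<Sum>k\<in>Ks. xs k) j i"
    proof (cases "\<nu>' j i = 0")
      case True then show ?thesis by (simp add: sum_fun_apply2 xs_def)
    next
      case False
      then have "(\<Sum>k\<in>Ks. xs k j i) = (\<Sum>k\<in>Ks. if v (\<nu>' j i) = k then \<nu>' j i else 0)" by (simp add: xs_def)
      also have "\<dots> = \<nu>' j i" using Ks in_Ks[OF False] by simp
      finally show ?thesis by (simp add: sum_fun_apply2)
    qed
  qed
  have xs_fin: "finite_series (xs k)" for k
    unfolding finite_series_def
    by (rule finite_subset[OF _ \<nu>'(1)[unfolded finite_series_def]]) (auto simp: xs_def)
  have xs_M: "gauss_bound \<eta> (xs k) M" for k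
    using gauss_boundD[OF \<nu>'M] M(1) by (auto simp: gauss_bound_def xs_def)
  have xs_val: "absval (xs k j i) = absval uK powi k" if "xs k j i \<noteq> 0" for k j i
    using that v[of "\<nu>' j i"] by (auto simp: xs_def q_def split: if_splits)
  have xs_normal: "normal (xs k)" for k
    unfolding normal_def
  proof (intro allI impI)
    fix j i assume "xs k j i \<noteq> 0"
    then have "\<nu>' j i \<noteq> 0" by (auto simp: xs_def split: if_splits)
    then have "\<nu> j i \<noteq> 0" using \<nu>'(3)[of j i] by auto
    then show "i \<notin> L" using \<nu>(1) unfolding normal_def by blast
  qed
  have xs_nz: "xs k \<noteq> 0" if "k \<in> Ks" for k
  proof -
    from that[unfolded Ks_def] obtain x where "x \<in> {(j, i). \<nu>' j i \<noteq> 0}" "k = (\<lambda>(j, i). v (\<nu>' j i)) x" by (rule imageE)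
    then have "\<nu>' (fst x) (snd x) \<noteq> 0" "v (\<nu>' (fst x) (snd x)) = k" by (simp_all only: mem_Collect_eq case_prod_unfold not_False_eq_True)
    then have "xs k (fst x) (snd x) \<noteq> 0" by (simp add: xs_def)
    then show ?thesis by (metis zero_fun_apply)
  qed
  have "\<forall>k\<in>Ks. \<exists>\<mu> E. E \<in> ?N \<and> gauss_bound \<eta> E (\<theta> * M ^ p) \<and> normal (lift_kseries \<mu>) \<and>
    spow (xs k) p - scale (uK powi (k * int p)) (lift_kseries \<mu>) - E \<in> combos ?N \<and>
    (\<forall>j i. xs k j i \<noteq> 0 \<longrightarrow> (\<exists>j0 i0. kcoeff \<mu> (j0, i0) \<noteq> 0 \<and> real_of_int j0 \<le> real p * (c + real_of_int j)))"
    unfolding \<theta>_def q_def using level_power[OF xs_fin xs_nz xs_normal xs_val xs_M \<eta>] by blast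
  from bchoice[OF this] obtain \<mu> where "\<forall>k\<in>Ks. \<exists>E. E \<in> ?N \<and> gauss_bound \<eta> E (\<theta> * M ^ p) \<and> normal (lift_kseries (\<mu> k)) \<and>
    spow (xs k) p - scale (uK powi (k * int p)) (lift_kseries (\<mu> k)) - E \<in> combos ?N \<and>
    (\<forall>j i. xs k j i \<noteq> 0 \<longrightarrow> (\<exists>j0 i0. kcoeff (\<mu> k) (j0, i0) \<noteq> 0 \<and> real_of_int j0 \<le> real p * (c + real_of_int j)))" by blast
  from bchoice[OF this] obtain E where lev: "\<And>k. k \<in> Ks \<Longrightarrow> E k \<in> ?N" "\<And>k. k \<in> Ks \<Longrightarrow> gauss_bound \<eta> (E k) (\<theta> * M ^ p)"
    "\<And>k. k \<in> Ks \<Longrightarrow> normal (lift_kseries (\<mu> k))"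
    "\<And>k. k \<in> Ks \<Longrightarrow> spow (xs k) p - scale (uK powi (k * int p)) (lift_kseries (\<mu> k)) - E k \<in> combos ?N"
    "\<And>k j i. k \<in> Ks \<Longrightarrow> xs k j i \<noteq> 0 \<Longrightarrow> \<exists>j0 i0. kcoeff (\<mu> k) (j0, i0) \<noteq> 0 \<and> real_of_int j0 \<le> real p * (c + real_of_int j)" by blast
  let ?lift = "\<lambda>k. scale (uK powi (k * int p)) (lift_kseries (\<mu> k)) :: ('n, 'k) series"
  define S where "S = (\<Sum>k\<in>Ks. ?lift k)"
  \<comment> \<open>Three errors, each of norm at most \<open>\<theta> * M ^ p\<close>: truncation,
    failure of additivity of p-th powers, and the lower digits of the pieces.\<close>
  define E0 where "E0 = spow \<nu> p - spow \<nu>' p"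
  define E1 where "E1 = spow \<nu>' p - (\<Sum>k\<in>Ks. spow (xs k) p)"
  define Es where "Es = (\<Sum>k\<in>Ks. E k)"
  have E0: "gauss_bound \<eta> E0 (\<theta> * M ^ p)" unfolding E0_def
    by (rule spow_diff_bound[OF \<eta>'(1) \<nu>(2) M(3) \<nu>'n \<nu>'M \<nu>'(2)]) (use M in simp)
  have E1: "gauss_bound \<eta> E1 (\<theta> * M ^ p)"
  proof -
    have xb: "xs k \<in> bounded_null_series \<eta>" for k
    proof -
      obtain B where "B > 0" "gauss_bound 1 (xs k) B" using null_series_bounded[OF finite_series_null[OF xs_fin]] by blast
      then show ?thesis using finite_series_null[OF xs_fin] unfolding bounded_null_series_def by blast
    qed
    note rx = rep_o_Abs[OF xb \<eta>'(1) \<eta>(2)]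
    have "obound \<eta> ((\<Sum>k\<in>Ks. Abs_o (xs k)) ^ p - (\<Sum>k\<in>Ks. Abs_o (xs k) ^ p)) (absval uK * M ^ p)"
      by (rule freshman[OF \<eta>'(1) _ _ Ks]) (use xs_M M in \<open>simp_all add: obound_def rx\<close>)
    then have "gauss_bound \<eta> E1 (q * M ^ p)"
      unfolding obound_def rep_o_simps(6) rep_o_power rep_o_sum rx xs_sum[symmetric] E1_def q_def .
    then show ?thesis by (rule gauss_bound_mono) (use q\<theta> M in \<open>simp add: mult_right_mono\<close>)
  qed
  have Es: "gauss_bound \<eta> Es (\<theta> * M ^ p)" unfolding Es_def
    by (rule gauss_bound_sum[OF lev(2) \<eta>'(1)]) (use \<theta> M in auto)
  let ?E = "E0 + E1 + Es"
  have Eb: "gauss_bound \<eta> ?E (\<theta> * M ^ p)"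
    by (rule gauss_bound_add[OF gauss_bound_add[OF E0 E1 \<eta>'(1)] Es \<eta>'(1)])
  note sn = spow_null[OF \<eta>'(1)]
  have En: "?E \<in> ?N" unfolding E0_def E1_def Es_def
    by (intro null_series_add null_series_diff null_series_sum sn \<nu>(2) \<nu>'n finite_series_null xs_fin lev(1) \<eta>'(1))
  note ac = combos_add_closed[OF null_series_add_closed[OF \<eta>'(1)] subset_refl \<eta>'(1) \<eta>(2)]
  note cl = add_closedD[OF ac]
  have "(\<Sum>k\<in>Ks. spow (xs k) p - ?lift k - E k) \<in> combos ?N" by (rule add_closed_sum[OF ac lev(4)])
  then have "(\<Sum>k\<in>Ks. spow (xs k) p) - S - Es \<in> combos ?N" by (simp only: sum_subtractf S_def Es_def)
  then have A: "spow \<nu> p - S - ?E \<in> combos ?N"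
    unfolding E0_def E1_def by (simp add: algebra_simps)
  from division_admissible[OF En adm] obtain g \<epsilon> where g: "normal \<epsilon>" "?E = combination g + \<epsilon>"
    "\<forall>h. g h \<in> ?N" "\<epsilon> \<in> ?N" "gauss_bound \<eta> \<epsilon> (\<theta> * M ^ p)" using adm En Eb by blast
  have "combination g \<in> combos ?N" by (rule combosI) (use g(3) in blast)
  from cl(2)[OF cl(4)[OF A fixed] this] have diff: "\<nu> - (S + \<epsilon>) \<in> combos ?N"
    unfolding g(2) by (simp add: algebra_simps)
  have Sn: "S \<in> ?N" unfolding S_def
    by (intro null_series_sum null_series_scale lift_kseries_null \<eta>'(1) \<eta>(2))
  have Snorm: "normal S" unfolding S_def
    by (rule normal_sum) (use lev(3) in \<open>auto simp: normal_def scale_def\<close>)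
  \<comment> \<open>The p-th power is congruent to \<open>S + \<epsilon>\<close> and, by assumption,
    to \<nu>. Both are normal, so they agree.\<close>
  have \<nu>_eq: "\<nu> = S + \<epsilon>"
    by (rule normal_form_unique_combos[OF null_series_add_closed[OF \<eta>'(1)] subset_refl \<eta>'(1) \<eta>(2) adm
        \<nu> normal_add[OF Snorm g(1)] null_series_add[OF Sn g(4) \<eta>'(1)] diff])
  have SB: "gauss_bound \<eta> S (max M (\<theta> * M ^ p))"
  proof -
    have "S = \<nu> - \<epsilon>" using \<nu>_eq by simp
    moreover have "gauss_bound \<eta> (\<nu> - \<epsilon>) (max M (\<theta> * M ^ p))"
      by (rule gauss_bound_diff[OF gauss_bound_mono[OF M(3)] gauss_bound_mono[OF g(5)] \<eta>'(1)]) simp_all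
    ultimately show ?thesis by (simp only:)
  qed
  \<comment> \<open>The piece that contains the maximal coefficient of \<nu>. Its digit has a term
    at an exponent \<open>j0\<close> low enough to give it weight at least \<tau>.\<close>
  define k0 where "k0 = v (\<nu> js ss)"
  have "\<nu> js ss \<noteq> 0" using M(1) by (auto simp: M_def)
  then have k0: "k0 \<in> Ks" "xs k0 js ss \<noteq> 0" using in_Ks[of js ss] by (simp_all add: k0_def \<nu>'s xs_def)
  from lev(5)[OF k0] obtain j0 i0 where j0: "kcoeff (\<mu> k0) (j0, i0) \<noteq> 0"
    "real_of_int j0 \<le> real p * (c + real_of_int js)" by blast
  let ?t = "\<lambda>k. ?lift k j0 i0"
  have t: "absval (?t k) = q powi (k * int p)" if "?t k \<noteq> 0" for k
  proof -
    have "kcoeff (\<mu> k) (j0, i0) \<noteq> 0" using that by (auto simp: scale_def lift_kseries_nonzero)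
    then show ?thesis by (simp add: scale_def valuation_mult absval_lift_kseries absval_power_int q_def)
  qed
  have t0: "?t k0 \<noteq> 0" using j0(1) uK by (simp add: scale_def lift_kseries_nonzero)
  have "absval (?t k0) \<le> absval (\<Sum>k\<in>Ks. ?t k)"
  proof (rule absval_sum_distinct[of Ks k0 ?t, OF Ks k0(1) t0])
    show "inj_on (\<lambda>k. absval (?t k)) {k \<in> Ks. ?t k \<noteq> 0}"
    proof (rule inj_onI)
      fix k l assume kl: "k \<in> {k \<in> Ks. ?t k \<noteq> 0}" "l \<in> {k \<in> Ks. ?t k \<noteq> 0}" "absval (?t k) = absval (?t l)"
      then have "absval (?t k) = q powi (k * int p)" "absval (?t l) = q powi (l * int p)" using t by blast+
      with kl(3) have "q powi (k * int p) = q powi (l * int p)" by (simp only:)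
      moreover have "q powi b < q powi a" if "a < b" for a b using q that by (intro power_int_strict_decreasing) auto
      ultimately have "k * int p = l * int p" by (metis less_irrefl linorder_neqE_linordered_idom)
      then show "k = l" using CHAR(2) by simp
    qed
  qed
  also have "(\<Sum>k\<in>Ks. ?t k) = S j0 i0" by (simp add: S_def sum_fun_apply2)
  finally have "q powi (k0 * int p) * \<eta> powi j0 \<le> absval (S j0 i0) * \<eta> powi j0"
    unfolding t[OF t0] using \<eta>' by (intro mult_right_mono) auto
  also have "\<dots> \<le> max M (\<theta> * M ^ p)" by (rule gauss_boundD[OF SB])
  also have "\<dots> < \<tau>" using \<tau> \<theta>\<tau> by simp
  also have "\<tau> \<le> q powi (k0 * int p) * \<eta> powi j0"
  proof -
    have "absval (\<nu> js ss) = q powi k0" unfolding k0_def by (rule v) fact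
    then have "M = q powi k0 * \<eta> powr real_of_int js" using \<eta>' by (simp add: M_def powr_eq_powi)
    then have "M ^ p = q powi (k0 * int p) * \<eta> powr (real p * real_of_int js)"
      using \<eta>' by (simp add: power_mult_distrib power_int_mult powr_power mult.commute)
    then have "\<tau> = q powi (k0 * int p) * \<eta> powr (real p * (c + real_of_int js))"
      by (simp add: \<tau>_def powr_add distrib_left)
    also have "\<dots> \<le> q powi (k0 * int p) * \<eta> powr real_of_int j0"
      using j0(2) \<eta>' q by (intro mult_left_mono powr_mono') auto
    finally show ?thesis using \<eta>' by (simp add: powr_eq_powi)
  qed
  finally show False by simp
qed

lemma idempotent_power_fixed:
  assumes \<eta>: "0 < \<eta>" "\<eta> < 1" and \<nu>: "\<nu> \<in> null_series \<eta>" and id: "\<nu> \<star> \<nu> - \<nu> \<in> combos (null_series \<eta>)"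
  shows "spow \<nu> (Suc n) - \<nu> \<in> combos (null_series \<eta>)"
proof (induct n)
  note ac = null_series_add_closed[OF \<eta>(1)]
  note cl = add_closedD[OF combos_add_closed[OF ac subset_refl \<eta>]]
  {
    case 0
    have "spow \<nu> (Suc 0) = \<nu>" using series_one_mult[of \<nu>] by (simp only: spow_simps series_mult_commute)
    then show ?case using cl(1) by (simp only: diff_self)
  next
    case (Suc n)
    note sn = spow_null[OF \<eta>(1) \<nu>]
    have "\<nu> \<star> (spow \<nu> (Suc n) - \<nu>) \<in> combos (null_series \<eta>)"
      by (rule combos_mult[OF ac subset_refl \<eta> \<nu> _ Suc]) (rule null_series_mult[OF \<nu> _ \<eta>(1)])
    from cl(2)[OF this id] have "\<nu> \<star> (spow \<nu> (Suc n) - \<nu>) + (\<nu> \<star> \<nu> - \<nu>) \<in> combos (null_series \<eta>)" .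
    moreover have "\<nu> \<star> (spow \<nu> (Suc n) - \<nu>) = spow \<nu> (Suc (Suc n)) - \<nu> \<star> \<nu>"
      using null_mult_diff_left[OF \<eta>(1) sn[of "Suc n"] \<nu> \<nu>] series_mult_commute[of "spow \<nu> (Suc n) - \<nu>" \<nu>]
        series_mult_commute[of "spow \<nu> (Suc n)" \<nu>] spow_simps(2)[of \<nu> "Suc n"] by metis
    ultimately show ?case by (simp only: diff_add_eq add_diff_eq diff_add_cancel add_diff_cancel_right')
  }
qed

corollary idempotent_normal_bound:
  assumes \<alpha>: "\<eta>0 \<le> \<alpha>" "\<alpha> < 1" and \<nu>: "normal \<nu>" "\<And>\<eta>. \<alpha> \<le> \<eta> \<Longrightarrow> \<eta> < 1 \<Longrightarrow> \<nu> \<in> null_series \<eta>"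
    "\<And>\<eta>. \<alpha> \<le> \<eta> \<Longrightarrow> \<eta> < 1 \<Longrightarrow> \<nu> \<star> \<nu> - \<nu> \<in> combos (null_series \<eta>)"
  shows "gauss_bound 1 \<nu> 1"
  unfolding gauss_bound_1
proof (intro allI)
  fix j i
  let ?C = "- (real p * c / real (p - 1))"
  obtain k where k: "p = Suc k" using CHAR(2) by (cases p) auto
  have le: "absval (\<nu> j i) * \<eta> powr real_of_int j \<le> \<eta> powr ?C" if \<eta>: "\<alpha> \<le> \<eta>" "\<eta> < 1" for \<eta>
  proof -
    have \<eta>': "\<eta>0 \<le> \<eta>" "0 < \<eta>" using \<alpha> \<eta> \<eta>0_pos by auto
    have "spow \<nu> p - \<nu> \<in> combos (null_series \<eta>)"
      unfolding k by (rule idempotent_power_fixed[OF \<eta>'(2) \<eta>(2) \<nu>(2,3)[OF \<eta>]])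
    from power_fixed_bound[OF \<eta>'(1) \<eta>(2) \<nu>(1) \<nu>(2)[OF \<eta>] this]
    show ?thesis using gauss_boundD \<eta>'(2) by (simp only: powr_eq_powi)
  qed
  have lim: "((\<lambda>\<eta>. \<eta> powr a) \<longlongrightarrow> 1 powr a) (at_left 1)" for a :: real
    by (intro tendsto_powr tendsto_ident_at tendsto_const) simp
  have "absval (\<nu> j i) * 1 powr real_of_int j \<le> 1 powr ?C"
  proof (rule tendsto_le[OF _ lim tendsto_mult[OF tendsto_const lim]])
    show "eventually (\<lambda>\<eta>. absval (\<nu> j i) * \<eta> powr real_of_int j \<le> \<eta> powr ?C) (at_left 1)"
      unfolding eventually_at_left_field using le \<alpha>(2) by (intro exI[of _ \<alpha>]) auto
  qed simp
  then show "absval (\<nu> j i) \<le> 1" by simp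
qed

section \<open>The rings over the half-open annulus and their ideals\<close>

abbreviation Ieta where "Ieta \<equiv> I_eta \<eta>0 I"

definition annulus_series :: "real \<times> real \<Rightarrow> ('n, 'k) series set" where
  "annulus_series w = null_series (fst w) \<inter> null_series (snd w)"

lemma bounded_null_subset: "bounded_null_series \<eta> \<subseteq> null_series \<eta>"
  by (auto simp: bounded_null_series_def)

lemma adm0: "admissible \<eta>0"
  using radius_admissible \<eta>0_less_1 by simp

text \<open>The remainder of the division lies in the ideal and is normal, hence 0. So the
  \<open>r h\<close> generate the ideal also over the bounded series on the annulus.\<close>

lemma bounded_ideal_combos:
  assumes \<alpha>: "admissible \<alpha>" and f: "f \<in> extend_scalars I" "f \<in> bounded_null_series \<alpha>"
  shows "f \<in> combos (bounded_null_series \<alpha>)"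
proof -
  have \<alpha>': "0 < \<alpha>" "\<alpha> < 1" using \<alpha> by (auto simp: admissible_def)
  from division_bounded[OF f(2) \<alpha>] obtain g \<nu> where g: "normal \<nu>" "f = combination g + \<nu>"
    "\<forall>h. g h \<in> bounded_null_series \<alpha>" by blast
  have "combination g \<in> extend_scalars I" by (rule combination_extend_scalars[OF _ \<alpha>']) (use g(3) in blast)
  from add_closedD(4)[OF extend_scalars_add_closed f(1) this] have "\<nu> \<in> extend_scalars I" by (simp add: g(2))
  then have "\<nu> = 0" by (rule normal_in_ideal_eq_0[OF g(1)])
  then have "f = combination g" using g(2) by simp
  moreover have "combination g \<in> combos (bounded_null_series \<alpha>)" by (rule combosI) (use g(3) in blast)
  ultimately show ?thesis by (simp only:)
qed

text \<open>A converse in which the given coefficients may be unbounded: dividing \<open>f\<close>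
  anew with bounded quotients leaves a normal remainder that is a combination with convergent
  coefficients, hence 0.\<close>

lemma combos_bounded_ideal:
  assumes \<alpha>: "admissible \<alpha>" and f: "f \<in> combos (null_series \<alpha>)" "f \<in> bounded_null_series \<alpha>"
  shows "f \<in> extend_scalars I"
proof -
  have \<alpha>': "0 < \<alpha>" "\<alpha> < 1" using \<alpha> by (auto simp: admissible_def)
  note ac = null_series_add_closed[OF \<alpha>'(1)]
  from division_bounded[OF f(2) \<alpha>] obtain g \<nu> where g: "normal \<nu>" "f = combination g + \<nu>"
    "\<forall>h. g h \<in> bounded_null_series \<alpha>" "\<nu> \<in> bounded_null_series \<alpha>" by blast
  have gc: "combination g \<in> combos (null_series \<alpha>)" by (rule combosI) (use g(3) bounded_null_subset in blast)
  from add_closedD(4)[OF combos_add_closed[OF ac subset_refl \<alpha>'] f(1) gc]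
  have "\<nu> - 0 \<in> combos (null_series \<alpha>)" by (simp add: g(2))
  from normal_form_unique_combos[OF ac subset_refl \<alpha>' \<alpha> g(1) subsetD[OF bounded_null_subset g(4)] normal_0 null_series_0 this]
  have "f = combination g" using g(2) by simp
  moreover have "combination g \<in> extend_scalars I" by (rule combination_extend_scalars[OF _ \<alpha>']) (use g(3) in blast)
  ultimately show ?thesis by (simp only:)
qed

lemma R_eta_ring: "R_eta \<eta>0 = series_ring (bounded_null_series \<eta>0)"
  by (rule R_eta_eq[OF \<eta>0_pos \<eta>0_less_1])

lemma R_eta_add: "f \<oplus>\<^bsub>R_eta \<eta>0\<^esub> g = f + (g :: ('n, 'k) series)"
  by (simp only: R_eta_ring series_ring_simps)

lemma bounded_ideal: "ideal (extend_scalars I \<inter> bounded_null_series \<eta>0) (R_eta \<eta>0)"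
proof (rule ideal_from_add_closed[OF cring_R_eta[OF \<eta>0_pos \<eta>0_less_1] R_eta_add])
  note e = add_closedD[OF extend_scalars_add_closed] and b = bounded_null_series_closed[OF \<eta>0_pos]
  show "add_closed (extend_scalars I \<inter> bounded_null_series \<eta>0)"
    unfolding add_closed_def by (intro conjI ballI IntI) (simp_all only: Int_iff e b)
  fix a x :: "('n, 'k) series" assume ax: "a \<in> extend_scalars I \<inter> bounded_null_series \<eta>0" "x \<in> carrier (R_eta \<eta>0)"
  then have x: "x \<in> bounded_null_series \<eta>0" by (simp only: R_eta_ring series_ring_simps)
  have ra: "rep_o (Abs_o a) = a" and rx: "rep_o (Abs_o x) = x"
    using ax(1) rep_o_Abs[OF _ \<eta>0_pos \<eta>0_less_1] x by blast+
  have "rep_o (Abs_o x * Abs_o a) \<in> extend_scalars I" by (rule extend_scalars_mult) (use ax(1) ra in simp)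
  then show "x \<otimes>\<^bsub>R_eta \<eta>0\<^esub> a \<in> extend_scalars I \<inter> bounded_null_series \<eta>0"
    using b(5)[OF x, of a] ax(1) by (simp only: rep_o_simps ra rx R_eta_ring series_ring_simps) blast
qed (simp add: R_eta_ring)

lemma I_eta_eq: "Ieta = extend_scalars I \<inter> bounded_null_series \<eta>0"
proof -
  interpret R: cring "R_eta \<eta>0 :: ('n, 'k) series ring" by (rule cring_R_eta[OF \<eta>0_pos \<eta>0_less_1])
  have car: "carrier (R_eta \<eta>0) = bounded_null_series \<eta>0" by (simp only: R_eta_ring series_ring_simps)
  show ?thesis unfolding I_eta_def car
    by (intro equalityI R.genideal_minimal[OF bounded_ideal subset_refl] R.genideal_self) (simp add: car)
qed

lemma I_eta_ideal: "ideal Ieta (R_eta \<eta>0)"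
  unfolding I_eta_eq by (rule bounded_ideal)

lemma I_eta_add_closed: "add_closed Ieta"
  by (rule ideal_add_closed[OF I_eta_ideal R_eta_add])

lemma coset_I_eta: "Ieta +>\<^bsub>R_eta \<eta>0\<^esub> f = coset Ieta f"
  by (rule a_r_coset_eq_coset[OF I_eta_ideal R_eta_add])

lemma A_eta_simps:
  "carrier (A_eta \<eta>0 I) = coset Ieta ` bounded_null_series \<eta>0"
  "\<lbrakk>f \<in> bounded_null_series \<eta>0; g \<in> bounded_null_series \<eta>0\<rbrakk> \<Longrightarrow>
     coset Ieta f \<otimes>\<^bsub>A_eta \<eta>0 I\<^esub> coset Ieta g = coset Ieta (f \<star> g)"
  "\<lbrakk>f \<in> bounded_null_series \<eta>0; g \<in> bounded_null_series \<eta>0\<rbrakk> \<Longrightarrow>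
     coset Ieta f \<oplus>\<^bsub>A_eta \<eta>0 I\<^esub> coset Ieta g = coset Ieta (f + g)"
  "\<one>\<^bsub>A_eta \<eta>0 I\<^esub> = coset Ieta series_one"
  using carrier_Quot[OF I_eta_ideal R_eta_add] Quot_mult[OF I_eta_ideal R_eta_add, of f g]
    Quot_add[OF I_eta_ideal R_eta_add, of f g] Quot_one[OF I_eta_ideal R_eta_add]
  unfolding A_eta_def R_eta_ring series_ring_simps by blast+

definition integral_series :: "('n, 'k) series set" where
  "integral_series = {f \<in> null_series \<eta>0. gauss_bound 1 f 1}"

lemma carrier_R_eta_int': "carrier (R_eta_int \<eta>0) = integral_series"
  unfolding integral_series_def by (rule carrier_R_eta_int[OF \<eta>0_pos \<eta>0_less_1])

lemma integral_series:
  "f \<in> integral_series \<Longrightarrow> f \<in> bounded_null_series \<eta>0" "f \<in> integral_series \<Longrightarrow> f \<in> carrier R_int"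
  "series_one \<in> integral_series" "f \<in> integral_series \<Longrightarrow> g \<in> integral_series \<Longrightarrow> f \<star> g \<in> integral_series"
  "f \<in> integral_series \<Longrightarrow> g \<in> integral_series \<Longrightarrow> f + g \<in> integral_series"
  "f \<in> integral_series \<Longrightarrow> g \<in> integral_series \<Longrightarrow> f - g \<in> integral_series"
proof -
  show "f \<in> integral_series \<Longrightarrow> f \<in> bounded_null_series \<eta>0"
    unfolding integral_series_def bounded_null_series_def by blast
  show "f \<in> integral_series \<Longrightarrow> f \<in> carrier R_int"
    unfolding integral_series_def using bounded_null_series_R_int \<eta>0_pos \<eta>0_less_1 by blast
  show "series_one \<in> integral_series"
    unfolding integral_series_def by (auto intro!: gauss_bound_series_monom)
  assume "f \<in> integral_series" "g \<in> integral_series"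
  then have fg: "f \<in> null_series \<eta>0" "g \<in> null_series \<eta>0" "gauss_bound 1 f 1" "gauss_bound 1 g 1"
    by (auto simp: integral_series_def)
  have "gauss_bound 1 (f \<star> g) 1" using gauss_bound_mult[OF fg(3,4) zero_less_one] by simp
  then show "f \<star> g \<in> integral_series" "f + g \<in> integral_series" "f - g \<in> integral_series"
    using null_series_mult[OF fg(1,2) \<eta>0_pos] null_series_add[OF fg(1,2) \<eta>0_pos] null_series_diff[OF fg(1,2) \<eta>0_pos]
      gauss_bound_add[OF fg(3,4) zero_less_one] gauss_bound_diff[OF fg(3,4) zero_less_one]
    unfolding integral_series_def by blast+
qed

lemma A_eta_int_simps:
  "carrier (A_eta_int \<eta>0 I) = coset Ieta ` integral_series"
  "a \<otimes>\<^bsub>A_eta_int \<eta>0 I\<^esub> b = a \<otimes>\<^bsub>A_eta \<eta>0 I\<^esub> b" "a \<oplus>\<^bsub>A_eta_int \<eta>0 I\<^esub> b = a \<oplus>\<^bsub>A_eta \<eta>0 I\<^esub> b"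
  "\<one>\<^bsub>A_eta_int \<eta>0 I\<^esub> = \<one>\<^bsub>A_eta \<eta>0 I\<^esub>"
  by (simp_all add: A_eta_int_def carrier_R_eta_int' coset_I_eta)

lemma carrier_A_eta_int_subset: "carrier (A_eta_int \<eta>0 I) \<subseteq> carrier (A_eta \<eta>0 I)"
  unfolding A_eta_int_simps A_eta_simps using integral_series(1) by blast

lemma coset_I_kappa: "I_kappa res I +>\<^bsub>R_kappa\<^esub> x = coset (I_kappa res I) x"
  by (rule a_r_coset_eq_coset[OF I_kappa_ideal R_kappa_add])

text \<open>Two integral representatives differ by an integral element of the extended ideal, which
  lies in \<open>I\<close> by saturation. So the union in \<open>reduction\<close> runs over equal
  cosets.\<close>

lemma reduction_coset:
  assumes f: "f \<in> integral_series"
  shows "reduction \<eta>0 res I (coset Ieta f) = coset (I_kappa res I) (reduce res f)"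
proof -
  have eq: "coset (I_kappa res I) (reduce res g) = coset (I_kappa res I) (reduce res f)"
    if g: "g \<in> coset Ieta f \<inter> integral_series" for g
  proof -
    have "g - f \<in> integral_series" using integral_series(6) g f by blast
    then have "gauss_bound 1 (g - f) 1" by (simp add: integral_series_def)
    moreover have "g - f \<in> extend_scalars I" using g by (simp add: I_eta_eq)
    ultimately have gf: "g - f \<in> I" by (intro extend_scalars_integral)
    have "reduce res g - reduce res f = reduce res (g - f)"
      using reduce_diff[of g f] integral_series(2)[of g] integral_series(2)[OF f] I_carrier[OF ideal gf] g by simp
    then have "reduce res g - reduce res f \<in> I_kappa res I" using gf by (simp add: I_kappa_def)
    then show ?thesis by (simp only: coset_eq_iff[OF I_kappa_add_closed])
  qed
  have "f \<in> coset Ieta f \<inter> integral_series" using coset_self[OF I_eta_add_closed] f by blast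
  then show ?thesis unfolding reduction_def carrier_R_eta_int' coset_I_kappa using eq by blast
qed

lemma reduction_ring_hom: "reduction \<eta>0 res I \<in> ring_hom (A_eta_int \<eta>0 I) (A_kappa res I)"
proof (rule ring_hom_memI)
  note i = integral_series
  show "reduction \<eta>0 res I \<one>\<^bsub>A_eta_int \<eta>0 I\<^esub> = \<one>\<^bsub>A_kappa res I\<^esub>"
    unfolding A_eta_int_simps A_eta_simps A_kappa_simps reduction_coset[OF i(3)] reduce_one ..
  fix a assume "a \<in> carrier (A_eta_int \<eta>0 I)"
  then obtain f where f: "f \<in> integral_series" "a = coset Ieta f" unfolding A_eta_int_simps by blast
  then show "reduction \<eta>0 res I a \<in> carrier (A_kappa res I)" by (simp add: reduction_coset A_kappa_simps)
  fix b assume "b \<in> carrier (A_eta_int \<eta>0 I)"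
  then obtain g where g: "g \<in> integral_series" "b = coset Ieta g" unfolding A_eta_int_simps by blast
  note m = i(4)[OF f(1) g(1)] and s = i(5)[OF f(1) g(1)]
  show "reduction \<eta>0 res I (a \<otimes>\<^bsub>A_eta_int \<eta>0 I\<^esub> b) = reduction \<eta>0 res I a \<otimes>\<^bsub>A_kappa res I\<^esub> reduction \<eta>0 res I b"
    unfolding A_eta_int_simps f(2) g(2) A_eta_simps(2)[OF i(1)[OF f(1)] i(1)[OF g(1)]] reduction_coset[OF f(1)]
      reduction_coset[OF g(1)] reduction_coset[OF m] A_kappa_simps reduce_mult[OF i(2)[OF f(1)] i(2)[OF g(1)] i(2)[OF m]] ..
  show "reduction \<eta>0 res I (a \<oplus>\<^bsub>A_eta_int \<eta>0 I\<^esub> b) = reduction \<eta>0 res I a \<oplus>\<^bsub>A_kappa res I\<^esub> reduction \<eta>0 res I b"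
    unfolding A_eta_int_simps f(2) g(2) A_eta_simps(3)[OF i(1)[OF f(1)] i(1)[OF g(1)]] reduction_coset[OF f(1)]
      reduction_coset[OF g(1)] reduction_coset[OF s] A_kappa_simps reduce_add[OF i(2)[OF f(1)] i(2)[OF g(1)] i(2)[OF s]] ..
qed

section \<open>Idempotents and reduction\<close>

lemma integral_series_oseries:
  assumes "f \<in> integral_series"
  shows "\<exists>x. rep_o x = f \<and> onull \<eta>0 x \<and> obound 1 x 1"
proof -
  have r: "rep_o (Abs_o f) = f" by (rule rep_o_Abs[OF integral_series(1)[OF assms] \<eta>0_pos \<eta>0_less_1])
  then show ?thesis using integral_series(1)[OF assms] assms
    by (intro exI[of _ "Abs_o f"]) (simp add: onull_def obound_def integral_series_def)
qed

lemma oseries_integral_series: "onull \<eta>0 x \<Longrightarrow> obound 1 x 1 \<Longrightarrow> rep_o x \<in> integral_series"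
  by (simp add: onull_def obound_def integral_series_def bounded_null_series_def)

lemma A_eta_idempotent_iff:
  assumes "f \<in> bounded_null_series \<eta>0"
  shows "coset Ieta f \<in> idempotents (A_eta \<eta>0 I) \<longleftrightarrow> f \<star> f - f \<in> extend_scalars I"
proof -
  note b = bounded_null_series_closed[OF \<eta>0_pos]
  have "f \<star> f + - f \<in> bounded_null_series \<eta>0" by (intro b assms)
  then have "f \<star> f - f \<in> bounded_null_series \<eta>0" by simp
  then have "f \<star> f - f \<in> Ieta \<longleftrightarrow> f \<star> f - f \<in> extend_scalars I" unfolding I_eta_eq by blast
  then show ?thesis using assms
    unfolding idempotents_def mem_Collect_eq A_eta_simps(1) A_eta_simps(2)[OF assms assms]
      coset_eq_iff[OF I_eta_add_closed] by blast
qed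

lemma A_eta_int_idempotent:
  assumes "a \<in> idempotents (A_eta_int \<eta>0 I)"
  shows "\<exists>x. a = coset Ieta (rep_o x) \<and> onull \<eta>0 x \<and> obound 1 x 1 \<and> rep_o (x * x - x) \<in> I"
proof -
  obtain f where f: "f \<in> integral_series" "a = coset Ieta f"
    using assms unfolding idempotents_def A_eta_int_simps by blast
  obtain x where x: "rep_o x = f" "onull \<eta>0 x" "obound 1 x 1" using integral_series_oseries[OF f(1)] by blast
  have "a \<in> idempotents (A_eta \<eta>0 I)"
    using assms carrier_A_eta_int_subset unfolding idempotents_def A_eta_int_simps(2) by blast
  then have "rep_o (x * x - x) \<in> extend_scalars I"
    using A_eta_idempotent_iff[OF integral_series(1)[OF f(1)]] f(2) by (simp add: rep_o_simps x)
  moreover have "obound 1 (x * x - x) 1" using obound_mult[OF x(3) x(3)] by (intro obound_diff x) auto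
  ultimately have "rep_o (x * x - x) \<in> I" unfolding obound_def by (intro extend_scalars_integral)
  then show ?thesis using f x by blast
qed

lemma idempotents_integral: "idempotents (A_eta_int \<eta>0 I) = idempotents (A_eta \<eta>0 I)"
proof (intro equalityI subsetI)
  fix a assume "a \<in> idempotents (A_eta_int \<eta>0 I)"
  then show "a \<in> idempotents (A_eta \<eta>0 I)"
    using carrier_A_eta_int_subset unfolding idempotents_def A_eta_int_simps(2) by blast
next
  fix a assume a: "a \<in> idempotents (A_eta \<eta>0 I)"
  then obtain f where f: "f \<in> bounded_null_series \<eta>0" "a = coset Ieta f"
    unfolding idempotents_def A_eta_simps by blast
  have r: "rep_o (Abs_o f) = f" by (rule rep_o_Abs[OF f(1) \<eta>0_pos \<eta>0_less_1])
  have on: "onull \<eta>0 (Abs_o f)" unfolding onull_def r by (rule f(1))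
  have "rep_o (Abs_o f * Abs_o f - Abs_o f) \<in> extend_scalars I"
    using a A_eta_idempotent_iff[OF f(1)] f(2) by (simp add: rep_o_simps r)
  from integral_idempotent[OF reduced adm0 on this] obtain n where
    n: "onull \<eta>0 n" "obound 1 n 1" "rep_o (Abs_o f - n) \<in> extend_scalars I" by blast
  have "onull \<eta>0 (Abs_o f - n)" by (rule onull_closed(5)[OF \<eta>0_pos on n(1)])
  then have "f - rep_o n \<in> Ieta" using n(3) by (simp only: I_eta_eq onull_def rep_o_simps r) blast
  then have "a = coset Ieta (rep_o n)" using f(2) by (simp only: coset_eq_iff[OF I_eta_add_closed])
  then have "a \<in> carrier (A_eta_int \<eta>0 I)" unfolding A_eta_int_simps using oseries_integral_series[OF n(1,2)] by blast
  then show "a \<in> idempotents (A_eta_int \<eta>0 I)" using a unfolding idempotents_def A_eta_int_simps(2) by blast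
qed

lemma reduction_bij: "bij_betw (reduction \<eta>0 res I) (idempotents (A_eta_int \<eta>0 I)) (idempotents (A_kappa res I))"
proof -
  have "inj_on (reduction \<eta>0 res I) (idempotents (A_eta_int \<eta>0 I))"
  proof (rule inj_onI)
    fix a b assume ab: "a \<in> idempotents (A_eta_int \<eta>0 I)" "b \<in> idempotents (A_eta_int \<eta>0 I)"
      and eq: "reduction \<eta>0 res I a = reduction \<eta>0 res I b"
    obtain x where x: "a = coset Ieta (rep_o x)" "onull \<eta>0 x" "obound 1 x 1" "rep_o (x * x - x) \<in> I"
      using A_eta_int_idempotent[OF ab(1)] by blast
    obtain y where y: "b = coset Ieta (rep_o y)" "onull \<eta>0 y" "obound 1 y 1" "rep_o (y * y - y) \<in> I"
      using A_eta_int_idempotent[OF ab(2)] by blast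
    have "reduce res (rep_o x) - reduce res (rep_o y) \<in> I_kappa res I"
      using eq unfolding x(1) y(1) reduction_coset[OF oseries_integral_series[OF x(2,3)]]
        reduction_coset[OF oseries_integral_series[OF y(2,3)]] coset_eq_iff[OF I_kappa_add_closed] .
    from idempotent_unique[OF adm0 x(2-4) y(2-4) this] have "rep_o (x - y) \<in> extend_scalars I" by (rule extend_scalars_incl)
    moreover have "onull \<eta>0 (x - y)" by (rule onull_closed(5)[OF \<eta>0_pos x(2) y(2)])
    ultimately have "rep_o x - rep_o y \<in> Ieta" by (simp only: I_eta_eq onull_def rep_o_simps) blast
    then show "a = b" unfolding x(1) y(1) coset_eq_iff[OF I_eta_add_closed] .
  qed
  moreover have "reduction \<eta>0 res I ` idempotents (A_eta_int \<eta>0 I) = idempotents (A_kappa res I)"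
  proof (intro equalityI subsetI)
    fix b assume "b \<in> reduction \<eta>0 res I ` idempotents (A_eta_int \<eta>0 I)"
    then obtain a where a: "a \<in> carrier (A_eta_int \<eta>0 I)" "a \<otimes>\<^bsub>A_eta_int \<eta>0 I\<^esub> a = a" "b = reduction \<eta>0 res I a"
      unfolding idempotents_def by blast
    show "b \<in> idempotents (A_kappa res I)"
      using ring_hom_closed[OF reduction_ring_hom a(1)] ring_hom_mult[OF reduction_ring_hom a(1) a(1)] a(2,3)
      unfolding idempotents_def by simp
  next
    fix b assume "b \<in> idempotents (A_kappa res I)"
    then obtain y where y: "b = coset (I_kappa res I) y" "b \<otimes>\<^bsub>A_kappa res I\<^esub> b = b"
      unfolding idempotents_def A_kappa_simps(1) by blast
    then have "y * y - y \<in> I_kappa res I" by (simp add: A_kappa_simps coset_eq_iff[OF I_kappa_add_closed])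
    from idempotent_lift_exists[OF this] obtain E where E: "onull \<eta>0 E" "obound 1 E 1" "rep_o (E * E - E) \<in> I"
      "reduce res (rep_o E) - y \<in> I_kappa res I" by blast
    note Ei = oseries_integral_series[OF E(1,2)]
    have "coset Ieta (rep_o E) \<in> idempotents (A_eta_int \<eta>0 I)"
      unfolding idempotents_integral A_eta_idempotent_iff[OF integral_series(1)[OF Ei]]
      using extend_scalars_incl[OF E(3)] by (simp only: rep_o_simps)
    moreover have "reduction \<eta>0 res I (coset Ieta (rep_o E)) = b"
      unfolding reduction_coset[OF Ei] y(1) coset_eq_iff[OF I_kappa_add_closed] by (rule E(4))
    ultimately show "b \<in> reduction \<eta>0 res I ` idempotents (A_eta_int \<eta>0 I)" by blast
  qed
  ultimately show ?thesis unfolding bij_betw_def ..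
qed

section \<open>Functions on the affinoid annuli\<close>

lemma radiiD:
  assumes "w \<in> radii TYPE('k) \<eta>0"
  shows "\<eta>0 \<le> fst w" "fst w \<le> snd w" "snd w < 1" "0 < fst w" "0 < snd w" "fst w < 1" "\<eta>0 \<le> snd w"
  using assms \<eta>0_pos by (auto simp: radii_def)

lemma annulus_series_between:
  assumes "w \<in> radii TYPE('k) \<eta>0" "fst w \<le> \<eta>" "\<eta> \<le> snd w"
  shows "annulus_series w \<subseteq> null_series \<eta>"
  unfolding annulus_series_def using null_series_between[OF _ _ radiiD(4)[OF assms(1)] assms(2,3)] by blast

lemma bounded_annulus_series:
  assumes "w \<in> radii TYPE('k) \<eta>0" "0 < \<alpha>" "\<alpha> \<le> fst w"
  shows "bounded_null_series \<alpha> \<subseteq> annulus_series w"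
proof
  fix f :: "('n, 'k) series" assume "f \<in> bounded_null_series \<alpha>"
  then obtain B where "f \<in> null_series \<alpha>" "gauss_bound 1 f B" by (auto simp: bounded_null_series_def)
  then show "f \<in> annulus_series w" using null_series_mono_bounded[of f \<alpha> B] assms radiiD[OF assms(1)]
    unfolding annulus_series_def by fastforce
qed

context
  fixes w assumes w: "w \<in> radii TYPE('k) \<eta>0"
begin

lemma annulus_ring_eq: "annulus_ring w = series_ring (annulus_series w)"
  using carrier_annulus_ring[OF radiiD(4,5)[OF w]] by (simp add: annulus_series_def)

lemma annulus_add: "f \<oplus>\<^bsub>annulus_ring w\<^esub> g = f + (g :: ('n, 'k) series)"
  by (simp only: annulus_ring_eq series_ring_simps)

lemma annulus_series_closed:
  "add_closed (annulus_series w)" "annulus_series w \<subseteq> null_series (fst w)"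
  "f \<in> annulus_series w \<Longrightarrow> g \<in> annulus_series w \<Longrightarrow> f \<star> g \<in> annulus_series w"
  "series_one \<in> annulus_series w"
  unfolding annulus_series_def add_closed_def using radiiD(4,5)[OF w]
  by (auto intro: null_series_add null_series_mult)

lemmas annulus_combos = annulus_series_closed(1,2) radiiD(4,6)[OF w]

lemma combos_annulus_ideal: "ideal (combos (annulus_series w)) (annulus_ring w)"
proof (rule ideal_from_add_closed[OF _ annulus_add])
  show "cring (annulus_ring w :: ('n, 'k) series ring)"
    using cring_annulus_ring[OF radiiD(4,5)[OF w]] by simp
  show "combos (annulus_series w) \<subseteq> carrier (annulus_ring w)"
    unfolding annulus_ring_eq series_ring_simps
    using combos_null[of "annulus_series w" "fst w"] combos_null[of "annulus_series w" "snd w"] radiiD[OF w] annulus_series_closed(1)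
    by (auto simp: annulus_series_def)
  show "add_closed (combos (annulus_series w))" by (rule combos_add_closed[OF annulus_combos])
  fix a x :: "('n, 'k) series" assume ax: "a \<in> combos (annulus_series w)" "x \<in> carrier (annulus_ring w)"
  then have x: "x \<in> annulus_series w" by (simp only: annulus_ring_eq series_ring_simps)
  show "x \<otimes>\<^bsub>annulus_ring w\<^esub> a \<in> combos (annulus_series w)"
    unfolding annulus_ring_eq series_ring_simps
    by (rule combos_mult[OF annulus_combos _ _ ax(1)]) (use x annulus_series_closed in blast)+
qed

lemma r_combos: 
  assumes h: "h \<in> H"
  shows "r h \<in> combos (annulus_series w)"
proof -
  let ?a = "\<lambda>k. if k = h then series_one else 0"
  have "combination ?a = (\<Sum>k\<in>H. if k = h then r k else 0)"
    unfolding combination_def by (rule sum.cong) auto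
  also have "\<dots> = r h" using h by simp
  finally have "combination ?a = r h" .
  moreover have "combination ?a \<in> combos (annulus_series w)"
    by (rule combosI) (use annulus_series_closed(4) add_closedD(1)[OF annulus_series_closed(1)] in simp)
  ultimately show ?thesis by (simp only:)
qed

lemma annulus_ideal_eq: "annulus_ideal m r w = combos (annulus_series w)"
proof
  interpret R: cring "annulus_ring w :: ('n, 'k) series ring"
    using cring_annulus_ring[OF radiiD(4,5)[OF w]] by simp
  show "annulus_ideal m r w \<subseteq> combos (annulus_series w)" unfolding annulus_ideal_def
    by (rule R.genideal_minimal[OF combos_annulus_ideal]) (use r_combos in blast)
  have rs: "r ` H \<subseteq> carrier (annulus_ring w)" using r_combos ideal.Icarr[OF combos_annulus_ideal] by blast
  have id: "ideal (annulus_ideal m r w) (annulus_ring w)" unfolding annulus_ideal_def by (rule R.genideal_ideal[OF rs])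
  show "combos (annulus_series w) \<subseteq> annulus_ideal m r w"
  proof
    fix f assume "f \<in> combos (annulus_series w)"
    then obtain a where a: "f = combination a" "\<forall>h\<in>H. a h \<in> annulus_series w" unfolding combos_def by blast
    have "a h \<star> r h \<in> annulus_ideal m r w" if h: "h \<in> H" for h
    proof -
      have "r h \<in> annulus_ideal m r w" unfolding annulus_ideal_def using R.genideal_self[OF rs] h by blast
      moreover have "a h \<in> carrier (annulus_ring w)" using a(2) h by (simp only: annulus_ring_eq series_ring_simps)
      ultimately have "a h \<otimes>\<^bsub>annulus_ring w\<^esub> r h \<in> annulus_ideal m r w" by (rule ideal.I_l_closed[OF id])
      then show ?thesis by (simp only: annulus_ring_eq series_ring_simps)
    qed
    then show "f \<in> annulus_ideal m r w" unfolding a(1) combination_def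
      by (rule add_closed_sum[OF ideal_add_closed[OF id annulus_add]])
  qed
qed

lemma annulus_ideal_ideal: "ideal (annulus_ideal m r w) (annulus_ring w)"
  unfolding annulus_ideal_eq by (rule combos_annulus_ideal)

lemma annulus_ideal_add_closed: "add_closed (annulus_ideal m r w)"
  by (rule ideal_add_closed[OF annulus_ideal_ideal annulus_add])

lemma coset_annulus: "annulus_ideal m r w +>\<^bsub>annulus_ring w\<^esub> f = coset (annulus_ideal m r w) f"
  by (rule a_r_coset_eq_coset[OF annulus_ideal_ideal annulus_add])

lemma annulus_algebra_simps:
  "carrier (annulus_algebra m r w) = coset (annulus_ideal m r w) ` annulus_series w"
  "\<lbrakk>f \<in> annulus_series w; g \<in> annulus_series w\<rbrakk> \<Longrightarrow> coset (annulus_ideal m r w) f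
     \<otimes>\<^bsub>annulus_algebra m r w\<^esub> coset (annulus_ideal m r w) g = coset (annulus_ideal m r w) (f \<star> g)"
  "\<lbrakk>f \<in> annulus_series w; g \<in> annulus_series w\<rbrakk> \<Longrightarrow> coset (annulus_ideal m r w) f
     \<oplus>\<^bsub>annulus_algebra m r w\<^esub> coset (annulus_ideal m r w) g = coset (annulus_ideal m r w) (f + g)"
  "\<one>\<^bsub>annulus_algebra m r w\<^esub> = coset (annulus_ideal m r w) series_one"
  using carrier_Quot[OF annulus_ideal_ideal annulus_add] Quot_mult[OF annulus_ideal_ideal annulus_add, of f g]
    Quot_add[OF annulus_ideal_ideal annulus_add, of f g] Quot_one[OF annulus_ideal_ideal annulus_add]
  unfolding annulus_algebra_def annulus_ring_eq series_ring_simps by blast+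

lemma restriction_coset:
  assumes J: "add_closed J" "J \<subseteq> annulus_ideal m r w"
  shows "restriction m r w (coset J f) = coset (annulus_ideal m r w) f"
proof -
  have "coset (annulus_ideal m r w) g = coset (annulus_ideal m r w) f" if "g \<in> coset J f" for g
    using that J(2) by (simp only: coset_eq_iff[OF annulus_ideal_add_closed] mem_coset) blast
  moreover have "f \<in> coset J f" by (rule coset_self[OF J(1)])
  ultimately show ?thesis unfolding restriction_def coset_annulus by blast
qed

lemma I_eta_annulus: "Ieta \<subseteq> annulus_ideal m r w"
proof
  fix f assume "f \<in> Ieta"
  then have "f \<in> combos (bounded_null_series \<eta>0)" unfolding I_eta_eq using bounded_ideal_combos[OF adm0] by blast
  then show "f \<in> annulus_ideal m r w" unfolding annulus_ideal_eq
    using combos_mono[OF bounded_annulus_series[OF w \<eta>0_pos radiiD(1)[OF w]]] by blast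
qed

lemma to_analytic_coset: "to_analytic \<eta>0 m r (coset Ieta f) w = coset (annulus_ideal m r w) f"
  unfolding to_analytic_def using w restriction_coset[OF I_eta_add_closed I_eta_annulus] by simp

end

section \<open>Idempotent analytic functions\<close>

lemma annulus_series_mono:
  assumes "w \<in> radii TYPE('k) \<eta>0" "w' \<in> radii TYPE('k) \<eta>0" "fst w \<le> fst w'" "snd w' \<le> snd w"
  shows "annulus_series w \<subseteq> annulus_series w'"
proof -
  have "annulus_series w \<subseteq> null_series (fst w')" "annulus_series w \<subseteq> null_series (snd w')"
    by (rule annulus_series_between[OF assms(1)]; use assms radiiD[OF assms(2)] in linarith)+
  then show ?thesis unfolding annulus_series_def[of w'] by blast
qed

lemma annulus_ideal_mono:
  assumes "w \<in> radii TYPE('k) \<eta>0" "w' \<in> radii TYPE('k) \<eta>0" "fst w \<le> fst w'" "snd w' \<le> snd w"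
  shows "annulus_ideal m r w \<subseteq> annulus_ideal m r w'"
  unfolding annulus_ideal_eq[OF assms(1)] annulus_ideal_eq[OF assms(2)] by (rule combos_mono[OF annulus_series_mono[OF assms]])

lemma annulus_coset_eq_iff:
  assumes w: "w \<in> radii TYPE('k) \<eta>0"
  shows "coset (annulus_ideal m r w) f = coset (annulus_ideal m r w) g \<longleftrightarrow> f - g \<in> combos (annulus_series w)"
  unfolding coset_eq_iff[OF annulus_ideal_add_closed[OF w]] by (simp only: annulus_ideal_eq[OF w])

lemma analytic_simps:
  "F \<in> carrier (analytic_functions \<eta>0 m r) \<longleftrightarrow> F \<in> (\<Pi>\<^sub>E w\<in>radii TYPE('k) \<eta>0. carrier (annulus_algebra m r w)) \<and>
     (\<forall>w\<in>radii TYPE('k) \<eta>0. \<forall>w'\<in>radii TYPE('k) \<eta>0. fst w \<le> fst w' \<and> snd w' \<le> snd w \<longrightarrow>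
       F w' = restriction m r w' (F w))"
  "F \<otimes>\<^bsub>analytic_functions \<eta>0 m r\<^esub> G = (\<lambda>w\<in>radii TYPE('k) \<eta>0. F w \<otimes>\<^bsub>annulus_algebra m r w\<^esub> G w)"
  "F \<oplus>\<^bsub>analytic_functions \<eta>0 m r\<^esub> G = (\<lambda>w\<in>radii TYPE('k) \<eta>0. F w \<oplus>\<^bsub>annulus_algebra m r w\<^esub> G w)"
  "\<one>\<^bsub>analytic_functions \<eta>0 m r\<^esub> = (\<lambda>w\<in>radii TYPE('k) \<eta>0. \<one>\<^bsub>annulus_algebra m r w\<^esub>)"
  by (simp_all add: analytic_functions_def Let_def case_prod_unfold)

lemma to_analytic_ext: "to_analytic \<eta>0 m r Y \<in> extensional (radii TYPE('k) \<eta>0)"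
  by (simp add: to_analytic_def)

lemma bounded_annulus:
  "f \<in> bounded_null_series \<eta>0 \<Longrightarrow> w \<in> radii TYPE('k) \<eta>0 \<Longrightarrow> f \<in> annulus_series w"
  using bounded_annulus_series[OF _ \<eta>0_pos radiiD(1)] by blast

lemma to_analytic_carrier:
  assumes f: "f \<in> bounded_null_series \<eta>0"
  shows "to_analytic \<eta>0 m r (coset Ieta f) \<in> carrier (analytic_functions \<eta>0 m r)"
  unfolding analytic_simps
proof (intro conjI PiE_I ballI impI)
  fix w assume w: "w \<in> radii TYPE('k) \<eta>0"
  show "to_analytic \<eta>0 m r (coset Ieta f) w \<in> carrier (annulus_algebra m r w)"
    unfolding to_analytic_coset[OF w] annulus_algebra_simps[OF w] using bounded_annulus[OF f w] by blast
  fix w' assume w': "w' \<in> radii TYPE('k) \<eta>0" and le: "fst w \<le> fst w' \<and> snd w' \<le> snd w"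
  show "to_analytic \<eta>0 m r (coset Ieta f) w' = restriction m r w' (to_analytic \<eta>0 m r (coset Ieta f) w)"
    unfolding to_analytic_coset[OF w] to_analytic_coset[OF w']
    by (rule restriction_coset[OF w' annulus_ideal_add_closed[OF w] annulus_ideal_mono[OF w w'], symmetric]) (use le in blast)+
qed (simp add: to_analytic_def)

lemma to_analytic_ring_hom: "to_analytic \<eta>0 m r \<in> ring_hom (A_eta \<eta>0 I) (analytic_functions \<eta>0 m r)"
proof (rule ring_hom_memI)
  show "to_analytic \<eta>0 m r \<one>\<^bsub>A_eta \<eta>0 I\<^esub> = \<one>\<^bsub>analytic_functions \<eta>0 m r\<^esub>"
    unfolding A_eta_simps(4) analytic_simps
    by (rule extensionalityI[OF to_analytic_ext]) (simp_all add: to_analytic_coset annulus_algebra_simps)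
  fix x assume "x \<in> carrier (A_eta \<eta>0 I)"
  then obtain f where f: "f \<in> bounded_null_series \<eta>0" "x = coset Ieta f" unfolding A_eta_simps by blast
  show "to_analytic \<eta>0 m r x \<in> carrier (analytic_functions \<eta>0 m r)" unfolding f(2) by (rule to_analytic_carrier[OF f(1)])
  fix y assume "y \<in> carrier (A_eta \<eta>0 I)"
  then obtain g where g: "g \<in> bounded_null_series \<eta>0" "y = coset Ieta g" unfolding A_eta_simps by blast
  show "to_analytic \<eta>0 m r (x \<otimes>\<^bsub>A_eta \<eta>0 I\<^esub> y) =
      to_analytic \<eta>0 m r x \<otimes>\<^bsub>analytic_functions \<eta>0 m r\<^esub> to_analytic \<eta>0 m r y"
    unfolding f(2) g(2) A_eta_simps(2)[OF f(1) g(1)] analytic_simps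
  proof (rule extensionalityI[OF to_analytic_ext])
    fix w assume w: "w \<in> radii TYPE('k) \<eta>0"
    note fg = bounded_annulus[OF f(1) w] bounded_annulus[OF g(1) w]
    show "to_analytic \<eta>0 m r (coset Ieta (f \<star> g)) w = (\<lambda>w\<in>radii TYPE('k) \<eta>0. to_analytic \<eta>0 m r (coset Ieta f) w
        \<otimes>\<^bsub>annulus_algebra m r w\<^esub> to_analytic \<eta>0 m r (coset Ieta g) w) w"
      unfolding restrict_apply'[OF w] to_analytic_coset[OF w] annulus_algebra_simps(2)[OF w fg] ..
  qed simp
  show "to_analytic \<eta>0 m r (x \<oplus>\<^bsub>A_eta \<eta>0 I\<^esub> y) =
      to_analytic \<eta>0 m r x \<oplus>\<^bsub>analytic_functions \<eta>0 m r\<^esub> to_analytic \<eta>0 m r y"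
    unfolding f(2) g(2) A_eta_simps(3)[OF f(1) g(1)] analytic_simps
  proof (rule extensionalityI[OF to_analytic_ext])
    fix w assume w: "w \<in> radii TYPE('k) \<eta>0"
    note fg = bounded_annulus[OF f(1) w] bounded_annulus[OF g(1) w]
    show "to_analytic \<eta>0 m r (coset Ieta (f + g)) w = (\<lambda>w\<in>radii TYPE('k) \<eta>0. to_analytic \<eta>0 m r (coset Ieta f) w
        \<oplus>\<^bsub>annulus_algebra m r w\<^esub> to_analytic \<eta>0 m r (coset Ieta g) w) w"
      unfolding restrict_apply'[OF w] to_analytic_coset[OF w] annulus_algebra_simps(3)[OF w fg] ..
  qed simp
qed

text \<open>Roots of \<open>absval uK\<close> lie in the divisible value group and tend to
  1.\<close>

lemma radii_dense:
  assumes "\<eta> < 1"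
  shows "\<exists>\<beta>\<ge>\<eta>. \<beta> < 1 \<and> \<beta> \<in> divisible_value_group TYPE('k)"
proof -
  have "eventually (\<lambda>k. \<eta> < root k (absval uK)) sequentially"
    by (rule order_tendstoD(1)[OF LIMSEQ_root_const[OF uK(1)] assms])
  then have "eventually (\<lambda>k. \<eta> < root k (absval uK) \<and> k \<ge> 1) sequentially"
    by (rule eventually_conj) (rule eventually_ge_at_top)
  then obtain k where k: "\<eta> < root k (absval uK)" "k \<ge> 1" by (auto simp: eventually_sequentially)
  then have "root k (absval uK) \<in> divisible_value_group TYPE('k)"
    unfolding divisible_value_group_def using uK by (auto intro!: exI[of _ k] exI[of _ uK])
  moreover have "root k (absval uK) < 1" using k(2) uK by simp
  ultimately show ?thesis using k(1) by (intro exI[of _ "root k (absval uK)"]) auto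
qed

lemma radii_nonempty: "\<exists>w. w \<in> radii TYPE('k) \<eta>0"
  using radii_dense[OF \<eta>0_less_1] by (auto simp: radii_def)

text \<open>A single closed annulus decides: a bounded series that lies in the ideal on its inner
  circle lies in the extended ideal, by \<open>combos_bounded_ideal\<close>.\<close>

lemma to_analytic_inj: "inj_on (to_analytic \<eta>0 m r) (carrier (A_eta \<eta>0 I))"
proof (rule inj_onI)
  fix x y assume xy: "x \<in> carrier (A_eta \<eta>0 I)" "y \<in> carrier (A_eta \<eta>0 I)" and eq: "to_analytic \<eta>0 m r x = to_analytic \<eta>0 m r y"
  obtain f where f: "f \<in> bounded_null_series \<eta>0" "x = coset Ieta f" using xy(1) unfolding A_eta_simps by blast
  obtain g where g: "g \<in> bounded_null_series \<eta>0" "y = coset Ieta g" using xy(2) unfolding A_eta_simps by blast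
  obtain w where w: "w \<in> radii TYPE('k) \<eta>0" using radii_nonempty by blast
  have "to_analytic \<eta>0 m r x w = to_analytic \<eta>0 m r y w" by (simp only: eq)
  then have d: "f - g \<in> combos (annulus_series w)"
    unfolding f(2) g(2) to_analytic_coset[OF w] annulus_coset_eq_iff[OF w] .
  have "f + - g \<in> bounded_null_series \<eta>0" by (intro bounded_null_series_closed[OF \<eta>0_pos] f g)
  then have bd: "f - g \<in> bounded_null_series \<eta>0" by simp
  have "admissible (fst w)" by (rule radius_admissible[OF radiiD(1,6)[OF w]])
  moreover have "f - g \<in> combos (null_series (fst w))" using combos_mono[OF annulus_series_closed(2)[OF w]] d by blast
  moreover have "f - g \<in> bounded_null_series (fst w)"
    by (rule bounded_null_series_mono[OF bd \<eta>0_pos radiiD(1,6)[OF w]])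
  ultimately have "f - g \<in> extend_scalars I" by (rule combos_bounded_ideal)
  then have "f - g \<in> Ieta" unfolding I_eta_eq using bd by blast
  then show "x = y" unfolding f(2) g(2) coset_eq_iff[OF I_eta_add_closed] .
qed

text \<open>One division converges at both end radii, because \<open>division_admissible\<close>
  serves all radii with the same quotients and remainder.\<close>

lemma annulus_normal_form:
  assumes w: "w \<in> radii TYPE('k) \<eta>0" and f: "f \<in> annulus_series w"
  shows "\<exists>n. normal n \<and> n \<in> annulus_series w \<and> coset (annulus_ideal m r w) f = coset (annulus_ideal m r w) n"
proof -
  have adm: "admissible (fst w)" "admissible (snd w)"
    by (rule radius_admissible; use radiiD[OF w] in linarith)+
  have fn: "f \<in> null_series (fst w)" "f \<in> null_series (snd w)" using f by (auto simp: annulus_series_def)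
  from division_admissible[OF fn(1) adm(1)] obtain g \<nu> where g: "normal \<nu>" "f = combination g + \<nu>"
    "\<forall>\<eta>. admissible \<eta> \<longrightarrow> f \<in> null_series \<eta> \<longrightarrow> (\<forall>h. g h \<in> null_series \<eta>) \<and> \<nu> \<in> null_series \<eta>" by blast
  have "combination g \<in> combos (annulus_series w)"
    by (rule combosI) (use g(3) adm fn in \<open>auto simp: annulus_series_def\<close>)
  then have "f - \<nu> \<in> annulus_ideal m r w" unfolding annulus_ideal_eq[OF w] by (simp add: g(2))
  then have "coset (annulus_ideal m r w) f = coset (annulus_ideal m r w) \<nu>"
    unfolding coset_eq_iff[OF annulus_ideal_add_closed[OF w]] .
  moreover have "\<nu> \<in> annulus_series w" using g(3) adm fn by (auto simp: annulus_series_def)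
  ultimately show ?thesis using g(1) by blast
qed

lemma annulus_normal_form_unique:
  assumes w: "w \<in> radii TYPE('k) \<eta>0" and n: "normal n" "n \<in> annulus_series w" "normal n'" "n' \<in> annulus_series w"
    and eq: "coset (annulus_ideal m r w) n = coset (annulus_ideal m r w) n'"
  shows "n = n'"
proof (rule normal_form_unique_combos[OF annulus_combos[OF w] _ n(1) _ n(3)])
  show "admissible (fst w)" by (rule radius_admissible[OF radiiD(1,6)[OF w]])
  show "n - n' \<in> combos (annulus_series w)"
    using eq unfolding annulus_coset_eq_iff[OF w] .
qed (use n annulus_series_closed(2)[OF w] in blast)+

text \<open>Uniqueness of normal forms glues the local ones to a single series on the half-open annulus.\<close>

lemma analytic_normal_form:
  assumes F: "F \<in> carrier (analytic_functions \<eta>0 m r)"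
  shows "\<exists>n. normal n \<and> (\<forall>w\<in>radii TYPE('k) \<eta>0. n \<in> annulus_series w \<and> F w = coset (annulus_ideal m r w) n)"
proof -
  have "\<exists>n. normal n \<and> n \<in> annulus_series w \<and> F w = coset (annulus_ideal m r w) n"
    if w: "w \<in> radii TYPE('k) \<eta>0" for w
  proof -
    have "F w \<in> carrier (annulus_algebra m r w)" using F w unfolding analytic_simps by blast
    then obtain f where "f \<in> annulus_series w" "F w = coset (annulus_ideal m r w) f" unfolding annulus_algebra_simps[OF w] by blast
    then show ?thesis using annulus_normal_form[OF w] by metis
  qed
  then have "\<forall>w\<in>radii TYPE('k) \<eta>0. \<exists>n. normal n \<and> n \<in> annulus_series w \<and> F w = coset (annulus_ideal m r w) n" by blast
  from bchoice[OF this] obtain n where n: "\<forall>w\<in>radii TYPE('k) \<eta>0. normal (n w) \<and> n w \<in> annulus_series w \<and>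
    F w = coset (annulus_ideal m r w) (n w)" by blast
  have nest: "n w = n w'" if w: "w \<in> radii TYPE('k) \<eta>0" "w' \<in> radii TYPE('k) \<eta>0" "fst w \<le> fst w'" "snd w' \<le> snd w" for w w'
  proof (rule annulus_normal_form_unique[OF w(2)])
    have "F w' = restriction m r w' (F w)" using F w unfolding analytic_simps by blast
    also have "\<dots> = coset (annulus_ideal m r w') (n w)"
      using n w(1) restriction_coset[OF w(2) annulus_ideal_add_closed[OF w(1)] annulus_ideal_mono[OF w]] by simp
    finally show "coset (annulus_ideal m r w') (n w) = coset (annulus_ideal m r w') (n w')" using n w(2) by simp
    show "n w \<in> annulus_series w'" using n w(1) annulus_series_mono[OF w] by blast
  qed (use n w in blast)+
  obtain w0 where w0: "w0 \<in> radii TYPE('k) \<eta>0" using radii_nonempty by blast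
  have "n w = n w0" if w: "w \<in> radii TYPE('k) \<eta>0" for w
  proof -
    \<comment> \<open>A closed annulus containing both; restriction from it identifies the two
      normal forms.\<close>
    let ?v = "(min (fst w) (fst w0), max (snd w) (snd w0))"
    have v: "?v \<in> radii TYPE('k) \<eta>0" using w w0 by (auto simp: radii_def min_def max_def)
    have "n ?v = n w" "n ?v = n w0" by (rule nest[OF v w] nest[OF v w0]; simp)+
    then show ?thesis by simp
  qed
  then show ?thesis using n w0 by metis
qed

lemma analytic_idempotent:
  assumes "F \<in> idempotents (analytic_functions \<eta>0 m r)"
  shows "F \<in> to_analytic \<eta>0 m r ` idempotents (A_eta \<eta>0 I)"
proof -
  have F: "F \<in> carrier (analytic_functions \<eta>0 m r)" "F \<otimes>\<^bsub>analytic_functions \<eta>0 m r\<^esub> F = F"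
    using assms by (auto simp: idempotents_def)
  from analytic_normal_form[OF F(1)] obtain n where n: "normal n"
    "\<And>w. w \<in> radii TYPE('k) \<eta>0 \<Longrightarrow> n \<in> annulus_series w"
    "\<And>w. w \<in> radii TYPE('k) \<eta>0 \<Longrightarrow> F w = coset (annulus_ideal m r w) n" by blast
  have nn: "n \<star> n - n \<in> combos (annulus_series w)" if w: "w \<in> radii TYPE('k) \<eta>0" for w
  proof -
    have "F w \<otimes>\<^bsub>annulus_algebra m r w\<^esub> F w = F w"
      using fun_cong[OF F(2), of w] w unfolding analytic_simps by simp
    then have "coset (annulus_ideal m r w) (n \<star> n) = coset (annulus_ideal m r w) n"
      unfolding n(3)[OF w] annulus_algebra_simps(2)[OF w n(2)[OF w] n(2)[OF w]] .
    then show ?thesis unfolding annulus_coset_eq_iff[OF w] .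
  qed
  obtain w0 where w0: "w0 \<in> radii TYPE('k) \<eta>0" using radii_nonempty by blast
  \<comment> \<open>\<eta>0 itself need not be in the divisible value group, so convergence of
    \<open>n\<close> is used only from some radius \<alpha> of that group on.\<close>
  define \<alpha> where "\<alpha> = fst w0"
  have \<alpha>: "\<eta>0 \<le> \<alpha>" "0 < \<alpha>" "\<alpha> < 1" "\<alpha> \<in> divisible_value_group TYPE('k)"
    using radiiD[OF w0] w0 unfolding \<alpha>_def by (auto simp: radii_def)
  have adm: "admissible \<alpha>" by (rule radius_admissible[OF \<alpha>(1,3)])
  have sub: "\<exists>w\<in>radii TYPE('k) \<eta>0. annulus_series w \<subseteq> null_series \<eta>" if \<eta>: "\<alpha> \<le> \<eta>" "\<eta> < 1" for \<eta>
  proof -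
    from radii_dense[OF \<eta>(2)] obtain \<beta> where \<beta>: "\<eta> \<le> \<beta>" "\<beta> < 1" "\<beta> \<in> divisible_value_group TYPE('k)" by blast
    then have w: "(\<alpha>, \<beta>) \<in> radii TYPE('k) \<eta>0" using \<alpha> \<eta> by (auto simp: radii_def)
    have "annulus_series (\<alpha>, \<beta>) \<subseteq> null_series \<eta>" by (rule annulus_series_between[OF w]) (use \<eta> \<beta> in auto)
    then show ?thesis using w by blast
  qed
  have nn\<eta>: "n \<in> null_series \<eta> \<and> n \<star> n - n \<in> combos (null_series \<eta>)" if "\<alpha> \<le> \<eta>" "\<eta> < 1" for \<eta>
    using sub[OF that] n(2) nn combos_mono by blast
  have n1: "gauss_bound 1 n 1"
    by (rule idempotent_normal_bound[OF \<alpha>(1,3) n(1)]) (use nn\<eta> in blast)+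
  have nb: "n \<in> bounded_null_series \<alpha>" using nn\<eta>[of \<alpha>] n1 \<alpha> unfolding bounded_null_series_def by blast
  define x where "x = Abs_o n"
  have rx: "rep_o x = n" unfolding x_def by (rule rep_o_Abs[OF nb \<alpha>(2,3)])
  have x: "onull \<alpha> x" "obound 1 x 1" using nb n1 by (simp_all add: onull_def obound_def rx)
  have xx: "onull \<alpha> (x * x - x)" by (intro onull_closed x \<alpha>)
  have xx1: "obound 1 (x * x - x) 1" using obound_mult[OF x(2) x(2)] by (intro obound_diff x) auto
  have "rep_o (x * x - x) \<in> extend_scalars I"
    by (rule combos_bounded_ideal[OF adm _ xx[unfolded onull_def]])
      (use nn\<eta>[of \<alpha>] \<alpha> in \<open>simp add: rep_o_simps rx\<close>)
  then have xI: "rep_o (x * x - x) \<in> I" using xx1 unfolding obound_def by (intro extend_scalars_integral)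
  note int = onull_R_int[OF _ \<alpha>(2,3)]
  have x2: "onull \<alpha> (x * x)" "obound 1 (x * x) 1" using obound_mult[OF x(2) x(2)] by (auto intro!: onull_closed x \<alpha>)
  let ?y = "reduce res (rep_o x)"
  have "reduce res (rep_o (x * x - x)) = ?y * ?y - ?y"
    using reduce_diff[OF int[OF x2] int[OF x]] int[OF xx xx1] reduce_mult[OF int[OF x] int[OF x]] int[OF x2]
    by (simp only: rep_o_simps)
  then have "?y * ?y - ?y \<in> I_kappa res I" using xI unfolding I_kappa_def by (metis image_eqI)
  \<comment> \<open>The lift \<open>E\<close> converges from \<eta>0 on, which is not yet known for
    \<open>n\<close>; uniqueness at \<alpha> identifies the two modulo the ideal.\<close>
  from idempotent_lift_exists[OF this] obtain E where E: "onull \<eta>0 E" "obound 1 E 1" "rep_o (E * E - E) \<in> I"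
    "reduce res (rep_o E) - ?y \<in> I_kappa res I" by blast
  have E\<alpha>: "onull \<alpha> E" using bounded_null_series_mono[OF E(1)[unfolded onull_def] \<eta>0_pos \<alpha>(1,3)] by (simp only: onull_def)
  have "rep_o (E - x) \<in> I" by (rule idempotent_unique[OF adm E\<alpha> E(2,3) x xI E(4)])
  then have EI: "rep_o E - n \<in> extend_scalars I" unfolding rep_o_simps rx by (rule extend_scalars_incl)
  have Eb: "rep_o E \<in> bounded_null_series \<eta>0" using E(1) by (simp only: onull_def)
  have "F = to_analytic \<eta>0 m r (coset Ieta (rep_o E))"
  proof (rule extensionalityI[OF _ to_analytic_ext])
    show "F \<in> extensional (radii TYPE('k) \<eta>0)" using F(1) unfolding analytic_simps by (simp add: PiE_iff)
    fix w assume w: "w \<in> radii TYPE('k) \<eta>0"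
    note wD = radiiD[OF w]
    have "n \<in> null_series (fst w)" using n(2)[OF w] by (simp add: annulus_series_def)
    then have nw: "n \<in> bounded_null_series (fst w)" using n1 unfolding bounded_null_series_def by blast
    have "rep_o E + - n \<in> bounded_null_series (fst w)"
      by (intro bounded_null_series_closed[OF wD(4)] nw bounded_null_series_mono[OF Eb \<eta>0_pos wD(1,6)])
    then have "rep_o E - n \<in> bounded_null_series (fst w)" by simp
    from bounded_ideal_combos[OF radius_admissible[OF wD(1,6)] EI this]
    have "rep_o E - n \<in> annulus_ideal m r w" unfolding annulus_ideal_eq[OF w]
      using combos_mono[OF bounded_annulus_series[OF w wD(4) order_refl]] by blast
    then show "F w = to_analytic \<eta>0 m r (coset Ieta (rep_o E)) w"
      unfolding n(3)[OF w] to_analytic_coset[OF w] using coset_eq_iff[OF annulus_ideal_add_closed[OF w]] by blast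
  qed
  moreover have "coset Ieta (rep_o E) \<in> idempotents (A_eta \<eta>0 I)"
    unfolding A_eta_idempotent_iff[OF Eb] using extend_scalars_incl[OF E(3)] by (simp only: rep_o_simps)
  ultimately show ?thesis by blast
qed

lemma to_analytic_bij:
  "bij_betw (to_analytic \<eta>0 m r) (idempotents (A_eta \<eta>0 I)) (idempotents (analytic_functions \<eta>0 m r))"
proof -
  have "inj_on (to_analytic \<eta>0 m r) (idempotents (A_eta \<eta>0 I))"
    by (rule inj_on_subset[OF to_analytic_inj]) (auto simp: idempotents_def)
  moreover have "to_analytic \<eta>0 m r a \<in> idempotents (analytic_functions \<eta>0 m r)" if a: "a \<in> idempotents (A_eta \<eta>0 I)" for a
  proof -
    have a: "a \<in> carrier (A_eta \<eta>0 I)" "a \<otimes>\<^bsub>A_eta \<eta>0 I\<^esub> a = a" using a by (auto simp: idempotents_def)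
    show ?thesis
      using ring_hom_closed[OF to_analytic_ring_hom a(1)] ring_hom_mult[OF to_analytic_ring_hom a(1) a(1)] a(2)
      unfolding idempotents_def by simp
  qed
  ultimately show ?thesis unfolding bij_betw_def using analytic_idempotent by blast
qed

end

section \<open>The correspondences between the four sets\<close>

theorem theorem1p2p9:
  fixes p :: nat
    and uK :: "'k::complete_discretely_valued_field"
    and res :: "'k \<Rightarrow> 'r::field"
    and Iint :: "('n::{finite,linorder}, 'k) series set"
    and rbar :: "nat \<Rightarrow> ('n, 'r) kseries"
    and r :: "nat \<Rightarrow> ('n, 'k) series"
    and m :: nat
    and \<sigma> c \<eta>0 :: real
  assumes "uniformizer uK"
    and "residue_map res"
    and "CHAR('r) = p" and "p > 0"
    and "absval (of_nat p :: 'k) = 1 / real p"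
    and "ideal Iint R_int"
    and "flat_module integer_ring (quotient_module Iint)"
    and "Groebner_basis (I_kappa res Iint) (rbar ` {1..m})"
    and "\<And>h. h \<in> {1..m} \<Longrightarrow> r h \<in> Iint \<and> reduce res (r h) = rbar h \<and> finite_principal_part (r h)"
    and "reduced_ring (A_kappa res Iint)"
    and "0 < \<sigma>" and "\<sigma> < 1" and "c > 0"
    and "\<And>Y. Y \<in> carrier (A_kappa res Iint) \<Longrightarrow>
           quotient_norm \<sigma> Y \<le> \<sigma> powr (- c) * spectral_norm \<sigma> (A_kappa res Iint) Y"
    and "absval uK powr (1 / (- real_of_int (minimal_exponent m r) + real p * c)) < \<eta>0"
    and "\<eta>0 < 1"
  shows
    \<comment> \<open>(b) and (a), via reduction\<close>
    "reduction \<eta>0 res Iint \<in> ring_hom (A_eta_int \<eta>0 Iint) (A_kappa res Iint) \<and>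
     (\<forall>f\<in>carrier (R_eta_int \<eta>0).
        reduction \<eta>0 res Iint (I_eta \<eta>0 Iint +>\<^bsub>R_eta \<eta>0\<^esub> f)
          = I_kappa res Iint +>\<^bsub>R_kappa\<^esub> reduce res f) \<and>
     bij_betw (reduction \<eta>0 res Iint)
       (idempotents (A_eta_int \<eta>0 Iint)) (idempotents (A_kappa res Iint)) \<and>
     \<comment> \<open>(b) and (c), via the inclusion of rings\<close>
     carrier (A_eta_int \<eta>0 Iint) \<subseteq> carrier (A_eta \<eta>0 Iint) \<and>
     idempotents (A_eta_int \<eta>0 Iint) = idempotents (A_eta \<eta>0 Iint) \<and>
     \<comment> \<open>(c) and (d), via the injection of rings\<close>
     to_analytic \<eta>0 m r \<in> ring_hom (A_eta \<eta>0 Iint) (analytic_functions \<eta>0 m r) \<and>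
     (\<forall>f\<in>carrier (R_eta \<eta>0). \<forall>w\<in>radii TYPE('k) \<eta>0.
        to_analytic \<eta>0 m r (I_eta \<eta>0 Iint +>\<^bsub>R_eta \<eta>0\<^esub> f) w
          = annulus_ideal m r w +>\<^bsub>annulus_ring w\<^esub> f) \<and>
     inj_on (to_analytic \<eta>0 m r) (carrier (A_eta \<eta>0 Iint)) \<and>
     bij_betw (to_analytic \<eta>0 m r)
       (idempotents (A_eta \<eta>0 Iint)) (idempotents (analytic_functions \<eta>0 m r))"
proof -
  have rf: "residue_field uK res" by unfold_locales (rule assms(1,2))+
  interpret residue_field uK res by (rule rf)
  have rbar: "(\<lambda>h. reduce res (r h)) ` {1..m} = rbar ` {1..m}" using assms(9) by simp
  interpret groebner_lift uK res Iint r m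
  proof (rule groebner_lift.intro[OF rf groebner_lift_axioms.intro])
    show "ideal Iint R_int" by (rule assms(6))
    show "f \<in> Iint" if "f \<in> carrier R_int" "scale uK f \<in> Iint" for f
      by (rule flat_imp_saturated[OF assms(6,7) less_imp_le[OF uK(2)] uK(3) that])
    show "Groebner_basis (I_kappa res Iint) ((\<lambda>h. reduce res (r h)) ` {1..m})" unfolding rbar by (rule assms(8))
  qed (use assms(9) in blast)+
  interpret spectral_lift uK res Iint r m p \<sigma> c \<eta>0
    by unfold_locales (use assms(3-5,10-16) in \<open>simp_all only: jI_def\<close>)
  show ?thesis
    unfolding carrier_R_eta_int' coset_I_eta coset_I_kappa
    using reduction_ring_hom reduction_coset reduction_bij carrier_A_eta_int_subset idempotents_integral
      to_analytic_ring_hom to_analytic_coset coset_annulus to_analytic_inj to_analytic_bij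
    by simp
qed

end
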